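(* Let $A$ be a finite group of order $a$, and let $d_1=1,d_2,\ldots,d_s$ be the degrees of the irreducible representations of $A$ over a splitting field for $A$. For each integer $r$ with $0\le r<a$, let $m_r$ be the number of minimal tuples for $r$, let $(r_1,\ldots,r_s)$ be one of the minimal tuples for $r$, and let $\epsilon_r=\sum_{i=1}^s r_i^2-r^2a^{-1}$. Let $N\in\mathbb{N}$ be such that for all $n\ge N$ every minimal tuple for $n$ is eligible. Let $n\in\mathbb{N}$ with $n\ge N$, and write $n=ka+r$ with $k\in\mathbb{Z}$ and $0\le r<a$. Then: (i) $\epsilon_r\ge 0$, with equality if and only if $r=0$; (ii) there exists a polynomial $f_n(x)\in\mathbb{Z}[x]$, independent of $q$, whose leading term is $m_r x^{n^2(1-a^{-1})-\epsilon_r}$, such that $|\mathrm{Hom}(A,\mathrm{GL}_n(q))|=f_n(q)$ for every prime power $q$ such that $\mathbb{F}_q$ is a splitting field for $A$.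
   Context: $\mathbb{F}_q$ (with $q$ a power of a prime $p$) is called a splitting field for $A$ if $p$ does not divide $a=|A|$ and all irreducible $\mathbb{F}_qA$-modules are absolutely irreducible. Over a splitting field, let $M_1,\ldots,M_s$ be representatives of the isomorphism classes of irreducible $A$-modules, with $M_1$ the trivial module, and let $d_i=\dim M_i$. The number $s$ and the degrees $d_i$ are the same for any splitting field, $d_1=1$, and $a=\sum_{i=1}^s d_i^2$. For a non-negative integer $n$, a tuple $(n_1,\ldots,n_s)$ of integers (not necessarily non-negative) is admissible for $n$ if $\sum_{i=1}^s n_id_i=n$. An admissible tuple is eligible if in addition $n_i\ge 0$ for all $i$. An admissible tuple for $n$ is a minimal tuple for $n$ if $\sum_{i=1}^s n_i^2$ is minimal amongst all admissible tuples for $n$. (For each $n$ there are finitely many minimal tuples, and $\sum_i n_i^2$ takes the same value on all of them; integers $N$ as in the claim exist.) $\mathrm{Hom}(A,\mathrm{GL}_n(q))$ is the set of group homomorphisms from $A$ to the group $\mathrm{GL}_n(q)$ of invertible $n\times n$ matrices over $\mathbb{F}_q$. *)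

theory Defs
  imports "HOL-Algebra.Module" "HOL-Computational_Algebra.Polynomial"
begin

text \<open>
  Vectors and matrices are extensional functions with index sets \<open>{..<n}\<close> and
  \<open>{..<n} \<times> {..<n}\<close>, so that distinct functions are distinct vectors (matrices).
\<close>

text \<open>The module \<open>K\<^sup>n\<close>; the ring fields \<open>mult\<close> and \<open>one\<close> of a module record carry no meaning.\<close>

definition coord_space :: "('k, 'm) ring_scheme \<Rightarrow> nat \<Rightarrow> ('k, nat \<Rightarrow> 'k) module" where
  "coord_space K n =
     \<lparr>carrier = {..<n} \<rightarrow>\<^sub>E carrier K,
      monoid.mult = undefined,
      one = undefined,
      zero = (\<lambda>i\<in>{..<n}. \<zero>\<^bsub>K\<^esub>),
      add = (\<lambda>v w. \<lambda>i\<in>{..<n}. v i \<oplus>\<^bsub>K\<^esub> w i),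
      module.smult = (\<lambda>c v. \<lambda>i\<in>{..<n}. c \<otimes>\<^bsub>K\<^esub> v i)\<rparr>"

definition mat_monoid :: "('k, 'm) ring_scheme \<Rightarrow> nat \<Rightarrow> (nat \<times> nat \<Rightarrow> 'k) monoid" where
  "mat_monoid K n =
     \<lparr>carrier = {..<n} \<times> {..<n} \<rightarrow>\<^sub>E carrier K,
      monoid.mult = (\<lambda>X Y. \<lambda>(i, j)\<in>{..<n} \<times> {..<n}. \<Oplus>\<^bsub>K\<^esub>l\<in>{..<n}. X (i, l) \<otimes>\<^bsub>K\<^esub> Y (l, j)),
      one = (\<lambda>(i, j)\<in>{..<n} \<times> {..<n}. if i = j then \<one>\<^bsub>K\<^esub> else \<zero>\<^bsub>K\<^esub>)\<rparr>"

definition GL :: "('k, 'm) ring_scheme \<Rightarrow> nat \<Rightarrow> (nat \<times> nat \<Rightarrow> 'k) monoid" where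
  "GL K n = units_of (mat_monoid K n)"

definition mat_vec ::
    "('k, 'm) ring_scheme \<Rightarrow> nat \<Rightarrow> (nat \<times> nat \<Rightarrow> 'k) \<Rightarrow> (nat \<Rightarrow> 'k) \<Rightarrow> nat \<Rightarrow> 'k" where
  "mat_vec K n X v = (\<lambda>i\<in>{..<n}. \<Oplus>\<^bsub>K\<^esub>j\<in>{..<n}. X (i, j) \<otimes>\<^bsub>K\<^esub> v j)"

text \<open>
  \<^const>\<open>hom\<close> leaves a homomorphism arbitrary outside the carrier of its domain; restricting to
  extensional functions makes the cardinality of the following set the number of homomorphisms.
\<close>

definition Homs :: "('a, 'm) monoid_scheme \<Rightarrow> ('b, 'n) monoid_scheme \<Rightarrow> ('a \<Rightarrow> 'b) set" where
  "Homs G H = hom G H \<inter> extensional (carrier G)"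

text \<open>
  A \<open>KA\<close>-module of dimension \<open>n\<close> is given as \<open>K\<^sup>n\<close> with \<open>A\<close> acting through some
  \<open>\<rho> \<in> Homs A (GL K n)\<close>; its \<open>KA\<close>-submodules are the \<open>A\<close>-invariant \<open>K\<close>-subspaces. Irreducible
  modules of a finite group are finite-dimensional, so each one arises in this way.
\<close>

definition irreducible_rep ::
    "('a, 'm) monoid_scheme \<Rightarrow> ('k, 'l) ring_scheme \<Rightarrow> nat \<Rightarrow> ('a \<Rightarrow> nat \<times> nat \<Rightarrow> 'k) \<Rightarrow> bool" where
  "irreducible_rep A K n \<rho> \<longleftrightarrow>
     \<rho> \<in> Homs A (GL K n) \<and> n \<ge> 1 \<and>
     (\<forall>W. submodule W K (coord_space K n) \<and>
          (\<forall>g\<in>carrier A. \<forall>w\<in>W. mat_vec K n (\<rho> g) w \<in> W) \<longrightarrow>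
        W = {\<zero>\<^bsub>coord_space K n\<^esub>} \<or> W = carrier (coord_space K n))"

text \<open>Isomorphism of the modules given by \<open>\<rho>\<close> and \<open>\<sigma>\<close>, expressed in coordinates.\<close>

definition equivalent_reps ::
    "('a, 'm) monoid_scheme \<Rightarrow> ('k, 'l) ring_scheme \<Rightarrow> nat \<Rightarrow> ('a \<Rightarrow> nat \<times> nat \<Rightarrow> 'k) \<Rightarrow>
     nat \<Rightarrow> ('a \<Rightarrow> nat \<times> nat \<Rightarrow> 'k) \<Rightarrow> bool" where
  "equivalent_reps A K n \<rho> m \<sigma> \<longleftrightarrow>
     n = m \<and>
     (\<exists>T\<in>carrier (GL K n). \<forall>g\<in>carrier A. T \<otimes>\<^bsub>GL K n\<^esub> \<rho> g = \<sigma> g \<otimes>\<^bsub>GL K n\<^esub> T)"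

definition trivial_rep ::
    "('a, 'm) monoid_scheme \<Rightarrow> ('k, 'l) ring_scheme \<Rightarrow> 'a \<Rightarrow> nat \<times> nat \<Rightarrow> 'k" where
  "trivial_rep A K = (\<lambda>g\<in>carrier A. \<one>\<^bsub>GL K 1\<^esub>)"

text \<open>Extension of scalars along a field embedding \<open>h\<close>.\<close>

definition base_change ::
    "('a, 'm) monoid_scheme \<Rightarrow> nat \<Rightarrow> ('k \<Rightarrow> 'l) \<Rightarrow> ('a \<Rightarrow> nat \<times> nat \<Rightarrow> 'k) \<Rightarrow>
     'a \<Rightarrow> nat \<times> nat \<Rightarrow> 'l" where
  "base_change A n h \<rho> = (\<lambda>g\<in>carrier A. \<lambda>p\<in>{..<n} \<times> {..<n}. h (\<rho> g p))"

text \<open>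
  Fields are taken with carrier a set of natural numbers in order to quantify over all of them in
  one formula: every finite field, and the algebraic closure of every finite field, has an
  isomorphic copy of this kind. A module that stays irreducible over the algebraic closure of
  \<open>K\<close> stays irreducible over every extension field of \<open>K\<close>, so the restriction to such extension
  fields \<open>L\<close> below loses nothing. Ring homomorphisms between fields preserve \<open>\<one>\<close> and are
  therefore embeddings.
\<close>

definition absolutely_irreducible_rep ::
    "('a, 'm) monoid_scheme \<Rightarrow> nat ring \<Rightarrow> nat \<Rightarrow> ('a \<Rightarrow> nat \<times> nat \<Rightarrow> nat) \<Rightarrow> bool" where
  "absolutely_irreducible_rep A K n \<rho> \<longleftrightarrow>
     (\<forall>(L :: nat ring) h. field L \<and> h \<in> ring_hom K L \<longrightarrow>
        irreducible_rep A L n (base_change A n h \<rho>))"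

definition splitting_field :: "('a, 'm) monoid_scheme \<Rightarrow> nat ring \<Rightarrow> bool" where
  "splitting_field A K \<longleftrightarrow>
     field K \<and> finite (carrier K) \<and>
     (\<exists>p e. prime (p :: nat) \<and> card (carrier K) = p ^ e \<and> \<not> p dvd card (carrier A)) \<and>
     (\<forall>n \<rho>. irreducible_rep A K n \<rho> \<longrightarrow> absolutely_irreducible_rep A K n \<rho>)"

definition irreducible_representatives ::
    "('a, 'm) monoid_scheme \<Rightarrow> ('k, 'l) ring_scheme \<Rightarrow> nat \<Rightarrow> (nat \<Rightarrow> nat) \<Rightarrow>
     (nat \<Rightarrow> 'a \<Rightarrow> nat \<times> nat \<Rightarrow> 'k) \<Rightarrow> bool" where
  "irreducible_representatives A K s d M \<longleftrightarrow>
     s \<ge> 1 \<and> d 1 = 1 \<and> M 1 = trivial_rep A K \<and>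
     (\<forall>i\<in>{1..s}. irreducible_rep A K (d i) (M i)) \<and>
     (\<forall>i\<in>{1..s}. \<forall>j\<in>{1..s}. equivalent_reps A K (d i) (M i) (d j) (M j) \<longrightarrow> i = j) \<and>
     (\<forall>n \<rho>. irreducible_rep A K n \<rho> \<longrightarrow>
        (\<exists>i\<in>{1..s}. equivalent_reps A K n \<rho> (d i) (M i)))"

definition admissible :: "nat \<Rightarrow> (nat \<Rightarrow> nat) \<Rightarrow> nat \<Rightarrow> (nat \<Rightarrow> int) \<Rightarrow> bool" where
  "admissible s d n t \<longleftrightarrow>
     t \<in> {1..s} \<rightarrow>\<^sub>E UNIV \<and> (\<Sum>i=1..s. t i * int (d i)) = int n"

definition eligible :: "nat \<Rightarrow> (nat \<Rightarrow> nat) \<Rightarrow> nat \<Rightarrow> (nat \<Rightarrow> int) \<Rightarrow> bool" where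
  "eligible s d n t \<longleftrightarrow> admissible s d n t \<and> (\<forall>i\<in>{1..s}. t i \<ge> 0)"

definition minimal_tuple :: "nat \<Rightarrow> (nat \<Rightarrow> nat) \<Rightarrow> nat \<Rightarrow> (nat \<Rightarrow> int) \<Rightarrow> bool" where
  "minimal_tuple s d n t \<longleftrightarrow>
     admissible s d n t \<and>
     (\<forall>u. admissible s d n u \<longrightarrow> (\<Sum>i=1..s. (t i)\<^sup>2) \<le> (\<Sum>i=1..s. (u i)\<^sup>2))"

end

theory Submission
  imports Defs "HOL-Algebra.Multiplicative_Group"
begin

text \<open>
  Over a splitting field \<open>K\<close> with \<open>q\<close> elements, Schur orthogonality provides matrix units
  \<open>E\<^sub>i\<^sub>j\<^sub>k = d\<^sub>i/a \<Sum>\<^sub>g M\<^sub>i(g\<^sup>-\<^sup>1)\<^sub>k\<^sub>j g\<close> of the group algebra. If \<open>\<rho>\<close> is a representation on \<open>K\<^sup>n\<close> in which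
  \<open>M\<^sub>i\<close> has multiplicity \<open>t\<^sub>i\<close>, then bases of the spaces \<open>\<rho>(E\<^sub>i\<^sub>0\<^sub>0) K\<^sup>n\<close> are spread by the matrix units to a
  basis of \<open>K\<^sup>n\<close>, and every basis arises exactly once from a representation of type \<open>t\<close> and such
  bases. Hence there are \<open>|GL\<^sub>n(q)| / \<Prod>\<^sub>i |GL\<^sub>t\<^sub>i(q)|\<close> representations of type \<open>t\<close>; this is the value at \<open>q\<close> of a
  monic integer polynomial of degree \<open>n\<^sup>2 - \<Sum>\<^sub>i t\<^sub>i\<^sup>2\<close>. The leading terms of the sum over all eligible
  tuples come from the minimal ones, and adding \<open>k d\<close> maps minimal tuples for \<open>r\<close> to those for \<open>n\<close>.

  That the degrees do not depend on \<open>K\<close> is seen \<open>p\<close>-adically: the \<open>M\<^sub>i\<close> lift to representations over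
  \<open>\<int>[x]/(p\<^sup>k, F)\<close> for all \<open>k\<close>, and the orthogonality relations lift with them. They show that the number
  \<open>c\<^sub>m\<close> of ways to write \<open>1\<close> as a product of \<open>m\<close> commutators satisfies
  \<open>a c\<^sub>m = \<Sum>\<^sub>i d\<^sub>i\<^sup>2 (a/d\<^sub>i)\<^sup>2\<^sup>m\<close> modulo every \<open>p\<^sup>k\<close>, hence exactly; and these power sums determine
  the multiset of the \<open>d\<^sub>i\<close>.
\<close>

hide_const (open) up_ring.monom up_ring.coeff

section \<open>Orders of general linear groups as polynomials\<close>

text \<open>The degrees come from one field \<open>K\<^sub>0\<close>, but the polynomial has to
  serve every \<open>K\<close>. Two splitting fields of different characteristic have no common
  extension in which representations could be compared, so the comparison goes through integers that
  belong to \<open>A\<close> alone. In characteristic p the orthogonality relations yield such an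
  identity only modulo p, which does not determine the degrees; hence the lifts. No p-adic limit is
  formed: each power of p gets its own lifts, and only congruences between natural numbers are
  collected. Products of commutators serve because the sum of all commutators acts on
  \<open>M_i\<close> as the scalar \<open>(a/d_i)^2\<close>; its powers supply enough power sums to
  separate the degrees. The bound \<open>N\<close> enters the leading term: it ensures that the
  least sum of squares among integer tuples is attained by multiplicities of actual
  representations.\<close>

definition gl_poly :: "nat \<Rightarrow> int poly" where
  "gl_poly m = (\<Prod>i<m. monom 1 m - monom 1 i)"

lemma gl_poly_Suc: "gl_poly (Suc m) = (monom 1 (Suc m) - 1) * monom 1 m * gl_poly m"
proof -
  have "gl_poly (Suc m) = (monom 1 (Suc m) - monom 1 0) * (\<Prod>i<m. monom 1 (Suc m) - monom 1 (Suc i))"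
    unfolding gl_poly_def by (rule prod.lessThan_Suc_shift)
  also have "(\<Prod>i<m. monom 1 (Suc m) - monom 1 (Suc i) :: int poly) = (\<Prod>i<m. monom 1 1 * (monom 1 m - monom 1 i))"
    by (intro prod.cong refl) (simp add: algebra_simps mult_monom)
  also have "\<dots> = monom 1 m * gl_poly m"
    by (simp add: gl_poly_def prod.distrib monom_power)
  finally show ?thesis by (simp add: one_poly_eq_simps monom_0 one_pCons)
qed

text \<open>The quotient is x^(ab) times the Gaussian binomial coefficient of a + b over a, and the
  induction is its Pascal rule: for a + b = n + 1, x^(n+1) - 1 = x^b (x^a - 1) + (x^b - 1), and each
  summand supplies the factor that the induction hypothesis for (a-1, b) or (a, b-1) lacks.\<close>

lemma gl_poly_mult_dvd: "gl_poly a * gl_poly b dvd gl_poly (a + b)"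
proof (induction "a + b" arbitrary: a b)
  case 0
  then show ?case by (simp add: gl_poly_def)
next
  case (Suc n)
  show ?case
  proof (cases "a = 0 \<or> b = 0")
    case True
    then show ?thesis by (auto simp: gl_poly_def)
  next
    case False
    then obtain a' b' where ab: "a = Suc a'" "b = Suc b'"
      by (metis not0_implies_Suc)
    have n: "n = a' + b" "n = a + b'"
      using Suc.hyps(2) ab by auto
    have 1: "gl_poly a' * gl_poly b dvd gl_poly n"
      using Suc.hyps(1)[of a' b] n by simp
    have 2: "gl_poly a * gl_poly b' dvd gl_poly n"
      using Suc.hyps(1)[of a b'] n by simp
    have split: "monom 1 (Suc n) - 1 = monom 1 b * (monom 1 a - 1) + (monom 1 b - 1 :: int poly)"
      using n ab by (simp add: algebra_simps mult_monom)
    \<comment> \<open>The factor x^n of \<open>gl_poly (Suc n)\<close> is split so that x^(a-1), or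
      x^(b-1) below, completes \<open>gl_poly a\<close> or \<open>gl_poly b\<close>.\<close>
    have m1: "monom 1 n = monom 1 a' * (monom 1 b :: int poly)"
      using n by (simp add: mult_monom add.commute)
    have m2: "monom 1 n = monom 1 b' * (monom 1 a :: int poly)"
      using n by (simp add: mult_monom add.commute)
    have d1: "gl_poly a * gl_poly b dvd (monom 1 a - 1) * monom 1 n * gl_poly n"
    proof -
      have "gl_poly a * gl_poly b = ((monom 1 a - 1) * monom 1 a') * (gl_poly a' * gl_poly b)"
        unfolding ab(1) gl_poly_Suc by (simp add: algebra_simps)
      also have "\<dots> dvd ((monom 1 a - 1) * monom 1 n) * gl_poly n"
        unfolding m1 by (intro mult_dvd_mono 1) auto
      finally show ?thesis .
    qed
    have d2: "gl_poly a * gl_poly b dvd (monom 1 b - 1) * monom 1 n * gl_poly n"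
    proof -
      have "gl_poly a * gl_poly b = ((monom 1 b - 1) * monom 1 b') * (gl_poly a * gl_poly b')"
        unfolding ab(2) gl_poly_Suc by (simp add: algebra_simps)
      also have "\<dots> dvd ((monom 1 b - 1) * monom 1 n) * gl_poly n"
        unfolding m2 by (intro mult_dvd_mono 2) auto
      finally show ?thesis .
    qed
    have "gl_poly (a + b) = monom 1 b * ((monom 1 a - 1) * monom 1 n * gl_poly n)
        + (monom 1 b - 1) * monom 1 n * gl_poly n"
      unfolding Suc.hyps(2)[symmetric] gl_poly_Suc split by (simp add: algebra_simps)
    then show ?thesis using d1 d2 by (metis dvd_add dvd_mult)
  qed
qed

lemma prod_gl_poly_dvd: "finite S \<Longrightarrow> (\<Prod>i\<in>S. gl_poly (t i)) dvd gl_poly (\<Sum>i\<in>S. t i)"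
proof (induction S rule: finite_induct)
  case empty
  then show ?case by (simp add: gl_poly_def)
next
  case (insert x S)
  then have "gl_poly (t x) * (\<Prod>i\<in>S. gl_poly (t i)) dvd gl_poly (t x) * gl_poly (sum t S)"
    by (intro mult_dvd_mono) auto
  also have "\<dots> dvd gl_poly (t x + sum t S)" by (rule gl_poly_mult_dvd)
  finally show ?case using insert by simp
qed

lemma monom_minus_one_degree:
  assumes "m > 0"
  shows "degree (monom 1 m - 1 :: int poly) = m" "lead_coeff (monom 1 m - 1 :: int poly) = 1"
proof -
  have "degree (monom 1 m + (- 1) :: int poly) = degree (monom 1 m :: int poly)"
    using assms by (intro degree_add_eq_left) (simp add: degree_monom_eq)
  then show d: "degree (monom 1 m - 1 :: int poly) = m"
    by (simp add: degree_monom_eq)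
  show "lead_coeff (monom 1 m - 1 :: int poly) = 1"
    unfolding d using assms by simp
qed

lemma degree_gl_poly: "degree (gl_poly m) = m\<^sup>2"
  and lead_coeff_gl_poly: "lead_coeff (gl_poly m) = 1"
proof (induction m)
  case 0
  {
    case 1
    then show ?case by (simp add: gl_poly_def)
  next
    case 2
    then show ?case by (simp add: gl_poly_def)
  }
next
  case (Suc m)
  have nz: "gl_poly m \<noteq> 0" using Suc(2) by auto
  have nz2: "monom 1 (Suc m) - 1 \<noteq> (0 :: int poly)"
    using monom_minus_one_degree(2)[of "Suc m"] by auto
  {
    case 1
    have "degree (gl_poly (Suc m)) = Suc m + m + m\<^sup>2"
      unfolding gl_poly_Suc using nz nz2 Suc(1)
      by (simp add: degree_mult_eq degree_monom_eq monom_minus_one_degree)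
    then show ?case by (simp add: power2_eq_square)
  next
    case 2
    have "lead_coeff (monom 1 m :: int poly) = 1" by (simp add: degree_monom_eq)
    then show ?case
      unfolding gl_poly_Suc lead_coeff_mult Suc(2) using monom_minus_one_degree(2)[of "Suc m"]
      by (simp only: mult_1_right zero_less_Suc)
  }
qed

text \<open>Supplies the polynomial that will count the representations with multiplicities t. The
  multiplicities satisfy sum d_i t_i = n, so their plain sum may be smaller than n; the gap is
  filled by the further factor \<open>gl_poly (n - sum t S)\<close>.\<close>

lemma gl_poly_quotient:
  assumes "finite S" "(\<Sum>i\<in>S. t i) \<le> n"
  obtains f where "f * (\<Prod>i\<in>S. gl_poly (t i)) = gl_poly n" "lead_coeff f = 1"
    "degree f + (\<Sum>i\<in>S. (t i)\<^sup>2) = n\<^sup>2"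
proof -
  let ?P = "\<Prod>i\<in>S. gl_poly (t i)"
  have "?P dvd gl_poly (\<Sum>i\<in>S. t i)" by (rule prod_gl_poly_dvd) fact
  also have "\<dots> dvd gl_poly (sum t S) * gl_poly (n - sum t S)" by simp
  also have "\<dots> dvd gl_poly n" using gl_poly_mult_dvd[of "sum t S" "n - sum t S"] assms by simp
  finally obtain f where f: "gl_poly n = ?P * f" by (auto simp: dvd_def)
  have nz: "gl_poly k \<noteq> 0" for k using lead_coeff_gl_poly[of k] by auto
  have lP: "lead_coeff ?P = 1"
    unfolding lead_coeff_prod lead_coeff_gl_poly by simp
  have dP: "degree ?P = (\<Sum>i\<in>S. (t i)\<^sup>2)"
    using nz by (subst degree_prod_eq_sum_degree) (auto simp: degree_gl_poly)
  have fnz: "f \<noteq> 0" "?P \<noteq> 0" using f nz[of n] by auto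
  have "lead_coeff (gl_poly n) = lead_coeff ?P * lead_coeff f" unfolding f by (rule lead_coeff_mult)
  then have "lead_coeff f = 1" unfolding lP lead_coeff_gl_poly by simp
  moreover have "degree f + (\<Sum>i\<in>S. (t i)\<^sup>2) = n\<^sup>2"
    using degree_mult_eq[OF fnz(2,1)] f dP degree_gl_poly[of n] by simp
  ultimately show ?thesis using that[of f] f by (simp add: mult.commute)
qed

lemma poly_gl_poly: "poly (gl_poly m) q = (\<Prod>i<m. q ^ m - q ^ i)"
  by (simp add: gl_poly_def poly_prod poly_monom)

section \<open>Representations modulo a congruence\<close>

text \<open>
  Matrices and vectors are total functions of which only the entries at indices below the dimension
  matter. Elements of a residue ring are represented by elements of a ring of type class
  \<^class>\<open>comm_ring_1\<close>, equality of residues being equality of their images under \<open>\<phi>\<close>. In this way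
  residue rings that depend on parameters can be handled without a type for each of them.
\<close>

definition mat_mult :: "nat \<Rightarrow> ('i \<Rightarrow> nat \<Rightarrow> 'r) \<Rightarrow> (nat \<Rightarrow> 'j \<Rightarrow> 'r) \<Rightarrow> 'i \<Rightarrow> 'j \<Rightarrow> 'r::comm_ring_1" where
  "mat_mult n X Y i j = (\<Sum>l<n. X i l * Y l j)"

lemma mat_mult_assoc: "mat_mult m (mat_mult n X Y) Z i j = mat_mult n X (mat_mult m Y Z) i j"
  unfolding mat_mult_def sum_distrib_left sum_distrib_right
  by (subst sum.swap) (simp add: mult.assoc)

text \<open>Two kinds of instances occur: cosets of an ideal, and the evaluation map from Z[x] onto
  a finite field. The codomain carries no operations; only the equivalence relation induced by
  \<phi> matters.\<close>

locale ring_congruence =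
  fixes \<phi> :: "'r::comm_ring_1 \<Rightarrow> 'k"
  assumes add_cong: "\<phi> x = \<phi> x' \<Longrightarrow> \<phi> y = \<phi> y' \<Longrightarrow> \<phi> (x + y) = \<phi> (x' + y')"
    and mult_cong: "\<phi> x = \<phi> x' \<Longrightarrow> \<phi> y = \<phi> y' \<Longrightarrow> \<phi> (x * y) = \<phi> (x' * y')"
begin

lemma minus_cong: "\<phi> x = \<phi> x' \<Longrightarrow> \<phi> (- x) = \<phi> (- x')"
  using mult_cong[of "-1" "-1" x x'] by simp

lemma diff_cong: "\<phi> x = \<phi> x' \<Longrightarrow> \<phi> y = \<phi> y' \<Longrightarrow> \<phi> (x - y) = \<phi> (x' - y')"
  using add_cong[of x x' "- y" "- y'"] minus_cong[of y y'] by simp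

lemma sum_congr: "(\<And>i. i \<in> S \<Longrightarrow> \<phi> (f i) = \<phi> (g i)) \<Longrightarrow> \<phi> (sum f S) = \<phi> (sum g S)"
  by (induction S rule: infinite_finite_induct) (auto intro: add_cong)

lemma mult_congL: "\<phi> x = \<phi> x' \<Longrightarrow> \<phi> (y * x) = \<phi> (y * x')"
  by (rule mult_cong) auto

lemma mult_congR: "\<phi> x = \<phi> x' \<Longrightarrow> \<phi> (x * y) = \<phi> (x' * y)"
  by (rule mult_cong) auto

lemma eq_iff_diff: "\<phi> x = \<phi> y \<longleftrightarrow> \<phi> (x - y) = \<phi> 0"
  using diff_cong[of x y y y] add_cong[of "x - y" 0 y y] by auto

lemma sum_zero: "(\<And>i. i \<in> S \<Longrightarrow> \<phi> (f i) = \<phi> 0) \<Longrightarrow> \<phi> (sum f S) = \<phi> 0"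
  using sum_congr[of S f "\<lambda>_. 0"] by simp

lemma mult_zero: "\<phi> x = \<phi> 0 \<Longrightarrow> \<phi> (y * x) = \<phi> 0"
  using mult_congL[of x 0 y] by simp

lemma mult_zeroL: "\<phi> x = \<phi> 0 \<Longrightarrow> \<phi> (x * y) = \<phi> 0"
  using mult_congR[of x 0 y] by simp

lemma mat_mult_cong:
  "(\<And>l. l < n \<Longrightarrow> \<phi> (X i l) = \<phi> (X' i l)) \<Longrightarrow> (\<And>l. l < n \<Longrightarrow> \<phi> (Y l j) = \<phi> (Y' l j)) \<Longrightarrow>
    \<phi> (mat_mult n X Y i j) = \<phi> (mat_mult n X' Y' i j)"
  unfolding mat_mult_def by (intro sum_congr mult_cong) auto

end

section \<open>Sums over a finite group and products of commutators\<close>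

locale finite_group = group A for A :: "('a, 'm) monoid_scheme" (structure) +
  assumes finite_carrier: "finite (carrier A)"
begin

lemma sum_left_translate:
  assumes "g \<in> carrier A"
  shows "(\<Sum>x\<in>carrier A. f (g \<otimes> x)) = (\<Sum>x\<in>carrier A. f x)"
  by (rule sum.reindex_bij_witness[where i = "\<lambda>x. inv g \<otimes> x" and j = "\<lambda>x. g \<otimes> x"])
    (use assms in \<open>auto simp: m_assoc[symmetric]\<close>)

lemma sum_right_translate:
  assumes "g \<in> carrier A"
  shows "(\<Sum>x\<in>carrier A. f (x \<otimes> g)) = (\<Sum>x\<in>carrier A. f x)"
  by (rule sum.reindex_bij_witness[where i = "\<lambda>x. x \<otimes> inv g" and j = "\<lambda>x. x \<otimes> g"])
    (use assms in \<open>auto simp: m_assoc\<close>)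

lemma mult_inv_cancel: "x \<in> carrier A \<Longrightarrow> c \<in> carrier A \<Longrightarrow> x \<otimes> c \<otimes> inv c = x"
  by (simp add: m_assoc)

text \<open>The number of ways to write x as a product of m commutators; the recursion strips off
  the last factor.\<close>

primrec commutator_count :: "nat \<Rightarrow> 'a \<Rightarrow> nat" where
  "commutator_count 0 x = (if x = \<one> then 1 else 0)"
| "commutator_count (Suc m) x = (\<Sum>y\<in>carrier A. \<Sum>z\<in>carrier A.
     commutator_count m (x \<otimes> inv (y \<otimes> z \<otimes> inv y \<otimes> inv z)))"

end

section \<open>Averaged products of matrix coefficients\<close>

locale group_congruence = ring_congruence \<phi> + finite_group A
  for \<phi> :: "'r::comm_ring_1 \<Rightarrow> 'k" and A :: "('a, 'm) monoid_scheme" (structure)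
begin

definition rep :: "nat \<Rightarrow> ('a \<Rightarrow> nat \<Rightarrow> nat \<Rightarrow> 'r) \<Rightarrow> bool" where
  "rep n \<rho> \<longleftrightarrow>
    (\<forall>x\<in>carrier A. \<forall>y\<in>carrier A. \<forall>i<n. \<forall>j<n. \<phi> (\<rho> (x \<otimes> y) i j) = \<phi> (mat_mult n (\<rho> x) (\<rho> y) i j)) \<and>
    (\<forall>i<n. \<forall>j<n. \<phi> (\<rho> \<one> i j) = \<phi> (if i = j then 1 else 0))"

lemma rep_mult:
  "rep n \<rho> \<Longrightarrow> x \<in> carrier A \<Longrightarrow> y \<in> carrier A \<Longrightarrow> i < n \<Longrightarrow> j < n \<Longrightarrow>
    \<phi> (\<rho> (x \<otimes> y) i j) = \<phi> (\<Sum>l<n. \<rho> x i l * \<rho> y l j)"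
  by (simp add: rep_def mat_mult_def)

lemma rep_one: "rep n \<rho> \<Longrightarrow> i < n \<Longrightarrow> j < n \<Longrightarrow> \<phi> (\<rho> \<one> i j) = \<phi> (if i = j then 1 else 0)"
  by (simp add: rep_def)

text \<open>For fixed k and l this is, as a matrix in i and j, the sum of \<rho>(x) e \<sigma>(x)^-1
  over the group, where e is the matrix unit at (k, l). With rows (i, j) and columns (k, l) it is
  the matrix of the operator that sends X to the sum of \<rho>(x) X \<sigma>(x)^-1. Both readings
  are used.\<close>

definition corr :: "('a \<Rightarrow> nat \<Rightarrow> nat \<Rightarrow> 'r) \<Rightarrow> ('a \<Rightarrow> nat \<Rightarrow> nat \<Rightarrow> 'r) \<Rightarrow> nat \<Rightarrow> nat \<Rightarrow> nat \<Rightarrow> nat \<Rightarrow> 'r" where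
  "corr \<rho> \<sigma> i k l j = (\<Sum>x\<in>carrier A. \<rho> x i k * \<sigma> (inv x) l j)"

lemma corr_intertwines:
  assumes "rep n \<rho>" "rep m \<sigma>" "y \<in> carrier A" "i < n" "k < n" "l < m" "j < m"
  shows "\<phi> (\<Sum>i'<n. \<rho> y i i' * corr \<rho> \<sigma> i' k l j) = \<phi> (\<Sum>j'<m. corr \<rho> \<sigma> i k l j' * \<sigma> y j' j)"
proof -
  have "\<phi> (\<Sum>i'<n. \<rho> y i i' * corr \<rho> \<sigma> i' k l j)
      = \<phi> (\<Sum>x\<in>carrier A. (\<Sum>i'<n. \<rho> y i i' * \<rho> x i' k) * \<sigma> (inv x) l j)"
    unfolding corr_def sum_distrib_left sum_distrib_right
    by (subst sum.swap) (simp add: mult.assoc)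
  also have "\<dots> = \<phi> (\<Sum>x\<in>carrier A. \<rho> (y \<otimes> x) i k * \<sigma> (inv x) l j)"
    using assms by (intro sum_congr mult_cong rep_mult[symmetric]) auto
  \<comment> \<open>The summand is rewritten as a function of y x alone, so that the sum can be
    translated.\<close>
  also have "(\<Sum>x\<in>carrier A. \<rho> (y \<otimes> x) i k * \<sigma> (inv x) l j)
      = (\<Sum>x\<in>carrier A. \<rho> (y \<otimes> x) i k * \<sigma> (inv (y \<otimes> x) \<otimes> y) l j)"
    using assms by (intro sum.cong refl) (simp add: inv_mult_group m_assoc)
  also have "\<dots> = (\<Sum>x\<in>carrier A. \<rho> x i k * \<sigma> (inv x \<otimes> y) l j)"
    by (rule sum_left_translate[OF assms(3)])
  also have "\<phi> \<dots> = \<phi> (\<Sum>x\<in>carrier A. \<rho> x i k * (\<Sum>j'<m. \<sigma> (inv x) l j' * \<sigma> y j' j))"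
    using assms by (intro sum_congr mult_cong rep_mult) auto
  also have "(\<Sum>x\<in>carrier A. \<rho> x i k * (\<Sum>j'<m. \<sigma> (inv x) l j' * \<sigma> y j' j))
      = (\<Sum>j'<m. corr \<rho> \<sigma> i k l j' * \<sigma> y j' j)"
    unfolding corr_def sum_distrib_left sum_distrib_right
    by (subst sum.swap) (simp add: mult.assoc)
  finally show ?thesis .
qed

text \<open>Conjugation preserves the trace, so the averaged matrix unit has a times the trace of
  the matrix unit.\<close>

lemma corr_trace:
  assumes "rep n \<rho>" "k < n" "l < n"
  shows "\<phi> (\<Sum>i<n. corr \<rho> \<rho> i k l i) = \<phi> (if k = l then of_nat (card (carrier A)) else 0)"
proof -
  have "(\<Sum>i<n. corr \<rho> \<rho> i k l i) = (\<Sum>x\<in>carrier A. \<Sum>i<n. \<rho> (inv x) l i * \<rho> x i k)"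
    unfolding corr_def by (subst sum.swap) (simp add: mult.commute)
  also have "\<phi> \<dots> = \<phi> (\<Sum>x\<in>carrier A. \<rho> (inv x \<otimes> x) l k)"
    using assms by (intro sum_congr rep_mult[symmetric]) auto
  also have "(\<Sum>x\<in>carrier A. \<rho> (inv x \<otimes> x) l k) = (\<Sum>x\<in>carrier A. \<rho> \<one> l k)"
    by simp
  also have "\<phi> \<dots> = \<phi> (\<Sum>x\<in>carrier A. if l = k then 1 else 0)"
    using assms by (intro sum_congr rep_one) auto
  finally show ?thesis by auto
qed

text \<open>Schur's relations multiplied by the degree: when they are first established over the
  field, it is not yet known that the degree is invertible there.\<close>

definition orthogonal :: "'i set \<Rightarrow> ('i \<Rightarrow> nat) \<Rightarrow> ('i \<Rightarrow> 'a \<Rightarrow> nat \<Rightarrow> nat \<Rightarrow> 'r) \<Rightarrow> bool" where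
  "orthogonal S d M \<longleftrightarrow> (\<forall>i\<in>S. \<forall>i'\<in>S. \<forall>j<d i. \<forall>k<d i. \<forall>k'<d i'. \<forall>j'<d i'.
    \<phi> (of_nat (d i) * corr (M i) (M i') j k k' j')
      = \<phi> (if i = i' \<and> j = j' \<and> k = k' then of_nat (card (carrier A)) else 0))"

text \<open>The second orthogonality relation, dual to \<open>orthogonal\<close>; equivalently, the
  regular character is the sum of the irreducible ones with their degrees as multiplicities.\<close>

definition complete :: "'i set \<Rightarrow> ('i \<Rightarrow> nat) \<Rightarrow> ('i \<Rightarrow> 'a \<Rightarrow> nat \<Rightarrow> nat \<Rightarrow> 'r) \<Rightarrow> bool" where
  "complete S d M \<longleftrightarrow> (\<forall>g\<in>carrier A. \<forall>h\<in>carrier A.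
    \<phi> (\<Sum>i\<in>S. of_nat (d i) * (\<Sum>j<d i. \<Sum>k<d i. M i g j k * M i (inv h) k j))
      = \<phi> (if g = h then of_nat (card (carrier A)) else 0))"

lemma orthogonalD:
  "orthogonal S d M \<Longrightarrow> i \<in> S \<Longrightarrow> i' \<in> S \<Longrightarrow> j < d i \<Longrightarrow> k < d i \<Longrightarrow> k' < d i' \<Longrightarrow> j' < d i' \<Longrightarrow>
    \<phi> (of_nat (d i) * corr (M i) (M i') j k k' j')
      = \<phi> (if i = i' \<and> j = j' \<and> k = k' then of_nat (card (carrier A)) else 0)"
  by (simp add: orthogonal_def)

text \<open>The sum of all commutators is central in the group algebra and acts on
  \<open>M i\<close> as the scalar (a/d_i)^2. Here the four factors are expanded, and orthogonality
  is applied once to the sum over y and once to the sum over z.\<close>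

lemma sum_commutators:
  assumes "orthogonal S d M" "i \<in> S" "rep (d i) (M i)" "j < d i" "k < d i"
  shows "\<phi> (of_nat ((d i)\<^sup>2) * (\<Sum>y\<in>carrier A. \<Sum>z\<in>carrier A. M i (y \<otimes> z \<otimes> inv y \<otimes> inv z) j k))
     = \<phi> (if j = k then of_nat ((card (carrier A))\<^sup>2) else 0)"
proof -
  let ?n = "d i" and ?\<rho> = "M i" and ?a = "of_nat (card (carrier A)) :: 'r"
  have exp: "\<phi> (?\<rho> (y \<otimes> z \<otimes> inv y \<otimes> inv z) j k)
     = \<phi> (\<Sum>r<?n. \<Sum>q<?n. \<Sum>p<?n. (?\<rho> y j p * ?\<rho> (inv y) q r) * (?\<rho> z p q * ?\<rho> (inv z) r k))"
    if yz: "y \<in> carrier A" "z \<in> carrier A" for y z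
  proof -
    have "\<phi> (?\<rho> (y \<otimes> z \<otimes> inv y \<otimes> inv z) j k)
      = \<phi> (\<Sum>r<?n. ?\<rho> (y \<otimes> z \<otimes> inv y) j r * ?\<rho> (inv z) r k)"
      using assms yz by (intro rep_mult) auto
    also have "\<dots> = \<phi> (\<Sum>r<?n. (\<Sum>q<?n. ?\<rho> (y \<otimes> z) j q * ?\<rho> (inv y) q r) * ?\<rho> (inv z) r k)"
      using assms yz by (intro sum_congr mult_congR rep_mult) auto
    also have "\<dots> = \<phi> (\<Sum>r<?n. (\<Sum>q<?n. (\<Sum>p<?n. ?\<rho> y j p * ?\<rho> z p q) * ?\<rho> (inv y) q r) * ?\<rho> (inv z) r k)"
      using assms yz by (intro sum_congr mult_congR rep_mult) auto
    finally show ?thesis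
      by (simp add: sum_distrib_left sum_distrib_right mult_ac)
  qed
  have "\<phi> (\<Sum>y\<in>carrier A. \<Sum>z\<in>carrier A. ?\<rho> (y \<otimes> z \<otimes> inv y \<otimes> inv z) j k)
    = \<phi> (\<Sum>y\<in>carrier A. \<Sum>z\<in>carrier A. \<Sum>r<?n. \<Sum>q<?n. \<Sum>p<?n.
        (?\<rho> y j p * ?\<rho> (inv y) q r) * (?\<rho> z p q * ?\<rho> (inv z) r k))"
    by (intro sum_congr exp)
  also have "(\<Sum>y\<in>carrier A. \<Sum>z\<in>carrier A. \<Sum>r<?n. \<Sum>q<?n. \<Sum>p<?n.
        (?\<rho> y j p * ?\<rho> (inv y) q r) * (?\<rho> z p q * ?\<rho> (inv z) r k))
     = (\<Sum>r<?n. \<Sum>q<?n. \<Sum>p<?n. \<Sum>y\<in>carrier A. \<Sum>z\<in>carrier A.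
        (?\<rho> y j p * ?\<rho> (inv y) q r) * (?\<rho> z p q * ?\<rho> (inv z) r k))"
    by (simp only: sum.swap[where A = "carrier A" and B = "{..<?n}"])
  also have "\<dots> = (\<Sum>r<?n. \<Sum>q<?n. \<Sum>p<?n. corr ?\<rho> ?\<rho> j p q r * corr ?\<rho> ?\<rho> p q r k)"
    unfolding corr_def by (simp only: sum_product)
  finally have "\<phi> (of_nat (?n\<^sup>2) * (\<Sum>y\<in>carrier A. \<Sum>z\<in>carrier A. ?\<rho> (y \<otimes> z \<otimes> inv y \<otimes> inv z) j k))
    = \<phi> (of_nat (?n\<^sup>2) * (\<Sum>r<?n. \<Sum>q<?n. \<Sum>p<?n. corr ?\<rho> ?\<rho> j p q r * corr ?\<rho> ?\<rho> p q r k))"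
    by (rule mult_congL)
  also have "of_nat (?n\<^sup>2) * (\<Sum>r<?n. \<Sum>q<?n. \<Sum>p<?n. corr ?\<rho> ?\<rho> j p q r * corr ?\<rho> ?\<rho> p q r k)
    = (\<Sum>r<?n. \<Sum>q<?n. \<Sum>p<?n. (of_nat ?n * corr ?\<rho> ?\<rho> j p q r) * (of_nat ?n * corr ?\<rho> ?\<rho> p q r k))"
    by (simp add: sum_distrib_left power2_eq_square mult_ac)
  also have "\<phi> \<dots> = \<phi> (\<Sum>r<?n. \<Sum>q<?n. \<Sum>p<?n. (if i = i \<and> j = r \<and> p = q then ?a else 0) * (if i = i \<and> p = k \<and> q = r then ?a else 0))"
    using assms by (intro sum_congr mult_cong orthogonalD[OF assms(1)]) auto
  \<comment> \<open>The first factor forces r = j and p = q, the second p = k and q = r; only p = q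
    = r = k survives, and only if j = k.\<close>
  also have "(\<Sum>r<?n. \<Sum>q<?n. \<Sum>p<?n. (if i = i \<and> j = r \<and> p = q then ?a else 0) * (if i = i \<and> p = k \<and> q = r then ?a else 0))
    = (\<Sum>r<?n. \<Sum>q<?n. \<Sum>p<?n. if p = k then (if q = k then (if r = k then (if j = k then ?a * ?a else 0) else 0) else 0) else 0)"
    by (intro sum.cong refl) auto
  also have "\<dots> = (if j = k then ?a * ?a else 0)"
    using assms(5) by simp
  finally show ?thesis by (simp add: power2_eq_square)
qed

text \<open>The counts are the coefficients of the m-th power of the sum of all commutators in the
  group algebra, so the scalar of \<open>sum_commutators\<close> is raised to the m-th
  power.\<close>

lemma commutator_count_rep:
  assumes "orthogonal S d M" "i \<in> S" "rep (d i) (M i)" "j < d i" "k < d i"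
  shows "\<phi> (of_nat (d i ^ (2 * m)) * (\<Sum>x\<in>carrier A. of_nat (commutator_count m x) * M i x j k))
     = \<phi> (if j = k then of_nat (card (carrier A) ^ (2 * m)) else 0)"
  using assms(4,5)
proof (induction m arbitrary: j k)
  case 0
  have "(\<Sum>x\<in>carrier A. of_nat (commutator_count 0 x) * M i x j k) = (\<Sum>x\<in>carrier A. if x = \<one> then M i \<one> j k else 0)"
    by (intro sum.cong) auto
  also have "\<dots> = M i \<one> j k" by (simp add: finite_carrier)
  finally show ?case using rep_one[OF assms(3)] 0 by simp
next
  case (Suc m)
  let ?n = "d i" and ?\<rho> = "M i" and ?a = "of_nat (card (carrier A)) :: 'r"
  let ?c = "\<lambda>y z. y \<otimes> z \<otimes> inv y \<otimes> inv z"
  let ?C = "\<lambda>m x. of_nat (commutator_count m x) :: 'r"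
  have "(\<Sum>x\<in>carrier A. ?C (Suc m) x * ?\<rho> x j k)
    = (\<Sum>x\<in>carrier A. \<Sum>y\<in>carrier A. \<Sum>z\<in>carrier A. ?C m (x \<otimes> inv (?c y z)) * ?\<rho> x j k)"
    by (simp add: sum_distrib_right)
  also have "\<dots> = (\<Sum>y\<in>carrier A. \<Sum>z\<in>carrier A. \<Sum>x\<in>carrier A. ?C m (x \<otimes> inv (?c y z)) * ?\<rho> x j k)"
    by (rule trans[OF sum.swap], rule sum.cong[OF refl], rule sum.swap)
  \<comment> \<open>For a fixed last commutator c the substitution of x c for x separates the
    remaining m commutators from c.\<close>
  also have "\<dots> = (\<Sum>y\<in>carrier A. \<Sum>z\<in>carrier A. \<Sum>x\<in>carrier A. ?C m x * ?\<rho> (x \<otimes> ?c y z) j k)"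
  proof (rule sum.cong[OF refl], rule sum.cong[OF refl])
    fix y z assume yz: "y \<in> carrier A" "z \<in> carrier A"
    have "(\<Sum>x\<in>carrier A. ?C m (x \<otimes> inv (?c y z)) * ?\<rho> x j k)
      = (\<Sum>x\<in>carrier A. ?C m ((x \<otimes> ?c y z) \<otimes> inv (?c y z)) * ?\<rho> (x \<otimes> ?c y z) j k)"
      using yz by (intro sum_right_translate[symmetric, of "?c y z" "\<lambda>x. ?C m (x \<otimes> inv (?c y z)) * ?\<rho> x j k"]) auto
    also have "\<dots> = (\<Sum>x\<in>carrier A. ?C m x * ?\<rho> (x \<otimes> ?c y z) j k)"
    proof (rule sum.cong[OF refl])
      fix x assume x: "x \<in> carrier A"
      have "(x \<otimes> ?c y z) \<otimes> inv (?c y z) = x"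
        using x yz by (intro mult_inv_cancel) auto
      then show "?C m ((x \<otimes> ?c y z) \<otimes> inv (?c y z)) * ?\<rho> (x \<otimes> ?c y z) j k = ?C m x * ?\<rho> (x \<otimes> ?c y z) j k"
        by simp
    qed
    finally show "(\<Sum>x\<in>carrier A. ?C m (x \<otimes> inv (?c y z)) * ?\<rho> x j k) = (\<Sum>x\<in>carrier A. ?C m x * ?\<rho> (x \<otimes> ?c y z) j k)" .
  qed
  finally have "\<phi> (\<Sum>x\<in>carrier A. ?C (Suc m) x * ?\<rho> x j k)
    = \<phi> (\<Sum>y\<in>carrier A. \<Sum>z\<in>carrier A. \<Sum>x\<in>carrier A. ?C m x * ?\<rho> (x \<otimes> ?c y z) j k)"
    by (rule arg_cong)
  also have "\<dots> = \<phi> (\<Sum>y\<in>carrier A. \<Sum>z\<in>carrier A. \<Sum>x\<in>carrier A. ?C m x * (\<Sum>l<?n. ?\<rho> x j l * ?\<rho> (?c y z) l k))"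
    using assms(3) Suc.prems by (intro sum_congr mult_congL rep_mult) auto
  also have "(\<Sum>y\<in>carrier A. \<Sum>z\<in>carrier A. \<Sum>x\<in>carrier A. ?C m x * (\<Sum>l<?n. ?\<rho> x j l * ?\<rho> (?c y z) l k))
    = (\<Sum>y\<in>carrier A. \<Sum>z\<in>carrier A. \<Sum>l<?n. (\<Sum>x\<in>carrier A. ?C m x * ?\<rho> x j l) * ?\<rho> (?c y z) l k)"
    unfolding sum_distrib_left sum_distrib_right
    by (intro sum.cong refl, subst sum.swap) (simp add: mult.assoc)
  also have "\<dots> = (\<Sum>l<?n. \<Sum>y\<in>carrier A. \<Sum>z\<in>carrier A. (\<Sum>x\<in>carrier A. ?C m x * ?\<rho> x j l) * ?\<rho> (?c y z) l k)"
    by (simp only: sum.swap[where A = "carrier A" and B = "{..<?n}"])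
  also have "\<dots> = (\<Sum>l<?n. (\<Sum>x\<in>carrier A. ?C m x * ?\<rho> x j l) * (\<Sum>y\<in>carrier A. \<Sum>z\<in>carrier A. ?\<rho> (?c y z) l k))"
    by (simp only: sum_distrib_left)
  finally have "\<phi> (of_nat (?n ^ (2 * Suc m)) * (\<Sum>x\<in>carrier A. ?C (Suc m) x * ?\<rho> x j k))
    = \<phi> (of_nat (?n ^ (2 * Suc m)) * (\<Sum>l<?n. (\<Sum>x\<in>carrier A. ?C m x * ?\<rho> x j l) * (\<Sum>y\<in>carrier A. \<Sum>z\<in>carrier A. ?\<rho> (?c y z) l k)))"
    by (rule mult_congL)
  also have "of_nat (?n ^ (2 * Suc m)) * (\<Sum>l<?n. (\<Sum>x\<in>carrier A. ?C m x * ?\<rho> x j l) * (\<Sum>y\<in>carrier A. \<Sum>z\<in>carrier A. ?\<rho> (?c y z) l k))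
    = (\<Sum>l<?n. (of_nat (?n ^ (2 * m)) * (\<Sum>x\<in>carrier A. ?C m x * ?\<rho> x j l)) * (of_nat (?n\<^sup>2) * (\<Sum>y\<in>carrier A. \<Sum>z\<in>carrier A. ?\<rho> (?c y z) l k)))"
    by (subst sum_distrib_left, intro sum.cong refl) (simp add: power2_eq_square)
  also have "\<phi> \<dots> = \<phi> (\<Sum>l<?n. (if j = l then of_nat (card (carrier A) ^ (2 * m)) else 0) * (if l = k then of_nat ((card (carrier A))\<^sup>2) else 0))"
    using Suc.prems by (intro sum_congr mult_cong Suc.IH sum_commutators[OF assms(1-3)]) auto
  also have "(\<Sum>l<?n. (if j = l then of_nat (card (carrier A) ^ (2 * m)) else 0) * (if l = k then of_nat ((card (carrier A))\<^sup>2) else 0))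
     = (\<Sum>l<?n. if l = k then (if j = k then of_nat (card (carrier A) ^ (2 * m)) * of_nat ((card (carrier A))\<^sup>2) else 0) else (0::'r))"
    by (intro sum.cong) auto
  also have "\<dots> = (if j = k then of_nat (card (carrier A) ^ (2 * Suc m)) else 0)"
    using Suc.prems by (simp add: power2_eq_square)
  finally show ?case .
qed

text \<open>A formula of Frobenius type: the preceding identity is paired with the regular
  character, which singles out the identity element. The numbers \<open>e i\<close> = D/d_i keep it
  free of division, a \<open>e i\<close> being D times a/d_i.\<close>

lemma commutator_count_formula:
  assumes orth: "orthogonal S d M" and compl: "complete S d M" and rep: "\<And>i. i \<in> S \<Longrightarrow> rep (d i) (M i)"
    and fin: "finite S" and D: "\<And>i. i \<in> S \<Longrightarrow> d i * e i = D"
  shows "\<phi> (of_nat (card (carrier A) * commutator_count m \<one> * D ^ (2 * m)))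
    = \<phi> (of_nat (\<Sum>i\<in>S. (d i)\<^sup>2 * (card (carrier A) * e i) ^ (2 * m)))"
proof -
  let ?C = "\<lambda>x. of_nat (commutator_count m x) :: 'r" and ?a = "card (carrier A)"
  \<comment> \<open>Completeness at h = 1: the regular character vanishes off the identity.\<close>
  have tr: "\<phi> (\<Sum>i\<in>S. of_nat (d i) * (\<Sum>j<d i. M i g j j)) = \<phi> (if g = \<one> then of_nat ?a else 0)"
    if g: "g \<in> carrier A" for g
  proof -
    have "\<phi> (\<Sum>i\<in>S. of_nat (d i) * (\<Sum>j<d i. \<Sum>k<d i. M i g j k * M i (inv \<one>) k j)) = \<phi> (if g = \<one> then of_nat ?a else 0)"
      using compl g unfolding complete_def by blast
    moreover have "\<phi> (\<Sum>i\<in>S. of_nat (d i) * (\<Sum>j<d i. \<Sum>k<d i. M i g j k * M i (inv \<one>) k j))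
       = \<phi> (\<Sum>i\<in>S. of_nat (d i) * (\<Sum>j<d i. \<Sum>k<d i. M i g j k * (if k = j then 1 else 0)))"
      using rep_one[OF rep] by (intro sum_congr mult_congL) auto
    ultimately show ?thesis by (simp add: if_distrib[of "times _"] cong: if_cong)
  qed
  have "of_nat (?a * commutator_count m \<one> * D ^ (2 * m))
     = (of_nat (D ^ (2 * m)) * (\<Sum>g\<in>carrier A. if g = \<one> then ?C \<one> * of_nat ?a else 0) :: 'r)"
    by (simp add: finite_carrier)
  also have "\<dots> = of_nat (D ^ (2 * m)) * (\<Sum>g\<in>carrier A. ?C g * (if g = \<one> then of_nat ?a else 0))"
    by (intro arg_cong2[of _ _ _ _ times] sum.cong) auto
  finally have "\<phi> (of_nat (?a * commutator_count m \<one> * D ^ (2 * m)))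
    = \<phi> (of_nat (D ^ (2 * m)) * (\<Sum>g\<in>carrier A. ?C g * (if g = \<one> then of_nat ?a else 0)))"
    by (rule arg_cong)
  also have "\<dots> = \<phi> (of_nat (D ^ (2 * m)) * (\<Sum>g\<in>carrier A. ?C g * (\<Sum>i\<in>S. of_nat (d i) * (\<Sum>j<d i. M i g j j))))"
    using tr by (intro mult_congL sum_congr) auto
  also have "of_nat (D ^ (2 * m)) * (\<Sum>g\<in>carrier A. ?C g * (\<Sum>i\<in>S. of_nat (d i) * (\<Sum>j<d i. M i g j j)))
    = (\<Sum>i\<in>S. of_nat (D ^ (2 * m)) * of_nat (d i) * (\<Sum>j<d i. \<Sum>g\<in>carrier A. ?C g * M i g j j))"
    unfolding sum_distrib_left
    by (subst sum.swap, intro sum.cong refl, subst sum.swap) (simp add: mult_ac)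
  also have "\<dots> = (\<Sum>i\<in>S. of_nat (e i ^ (2 * m)) * of_nat (d i) * (\<Sum>j<d i. of_nat (d i ^ (2 * m)) * (\<Sum>g\<in>carrier A. ?C g * M i g j j)))"
  proof (intro sum.cong refl)
    fix i assume "i \<in> S"
    then have "D ^ (2 * m) = d i ^ (2 * m) * e i ^ (2 * m)"
      using D[of i] by (metis power_mult_distrib)
    then show "of_nat (D ^ (2 * m)) * of_nat (d i) * (\<Sum>j<d i. \<Sum>g\<in>carrier A. ?C g * M i g j j)
      = of_nat (e i ^ (2 * m)) * of_nat (d i) * (\<Sum>j<d i. of_nat (d i ^ (2 * m)) * (\<Sum>g\<in>carrier A. ?C g * M i g j j))"
      by (simp add: sum_distrib_left mult_ac)
  qed
  also have "\<phi> \<dots> = \<phi> (\<Sum>i\<in>S. of_nat (e i ^ (2 * m)) * of_nat (d i) * (\<Sum>j<d i. if j = j then of_nat (?a ^ (2 * m)) else 0))"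
    using rep by (intro sum_congr mult_congL commutator_count_rep[OF orth]) auto
  also have "(\<Sum>i\<in>S. of_nat (e i ^ (2 * m)) * of_nat (d i) * (\<Sum>j<d i. if j = j then of_nat (?a ^ (2 * m)) else 0))
     = (of_nat (\<Sum>i\<in>S. (d i)\<^sup>2 * (?a * e i) ^ (2 * m)) :: 'r)"
    by (simp add: power2_eq_square power_mult_distrib mult_ac)
  finally show ?thesis .
qed

end

section \<open>Lifting representations along an ideal filtration\<close>

lemma mat_mult_identity: "j < n \<Longrightarrow> mat_mult n X (\<lambda>l j. if l = j then 1 else 0) i j = X i j"
  by (simp add: mat_mult_def if_distrib[of "times _"] cong: if_cong)

locale ideal_filtration =
  fixes J :: "nat \<Rightarrow> 'r::comm_ring_1 set"
  assumes J_zero: "0 \<in> J k"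
    and J_add: "x \<in> J k \<Longrightarrow> y \<in> J k \<Longrightarrow> x + y \<in> J k"
    and J_smult: "x \<in> J k \<Longrightarrow> y * x \<in> J k"
    and J_mult: "x \<in> J k \<Longrightarrow> y \<in> J l \<Longrightarrow> x * y \<in> J (k + l)"
    and J_Suc: "x \<in> J (Suc k) \<Longrightarrow> x \<in> J k"
begin

text \<open>The coset as a set, so that congruence becomes equality of values, as
  \<open>ring_congruence\<close> demands.\<close>

definition residue :: "nat \<Rightarrow> 'r \<Rightarrow> 'r set" where
  "residue k x = {y. x - y \<in> J k}"

lemma J_smultR: "x \<in> J k \<Longrightarrow> x * y \<in> J k"
  using J_smult[of x k y] by (simp add: mult.commute)

lemma J_uminus: "x \<in> J k \<Longrightarrow> - x \<in> J k"
  using J_smult[of x k "-1"] by simp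

lemma J_diff: "x \<in> J k \<Longrightarrow> y \<in> J k \<Longrightarrow> x - y \<in> J k"
  using J_add[of x k "- y"] J_uminus[of y k] by simp

lemma J_sum: "(\<And>i. i \<in> S \<Longrightarrow> f i \<in> J k) \<Longrightarrow> sum f S \<in> J k"
  by (induction S rule: infinite_finite_induct) (auto intro: J_zero J_add)

lemma J_antimono: "k \<le> l \<Longrightarrow> J l \<subseteq> J k"
  by (rule lift_Suc_antimono_le) (auto intro: J_Suc)

lemma residue_eq_iff: "residue k x = residue k y \<longleftrightarrow> x - y \<in> J k"
proof
  assume "residue k x = residue k y"
  moreover have "y \<in> residue k y" by (simp add: residue_def J_zero)
  ultimately show "x - y \<in> J k" by (auto simp: residue_def)
next
  assume *: "x - y \<in> J k"
  show "residue k x = residue k y"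
    unfolding residue_def
  proof (intro Collect_cong iffI)
    fix z
    show "y - z \<in> J k" if "x - z \<in> J k" using J_diff[OF that *] by simp
    show "x - z \<in> J k" if "y - z \<in> J k" using J_add[OF that *] by simp
  qed
qed

lemma residue_eq_zero_iff: "residue k x = residue k 0 \<longleftrightarrow> x \<in> J k"
  by (simp add: residue_eq_iff)

sublocale level: ring_congruence "residue k" for k
proof
  fix x x' y y'
  assume *: "residue k x = residue k x'" "residue k y = residue k y'"
  then show "residue k (x + y) = residue k (x' + y')"
    using J_add[of "x - x'" k "y - y'"] unfolding residue_eq_iff by (simp add: algebra_simps)
  have "x * y - x' * y' = y * (x - x') + x' * (y - y')" by (simp add: algebra_simps)
  then show "residue k (x * y) = residue k (x' * y')"
    using * J_smult[of "x - x'" k y] J_smult[of "y - y'" k x'] J_add unfolding residue_eq_iff by metis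
qed

lemma residue_mono:
  assumes "residue l x = residue l y" "k \<le> l"
  shows "residue k x = residue k y"
  using assms J_antimono unfolding residue_eq_iff by blast

text \<open>
  The orthogonality relations lift because they say that two commuting projections agree: their
  difference is an idempotent that vanishes modulo \<open>J 1\<close>, hence modulo every \<open>J k\<close>.
\<close>

lemma idempotent_nilpotent:
  assumes idem: "\<And>u v. u \<in> I \<Longrightarrow> v \<in> I \<Longrightarrow> residue k (\<Sum>w\<in>I. E u w * E w v) = residue k (E u v)"
    and J1: "\<And>u v. u \<in> I \<Longrightarrow> v \<in> I \<Longrightarrow> E u v \<in> J 1"
    and "k \<ge> 1" "u \<in> I" "v \<in> I"
  shows "E u v \<in> J k"
proof -
  have "E u v \<in> J m" if "1 \<le> m" "m \<le> k" "u \<in> I" "v \<in> I" for m u v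
    using that
  proof (induction m arbitrary: u v rule: dec_induct)
    case base
    then show ?case by (simp add: J1[unfolded One_nat_def])
  next
    \<comment> \<open>Every product in the square of E has one factor in J 1 and one in J m, and E
      agrees with its square modulo J k.\<close>
    case (step m)
    have "(\<Sum>w\<in>I. E u w * E w v) \<in> J (1 + m)"
      using step by (intro J_sum J_mult J1) auto
    moreover have "(\<Sum>w\<in>I. E u w * E w v) - E u v \<in> J (Suc m)"
      using idem[of u v] J_antimono[of "Suc m" k] step.prems unfolding residue_eq_iff by auto
    ultimately show ?case using J_diff[of "\<Sum>w\<in>I. E u w * E w v" "Suc m"] by fastforce
  qed
  then show ?thesis using assms by auto
qed

end

locale group_filtration = ideal_filtration J + finite_group A
  for J :: "nat \<Rightarrow> 'r::comm_ring_1 set" and A :: "('a, 'm) monoid_scheme" (structure)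
begin

sublocale level: group_congruence "residue k" A for k ..

text \<open>
  The defect \<open>\<epsilon>\<close> of multiplicativity of \<open>r\<close> satisfies the cocycle identity exactly; averaging that
  identity over its last argument shows that the correction \<open>\<beta>\<close> cancels \<open>\<epsilon>\<close> up to terms quadratic in \<open>\<epsilon>\<close>.
\<close>

lemma lift_rep_step:
  assumes rep: "level.rep k n r" and k: "k \<ge> 1"
    and \<alpha>: "residue (Suc k) (\<alpha> * of_nat (card (carrier A))) = residue (Suc k) 1"
  shows "\<exists>r'. level.rep (Suc k) n r' \<and> (\<forall>g\<in>carrier A. \<forall>i<n. \<forall>j<n. residue 1 (r' g i j) = residue 1 (r g i j))"
proof -
  let ?M = "mat_mult n" and ?\<phi> = "residue (Suc k)"
  define \<epsilon> where "\<epsilon> g h i j = ?M (r g) (r h) i j - r (g \<otimes> h) i j" for g h i j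
  define \<beta> where "\<beta> g i j = - (\<alpha> * (\<Sum>l\<in>carrier A. ?M (\<epsilon> g l) (r (inv l)) i j))" for g i j
  define r' where "r' g i j = r g i j + \<beta> g i j" for g i j
  \<comment> \<open>Since k \<ge> 1, 2k is at least k + 1, so products of two correction terms
    vanish at the new level.\<close>
  have JJ: "x * y \<in> J (Suc k)" if "x \<in> J k" "y \<in> J k" for x y
    using J_mult[OF that] J_antimono[of "Suc k" "k + k"] k by auto
  have JM: "?M X Y i j \<in> J (Suc k)" if "\<And>l. l < n \<Longrightarrow> X i l \<in> J k" "\<And>l. l < n \<Longrightarrow> Y l j \<in> J k" for X Y i j
    unfolding mat_mult_def using that by (intro J_sum JJ) auto
  have \<epsilon>J: "\<epsilon> g h i j \<in> J k" if "g \<in> carrier A" "h \<in> carrier A" "i < n" "j < n" for g h i j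
    using rep that unfolding level.rep_def residue_eq_iff \<epsilon>_def
    by (metis J_uminus minus_diff_eq)
  have \<beta>J: "\<beta> g i j \<in> J k" if "g \<in> carrier A" "i < n" for g i j
    unfolding \<beta>_def mat_mult_def
    using that by (intro J_uminus J_smult[where y = \<alpha>] J_sum J_smultR \<epsilon>J) auto
  have cocycle: "?M (r g) (\<epsilon> h l) i j + \<epsilon> g (h \<otimes> l) i j = \<epsilon> (g \<otimes> h) l i j + ?M (\<epsilon> g h) (r l) i j"
    if "g \<in> carrier A" "h \<in> carrier A" "l \<in> carrier A" for g h l i j
  proof -
    have "?M (r g) (\<epsilon> h l) i j = ?M (r g) (?M (r h) (r l)) i j - ?M (r g) (r (h \<otimes> l)) i j"
      unfolding \<epsilon>_def by (simp add: mat_mult_def right_diff_distrib sum_subtractf)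
    moreover have "?M (\<epsilon> g h) (r l) i j = ?M (?M (r g) (r h)) (r l) i j - ?M (r (g \<otimes> h)) (r l) i j"
      unfolding \<epsilon>_def by (simp add: mat_mult_def left_diff_distrib sum_subtractf)
    ultimately show ?thesis
      using that by (simp add: \<epsilon>_def mat_mult_assoc m_assoc)
  qed
  \<comment> \<open>Against a factor from J k the map r is multiplicative up to J (k+1), because its
    own defect is in J k.\<close>
  have unit: "?\<phi> (?M X (?M (r g) (r h)) i j) = ?\<phi> (?M X (r (g \<otimes> h)) i j)"
    if "g \<in> carrier A" "h \<in> carrier A" "j < n" "\<And>l. l < n \<Longrightarrow> X i l \<in> J k" for X g h i j
  proof -
    have "?M X (?M (r g) (r h)) i j - ?M X (r (g \<otimes> h)) i j = ?M X (\<epsilon> g h) i j"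
      unfolding \<epsilon>_def by (simp add: mat_mult_def right_diff_distrib sum_subtractf)
    also have "\<dots> \<in> J (Suc k)" using that by (intro JM \<epsilon>J) auto
    finally show ?thesis by (simp add: residue_eq_iff)
  qed
  have unit1: "?\<phi> (?M X (r \<one>) i j) = ?\<phi> (X i j)"
    if "j < n" "\<And>l. l < n \<Longrightarrow> X i l \<in> J k" for X i j
  proof -
    have "X i j = ?M X (\<lambda>l j. if l = j then 1 else 0) i j"
      using that(1) by (simp add: mat_mult_identity)
    then have "?M X (r \<one>) i j - X i j = ?M X (\<lambda>l j. r \<one> l j - (if l = j then 1 else 0)) i j"
      by (simp add: mat_mult_def right_diff_distrib sum_subtractf)
    also have "\<dots> \<in> J (Suc k)"
      using level.rep_one[OF rep] that by (intro JM) (auto simp: residue_eq_iff)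
    finally show ?thesis by (simp add: residue_eq_iff)
  qed
  have mult: "?\<phi> (r' (g \<otimes> h) i j) = ?\<phi> (?M (r' g) (r' h) i j)"
    if gh: "g \<in> carrier A" "h \<in> carrier A" and ij: "i < n" "j < n" for g h i j
  proof -
    let ?T = "\<lambda>f. \<alpha> * (\<Sum>l\<in>carrier A. f l)"
    define s1 where "s1 = ?T (\<lambda>l. ?M (?M (r g) (\<epsilon> h l)) (r (inv l)) i j)"
    define s2 where "s2 = ?T (\<lambda>l. ?M (\<epsilon> g (h \<otimes> l)) (r (inv l)) i j)"
    define s3 where "s3 = ?T (\<lambda>l. ?M (\<epsilon> (g \<otimes> h) l) (r (inv l)) i j)"
    define s4 where "s4 = ?T (\<lambda>l. ?M (?M (\<epsilon> g h) (r l)) (r (inv l)) i j)"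
    have add: "?M X Z i j + ?M Y Z i j = ?M (\<lambda>i j. X i j + Y i j) Z i j" for X Y Z
      by (simp add: mat_mult_def distrib_right sum.distrib)
    \<comment> \<open>The cocycle identity for g, h, l multiplied on the right by r(l^-1), then
      summed over l and scaled by 1/a.\<close>
    have s: "s1 + s2 = s3 + s4"
      unfolding s1_def s2_def s3_def s4_def distrib_left[symmetric] sum.distrib[symmetric] add
      using gh by (simp add: cocycle cong: sum.cong)
    have e1: "?M (r g) (\<beta> h) i j = - s1"
      unfolding s1_def mat_mult_assoc
      by (simp add: mat_mult_def \<beta>_def sum_negf sum_distrib_left sum.swap[of _ "carrier A"] mult_ac)
    have e3: "\<beta> (g \<otimes> h) i j = - s3"
      by (simp add: s3_def \<beta>_def)
    have e4: "?\<phi> s4 = ?\<phi> (\<epsilon> g h i j)"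
    proof -
      have "?\<phi> s4 = ?\<phi> (?T (\<lambda>l. ?M (\<epsilon> g h) (r (l \<otimes> inv l)) i j))"
        unfolding s4_def mat_mult_assoc using gh ij \<epsilon>J by (intro level.mult_congL level.sum_congr unit) auto
      also have "?T (\<lambda>l. ?M (\<epsilon> g h) (r (l \<otimes> inv l)) i j) = ?T (\<lambda>l. ?M (\<epsilon> g h) (r \<one>) i j)"
        by simp
      also have "?\<phi> \<dots> = ?\<phi> (?T (\<lambda>l. \<epsilon> g h i j))"
        using gh ij \<epsilon>J by (intro level.mult_congL level.sum_congr unit1) auto
      also have "?T (\<lambda>l. \<epsilon> g h i j) = \<alpha> * of_nat (card (carrier A)) * \<epsilon> g h i j"
        by simp
      also have "?\<phi> \<dots> = ?\<phi> (1 * \<epsilon> g h i j)"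
        using \<alpha> by (rule level.mult_congR)
      finally show ?thesis by simp
    qed
    \<comment> \<open>Substituting h l for l turns r(l^-1) r(h) into r(l^-1 h^-1) r(h), which is
      r(l^-1) up to the defect.\<close>
    have e2: "?\<phi> (?M (\<beta> g) (r h) i j) = ?\<phi> (- s2)"
    proof -
      have "?M (\<beta> g) (r h) i j = - ?T (\<lambda>l. ?M (?M (\<epsilon> g l) (r (inv l))) (r h) i j)"
        unfolding \<beta>_def mat_mult_def[of n _ "r h"]
        by (simp add: sum_negf sum_distrib_left sum_distrib_right sum.swap[of _ "carrier A"] mult_ac)
      also have "\<dots> = - ?T (\<lambda>l. ?M (\<epsilon> g l) (?M (r (inv l)) (r h)) i j)"
        by (simp add: mat_mult_assoc)
      also have "\<dots> = - ?T (\<lambda>l. ?M (\<epsilon> g (h \<otimes> l)) (?M (r (inv (h \<otimes> l))) (r h)) i j)"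
        using sum_left_translate[OF gh(2), of "\<lambda>l. ?M (\<epsilon> g l) (?M (r (inv l)) (r h)) i j"] by simp
      finally have "?\<phi> (?M (\<beta> g) (r h) i j) = ?\<phi> (- ?T (\<lambda>l. ?M (\<epsilon> g (h \<otimes> l)) (?M (r (inv (h \<otimes> l))) (r h)) i j))"
        by (rule arg_cong)
      also have "\<dots> = ?\<phi> (- ?T (\<lambda>l. ?M (\<epsilon> g (h \<otimes> l)) (r (inv (h \<otimes> l) \<otimes> h)) i j))"
        using gh ij \<epsilon>J by (intro level.minus_cong level.mult_congL level.sum_congr unit) auto
      also have "?T (\<lambda>l. ?M (\<epsilon> g (h \<otimes> l)) (r (inv (h \<otimes> l) \<otimes> h)) i j) = s2"
        unfolding s2_def using gh by (simp add: inv_mult_group m_assoc cong: sum.cong)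
      finally show ?thesis .
    qed
    have e5: "?M (\<beta> g) (\<beta> h) i j \<in> J (Suc k)"
      using gh ij by (intro JM \<beta>J) auto
    have "?M (r' g) (r' h) i j - r' (g \<otimes> h) i j
       = \<epsilon> g h i j + ?M (r g) (\<beta> h) i j + ?M (\<beta> g) (r h) i j + ?M (\<beta> g) (\<beta> h) i j - \<beta> (g \<otimes> h) i j"
      unfolding r'_def \<epsilon>_def by (simp add: mat_mult_def algebra_simps sum.distrib)
    also have "\<dots> = (\<epsilon> g h i j - s4) + (?M (\<beta> g) (r h) i j + s2) + ?M (\<beta> g) (\<beta> h) i j"
      unfolding e1 e3 using s by (simp add: algebra_simps)
    also have "\<dots> \<in> J (Suc k)"
    proof (rule J_add[OF J_add e5])
      show "\<epsilon> g h i j - s4 \<in> J (Suc k)" using e4[symmetric] by (simp only: residue_eq_iff)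
      show "?M (\<beta> g) (r h) i j + s2 \<in> J (Suc k)" using e2 by (simp add: residue_eq_iff)
    qed
    finally show ?thesis by (metis residue_eq_iff)
  qed
  have r'k: "r' g i j - r g i j \<in> J k" if "g \<in> carrier A" "i < n" for g i j
    using \<beta>J[OF that] by (simp add: r'_def)
  \<comment> \<open>Multiplicativity only makes r'(1) idempotent. With r'(1) = 1 + \<delta> this
    says that \<delta>^2 + \<delta> vanishes modulo J (k+1); \<delta> is in J k, so \<delta>^2
    vanishes there and \<delta> does too.\<close>
  have one: "?\<phi> (r' \<one> i j) = ?\<phi> (if i = j then 1 else 0)" if "i < n" "j < n" for i j
  proof -
    define \<delta> where "\<delta> i j = r' \<one> i j - (if i = j then 1 else 0)" for i j
    have dk: "\<delta> i j \<in> J k" if "i < n" "j < n" for i j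
    proof -
      have "r \<one> i j - (if i = j then 1 else 0) \<in> J k"
        using level.rep_one[OF rep that] by (simp only: residue_eq_iff)
      from J_add[OF r'k[of \<one> i j] this] that show ?thesis by (simp add: \<delta>_def)
    qed
    have r1: "r' \<one> = (\<lambda>i j. \<delta> i j + (if i = j then 1 else 0))" by (simp add: \<delta>_def)
    have "?M (r' \<one>) (r' \<one>) i j - r' \<one> i j = ?M \<delta> \<delta> i j + \<delta> i j"
      unfolding r1 using that
      by (simp add: mat_mult_def distrib_left distrib_right sum.distrib if_distrib[of "times _"] if_distrib[of "\<lambda>x. x * _"] cong: if_cong)
    moreover have "?M (r' \<one>) (r' \<one>) i j - r' \<one> i j \<in> J (Suc k)"
      using mult[of \<one> \<one> i j] that by (metis l_one one_closed residue_eq_iff)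
    moreover have "?M \<delta> \<delta> i j \<in> J (Suc k)" using that dk by (intro JM) auto
    ultimately have "\<delta> i j \<in> J (Suc k)"
      using J_diff by (metis add_diff_cancel_left')
    then show ?thesis unfolding residue_eq_iff by (simp add: \<delta>_def)
  qed
  have "level.rep (Suc k) n r'" unfolding level.rep_def using mult one by blast
  moreover have "residue 1 (r' g i j) = residue 1 (r g i j)" if "g \<in> carrier A" "i < n" for g i j
    using r'k[OF that] J_antimono[OF k] unfolding residue_eq_iff by blast
  ultimately show ?thesis by blast
qed

end

section \<open>The averaging operator on matrices\<close>

context group_congruence
begin

text \<open>Averaging twice is averaging once: the operator that sends X to the sum of \<rho>(x) X
  \<sigma>(x)^-1 is a times a projection, and the double sum is the product of its matrix with
  itself.\<close>

lemma corr_compose: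
  assumes "rep n \<rho>" "rep m \<sigma>" "j < n" "l < n" "l' < m" "j' < m"
  shows "\<phi> (\<Sum>k<n. \<Sum>k'<m. corr \<rho> \<sigma> j k k' j' * corr \<rho> \<sigma> k l l' k')
    = \<phi> (of_nat (card (carrier A)) * corr \<rho> \<sigma> j l l' j')"
proof -
  have "\<phi> (\<Sum>k<n. \<Sum>k'<m. corr \<rho> \<sigma> j k k' j' * corr \<rho> \<sigma> k l l' k')
    = \<phi> (\<Sum>k<n. \<Sum>k'<m. \<Sum>x\<in>carrier A. \<Sum>y\<in>carrier A. \<rho> x j k * \<sigma> (inv x) k' j' * (\<rho> y k l * \<sigma> (inv y) l' k'))"
    unfolding corr_def by (simp only: sum_product)
  also have "\<dots> = \<phi> (\<Sum>x\<in>carrier A. \<Sum>y\<in>carrier A. \<Sum>k<n. \<Sum>k'<m. \<rho> x j k * \<sigma> (inv x) k' j' * (\<rho> y k l * \<sigma> (inv y) l' k'))"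
    by (simp only: sum.swap[where B = "carrier A" and A = "{..<n}"] sum.swap[where B = "carrier A" and A = "{..<m}"])
  also have "\<dots> = \<phi> (\<Sum>x\<in>carrier A. \<Sum>y\<in>carrier A. (\<Sum>k<n. \<rho> x j k * \<rho> y k l) * (\<Sum>k'<m. \<sigma> (inv y) l' k' * \<sigma> (inv x) k' j'))"
    unfolding sum_product by (simp only: mult_ac)
  also have "\<dots> = \<phi> (\<Sum>x\<in>carrier A. \<Sum>y\<in>carrier A. \<rho> (x \<otimes> y) j l * \<sigma> (inv y \<otimes> inv x) l' j')"
    using assms by (intro sum_congr mult_cong rep_mult[symmetric]) auto
  also have "\<dots> = \<phi> (\<Sum>x\<in>carrier A. \<Sum>y\<in>carrier A. \<rho> (x \<otimes> y) j l * \<sigma> (inv (x \<otimes> y)) l' j')"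
    by (intro arg_cong[where f = \<phi>] sum.cong refl) (simp add: inv_mult_group)
  also have "\<dots> = \<phi> (\<Sum>x\<in>carrier A. corr \<rho> \<sigma> j l l' j')"
    unfolding corr_def
    by (intro arg_cong[where f = \<phi>] sum.cong refl sum_left_translate[where f = "\<lambda>y. \<rho> y j l * \<sigma> (inv y) l' j'"])
  finally show ?thesis by simp
qed

text \<open>The averaging operator multiplies the identity matrix by a. Together with
  \<open>corr_trace\<close> this relates it to the projection onto scalar matrices.\<close>

lemma corr_contract:
  assumes "rep n \<rho>" "j < n" "j' < n"
  shows "\<phi> (\<Sum>k<n. corr \<rho> \<rho> j k k j') = \<phi> (if j = j' then of_nat (card (carrier A)) else 0)"
proof -
  have "(\<Sum>k<n. corr \<rho> \<rho> j k k j') = (\<Sum>x\<in>carrier A. \<Sum>k<n. \<rho> x j k * \<rho> (inv x) k j')"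
    unfolding corr_def by (rule sum.swap)
  then have "\<phi> (\<Sum>k<n. corr \<rho> \<rho> j k k j') = \<phi> (\<Sum>x\<in>carrier A. \<Sum>k<n. \<rho> x j k * \<rho> (inv x) k j')"
    by (rule arg_cong)
  also have "\<dots> = \<phi> (\<Sum>x\<in>carrier A. \<rho> (x \<otimes> inv x) j j')"
    using assms by (intro sum_congr rep_mult[symmetric]) auto
  also have "(\<Sum>x\<in>carrier A. \<rho> (x \<otimes> inv x) j j') = (\<Sum>x\<in>carrier A. \<rho> \<one> j j')"
    by simp
  also have "\<phi> \<dots> = \<phi> (\<Sum>x\<in>carrier A. if j = j' then 1 else 0)"
    using assms by (intro sum_congr rep_one) auto
  finally show ?thesis by auto
qed

end

section \<open>Orthogonality and completeness modulo higher ideals\<close>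

context group_filtration
begin

abbreviation (input) "a \<equiv> card (carrier A)"

lemma lift_rep:
  assumes \<alpha>: "\<And>k. \<exists>\<alpha>. residue k (\<alpha> * of_nat a) = residue k 1"
    and rep: "level.rep 1 n r" and k: "k \<ge> 1"
  shows "\<exists>r'. level.rep k n r' \<and> (\<forall>g\<in>carrier A. \<forall>i<n. \<forall>j<n. residue 1 (r' g i j) = residue 1 (r g i j))"
  using k
proof (induction k rule: dec_induct)
  case base
  then show ?case using rep by auto
next
  case (step k)
  then obtain r' where r': "level.rep k n r'" "\<forall>g\<in>carrier A. \<forall>i<n. \<forall>j<n. residue 1 (r' g i j) = residue 1 (r g i j)"
    by auto
  obtain \<alpha> where "residue (Suc k) (\<alpha> * of_nat a) = residue (Suc k) 1" using \<alpha> by blast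
  from lift_rep_step[OF r'(1) step.hyps(1) this] r'(2) show ?case by metis
qed

lemma corr_cong:
  assumes "\<And>g. g \<in> carrier A \<Longrightarrow> residue k (\<rho> g i j) = residue k (\<rho>' g i j)"
    "\<And>g. g \<in> carrier A \<Longrightarrow> residue k (\<sigma> g l m) = residue k (\<sigma>' g l m)"
  shows "residue k (level.corr \<rho> \<sigma> i j l m) = residue k (level.corr \<rho>' \<sigma>' i j l m)"
  unfolding level.corr_def using assms by (intro level.sum_congr level.mult_cong) auto

text \<open>Takes the place of Schur's lemma for the lifts: \<alpha> times the averaging operator on
  n x m matrices is idempotent at level k and vanishes at level 1, so it vanishes.\<close>

lemma orthogonal_different:
  assumes k: "k \<ge> 1" and rep: "level.rep k n \<rho>" "level.rep k m \<sigma>"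
    and \<alpha>: "residue k (\<alpha> * of_nat a) = residue k 1"
    and zero: "\<And>i j l h. i < n \<Longrightarrow> j < n \<Longrightarrow> l < m \<Longrightarrow> h < m \<Longrightarrow> residue 1 (level.corr \<rho> \<sigma> i j l h) = residue 1 0"
    and ij: "i < n" "j < n" "l < m" "h < m"
  shows "residue k (level.corr \<rho> \<sigma> i j l h) = residue k 0"
proof -
  define E where "E u v = \<alpha> * level.corr \<rho> \<sigma> (fst u) (fst v) (snd v) (snd u)" for u v
  let ?I = "{..<n} \<times> {..<m}"
  have "E (i, h) (j, l) \<in> J k"
  proof (rule idempotent_nilpotent[where I = ?I])
    fix u v assume uv: "u \<in> ?I" "v \<in> ?I"
    obtain u1 u2 v1 v2 where uv': "u = (u1, u2)" "v = (v1, v2)" by (cases u, cases v)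
    have "(\<Sum>w\<in>?I. E u w * E w v)
      = (\<Sum>k<n. \<Sum>k'<m. \<alpha> * \<alpha> * (level.corr \<rho> \<sigma> u1 k k' u2 * level.corr \<rho> \<sigma> k v1 v2 k'))"
      unfolding E_def uv' by (simp add: sum.cartesian_product case_prod_beta mult_ac)
    also have "\<dots> = \<alpha> * \<alpha> * (\<Sum>k<n. \<Sum>k'<m. (level.corr \<rho> \<sigma> u1 k k' u2 * level.corr \<rho> \<sigma> k v1 v2 k'))"
      by (simp add: sum_distrib_left)
    finally have "residue k (\<Sum>w\<in>?I. E u w * E w v)
      = residue k (\<alpha> * \<alpha> * (\<Sum>k<n. \<Sum>k'<m. (level.corr \<rho> \<sigma> u1 k k' u2 * level.corr \<rho> \<sigma> k v1 v2 k')))"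
      by (rule arg_cong)
    also have "\<dots> = residue k (\<alpha> * \<alpha> * (of_nat a * level.corr \<rho> \<sigma> u1 v1 v2 u2))"
      using uv uv' by (intro level.mult_congL level.corr_compose rep) auto
    also have "\<alpha> * \<alpha> * (of_nat a * level.corr \<rho> \<sigma> u1 v1 v2 u2) = (\<alpha> * of_nat a) * E u v"
      by (simp add: E_def uv' mult_ac)
    also have "residue k \<dots> = residue k (1 * E u v)" by (intro level.mult_congR \<alpha>)
    finally show "residue k (\<Sum>w\<in>?I. E u w * E w v) = residue k (E u v)" by simp
    show "E u v \<in> J 1" unfolding E_def using uv uv' zero
      by (intro J_smult) (auto simp: residue_eq_zero_iff)
  qed (use k ij in auto)
  then have "of_nat a * (\<alpha> * level.corr \<rho> \<sigma> i j l h) \<in> J k" by (simp add: E_def J_smult)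
  then have "residue k ((\<alpha> * of_nat a) * level.corr \<rho> \<sigma> i j l h) = residue k 0"
    by (simp add: residue_eq_zero_iff mult_ac)
  then show ?thesis using level.mult_congR[OF \<alpha>, of "level.corr \<rho> \<sigma> i j l h"] by simp
qed

text \<open>P is the averaging projection on n x n matrices, Q sends X to the scalar matrix tr(X)/n.
  Averaging fixes scalars and preserves traces, so PQ = QP = Q and P - Q is idempotent. The
  relations at level 1 say that P and Q agree there, hence they agree at level k.\<close>

lemma orthogonal_same:
  assumes k: "k \<ge> 1" and rep: "level.rep k n \<rho>"
    and \<alpha>: "residue k (\<alpha> * of_nat a) = residue k 1"
    and \<gamma>: "residue k (\<gamma> * of_nat n) = residue k 1"
    and one: "\<And>i j l h. i < n \<Longrightarrow> j < n \<Longrightarrow> l < n \<Longrightarrow> h < n \<Longrightarrow>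
      residue 1 (of_nat n * level.corr \<rho> \<rho> i j l h) = residue 1 (if i = h \<and> j = l then of_nat a else 0)"
    and ij: "i < n" "j < n" "l < n" "h < n"
  shows "residue k (of_nat n * level.corr \<rho> \<rho> i j l h) = residue k (if i = h \<and> j = l then of_nat a else 0)"
proof -
  let ?c = "level.corr \<rho> \<rho>" and ?a = "of_nat a :: 'r"
  define Q where "Q u v = (if fst u = snd u then 1 else 0) * (if fst v = snd v then \<gamma> else 0)" for u v :: "nat \<times> nat"
  define P where "P u v = \<alpha> * ?c (fst u) (fst v) (snd v) (snd u)" for u v
  let ?I = "{..<n} \<times> {..<n}"
  have diag: "(\<Sum>w\<in>?I. (if fst w = snd w then c w else 0)) = (\<Sum>k<n. c (k, k))" for c :: "nat \<times> nat \<Rightarrow> 'r"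
  proof -
    have "(\<Sum>w\<in>?I. (if fst w = snd w then c w else 0)) = (\<Sum>(x, y)\<in>?I. if x = y then c (x, y) else 0)"
      by (intro sum.cong) auto
    also have "\<dots> = (\<Sum>x<n. \<Sum>y<n. if x = y then c (x, y) else 0)"
      by (rule sum.cartesian_product[symmetric])
    finally show ?thesis by simp
  qed
  have PP: "residue k (\<Sum>w\<in>?I. P u w * P w v) = residue k (P u v)" if uv: "u \<in> ?I" "v \<in> ?I" for u v
  proof -
    obtain u1 u2 v1 v2 where uv': "u = (u1, u2)" "v = (v1, v2)" by (cases u, cases v)
    have "(\<Sum>w\<in>?I. P u w * P w v)
      = (\<Sum>k<n. \<Sum>k'<n. \<alpha> * \<alpha> * (?c u1 k k' u2 * ?c k v1 v2 k'))"
      unfolding P_def uv' by (simp add: sum.cartesian_product case_prod_beta mult_ac)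
    also have "\<dots> = \<alpha> * \<alpha> * (\<Sum>k<n. \<Sum>k'<n. (?c u1 k k' u2 * ?c k v1 v2 k'))"
      by (simp add: sum_distrib_left)
    finally have "residue k (\<Sum>w\<in>?I. P u w * P w v)
      = residue k (\<alpha> * \<alpha> * (\<Sum>k<n. \<Sum>k'<n. (?c u1 k k' u2 * ?c k v1 v2 k')))"
      by (rule arg_cong)
    also have "\<dots> = residue k (\<alpha> * \<alpha> * (?a * ?c u1 v1 v2 u2))"
      using uv uv' by (intro level.mult_congL level.corr_compose rep) auto
    also have "\<alpha> * \<alpha> * (?a * ?c u1 v1 v2 u2) = (\<alpha> * ?a) * P u v"
      by (simp add: P_def uv' mult_ac)
    also have "residue k \<dots> = residue k (1 * P u v)" by (intro level.mult_congR \<alpha>)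
    finally show ?thesis by simp
  qed
  have PQ: "residue k (\<Sum>w\<in>?I. P u w * Q w v) = residue k (Q u v)" if uv: "u \<in> ?I" "v \<in> ?I" for u v
  proof -
    let ?q = "if fst v = snd v then \<gamma> else 0"
    have "(\<Sum>w\<in>?I. P u w * Q w v) = (\<Sum>w\<in>?I. if fst w = snd w then P u w * ?q else 0)"
      by (intro sum.cong) (auto simp: Q_def)
    also have "\<dots> = \<alpha> * ?q * (\<Sum>k<n. ?c (fst u) k k (snd u))"
      unfolding diag by (simp add: P_def sum_distrib_left mult_ac)
    finally have "residue k (\<Sum>w\<in>?I. P u w * Q w v) = residue k (\<alpha> * ?q * (\<Sum>k<n. ?c (fst u) k k (snd u)))"
      by (rule arg_cong)
    also have "\<dots> = residue k (\<alpha> * ?q * (if fst u = snd u then ?a else 0))"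
      using uv by (intro level.mult_congL level.corr_contract rep) auto
    also have "\<alpha> * ?q * (if fst u = snd u then ?a else 0) = (\<alpha> * ?a) * Q u v"
      by (simp add: Q_def)
    also have "residue k \<dots> = residue k (1 * Q u v)" by (intro level.mult_congR \<alpha>)
    finally show ?thesis by simp
  qed
  have QP: "residue k (\<Sum>w\<in>?I. Q u w * P w v) = residue k (Q u v)" if uv: "u \<in> ?I" "v \<in> ?I" for u v
  proof -
    let ?q = "if fst u = snd u then \<gamma> else 0"
    have "(\<Sum>w\<in>?I. Q u w * P w v) = (\<Sum>w\<in>?I. if fst w = snd w then ?q * P w v else 0)"
      by (intro sum.cong) (auto simp: Q_def)
    also have "\<dots> = \<alpha> * ?q * (\<Sum>k<n. ?c k (fst v) (snd v) k)"
      unfolding diag by (simp add: P_def sum_distrib_left mult_ac)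
    finally have "residue k (\<Sum>w\<in>?I. Q u w * P w v) = residue k (\<alpha> * ?q * (\<Sum>k<n. ?c k (fst v) (snd v) k))"
      by (rule arg_cong)
    also have "\<dots> = residue k (\<alpha> * ?q * (if fst v = snd v then ?a else 0))"
      using uv by (intro level.mult_congL level.corr_trace rep) auto
    also have "\<alpha> * ?q * (if fst v = snd v then ?a else 0) = (\<alpha> * ?a) * Q u v"
      by (simp add: Q_def)
    also have "residue k \<dots> = residue k (1 * Q u v)" by (intro level.mult_congR \<alpha>)
    finally show ?thesis by simp
  qed
  have QQ: "residue k (\<Sum>w\<in>?I. Q u w * Q w v) = residue k (Q u v)" for u v
  proof -
    have "(\<Sum>w\<in>?I. Q u w * Q w v) = (\<Sum>w\<in>?I. if fst w = snd w then \<gamma> * Q u v else 0)"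
      by (intro sum.cong) (auto simp: Q_def)
    also have "\<dots> = (\<gamma> * of_nat n) * Q u v"
      unfolding diag by simp
    finally have "residue k (\<Sum>w\<in>?I. Q u w * Q w v) = residue k ((\<gamma> * of_nat n) * Q u v)"
      by (rule arg_cong)
    also have "\<dots> = residue k (1 * Q u v)" by (intro level.mult_congR \<gamma>)
    finally show ?thesis by simp
  qed
  have "P (i, h) (j, l) - Q (i, h) (j, l) \<in> J k"
  proof (rule idempotent_nilpotent[where I = ?I])
    fix u v assume uv: "u \<in> ?I" "v \<in> ?I"
    have "(\<Sum>w\<in>?I. (P u w - Q u w) * (P w v - Q w v))
      = (\<Sum>w\<in>?I. P u w * P w v) - (\<Sum>w\<in>?I. P u w * Q w v) - ((\<Sum>w\<in>?I. Q u w * P w v) - (\<Sum>w\<in>?I. Q u w * Q w v))"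
      by (simp add: algebra_simps sum.distrib sum_subtractf)
    also have "residue k \<dots> = residue k (P u v - Q u v - (Q u v - Q u v))"
      by (intro level.diff_cong PP PQ QP QQ uv)
    finally show "residue k (\<Sum>w\<in>?I. (P u w - Q u w) * (P w v - Q w v)) = residue k (P u v - Q u v)" by simp
    let ?X = "?c (fst u) (fst v) (snd v) (snd u)"
    have \<alpha>1: "residue 1 (\<alpha> * ?a) = residue 1 1" and \<gamma>1: "residue 1 (\<gamma> * of_nat n) = residue 1 1"
      by (rule residue_mono[OF \<alpha> k], rule residue_mono[OF \<gamma> k])
    have "residue 1 (P u v) = residue 1 (\<alpha> * (1 * ?X))" by (simp add: P_def)
    also have "\<dots> = residue 1 (\<alpha> * ((\<gamma> * of_nat n) * ?X))"
      by (intro level.mult_congL level.mult_congR \<gamma>1[symmetric])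
    also have "\<dots> = residue 1 (\<alpha> * \<gamma> * (of_nat n * ?X))" by (simp add: mult_ac)
    also have "\<dots> = residue 1 (\<alpha> * \<gamma> * (if fst u = snd u \<and> fst v = snd v then ?a else 0))"
      using uv by (intro level.mult_congL one) auto
    also have "\<alpha> * \<gamma> * (if fst u = snd u \<and> fst v = snd v then ?a else 0) = (\<alpha> * ?a) * Q u v"
      by (simp add: Q_def)
    also have "residue 1 \<dots> = residue 1 (1 * Q u v)" by (intro level.mult_congR \<alpha>1)
    finally show "P u v - Q u v \<in> J 1" by (simp add: residue_eq_iff)
  qed (use k ij in auto)
  then have e: "residue k (P (i, h) (j, l)) = residue k (Q (i, h) (j, l))" by (simp add: residue_eq_iff)
  have "residue k (of_nat n * ?c i j l h) = residue k (of_nat n * (1 * ?c i j l h))" by simp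
  also have "\<dots> = residue k (of_nat n * ((\<alpha> * ?a) * ?c i j l h))"
    by (intro level.mult_congL level.mult_congR \<alpha>[symmetric])
  also have "\<dots> = residue k (of_nat n * ?a * P (i, h) (j, l))" by (simp add: P_def mult_ac)
  also have "\<dots> = residue k (of_nat n * ?a * Q (i, h) (j, l))" by (intro level.mult_congL e)
  also have "\<dots> = residue k ((\<gamma> * of_nat n) * (if i = h \<and> j = l then ?a else 0))"
    by (simp add: Q_def mult_ac)
  also have "\<dots> = residue k (1 * (if i = h \<and> j = l then ?a else 0))" by (intro level.mult_congR \<gamma>)
  finally show ?thesis by simp
qed

text \<open>By orthogonality, U/a is the matrix of a projection on the functions on the group. The
  complementary projection E vanishes at level 1 by completeness there, hence at level k.\<close>

lemma complete_of_orthogonal: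
  assumes k: "k \<ge> 1" and fin: "finite S"
    and \<alpha>: "residue k (\<alpha> * of_nat a) = residue k 1"
    and orth: "level.orthogonal k S d M" and compl: "level.complete 1 S d M"
  shows "level.complete k S d M"
proof -
  let ?a = "of_nat a :: 'r"
  define T where "T = (SIGMA i:S. {..<d i} \<times> {..<d i})"
  define U where "U g h = (\<Sum>(i,j,l)\<in>T. of_nat (d i) * (M i g j l * M i (inv h) l j))" for g h
  have U: "(\<Sum>i\<in>S. of_nat (d i) * (\<Sum>j<d i. \<Sum>k<d i. M i g j k * M i (inv h) k j)) = U g h" for g h
    unfolding U_def T_def using fin
    by (simp add: sum.Sigma[symmetric] sum.cartesian_product[symmetric] sum_distrib_left)
  define E where "E g h = (if g = h then 1 else 0) - \<alpha> * U g h" for g h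
  have UU: "residue k (\<Sum>h\<in>carrier A. (\<alpha> * U g h) * (\<alpha> * U h l)) = residue k (\<alpha> * U g l)"
    if "g \<in> carrier A" "l \<in> carrier A" for g l
  proof -
    define X where "X = (\<lambda>(i,j,k) g. M i g j k)"
    define Y where "Y = (\<lambda>(i,j,k) g. M i (inv g) k j)"
    let ?d = "\<lambda>\<tau>. of_nat (d (fst \<tau>)) :: 'r"
    have U': "U g h = (\<Sum>\<tau>\<in>T. ?d \<tau> * (X \<tau> g * Y \<tau> h))" for g h
      unfolding U_def X_def Y_def by (intro sum.cong) auto
    have "(\<Sum>h\<in>carrier A. (\<alpha> * U g h) * (\<alpha> * U h l))
      = (\<Sum>h\<in>carrier A. \<Sum>\<tau>\<in>T. \<Sum>\<tau>'\<in>T. \<alpha> * \<alpha> * ((?d \<tau> * (X \<tau> g * Y \<tau> h)) * (?d \<tau>' * (X \<tau>' h * Y \<tau>' l))))"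
      unfolding U' by (simp add: sum_distrib_left sum_product mult_ac)
    also have "\<dots> = (\<Sum>\<tau>\<in>T. \<Sum>\<tau>'\<in>T. \<Sum>h\<in>carrier A. \<alpha> * \<alpha> * ((?d \<tau> * (X \<tau> g * Y \<tau> h)) * (?d \<tau>' * (X \<tau>' h * Y \<tau>' l))))"
      by (simp only: sum.swap[where A = "carrier A" and B = T])
    also have "\<dots> = (\<Sum>\<tau>\<in>T. \<Sum>\<tau>'\<in>T. \<alpha> * \<alpha> * ?d \<tau> * X \<tau> g * Y \<tau>' l * (?d \<tau>' * (\<Sum>h\<in>carrier A. X \<tau>' h * Y \<tau> h)))"
      by (simp add: sum_distrib_left mult_ac)
    finally have "residue k (\<Sum>h\<in>carrier A. (\<alpha> * U g h) * (\<alpha> * U h l))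
      = residue k (\<Sum>\<tau>\<in>T. \<Sum>\<tau>'\<in>T. \<alpha> * \<alpha> * ?d \<tau> * X \<tau> g * Y \<tau>' l * (?d \<tau>' * (\<Sum>h\<in>carrier A. X \<tau>' h * Y \<tau> h)))"
      by (rule arg_cong)
    also have "\<dots> = residue k (\<Sum>\<tau>\<in>T. \<Sum>\<tau>'\<in>T. \<alpha> * \<alpha> * ?d \<tau> * X \<tau> g * Y \<tau>' l * (if \<tau>' = \<tau> then ?a else 0))"
    proof (intro level.sum_congr level.mult_congL)
      fix \<tau> \<tau>' assume "\<tau> \<in> T" "\<tau>' \<in> T"
      moreover obtain i j m i' j' m' where "\<tau> = (i, j, m)" "\<tau>' = (i', j', m')" by (cases \<tau>, cases \<tau>')
      ultimately show "residue k (?d \<tau>' * (\<Sum>h\<in>carrier A. X \<tau>' h * Y \<tau> h)) = residue k (if \<tau>' = \<tau> then ?a else 0)"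
        using level.orthogonalD[OF orth, of i' i j' m' m j] unfolding T_def X_def Y_def level.corr_def by auto
    qed
    also have "(\<Sum>\<tau>\<in>T. \<Sum>\<tau>'\<in>T. \<alpha> * \<alpha> * ?d \<tau> * X \<tau> g * Y \<tau>' l * (if \<tau>' = \<tau> then ?a else 0))
      = (\<Sum>\<tau>\<in>T. \<alpha> * \<alpha> * ?d \<tau> * X \<tau> g * Y \<tau> l * ?a)"
    proof (intro sum.cong refl)
      fix \<tau> assume "\<tau> \<in> T"
      moreover have "finite T" using fin by (simp add: T_def)
      moreover have "(\<Sum>\<tau>'\<in>T. \<alpha> * \<alpha> * ?d \<tau> * X \<tau> g * Y \<tau>' l * (if \<tau>' = \<tau> then ?a else 0))
        = (\<Sum>\<tau>'\<in>T. if \<tau>' = \<tau> then \<alpha> * \<alpha> * ?d \<tau> * X \<tau> g * Y \<tau> l * ?a else 0)"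
        by (intro sum.cong) auto
      ultimately show "(\<Sum>\<tau>'\<in>T. \<alpha> * \<alpha> * ?d \<tau> * X \<tau> g * Y \<tau>' l * (if \<tau>' = \<tau> then ?a else 0)) = \<alpha> * \<alpha> * ?d \<tau> * X \<tau> g * Y \<tau> l * ?a"
        by simp
    qed
    also have "\<dots> = (\<alpha> * ?a) * (\<alpha> * U g l)"
      unfolding U' by (simp add: sum_distrib_left mult_ac)
    also have "residue k \<dots> = residue k (1 * (\<alpha> * U g l))" by (intro level.mult_congR \<alpha>)
    finally show ?thesis by simp
  qed
  have EJ: "E g h \<in> J k" if gh: "g \<in> carrier A" "h \<in> carrier A" for g h
  proof (rule idempotent_nilpotent[where I = "carrier A"])
    fix g l assume gl: "g \<in> carrier A" "l \<in> carrier A"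
    have "(\<Sum>h\<in>carrier A. E g h * E h l) = (\<Sum>h\<in>carrier A. (if h = g then (if g = l then 1 else 0) else 0)
       - (if h = g then \<alpha> * U g l else 0) - (if h = l then \<alpha> * U g l else 0) + (\<alpha> * U g h) * (\<alpha> * U h l))"
      unfolding E_def by (intro sum.cong refl) (auto simp: algebra_simps)
    also have "\<dots> = (if g = l then 1 else 0) - \<alpha> * U g l - \<alpha> * U g l + (\<Sum>h\<in>carrier A. (\<alpha> * U g h) * (\<alpha> * U h l))"
      using gl by (simp add: sum.distrib sum_subtractf finite_carrier)
    also have "residue k \<dots> = residue k ((if g = l then 1 else 0) - \<alpha> * U g l - \<alpha> * U g l + \<alpha> * U g l)"
      by (intro level.add_cong UU gl refl)
    finally show "residue k (\<Sum>h\<in>carrier A. E g h * E h l) = residue k (E g l)" by (simp add: E_def)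
    have \<alpha>1: "residue 1 (\<alpha> * ?a) = residue 1 1" by (rule residue_mono[OF \<alpha> k])
    have "residue 1 (\<alpha> * U g l) = residue 1 (\<alpha> * (if g = l then ?a else 0))"
      using compl gl unfolding level.complete_def U by (intro level.mult_congL) auto
    also have "\<dots> = residue 1 (if g = l then 1 else 0)" using \<alpha>1 by simp
    finally show "E g l \<in> J 1" unfolding E_def by (metis residue_eq_iff)
  qed (use k gh in auto)
  show ?thesis
    unfolding level.complete_def U
  proof (intro ballI)
    fix g h assume gh: "g \<in> carrier A" "h \<in> carrier A"
    have e: "residue k (\<alpha> * U g h) = residue k (if g = h then 1 else 0)"
      using EJ[OF gh] unfolding E_def by (metis residue_eq_iff)
    have "residue k (U g h) = residue k (1 * U g h)" by simp
    also have "\<dots> = residue k ((\<alpha> * ?a) * U g h)" by (intro level.mult_congR \<alpha>[symmetric])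
    also have "\<dots> = residue k (?a * (\<alpha> * U g h))" by (simp add: mult_ac)
    also have "\<dots> = residue k (?a * (if g = h then 1 else 0))" by (intro level.mult_congL e)
    finally show "residue k (U g h) = residue k (if g = h then ?a else 0)" by (auto split: if_splits)
  qed
qed

text \<open>Both sides are natural numbers independent of k, so it is enough to have their
  congruence at every level; the lifts behind it may vary with k.\<close>

theorem degree_identity:
  assumes fin: "finite S"
    and inv_a: "\<And>k. \<exists>\<alpha>. residue k (\<alpha> * of_nat a) = residue k 1"
    and inv_d: "\<And>k i. i \<in> S \<Longrightarrow> \<exists>\<gamma>. residue k (\<gamma> * of_nat (d i)) = residue k 1"
    and separated: "\<And>x y :: nat. (\<And>k. k \<ge> 1 \<Longrightarrow> residue k (of_nat x) = residue k (of_nat y)) \<Longrightarrow> x = y"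
    and rep: "\<And>i. i \<in> S \<Longrightarrow> level.rep 1 (d i) (M i)"
    and orth: "level.orthogonal 1 S d M" and compl: "level.complete 1 S d M"
    and D: "\<And>i. i \<in> S \<Longrightarrow> d i * e i = D"
  shows "a * commutator_count m \<one> * D ^ (2 * m) = (\<Sum>i\<in>S. (d i)\<^sup>2 * (a * e i) ^ (2 * m))"
proof (rule separated)
  fix k :: nat assume k: "k \<ge> 1"
  have "\<forall>i\<in>S. \<exists>r'. level.rep k (d i) r' \<and> (\<forall>g\<in>carrier A. \<forall>u<d i. \<forall>v<d i. residue 1 (r' g u v) = residue 1 (M i g u v))"
    using lift_rep[OF inv_a rep k] by blast
  then obtain N where N: "\<And>i. i \<in> S \<Longrightarrow> level.rep k (d i) (N i)"
    and NM: "\<And>i g u v. i \<in> S \<Longrightarrow> g \<in> carrier A \<Longrightarrow> u < d i \<Longrightarrow> v < d i \<Longrightarrow> residue 1 (N i g u v) = residue 1 (M i g u v)"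
    by metis
  obtain \<alpha> where \<alpha>: "residue k (\<alpha> * of_nat a) = residue k 1" using inv_a by blast
  have orth1: "residue 1 (of_nat (d i) * level.corr (N i) (N i') j l l' j')
      = residue 1 (if i = i' \<and> j = j' \<and> l = l' then of_nat a else 0)"
    if "i \<in> S" "i' \<in> S" "j < d i" "l < d i" "l' < d i'" "j' < d i'" for i i' j l l' j'
  proof -
    have "residue 1 (of_nat (d i) * level.corr (N i) (N i') j l l' j') = residue 1 (of_nat (d i) * level.corr (M i) (M i') j l l' j')"
      using that by (intro level.mult_congL corr_cong NM) auto
    then show ?thesis using level.orthogonalD[OF orth, of i i' j l l' j'] that by simp
  qed
  have orthk: "level.orthogonal k S d N"
    unfolding level.orthogonal_def
  proof (intro ballI allI impI)
    fix i i' j l l' j' assume *: "i \<in> S" "i' \<in> S" "j < d i" "l < d i" "l' < d i'" "j' < d i'"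
    obtain \<gamma> where \<gamma>: "residue k (\<gamma> * of_nat (d i)) = residue k 1" using inv_d *(1) by blast
    show "residue k (of_nat (d i) * level.corr (N i) (N i') j l l' j')
      = residue k (if i = i' \<and> j = j' \<and> l = l' then of_nat a else 0)"
    proof (cases "i = i'")
      case True
      then show ?thesis
        using orthogonal_same[OF k N[OF *(1)] \<alpha> \<gamma>, of j l l' j'] orth1[OF *(1) *(1)] * by simp
    next
      case False
      \<comment> \<open>The degree is invertible at every level; it is cancelled because the
        hypothesis of \<open>orthogonal_different\<close> is free of it.\<close>
      have \<gamma>1: "residue 1 (\<gamma> * of_nat (d i)) = residue 1 1" using residue_mono[OF \<gamma> k] .
      have "residue 1 (level.corr (N i) (N i') u v v' u') = residue 1 0"
        if "u < d i" "v < d i" "v' < d i'" "u' < d i'" for u v u' v'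
      proof -
        let ?c = "level.corr (N i) (N i') u v v' u'"
        have "residue 1 (1 * ?c) = residue 1 ((\<gamma> * of_nat (d i)) * ?c)"
          by (intro level.mult_congR \<gamma>1[symmetric])
        also have "\<dots> = residue 1 (\<gamma> * (of_nat (d i) * ?c))" by (simp add: mult_ac)
        also have "\<dots> = residue 1 (\<gamma> * 0)"
          using orth1[OF *(1,2) that] False by (intro level.mult_congL) simp
        finally show ?thesis by simp
      qed
      from level.mult_zero[OF orthogonal_different[OF k N[OF *(1)] N[OF *(2)] \<alpha> this *(3-6)]] False
      show ?thesis by simp
    qed
  qed
  have compl1: "level.complete 1 S d N"
    unfolding level.complete_def
  proof (intro ballI)
    fix g h assume gh: "g \<in> carrier A" "h \<in> carrier A"
    have "residue 1 (\<Sum>i\<in>S. of_nat (d i) * (\<Sum>j<d i. \<Sum>k<d i. N i g j k * N i (inv h) k j))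
      = residue 1 (\<Sum>i\<in>S. of_nat (d i) * (\<Sum>j<d i. \<Sum>k<d i. M i g j k * M i (inv h) k j))"
      using gh by (intro level.sum_congr level.mult_congL level.mult_cong NM) auto
    also have "\<dots> = residue 1 (if g = h then of_nat a else 0)"
      using compl gh unfolding level.complete_def by blast
    finally show "residue 1 (\<Sum>i\<in>S. of_nat (d i) * (\<Sum>j<d i. \<Sum>k<d i. N i g j k * N i (inv h) k j))
       = residue 1 (if g = h then of_nat a else 0)" .
  qed
  show "residue k (of_nat (a * commutator_count m \<one> * D ^ (2 * m)))
     = residue k (of_nat (\<Sum>i\<in>S. (d i)\<^sup>2 * (a * e i) ^ (2 * m)))"
    by (rule level.commutator_count_formula[OF orthk complete_of_orthogonal[OF k fin \<alpha> orthk compl1] N fin D])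
qed

end

section \<open>Finite fields as quotients of integer polynomials\<close>

locale finite_field = field K for K :: "('k, 'l) ring_scheme" (structure) +
  fixes p e :: nat
  assumes finite_K: "finite (carrier K)" and prime_p: "prime p" and card_K: "card (carrier K) = p ^ e"
begin

definition int_embed :: "int \<Rightarrow> 'k" where
  "int_embed c = add_pow K c \<one>"

lemma int_embed_closed [simp]: "int_embed c \<in> carrier K"
  by (simp add: int_embed_def)

lemma int_embed_0 [simp]: "int_embed 0 = \<zero>" and int_embed_1 [simp]: "int_embed 1 = \<one>"
  using add.int_pow_pow[of \<one> 0 0] add.int_pow_1[of \<one>] by (simp_all add: int_embed_def add_pow_def)

lemma int_embed_add: "int_embed (c + d) = int_embed c \<oplus> int_embed d"
  by (simp add: int_embed_def add.int_pow_mult)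

lemma int_embed_mult: "int_embed (c * d) = int_embed c \<otimes> int_embed d"
proof -
  have "int_embed c \<otimes> int_embed d = add_pow K c (\<one> \<otimes> add_pow K d \<one>)"
    unfolding int_embed_def by (intro add_pow_ldistr_int) auto
  also have "\<dots> = add_pow K (d * c) \<one>"
    using add.int_pow_pow[of \<one> c d] by (simp add: mult.commute)
  finally show ?thesis by (simp add: int_embed_def mult.commute)
qed

text \<open>A generator of the multiplicative group. Its powers are all nonzero elements, so
  evaluation of integer polynomials at \<theta> is onto K.\<close>

definition \<theta> :: 'k where
  "\<theta> = (SOME x. x \<in> carrier K \<and> carrier K - {\<zero>} = range (\<lambda>i::nat. x [^] i))"

lemma theta: "\<theta> \<in> carrier K" "carrier K - {\<zero>} = range (\<lambda>i::nat. \<theta> [^] i)"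
proof -
  obtain x where "x \<in> carrier (mult_of K)" "carrier (mult_of K) = {x [^] i | i::nat. i \<in> UNIV}"
    using finite_field_mult_group_has_gen[OF finite_K] by auto
  then have "\<exists>x. x \<in> carrier K \<and> carrier K - {\<zero>} = range (\<lambda>i::nat. x [^] i)"
    by (intro exI[of _ x]) auto
  from someI_ex[OF this] show "\<theta> \<in> carrier K" "carrier K - {\<zero>} = range (\<lambda>i::nat. \<theta> [^] i)"
    by (simp_all add: \<theta>_def)
qed

text \<open>Evaluation at \<theta> by Horner's scheme. In this way Z[x] lies above every finite
  field and above the rings to which its representations are lifted.\<close>

definition \<phi> :: "int poly \<Rightarrow> 'k" where
  "\<phi> f = fold_coeffs (\<lambda>c r. int_embed c \<oplus> \<theta> \<otimes> r) f \<zero>"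

lemma phi_0 [simp]: "\<phi> 0 = \<zero>"
  by (simp add: \<phi>_def)

lemma phi_closed [simp]: "\<phi> f \<in> carrier K"
  by (induction f) (use theta(1) in \<open>auto simp: \<phi>_def fold_coeffs_pCons_coeff_not_0_eq\<close>)

lemma phi_pCons: "\<phi> (pCons c f) = int_embed c \<oplus> \<theta> \<otimes> \<phi> f"
proof (cases "f = 0 \<and> c = 0")
  case True
  then show ?thesis using theta(1) by simp
next
  case False
  then show ?thesis using theta(1)
    by (cases "f = 0") (auto simp: \<phi>_def)
qed

lemma phi_add: "\<phi> (f + g) = \<phi> f \<oplus> \<phi> g"
proof (induction f g rule: poly_induct2)
  case (pCons a f b g)
  then show ?case
    using theta(1) by (simp add: phi_pCons int_embed_add r_distr a_ac)
qed simp

lemma phi_smult: "\<phi> (Polynomial.smult c f) = int_embed c \<otimes> \<phi> f"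
proof (induction f)
  case (pCons a f)
  then show ?case
    using theta(1) by (simp add: phi_pCons int_embed_mult r_distr m_ac)
qed simp

lemma phi_mult: "\<phi> (f * g) = \<phi> f \<otimes> \<phi> g"
proof (induction f)
  case (pCons a f)
  have "\<phi> (pCons a f * g) = int_embed a \<otimes> \<phi> g \<oplus> (int_embed 0 \<oplus> \<theta> \<otimes> \<phi> (f * g))"
    by (simp add: phi_add phi_smult phi_pCons)
  also have "\<dots> = (int_embed a \<oplus> \<theta> \<otimes> \<phi> f) \<otimes> \<phi> g"
    using pCons theta(1) by (simp add: l_distr m_assoc)
  finally show ?case by (simp add: phi_pCons)
qed simp

lemma phi_1 [simp]: "\<phi> 1 = \<one>"
  using theta(1) by (simp add: one_pCons phi_pCons)

lemma phi_const: "\<phi> [:c:] = int_embed c"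
  using theta(1) by (simp add: phi_pCons)

lemma phi_monom: "\<phi> (monom 1 i) = \<theta> [^] i"
proof (induction i)
  case (Suc i)
  have "monom 1 (Suc i) = monom 1 1 * (monom 1 i :: int poly)" by (simp add: mult_monom)
  then show ?case using Suc theta(1) phi_pCons[of 0 "monom 1 i"]
    by (simp add: monom_Suc m_comm)
qed (simp add: monom_0 one_pCons[symmetric])

lemma range_phi: "range \<phi> = carrier K"
proof
  show "carrier K \<subseteq> range \<phi>"
  proof
    fix x assume "x \<in> carrier K"
    then show "x \<in> range \<phi>"
    proof (cases "x = \<zero>")
      case False
      then obtain i :: nat where "x = \<theta> [^] i" using theta(2) \<open>x \<in> carrier K\<close> by blast
      then show ?thesis using phi_monom by (metis rangeI)
    qed (metis phi_0 rangeI)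
  qed
qed auto

sublocale ring_congruence \<phi>
  by standard (simp_all add: phi_add phi_mult)

text \<open>The order p^e of the additive group annihilates 1, and K has no zero divisors, so p
  annihilates 1 already.\<close>

lemma phi_p: "\<phi> [:int p:] = \<zero>"
proof -
  have pw: "\<phi> (f ^ n) = \<zero> \<Longrightarrow> \<phi> f = \<zero>" for f n
  proof (induction n)
    case (Suc n)
    then show ?case using integral[of "\<phi> f" "\<phi> (f ^ n)"] by (auto simp: phi_mult)
  qed simp
  have "add_pow K (order (add_monoid K)) \<one> = \<zero>"
    using add.pow_order_eq_1[of \<one>] by simp
  moreover have "order (add_monoid K) = p ^ e"
    using card_K by (simp add: order_def)
  ultimately have "\<phi> [:int (p ^ e):] = \<zero>"
    by (simp add: phi_const int_embed_def add_pow_def int_pow_int del: of_nat_power)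
  then have "\<phi> ([:int p:] ^ e) = \<zero>"
    by (simp add: poly_const_pow)
  then show ?thesis by (rule pw)
qed

lemma phi_smult_p: "\<phi> (Polynomial.smult (int p) f) = \<zero>"
  using phi_p by (simp add: phi_smult phi_const)

text \<open>
  \<open>F\<close> is a monic integer polynomial of least degree that vanishes at \<open>\<theta>\<close>. Minimality implies that a
  polynomial of smaller degree vanishing at \<open>\<theta>\<close> is divisible by \<open>p\<close>, so that the kernel of \<open>\<phi>\<close> is \<open>(p, F)\<close>.
\<close>

definition is_relation :: "int poly \<Rightarrow> bool" where
  "is_relation F \<longleftrightarrow> lead_coeff F = 1 \<and> \<phi> F = \<zero>"

definition F :: "int poly" where
  "F = arg_min degree is_relation"

lemma F: "lead_coeff F = 1" "\<phi> F = \<zero>" and F_min: "is_relation G \<Longrightarrow> degree F \<le> degree G"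
proof -
  \<comment> \<open>The powers of \<theta> repeat and \<theta> is nonzero, so x^i - 1 is a monic
    relation for some positive i.\<close>
  have "\<exists>i>0. \<theta> [^] (i::nat) = \<one>"
  proof -
    have "\<not> inj (\<lambda>i::nat. \<theta> [^] i)"
      using theta(2) finite_K by (metis finite_Diff finite_imageD infinite_UNIV_nat)
    then obtain i j :: nat where ij: "i < j" "\<theta> [^] i = \<theta> [^] j"
      unfolding inj_def by (metis linorder_neqE_nat)
    have t: "\<theta> [^] i \<noteq> \<zero>" "\<theta> [^] i \<in> carrier K" using theta by blast+
    have "\<theta> [^] i \<otimes> \<theta> [^] (j - i) = \<theta> [^] j"
      using ij(1) theta(1) by (simp add: nat_pow_mult)
    then have "\<theta> [^] i \<otimes> \<theta> [^] (j - i) = \<theta> [^] i \<otimes> \<one>"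
      using ij(2) t by simp
    then have "\<theta> [^] (j - i) = \<one>"
      using m_lcancel[OF t] theta(1) by (metis nat_pow_closed one_closed)
    then show ?thesis using ij by (intro exI[of _ "j - i"]) auto
  qed
  then obtain i :: nat where i: "i > 0" "\<theta> [^] i = \<one>" by blast
  have m1: "monom 1 i - 1 = monom 1 i + [:-1::int:]" by (simp add: one_pCons)
  then have "\<phi> (monom 1 i - 1) = \<one> \<oplus> int_embed (- 1)"
    by (simp only: m1 phi_add phi_monom phi_const i)
  also have "\<dots> = int_embed (1 + - 1)" unfolding int_embed_add by simp
  finally have "is_relation (monom 1 i - 1)"
    using monom_minus_one_degree[OF i(1)] by (simp add: is_relation_def)
  then have "is_relation F" unfolding F_def by (rule arg_min_natI)
  then show "lead_coeff F = 1" "\<phi> F = \<zero>" by (auto simp: is_relation_def)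
  show "is_relation G \<Longrightarrow> degree F \<le> degree G" unfolding F_def by (rule arg_min_nat_le)
qed

lemma F_nonzero: "F \<noteq> 0"
  using F(1) by auto

lemma degree_F_pos: "degree F > 0"
proof (rule ccontr)
  assume "\<not> degree F > 0"
  then obtain c where "F = [:c:]" by (metis degree_eq_zeroE neq0_conv)
  then have "F = 1" using F(1) by (simp add: one_pCons)
  then show False using F(2) by simp
qed

text \<open>Division with remainder works over the integers because F is monic.\<close>

lemma F_division: "\<exists>v r. f = F * v + r \<and> degree r < degree F"
proof (induction "degree f" arbitrary: f rule: less_induct)
  case less
  show ?case
  proof (cases "degree f < degree F")
    case True
    then show ?thesis by (intro exI[of _ 0] exI[of _ f]) simp
  next
    case False
    let ?m = "monom (lead_coeff f) (degree f - degree F)"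
    let ?g = "f - F * ?m"
    have nz: "f \<noteq> 0" using False degree_F_pos by auto
    have d: "degree (F * ?m) = degree f"
      using nz F_nonzero False by (simp add: degree_mult_eq monom_eq_0_iff degree_monom_eq)
    have "lead_coeff (F * ?m) = lead_coeff f"
      unfolding lead_coeff_mult F(1) by (simp add: degree_monom_eq nz)
    then have c: "coeff ?g (degree f) = 0" by (simp add: d)
    have "degree ?g \<le> degree f" using d by (metis degree_diff_le order_refl)
    then have "degree ?g < degree f \<or> ?g = 0"
      using c by (metis le_neq_implies_less leading_coeff_0_iff)
    then have "degree ?g < degree f"
      using False degree_F_pos by auto
    from less[OF this] obtain v r where "?g = F * v + r" "degree r < degree F" by blast
    then show ?thesis by (intro exI[of _ "v + ?m"] exI[of _ r]) (simp add: algebra_simps)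
  qed
qed

lemma low_degree_kernel:
  assumes "\<phi> r = \<zero>" "degree r < degree F"
  shows "\<exists>u. r = Polynomial.smult (int p) u"
  using assms
proof (induction "degree r" arbitrary: r rule: less_induct)
  case less
  let ?c = "lead_coeff r" and ?n = "degree r"
  have "int p dvd ?c"
  proof (rule ccontr)
    assume "\<not> int p dvd ?c"
    then have "coprime (int p) ?c" using prime_p by (simp add: prime_imp_coprime)
    then obtain u w where uw: "u * ?c + w * int p = 1"
      by (metis bezout_int coprime_iff_gcd_eq_1 mult.commute add.commute)
    \<comment> \<open>By the Bezout identity this is a monic relation of the same degree as r,
      against the minimality of F.\<close>
    let ?r = "Polynomial.smult u r + Polynomial.smult (int p) (monom w ?n)"
    have c: "coeff ?r ?n = 1" using uw by (simp add: mult.commute)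
    have "degree ?r \<le> ?n"
      by (intro degree_add_le order_trans[OF degree_smult_le]) (auto simp: degree_monom_le)
    then have d: "degree ?r = ?n" using c by (metis le_antisym le_degree zero_neq_one)
    have "\<phi> ?r = \<zero>" using less.prems(1) by (simp only: phi_add phi_smult_p) (simp add: phi_smult)
    then have "is_relation ?r" using c d by (simp add: is_relation_def)
    from F_min[OF this] show False using d less.prems(2) by simp
  qed
  then obtain b where b: "?c = int p * b" by (auto simp: dvd_def)
  let ?s = "r - monom ?c ?n"
  have m: "monom ?c ?n = Polynomial.smult (int p) (monom b ?n)" by (simp add: b smult_monom)
  show ?case
  proof (cases "?n = 0")
    case True
    then have "r = monom ?c ?n" by (metis degree_eq_zeroE monom_0 coeff_pCons_0)
    then show ?thesis using m by metis
  next
    case False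
    have c0: "coeff ?s ?n = 0" by simp
    have "degree ?s \<le> ?n" by (metis degree_diff_le degree_monom_le order_refl)
    then have ds: "degree ?s < ?n"
      using c0 False by (metis le_neq_implies_less leading_coeff_0_iff degree_0 neq0_conv)
    have "\<phi> r = \<phi> ?s \<oplus> \<phi> (monom ?c ?n)" by (simp add: phi_add[symmetric])
    then have "\<phi> ?s = \<zero>" using less.prems(1) m phi_smult_p by simp
    from less.hyps[OF ds this] ds less.prems(2) obtain u where "?s = Polynomial.smult (int p) u" by auto
    then have "r = Polynomial.smult (int p) (u + monom b ?n)" using m by (simp add: smult_add_right algebra_simps)
    then show ?thesis by blast
  qed
qed

section \<open>The ideals (p^k, F)\<close>

definition J :: "nat \<Rightarrow> int poly set" where
  "J k = {x. \<exists>u v. x = Polynomial.smult (int p ^ k) u + F * v}"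

sublocale ideal_filtration J
proof
  fix k l and x y :: "int poly"
  show "0 \<in> J k" unfolding J_def by (intro CollectI exI[of _ 0]) simp
  show "x + y \<in> J k" if "x \<in> J k" "y \<in> J k"
  proof -
    obtain u v u' v' where "x = Polynomial.smult (int p ^ k) u + F * v" "y = Polynomial.smult (int p ^ k) u' + F * v'"
      using \<open>x \<in> J k\<close> \<open>y \<in> J k\<close> unfolding J_def by blast
    then have "x + y = Polynomial.smult (int p ^ k) (u + u') + F * (v + v')" by (simp add: smult_add_right algebra_simps)
    then show ?thesis unfolding J_def by blast
  qed
  show "y * x \<in> J k" if x: "x \<in> J k"
  proof -
    obtain u v where "x = Polynomial.smult (int p ^ k) u + F * v"
      using x unfolding J_def by blast
    then have "y * x = Polynomial.smult (int p ^ k) (y * u) + F * (y * v)" by (simp add: algebra_simps)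
    then show ?thesis unfolding J_def by blast
  qed
  show "x * y \<in> J (k + l)" if "x \<in> J k" "y \<in> J l"
  proof -
    obtain u v u' v' where "x = Polynomial.smult (int p ^ k) u + F * v" "y = Polynomial.smult (int p ^ l) u' + F * v'"
      using \<open>x \<in> J k\<close> \<open>y \<in> J l\<close> unfolding J_def by blast
    then have "x * y = Polynomial.smult (int p ^ (k + l)) (u * u')
        + F * (v * y + Polynomial.smult (int p ^ k) u * v')"
      by (simp add: algebra_simps power_add)
    then show ?thesis unfolding J_def by blast
  qed
  show "x \<in> J k" if "x \<in> J (Suc k)"
  proof -
    obtain u v where "x = Polynomial.smult (int p ^ Suc k) u + F * v"
      using \<open>x \<in> J (Suc k)\<close> unfolding J_def by blast
    then have "x = Polynomial.smult (int p ^ k) (Polynomial.smult (int p) u) + F * v" by (simp add: mult.commute)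
    then show ?thesis unfolding J_def by blast
  qed
qed

lemma kernel_phi: "\<phi> x = \<zero> \<longleftrightarrow> x \<in> J 1"
proof
  assume *: "\<phi> x = \<zero>"
  obtain v r where vr: "x = F * v + r" "degree r < degree F" using F_division by blast
  then have "\<phi> r = \<zero>" using * F(2) by (simp add: phi_add phi_mult)
  from low_degree_kernel[OF this vr(2)] obtain u where "r = Polynomial.smult (int p) u" by blast
  then have "x = Polynomial.smult (int p ^ 1) u + F * v" using vr(1) by simp
  then show "x \<in> J 1" unfolding J_def by blast
next
  assume "x \<in> J 1"
  then show "\<phi> x = \<zero>" using F(2) by (auto simp: J_def phi_add phi_smult_p phi_mult)
qed

lemma phi_eq_iff: "\<phi> x = \<phi> y \<longleftrightarrow> residue 1 x = residue 1 y"
  unfolding eq_iff_diff[of x y] residue_eq_iff kernel_phi[symmetric] by simp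

text \<open>Z/p^k embeds in Z[x]/(p^k, F). Once u is reduced modulo F, the difference of c and p^k r
  is a multiple of F of smaller degree than F, hence zero.\<close>

lemma const_in_J: "[:c:] \<in> J k \<longleftrightarrow> int p ^ k dvd c"
proof
  assume "[:c:] \<in> J k"
  then obtain u v where uv: "[:c:] = Polynomial.smult (int p ^ k) u + F * v" by (auto simp: J_def)
  obtain v' r where r: "u = F * v' + r" "degree r < degree F" using F_division by blast
  have e: "[:c:] - Polynomial.smult (int p ^ k) r = F * (Polynomial.smult (int p ^ k) v' + v)"
    unfolding uv r(1) by (simp add: algebra_simps smult_add_right)
  have "degree ([:c:] - Polynomial.smult (int p ^ k) r) < degree F"
    using r(2) degree_F_pos
    by (intro le_less_trans[OF degree_diff_le_max]) (auto intro: le_less_trans[OF degree_smult_le])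
  then have "Polynomial.smult (int p ^ k) v' + v = 0"
    unfolding e by (metis F_nonzero degree_mult_eq leD le_add1)
  then have "[:c:] = Polynomial.smult (int p ^ k) r" using e by simp
  then have "c = int p ^ k * coeff r 0" by (metis coeff_pCons_0 coeff_smult)
  then show "int p ^ k dvd c" by simp
next
  assume "int p ^ k dvd c"
  then obtain b where "c = int p ^ k * b" by (auto simp: dvd_def)
  then have "[:c:] = Polynomial.smult (int p ^ k) [:b:] + F * 0" by simp
  then show "[:c:] \<in> J k" unfolding J_def by blast
qed

lemma residue_of_nat_inverse:
  assumes "\<not> p dvd n"
  shows "\<exists>\<alpha>. residue k (\<alpha> * of_nat n) = residue k 1"
proof -
  have "coprime (int p ^ k) (int n)" using assms prime_p by (simp add: prime_imp_coprime)
  then obtain u w where uw: "u * int n + w * int p ^ k = 1"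
    by (metis bezout_int coprime_iff_gcd_eq_1 mult.commute add.commute)
  have "[:u:] * of_nat n - 1 = [:u * int n - 1:]"
    by (simp add: of_nat_poly one_pCons)
  also have "u * int n - 1 = int p ^ k * (- w)" using uw by (simp add: algebra_simps)
  finally have "[:u:] * of_nat n - 1 \<in> J k" by (simp only: const_in_J) simp
  then show ?thesis unfolding residue_eq_iff by blast
qed

lemma residue_of_nat_separated:
  assumes "\<And>k. k \<ge> 1 \<Longrightarrow> residue k (of_nat x) = residue k (of_nat y)"
  shows "x = y"
proof (rule ccontr)
  assume "x \<noteq> y"
  let ?c = "int x - int y"
  \<comment> \<open>As p is at least 2, p^k exceeds the absolute value of the difference, which p^k
    would have to divide.\<close>
  obtain k :: nat where k: "\<bar>?c\<bar> < 2 ^ k" "k \<ge> 1"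
    by (metis le_add1 nat_le_linear of_nat_less_two_power order_less_le_trans power_increasing one_le_numeral linorder_not_less abs_of_nat nat_int_comparison(2) zero_le_imp_eq_int abs_ge_zero)
  have "of_nat x - of_nat y = ([:?c:] :: int poly)" by (simp add: of_nat_poly)
  then have "int p ^ k dvd ?c"
    using assms[OF k(2)] by (simp add: residue_eq_iff const_in_J)
  then have "int p ^ k \<le> \<bar>?c\<bar>" using \<open>x \<noteq> y\<close> dvd_imp_le_int[of ?c "int p ^ k"] by simp
  moreover have "2 ^ k \<le> int p ^ k" using prime_ge_2_nat[OF prime_p] by (intro power_mono) auto
  ultimately show False using k(1) by linarith
qed

end

section \<open>Linear algebra over a residue field\<close>

text \<open>The field is present only through the congruence: there are finitely many classes, and
  every class other than that of 0 is invertible.\<close>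

locale residue_field = ring_congruence \<phi> for \<phi> :: "'r::comm_ring_1 \<Rightarrow> 'k" +
  assumes finite_range: "finite (range \<phi>)"
    and one_neq_zero: "\<phi> 1 \<noteq> \<phi> 0"
    and inverse_ex: "\<phi> x \<noteq> \<phi> 0 \<Longrightarrow> \<exists>y. \<phi> (x * y) = \<phi> 1"
begin

definition lift :: "'k \<Rightarrow> 'r" where
  "lift c = (SOME x. \<phi> x = c)"

lemma phi_lift: "\<phi> (lift (\<phi> x)) = \<phi> x"
  unfolding lift_def by (rule someI) (rule refl)

text \<open>A system of representatives of the residue classes; functions with values in C are the
  canonical vectors and matrices that get counted.\<close>

definition C :: "'r set" where
  "C = lift ` range \<phi>"

lemma lift_in_C [simp]: "lift (\<phi> x) \<in> C"
  by (simp add: C_def)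

lemma lift_C: "x \<in> C \<Longrightarrow> lift (\<phi> x) = x"
  unfolding C_def using phi_lift by auto

definition q :: nat where
  "q = card (range \<phi>)"

lemma finite_C: "finite C"
  using finite_range by (simp add: C_def)

lemma card_C: "card C = q"
  unfolding C_def q_def by (rule card_image) (rule inj_on_inverseI[where g = \<phi>], auto simp: phi_lift)

lemma q_ge_2: "q \<ge> 2"
proof -
  have "card {\<phi> 0, \<phi> 1} \<le> q" unfolding q_def using finite_range by (intro card_mono) auto
  then show ?thesis using one_neq_zero by simp
qed

text \<open>
  A subspace of \<open>K\<^sup>I\<close> is represented by its full preimage, which is closed under congruence of
  the entries at \<open>I\<close>; its elements are counted through the canonical representatives \<open>points I W\<close>.
\<close>

definition subspace :: "'i set \<Rightarrow> ('i \<Rightarrow> 'r) set \<Rightarrow> bool" where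
  "subspace I W \<longleftrightarrow> (\<lambda>_. 0) \<in> W \<and> (\<forall>v\<in>W. \<forall>w\<in>W. (\<lambda>i. v i + w i) \<in> W) \<and>
     (\<forall>c. \<forall>v\<in>W. (\<lambda>i. c * v i) \<in> W) \<and> (\<forall>v\<in>W. \<forall>w. (\<forall>i\<in>I. \<phi> (v i) = \<phi> (w i)) \<longrightarrow> w \<in> W)"

lemma
  assumes "subspace I W"
  shows subspace_zero: "(\<lambda>_. 0) \<in> W"
    and subspace_add: "v \<in> W \<Longrightarrow> w \<in> W \<Longrightarrow> (\<lambda>i. v i + w i) \<in> W"
    and subspace_scale: "v \<in> W \<Longrightarrow> (\<lambda>i. c * v i) \<in> W"
    and subspace_cong: "v \<in> W \<Longrightarrow> (\<And>i. i \<in> I \<Longrightarrow> \<phi> (v i) = \<phi> (w i)) \<Longrightarrow> w \<in> W"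
  using assms unfolding subspace_def by blast+

lemma subspace_sum:
  assumes "subspace I W" "\<And>l. l \<in> L \<Longrightarrow> b l \<in> W"
  shows "(\<lambda>i. \<Sum>l\<in>L. c l * b l i) \<in> W"
  using assms(2)
proof (induction L rule: infinite_finite_induct)
  case (insert x F)
  then show ?case
    using subspace_add[OF assms(1) subspace_scale[OF assms(1), of "b x" "c x"], of "\<lambda>i. \<Sum>l\<in>F. c l * b l i"]
    by simp
qed (use subspace_zero[OF assms(1)] in simp_all)

definition points :: "'i set \<Rightarrow> ('i \<Rightarrow> 'r) set \<Rightarrow> ('i \<Rightarrow> 'r) set" where
  "points I W = W \<inter> (I \<rightarrow>\<^sub>E C)"

definition canon :: "'i set \<Rightarrow> ('i \<Rightarrow> 'r) \<Rightarrow> 'i \<Rightarrow> 'r" where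
  "canon I v = (\<lambda>i\<in>I. lift (\<phi> (v i)))"

lemma phi_canon: "i \<in> I \<Longrightarrow> \<phi> (canon I v i) = \<phi> (v i)"
  by (simp add: canon_def phi_lift)

lemma canon_PiE: "canon I v \<in> I \<rightarrow>\<^sub>E C"
  by (simp add: canon_def)

lemma canon_eq_iff: "canon I v = canon I w \<longleftrightarrow> (\<forall>i\<in>I. \<phi> (v i) = \<phi> (w i))"
proof
  assume eq: "canon I v = canon I w"
  show "\<forall>i\<in>I. \<phi> (v i) = \<phi> (w i)"
  proof
    fix i assume "i \<in> I"
    then show "\<phi> (v i) = \<phi> (w i)" using phi_canon[of i I v] phi_canon[of i I w] eq by simp
  qed
next
  assume "\<forall>i\<in>I. \<phi> (v i) = \<phi> (w i)"
  then show "canon I v = canon I w" unfolding canon_def by (intro restrict_ext) simp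
qed

lemma canon_id: "v \<in> I \<rightarrow>\<^sub>E C \<Longrightarrow> canon I v = v"
  by (rule ext) (metis (no_types, lifting) PiE_arb PiE_mem canon_def lift_C restrict_apply)

lemma canon_in_points: "subspace I W \<Longrightarrow> canon I v \<in> points I W \<longleftrightarrow> v \<in> W"
  unfolding points_def using canon_PiE[of I v] subspace_cong[of I W v "canon I v"] subspace_cong[of I W "canon I v" v]
  by (auto simp: phi_canon)

lemma finite_points: "finite I \<Longrightarrow> finite (points I W)"
  unfolding points_def using finite_C by (intro finite_Int disjI2 finite_PiE) auto

lemma points_mono: "W \<subseteq> W' \<Longrightarrow> points I W \<subseteq> points I W'"
  by (auto simp: points_def)

lemma points_eq_imp_eq:
  assumes "subspace I W" "subspace I W'" "points I W = points I W'"
  shows "W = W'"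
  using canon_in_points[OF assms(1)] canon_in_points[OF assms(2)] assms(3) by auto

lemma card_points_UNIV: "finite I \<Longrightarrow> card (points I UNIV) = q ^ card I"
  by (simp add: points_def card_funcsetE card_C)

lemma subspace_UNIV: "subspace I UNIV"
  by (simp add: subspace_def)

section \<open>Independent families, spans and frames\<close>

definition lincomb :: "'l set \<Rightarrow> ('l \<Rightarrow> 'i \<Rightarrow> 'r) \<Rightarrow> ('l \<Rightarrow> 'r) \<Rightarrow> 'i \<Rightarrow> 'r" where
  "lincomb L b c = (\<lambda>i. \<Sum>l\<in>L. c l * b l i)"

definition indep :: "'i set \<Rightarrow> 'l set \<Rightarrow> ('l \<Rightarrow> 'i \<Rightarrow> 'r) \<Rightarrow> bool" where
  "indep I L b \<longleftrightarrow> (\<forall>c. (\<forall>i\<in>I. \<phi> (lincomb L b c i) = \<phi> 0) \<longrightarrow> (\<forall>l\<in>L. \<phi> (c l) = \<phi> 0))"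

lemma indepD: "indep I L b \<Longrightarrow> (\<And>i. i \<in> I \<Longrightarrow> \<phi> (lincomb L b c i) = \<phi> 0) \<Longrightarrow> l \<in> L \<Longrightarrow> \<phi> (c l) = \<phi> 0"
  unfolding indep_def by blast

definition span :: "'i set \<Rightarrow> 'l set \<Rightarrow> ('l \<Rightarrow> 'i \<Rightarrow> 'r) \<Rightarrow> ('i \<Rightarrow> 'r) set" where
  "span I L b = {v. \<exists>c. \<forall>i\<in>I. \<phi> (v i) = \<phi> (lincomb L b c i)}"

lemma lincomb_add: "lincomb L b (\<lambda>l. c l + c' l) i = lincomb L b c i + lincomb L b c' i"
  by (simp add: lincomb_def distrib_right sum.distrib)

lemma lincomb_diff: "lincomb L b (\<lambda>l. c l - c' l) i = lincomb L b c i - lincomb L b c' i"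
  by (simp add: lincomb_def left_diff_distrib sum_subtractf)

lemma lincomb_scale: "lincomb L b (\<lambda>l. x * c l) i = x * lincomb L b c i"
  by (simp add: lincomb_def sum_distrib_left mult.assoc)

lemma lincomb_cong_coeff:
  "(\<And>l. l \<in> L \<Longrightarrow> \<phi> (c l) = \<phi> (c' l)) \<Longrightarrow> \<phi> (lincomb L b c i) = \<phi> (lincomb L b c' i)"
  unfolding lincomb_def by (intro sum_congr mult_congR) auto

lemma subspace_span: "subspace I (span I L b)"
  unfolding subspace_def span_def
proof (intro conjI ballI allI impI CollectI)
  show "\<exists>c. \<forall>i\<in>I. \<phi> 0 = \<phi> (lincomb L b c i)"
    by (intro exI[of _ "\<lambda>_. 0"]) (simp add: lincomb_def)
next
  fix v w assume "v \<in> {v. \<exists>c. \<forall>i\<in>I. \<phi> (v i) = \<phi> (lincomb L b c i)}" "w \<in> {v. \<exists>c. \<forall>i\<in>I. \<phi> (v i) = \<phi> (lincomb L b c i)}"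
  then obtain c c' where "\<forall>i\<in>I. \<phi> (v i) = \<phi> (lincomb L b c i)" "\<forall>i\<in>I. \<phi> (w i) = \<phi> (lincomb L b c' i)" by blast
  then show "\<exists>c. \<forall>i\<in>I. \<phi> (v i + w i) = \<phi> (lincomb L b c i)"
    by (intro exI[of _ "\<lambda>l. c l + c' l"]) (auto simp: lincomb_add intro: add_cong)
next
  fix x v assume "v \<in> {v. \<exists>c. \<forall>i\<in>I. \<phi> (v i) = \<phi> (lincomb L b c i)}"
  then obtain c where "\<forall>i\<in>I. \<phi> (v i) = \<phi> (lincomb L b c i)" by blast
  then show "\<exists>c. \<forall>i\<in>I. \<phi> (x * v i) = \<phi> (lincomb L b c i)"
    by (intro exI[of _ "\<lambda>l. x * c l"]) (auto simp: lincomb_scale intro: mult_congL)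
next
  fix v w assume "v \<in> {v. \<exists>c. \<forall>i\<in>I. \<phi> (v i) = \<phi> (lincomb L b c i)}" "\<forall>i\<in>I. \<phi> (v i) = \<phi> (w i)"
  then show "\<exists>c. \<forall>i\<in>I. \<phi> (w i) = \<phi> (lincomb L b c i)" by auto
qed

lemma span_subset:
  assumes "subspace I W" "\<And>l. l \<in> L \<Longrightarrow> b l \<in> W"
  shows "span I L b \<subseteq> W"
proof
  fix v assume "v \<in> span I L b"
  then obtain c where "\<And>i. i \<in> I \<Longrightarrow> \<phi> (v i) = \<phi> (lincomb L b c i)" by (auto simp: span_def)
  moreover have "lincomb L b c \<in> W" unfolding lincomb_def by (rule subspace_sum[OF assms])
  ultimately show "v \<in> W" using subspace_cong[OF assms(1)] by metis
qed

lemma points_span: "points I (span I L b) = (\<lambda>c. canon I (lincomb L b c)) ` (L \<rightarrow>\<^sub>E C)"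
proof (intro equalityI subsetI)
  fix v assume "v \<in> (\<lambda>c. canon I (lincomb L b c)) ` (L \<rightarrow>\<^sub>E C)"
  then obtain c where v: "v = canon I (lincomb L b c)" by blast
  have "lincomb L b c \<in> span I L b" by (auto simp: span_def)
  then show "v \<in> points I (span I L b)" using v canon_in_points[OF subspace_span] by blast
next
  fix v assume v: "v \<in> points I (span I L b)"
  then obtain c where c: "\<forall>i\<in>I. \<phi> (v i) = \<phi> (lincomb L b c i)" by (auto simp: points_def span_def)
  have "v = canon I v" using v canon_id by (metis IntE points_def)
  also have "\<dots> = canon I (lincomb L b (canon L c))"
    unfolding canon_eq_iff using c lincomb_cong_coeff[of L c "canon L c" b] phi_canon by metis
  finally show "v \<in> (\<lambda>c. canon I (lincomb L b c)) ` (L \<rightarrow>\<^sub>E C)" by (rule image_eqI[OF _ canon_PiE])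
qed

lemma card_points_span_le:
  assumes "finite L"
  shows "card (points I (span I L b)) \<le> q ^ card L"
proof -
  have "card (points I (span I L b)) \<le> card (L \<rightarrow>\<^sub>E C)"
    unfolding points_span using assms finite_C by (intro card_image_le finite_PiE) auto
  then show ?thesis using assms by (simp add: card_funcsetE card_C)
qed

lemma card_points_span:
  assumes "finite L" "indep I L b"
  shows "card (points I (span I L b)) = q ^ card L"
proof -
  have "inj_on (\<lambda>c. canon I (lincomb L b c)) (L \<rightarrow>\<^sub>E C)"
  proof (rule inj_onI)
    fix c c' assume c: "c \<in> L \<rightarrow>\<^sub>E C" "c' \<in> L \<rightarrow>\<^sub>E C" "canon I (lincomb L b c) = canon I (lincomb L b c')"
    then have "\<phi> (lincomb L b (\<lambda>l. c l - c' l) i) = \<phi> 0" if "i \<in> I" for i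
      using that unfolding lincomb_diff canon_eq_iff by (simp add: eq_iff_diff[symmetric])
    from indepD[OF assms(2) this] have "\<phi> (c l) = \<phi> (c' l)" if "l \<in> L" for l
      using that eq_iff_diff by blast
    then show "c = c'" using c(1,2) canon_id canon_eq_iff by metis
  qed
  then have "card (points I (span I L b)) = card (L \<rightarrow>\<^sub>E C)"
    unfolding points_span by (rule card_image)
  then show ?thesis using assms(1) by (simp add: card_funcsetE card_C)
qed

lemma indep_empty: "indep I {} b"
  by (simp add: indep_def)

lemma indep_insert:
  assumes "finite L" "x \<notin> L"
  shows "indep I (insert x L) (b(x := w)) \<longleftrightarrow> indep I L b \<and> w \<notin> span I L b"
proof -
  have lc: "lincomb (insert x L) (b(x := w)) c i = c x * w i + lincomb L b c i" for c i
    using assms by (simp add: lincomb_def) (intro sum.cong, auto)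
  show ?thesis
  proof (intro iffI conjI notI)
    assume ind: "indep I (insert x L) (b(x := w))"
    show "indep I L b"
      unfolding indep_def
    proof (intro allI impI ballI)
      fix c l assume c: "\<forall>i\<in>I. \<phi> (lincomb L b c i) = \<phi> 0" and l: "l \<in> L"
      have "lincomb L b (c(x := 0)) = lincomb L b c"
        unfolding lincomb_def using assms(2) by (intro ext sum.cong) auto
      then have "\<phi> (lincomb (insert x L) (b(x := w)) (c(x := 0)) i) = \<phi> 0" if "i \<in> I" for i
        unfolding lc using c that by simp
      from indepD[OF ind this, of l] show "\<phi> (c l) = \<phi> 0" using l assms(2) by (auto split: if_splits)
    qed
    assume "w \<in> span I L b"
    then obtain c where c: "\<forall>i\<in>I. \<phi> (w i) = \<phi> (lincomb L b c i)" by (auto simp: span_def)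
    have "lincomb L b (c(x := - 1)) = lincomb L b c"
      unfolding lincomb_def using assms(2) by (intro ext sum.cong) auto
    then have "\<phi> (lincomb (insert x L) (b(x := w)) (c(x := - 1)) i) = \<phi> 0" if "i \<in> I" for i
      unfolding lc using c that eq_iff_diff[of "lincomb L b c i" "w i"] by simp
    from indepD[OF ind this, of x] have "\<phi> (- 1) = \<phi> 0" by simp
    then show False using minus_cong[of "- 1" 0] one_neq_zero by simp
  next
    assume *: "indep I L b \<and> w \<notin> span I L b"
    show "indep I (insert x L) (b(x := w))"
      unfolding indep_def
    proof (intro allI impI)
      fix c assume c: "\<forall>i\<in>I. \<phi> (lincomb (insert x L) (b(x := w)) c i) = \<phi> 0"
      have cx: "\<phi> (c x) = \<phi> 0"
      proof (rule ccontr)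
        assume "\<phi> (c x) \<noteq> \<phi> 0"
        then obtain y where y: "\<phi> (c x * y) = \<phi> 1" using inverse_ex by blast
        have "\<phi> (w i) = \<phi> (lincomb L b (\<lambda>l. - y * c l) i)" if i: "i \<in> I" for i
        proof -
          have "\<phi> (1 * w i) = \<phi> ((c x * y) * w i)" by (rule mult_congR[OF y[symmetric]])
          also have "(c x * y) * w i = y * (c x * w i + lincomb L b c i) + - y * lincomb L b c i"
            by (simp add: algebra_simps)
          also have "\<phi> \<dots> = \<phi> (y * 0 + - y * lincomb L b c i)"
            using c i unfolding lc by (intro add_cong mult_congL) auto
          finally show ?thesis by (simp only: lincomb_scale) simp
        qed
        then show False using * by (auto simp: span_def)
      qed
      have "\<phi> (lincomb L b c i) = \<phi> 0" if i: "i \<in> I" for i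
      proof -
        have "\<phi> (lincomb L b c i) = \<phi> ((c x * w i + lincomb L b c i) - c x * w i)" by simp
        also have "\<dots> = \<phi> (0 - 0 * w i)" using c i cx unfolding lc by (intro diff_cong mult_congR) auto
        finally show ?thesis by simp
      qed
      with * have "\<forall>l\<in>L. \<phi> (c l) = \<phi> 0" unfolding indep_def by blast
      with cx show "\<forall>l\<in>insert x L. \<phi> (c l) = \<phi> 0" by simp
    qed
  qed
qed

text \<open>Ordered independent families of canonical vectors, extensional so that each is counted
  once. The index set is arbitrary because bases will be indexed by triples.\<close>

definition frames :: "'i set \<Rightarrow> 'l set \<Rightarrow> ('i \<Rightarrow> 'r) set \<Rightarrow> ('l \<Rightarrow> 'i \<Rightarrow> 'r) set" where
  "frames I L W = {b \<in> L \<rightarrow>\<^sub>E points I W. indep I L b}"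

lemma fun_upd_in_frames:
  assumes "finite L" "x \<notin> L" "b \<in> frames I L W" "w \<in> points I W" "w \<notin> span I L b"
  shows "b(x := w) \<in> frames I (insert x L) W"
  using assms PiE_fun_upd[of w "\<lambda>_. points I W" x b L] by (simp add: frames_def indep_insert)

lemma finite_frames: "finite I \<Longrightarrow> finite L \<Longrightarrow> finite (frames I L W)"
  unfolding frames_def by (simp add: finite_points finite_PiE)

text \<open>A frame with i members is extended by any point outside its span, which has q^i points.
  The differences are taken in the integers, so the product is correct even if L is larger than the
  dimension: then one factor vanishes.\<close>

lemma card_frames:
  fixes L :: "'l set"
  assumes "finite I" "finite L" "subspace I W"
  shows "int (card (frames I L W)) = (\<Prod>i<card L. int (card (points I W)) - int q ^ i)"
  using assms(2)
proof (induction L rule: finite_induct)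
  case empty
  have "frames I ({} :: 'l set) W = {\<lambda>_. undefined}" by (auto simp: frames_def indep_empty)
  then show ?case by simp
next
  case (insert x L)
  let ?F = "SIGMA b:frames I L W. points I W - points I (span I L b)"
  have inspan: "w \<in> span I L b \<longleftrightarrow> w \<in> points I (span I L b)" if "w \<in> points I W" for w b
    using that by (auto simp: points_def)
  have "bij_betw (\<lambda>(b, w). b(x := w)) ?F (frames I (insert x L) W)"
  proof (rule bij_betw_byWitness[where f' = "\<lambda>b. (restrict b L, b x)"])
    show "\<forall>p\<in>?F. (restrict ((\<lambda>(b, w). b(x := w)) p) L, ((\<lambda>(b, w). b(x := w)) p) x) = p"
    proof
      fix p assume "p \<in> ?F"
      then obtain b w where p: "p = (b, w)" "b \<in> frames I L W" by blast
      then have "b \<in> extensional L" by (simp add: frames_def PiE_def)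
      then show "(restrict ((\<lambda>(b, w). b(x := w)) p) L, ((\<lambda>(b, w). b(x := w)) p) x) = p"
        using insert.hyps p(1) by (auto simp: extensional_def restrict_def fun_eq_iff)
    qed
    show "\<forall>b\<in>frames I (insert x L) W. (\<lambda>(b, w). b(x := w)) (restrict b L, b x) = b"
      by (auto simp: frames_def fun_eq_iff restrict_def PiE_def extensional_def)
    show "(\<lambda>(b, w). b(x := w)) ` ?F \<subseteq> frames I (insert x L) W"
    proof
      fix b' assume "b' \<in> (\<lambda>(b, w). b(x := w)) ` ?F"
      then obtain b w where "b' = b(x := w)" "b \<in> frames I L W" "w \<in> points I W" "w \<notin> points I (span I L b)"
        by auto
      then show "b' \<in> frames I (insert x L) W"
        using inspan[of w b] fun_upd_in_frames[OF insert.hyps(1,2), of b I W w] by simp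
    qed
    show "(\<lambda>b. (restrict b L, b x)) ` frames I (insert x L) W \<subseteq> ?F"
    proof
      fix p assume "p \<in> (\<lambda>b. (restrict b L, b x)) ` frames I (insert x L) W"
      then obtain b where b: "p = (restrict b L, b x)" "b \<in> insert x L \<rightarrow>\<^sub>E points I W" "indep I (insert x L) b"
        by (auto simp: frames_def)
      have "b = (restrict b L)(x := b x)"
        using b(2) by (auto simp: fun_eq_iff restrict_def PiE_def extensional_def)
      then have "indep I L (restrict b L) \<and> b x \<notin> span I L (restrict b L)"
        using b(3) indep_insert[OF insert.hyps] by metis
      then show "p \<in> ?F" using b inspan[of "b x"] by (auto simp: frames_def)
    qed
  qed
  then have "card (frames I (insert x L) W) = card ?F" by (simp add: bij_betw_same_card)
  also have "\<dots> = (\<Sum>b\<in>frames I L W. card (points I W - points I (span I L b)))"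
    using assms(1) insert.hyps by (intro card_SigmaI ballI finite_Diff finite_points finite_frames)
  finally have "int (card (frames I (insert x L) W)) = (\<Sum>b\<in>frames I L W. int (card (points I W - points I (span I L b))))"
    by simp
  also have "\<dots> = (\<Sum>b\<in>frames I L W. int (card (points I W)) - int q ^ card L)"
  proof (intro sum.cong refl)
    fix b assume b: "b \<in> frames I L W"
    then have "span I L b \<subseteq> W" by (intro span_subset assms) (auto simp: frames_def points_def)
    then have sub: "points I (span I L b) \<subseteq> points I W" by (rule points_mono)
    have "card (points I (span I L b)) = q ^ card L"
      using b assms insert.hyps by (intro card_points_span) (auto simp: frames_def)
    then show "int (card (points I W - points I (span I L b))) = int (card (points I W)) - int q ^ card L"
      using sub finite_points[OF assms(1)] card_mono[OF finite_points[OF assms(1)] sub]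
      by (simp add: card_Diff_subset of_nat_diff finite_points[OF assms(1)])
  qed
  finally show ?case using insert by simp
qed

lemma indep_card_imp_span:
  assumes "finite I" "finite L" "subspace I W" "\<And>l. l \<in> L \<Longrightarrow> b l \<in> W" "indep I L b"
    "card (points I W) = q ^ card L"
  shows "span I L b = W"
proof (rule points_eq_imp_eq[OF subspace_span assms(3)])
  have "span I L b \<subseteq> W" by (rule span_subset[OF assms(3,4)])
  then show "points I (span I L b) = points I W"
    using card_points_span[OF assms(2,5)] assms(6) finite_points[OF assms(1)]
    by (intro card_subset_eq points_mono) auto
qed

text \<open>A longest independent family spans. Lengths are bounded because an independent family of
  m vectors spans q^m > m points.\<close>

lemma basis_exists:
  assumes "finite I" "subspace I W"
  obtains m :: nat and b where "b \<in> frames I {..<m} W" "span I {..<m} b = W" "card (points I W) = q ^ m"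
proof -
  define P where "P m \<longleftrightarrow> frames I {..<m} W \<noteq> {}" for m :: nat
  have P0: "P 0" by (auto simp: P_def frames_def indep_empty)
  have bound: "m \<le> card (points I W)" if Pm: "P m" for m
  proof -
    obtain b where b: "b \<in> frames I {..<m} W" using Pm unfolding P_def by blast
    then have "span I {..<m} b \<subseteq> W" by (intro span_subset assms) (auto simp: frames_def points_def)
    then have "card (points I (span I {..<m} b)) \<le> card (points I W)"
      by (intro card_mono[OF finite_points[OF assms(1)]] points_mono)
    moreover have "indep I {..<m} b" using b by (simp add: frames_def)
    ultimately have "q ^ m \<le> card (points I W)"
      using card_points_span[OF finite_lessThan, of I m b] by simp
    moreover have "m < q ^ m" using q_ge_2 by (intro power_gt_expt) auto
    ultimately show ?thesis by simp
  qed
  define m where "m = Greatest P"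
  have "P m" unfolding m_def using P0 bound by (rule GreatestI_nat)
  then obtain b where b: "b \<in> frames I {..<m} W" unfolding P_def by blast
  then have sub: "span I {..<m} b \<subseteq> W" by (intro span_subset assms) (auto simp: frames_def points_def)
  have "W \<subseteq> span I {..<m} b"
  proof (rule ccontr)
    assume "\<not> W \<subseteq> span I {..<m} b"
    then obtain w where w: "w \<in> W" "w \<notin> span I {..<m} b" by blast
    \<comment> \<open>Frames consist of canonical vectors, so w is replaced by its representative,
      which lies in the same subspaces.\<close>
    then have "canon I w \<in> points I W" "canon I w \<notin> span I {..<m} b"
      using canon_in_points[OF assms(2)] canon_in_points[OF subspace_span, of I w "{..<m}" b] canon_PiE
      by (auto simp: points_def)
    then have "b(m := canon I w) \<in> frames I (insert m {..<m}) W"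
      using b by (intro fun_upd_in_frames) auto
    then have "P (Suc m)" by (auto simp: P_def lessThan_Suc)
    then have "Suc m \<le> m" unfolding m_def using bound by (rule Greatest_le_nat)
    then show False by simp
  qed
  then have "span I {..<m} b = W" using sub by simp
  moreover have "card (points I (span I {..<m} b)) = q ^ m"
    using card_points_span[OF finite_lessThan, of I m b] b by (auto simp: frames_def)
  ultimately show ?thesis using that b by metis
qed

end

section \<open>Irreducible representations over a residue field\<close>

lemma (in finite_group) sum_inverse: "(\<Sum>x\<in>carrier A. f (inv x)) = (\<Sum>x\<in>carrier A. f x)"
  by (rule sum.reindex_bij_witness[where i = "\<lambda>x. inv x" and j = "\<lambda>x. inv x"]) auto

locale group_residue_field = residue_field \<phi> + finite_group A
  for \<phi> :: "'r::comm_ring_1 \<Rightarrow> 'k" and A :: "('a, 'm) monoid_scheme" (structure)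
begin

sublocale group_congruence \<phi> A ..

text \<open>The product of matrix and vector as a combination of columns, so that kernel and image
  of a matrix are governed by \<open>indep\<close> and \<open>span\<close>.\<close>

definition act :: "nat \<Rightarrow> (nat \<Rightarrow> nat \<Rightarrow> 'r) \<Rightarrow> (nat \<Rightarrow> 'r) \<Rightarrow> nat \<Rightarrow> 'r" where
  "act n X v = lincomb {..<n} (\<lambda>j i. X i j) v"

lemma act_eq: "act n X v i = (\<Sum>j<n. X i j * v j)"
  by (simp add: act_def lincomb_def mult.commute)

lemma act_add: "act n X (\<lambda>i. v i + w i) i = act n X v i + act n X w i"
  by (simp add: act_eq distrib_left sum.distrib)

lemma act_scale: "act n X (\<lambda>i. c * v i) i = c * act n X v i"
  by (simp add: act_eq sum_distrib_left mult_ac)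

lemma act_cong:
  "(\<And>j. j < n \<Longrightarrow> \<phi> (X i j) = \<phi> (Y i j)) \<Longrightarrow> (\<And>j. j < n \<Longrightarrow> \<phi> (v j) = \<phi> (w j)) \<Longrightarrow>
    \<phi> (act n X v i) = \<phi> (act n Y w i)"
  unfolding act_eq by (intro sum_congr mult_cong) auto

lemma act_mult: "act m (mat_mult n X Y) v i = act n X (act m Y v) i"
  unfolding act_eq mat_mult_def sum_distrib_left sum_distrib_right
  by (subst sum.swap) (simp add: mult.assoc)

lemma act_unit: "j < n \<Longrightarrow> act n X (\<lambda>l. if l = j then 1 else 0) i = X i j"
  by (simp add: act_eq if_distrib[of "times _"] cong: if_cong)

definition invariant :: "nat \<Rightarrow> ('a \<Rightarrow> nat \<Rightarrow> nat \<Rightarrow> 'r) \<Rightarrow> (nat \<Rightarrow> 'r) set \<Rightarrow> bool" where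
  "invariant n \<rho> W \<longleftrightarrow> subspace {..<n} W \<and> (\<forall>g\<in>carrier A. \<forall>w\<in>W. act n (\<rho> g) w \<in> W)"

definition irreducible :: "nat \<Rightarrow> ('a \<Rightarrow> nat \<Rightarrow> nat \<Rightarrow> 'r) \<Rightarrow> bool" where
  "irreducible n \<rho> \<longleftrightarrow> rep n \<rho> \<and> n \<ge> 1 \<and>
    (\<forall>W. invariant n \<rho> W \<longrightarrow> (\<forall>w\<in>W. \<forall>i<n. \<phi> (w i) = \<phi> 0) \<or> W = UNIV)"

text \<open>T goes from the m-dimensional space of \<sigma> to the n-dimensional space of
  \<rho>.\<close>

definition intertwiner :: "nat \<Rightarrow> ('a \<Rightarrow> nat \<Rightarrow> nat \<Rightarrow> 'r) \<Rightarrow> nat \<Rightarrow> ('a \<Rightarrow> nat \<Rightarrow> nat \<Rightarrow> 'r) \<Rightarrow> (nat \<Rightarrow> nat \<Rightarrow> 'r) \<Rightarrow> bool" where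
  "intertwiner n \<rho> m \<sigma> T \<longleftrightarrow> (\<forall>g\<in>carrier A. \<forall>i<n. \<forall>j<m.
    \<phi> (mat_mult m T (\<sigma> g) i j) = \<phi> (mat_mult n (\<rho> g) T i j))"

definition inverse_mats :: "nat \<Rightarrow> (nat \<Rightarrow> nat \<Rightarrow> 'r) \<Rightarrow> (nat \<Rightarrow> nat \<Rightarrow> 'r) \<Rightarrow> bool" where
  "inverse_mats n T T' \<longleftrightarrow> (\<forall>i<n. \<forall>j<n. \<phi> (mat_mult n T T' i j) = \<phi> (if i = j then 1 else 0) \<and>
     \<phi> (mat_mult n T' T i j) = \<phi> (if i = j then 1 else 0))"

definition equivalent :: "nat \<Rightarrow> ('a \<Rightarrow> nat \<Rightarrow> nat \<Rightarrow> 'r) \<Rightarrow> nat \<Rightarrow> ('a \<Rightarrow> nat \<Rightarrow> nat \<Rightarrow> 'r) \<Rightarrow> bool" where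
  "equivalent n \<rho> m \<sigma> \<longleftrightarrow> n = m \<and> (\<exists>T T'. intertwiner n \<rho> n \<sigma> T \<and> inverse_mats n T T')"

definition scalar_commutant :: "nat \<Rightarrow> ('a \<Rightarrow> nat \<Rightarrow> nat \<Rightarrow> 'r) \<Rightarrow> bool" where
  "scalar_commutant n \<rho> \<longleftrightarrow> (\<forall>T. intertwiner n \<rho> n \<rho> T \<longrightarrow>
    (\<exists>c. \<forall>i<n. \<forall>j<n. \<phi> (T i j) = \<phi> (if i = j then c else 0)))"

text \<open>The kernel of T is invariant and omits the unit vector at \<open>j\<^sub>0\<close>, so
  it is zero. The image is invariant and contains a nonzero column, so it is everything. Counting
  the points of the image then gives q^n = q^m.\<close>

lemma schur:
  assumes \<rho>: "irreducible n \<rho>" and \<sigma>: "irreducible m \<sigma>" and T: "intertwiner n \<rho> m \<sigma> T"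
    and nz: "i\<^sub>0 < n" "j\<^sub>0 < m" "\<phi> (T i\<^sub>0 j\<^sub>0) \<noteq> \<phi> 0"
  shows "n = m \<and> (\<exists>T'. inverse_mats n T T')"
proof -
  have comm: "\<phi> (act m T (act m (\<sigma> g) v) i) = \<phi> (act n (\<rho> g) (act m T v) i)"
    if "g \<in> carrier A" "i < n" for g i v
  proof -
    have "\<phi> (act m (mat_mult m T (\<sigma> g)) v i) = \<phi> (act m (mat_mult n (\<rho> g) T) v i)"
      using T that unfolding intertwiner_def by (intro act_cong) auto
    then show ?thesis by (simp add: act_mult)
  qed
  have zero_act: "\<phi> (act n X v i) = \<phi> 0" if "\<And>j. j < n \<Longrightarrow> \<phi> (v j) = \<phi> 0" for n X v i
    unfolding act_eq using that by (intro sum_zero mult_zero) auto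
  define Ker where "Ker = {v. \<forall>i<n. \<phi> (act m T v i) = \<phi> 0}"
  have "subspace {..<m} Ker"
    unfolding subspace_def Ker_def
  proof (intro conjI ballI allI impI CollectI)
    fix v w i assume "v \<in> {v. \<forall>i<n. \<phi> (act m T v i) = \<phi> 0}" "w \<in> {v. \<forall>i<n. \<phi> (act m T v i) = \<phi> 0}" "i < n"
    then show "\<phi> (act m T (\<lambda>i. v i + w i) i) = \<phi> 0"
      unfolding act_add using add_cong[of "act m T v i" 0 "act m T w i" 0] by simp
  next
    fix c v i assume "v \<in> {v. \<forall>i<n. \<phi> (act m T v i) = \<phi> 0}" "i < n"
    then show "\<phi> (act m T (\<lambda>i. c * v i) i) = \<phi> 0" unfolding act_scale by (intro mult_zero) auto
  next
    fix v w i assume *: "v \<in> {v. \<forall>i<n. \<phi> (act m T v i) = \<phi> 0}" "\<forall>i\<in>{..<m}. \<phi> (v i) = \<phi> (w i)" "i < n"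
    then have "\<phi> (act m T v i) = \<phi> (act m T w i)" by (intro act_cong) auto
    then show "\<phi> (act m T w i) = \<phi> 0" using * by simp
  qed (simp add: act_eq)
  moreover have "act m (\<sigma> g) v \<in> Ker" if "g \<in> carrier A" "v \<in> Ker" for g v
    using that unfolding Ker_def by (auto simp: comm intro: zero_act)
  ultimately have "invariant m \<sigma> Ker" by (simp add: invariant_def)
  moreover have "(\<lambda>l. if l = j\<^sub>0 then 1 else 0) \<notin> Ker" using nz by (auto simp: Ker_def act_unit)
  ultimately have ker0: "\<And>v i. v \<in> Ker \<Longrightarrow> i < m \<Longrightarrow> \<phi> (v i) = \<phi> 0"
    using \<sigma> unfolding irreducible_def by blast
  define Im where "Im = span {..<n} {..<m} (\<lambda>j i. T i j)"
  have Im_iff: "v \<in> Im \<longleftrightarrow> (\<exists>c. \<forall>i<n. \<phi> (v i) = \<phi> (act m T c i))" for v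
    unfolding Im_def span_def act_def by auto
  have "act n (\<rho> g) v \<in> Im" if g: "g \<in> carrier A" and v: "v \<in> Im" for g v
  proof -
    obtain c where c: "\<And>i. i < n \<Longrightarrow> \<phi> (v i) = \<phi> (act m T c i)" using v Im_iff by blast
    have "\<phi> (act n (\<rho> g) v i) = \<phi> (act m T (act m (\<sigma> g) c) i)" if "i < n" for i
      unfolding comm[OF g that] using c by (intro act_cong) auto
    then show ?thesis unfolding Im_iff by (intro exI[of _ "act m (\<sigma> g) c"]) auto
  qed
  then have inv: "invariant n \<rho> Im" unfolding invariant_def Im_def using subspace_span by blast
  have col: "(\<lambda>i. T i j\<^sub>0) \<in> Im" unfolding Im_iff
    by (intro exI[of _ "\<lambda>l. if l = j\<^sub>0 then 1 else 0"]) (simp add: act_unit nz)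
  have "\<not> (\<forall>w\<in>Im. \<forall>i<n. \<phi> (w i) = \<phi> 0)"
    using bspec[OF _ col, of "\<lambda>w. \<forall>i<n. \<phi> (w i) = \<phi> 0"] nz by auto
  then have Im: "Im = UNIV" using \<rho> inv unfolding irreducible_def by blast
  have "indep {..<n} {..<m} (\<lambda>j i. T i j)"
    unfolding indep_def act_def[symmetric] using ker0 by (auto simp: Ker_def)
  from card_points_span[OF finite_lessThan this] have "q ^ n = q ^ m"
    using Im by (simp add: Im_def card_points_UNIV)
  then have nm: "n = m" using q_ge_2 by (simp add: power_inject_exp)
  have "\<exists>c. \<forall>i<n. \<phi> (if i = k then 1 else 0) = \<phi> (act m T c i)" for k
    using Im Im_iff[of "\<lambda>i. if i = k then 1 else 0"] by blast
  then obtain U where U: "\<And>k i. i < n \<Longrightarrow> \<phi> (if i = k then 1 else 0) = \<phi> (act m T (U k) i)" by metis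
  \<comment> \<open>Column k of the inverse is a preimage of the k-th unit vector.\<close>
  define T' where "T' j k = U k j" for j k
  have TT': "\<phi> (mat_mult n T T' i k) = \<phi> (if i = k then 1 else 0)" if "i < n" for i k
    using U[OF that, of k] by (simp add: mat_mult_def act_eq T'_def nm)
  have "\<phi> (mat_mult n T' T i k) = \<phi> (if i = k then 1 else 0)" if ik: "i < n" "k < n" for i k
  proof -
    \<comment> \<open>Column k of T' T - 1. Since T T' = 1, T annihilates it, and T is
      injective.\<close>
    let ?u = "\<lambda>l. mat_mult n T' T l k - (if l = k then 1 else 0)"
    have "?u \<in> Ker"
      unfolding Ker_def
    proof (intro CollectI allI impI)
      fix i assume i: "i < n"
      have "act m T ?u i = mat_mult n T (mat_mult n T' T) i k - T i k"
        unfolding act_eq nm[symmetric] using ik(2)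
        by (simp add: mat_mult_def[of n T "mat_mult n T' T"] right_diff_distrib sum_subtractf
            if_distrib[of "times _"] cong: if_cong)
      also have "\<dots> = mat_mult n (mat_mult n T T') T i k - mat_mult n (\<lambda>i l. if i = l then 1 else 0) T i k"
        using i by (simp add: mat_mult_assoc mat_mult_def[of n "\<lambda>i l. if i = l then 1 else 0"] if_distrib[of "\<lambda>x. x * _"] cong: if_cong)
      finally show "\<phi> (act m T ?u i) = \<phi> 0"
        using TT' i by (simp only: eq_iff_diff[symmetric]) (intro mat_mult_cong, auto)
    qed
    from ker0[OF this, of i] ik nm show ?thesis by (simp add: eq_iff_diff[symmetric])
  qed
  then show ?thesis using nm TT' unfolding inverse_mats_def by blast
qed

lemma corr_intertwiner:
  assumes "rep n \<rho>" "rep m \<sigma>" "k < n" "l < m"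
  shows "intertwiner n \<rho> m \<sigma> (\<lambda>i j. corr \<rho> \<sigma> i k l j)"
  unfolding intertwiner_def mat_mult_def
proof (intro ballI allI impI)
  fix g i j assume "g \<in> carrier A" "i < n" "j < m"
  then show "\<phi> (\<Sum>j'<m. corr \<rho> \<sigma> i k l j' * \<sigma> g j' j) = \<phi> (\<Sum>i'<n. \<rho> g i i' * corr \<rho> \<sigma> i' k l j)"
    using corr_intertwines[OF assms(1,2), of g i k l j] assms(3,4) by simp
qed

text \<open>The averaged matrix unit commutes with \<rho>, so it is a scalar c; its trace n c is
  known from \<open>corr_trace\<close>.\<close>

lemma degree_scalar:
  assumes "irreducible n \<rho>" "scalar_commutant n \<rho>" "i < n" "k < n" "l < n" "j < n"
  shows "\<phi> (of_nat n * corr \<rho> \<rho> i k l j) = \<phi> (if i = j \<and> k = l then of_nat (card (carrier A)) else 0)"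
proof -
  have rep: "rep n \<rho>" using assms(1) by (simp add: irreducible_def)
  obtain c where c: "\<And>i j. i < n \<Longrightarrow> j < n \<Longrightarrow> \<phi> (corr \<rho> \<rho> i k l j) = \<phi> (if i = j then c else 0)"
    using assms(2) corr_intertwiner[OF rep rep assms(4,5)] unfolding scalar_commutant_def by blast
  have "\<phi> (\<Sum>i<n. corr \<rho> \<rho> i k l i) = \<phi> (\<Sum>i<n. if i = i then c else 0)"
    using c by (intro sum_congr) auto
  then have nc: "\<phi> (of_nat n * c) = \<phi> (if k = l then of_nat (card (carrier A)) else 0)"
    using corr_trace[OF rep assms(4,5)] by simp
  have "\<phi> (of_nat n * corr \<rho> \<rho> i k l j) = \<phi> (of_nat n * (if i = j then c else 0))"
    using c assms(3,6) by (intro mult_congL) auto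
  then show ?thesis using nc by (cases "i = j") auto
qed

text \<open>With all indices 0 the preceding relation makes a multiple of n equal to a, so the
  characteristic does not divide the degree.\<close>

lemma degree_nonzero:
  assumes "irreducible n \<rho>" "scalar_commutant n \<rho>" "\<phi> (of_nat (card (carrier A))) \<noteq> \<phi> 0"
  shows "\<phi> (of_nat n) \<noteq> \<phi> 0"
proof
  assume *: "\<phi> (of_nat n) = \<phi> 0"
  have "0 < n" using assms(1) by (simp add: irreducible_def)
  then have "\<phi> (of_nat n * corr \<rho> \<rho> 0 0 0 0) = \<phi> (of_nat (card (carrier A)))"
    using degree_scalar[OF assms(1,2), of 0 0 0 0] by simp
  then show False using mult_zeroL[OF *] assms(3) by metis
qed

lemma orthogonal_irreducibles:
  assumes irr: "\<And>i. i \<in> S \<Longrightarrow> irreducible (d i) (M i)" "\<And>i. i \<in> S \<Longrightarrow> scalar_commutant (d i) (M i)"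
    and ineq: "\<And>i i'. i \<in> S \<Longrightarrow> i' \<in> S \<Longrightarrow> equivalent (d i) (M i) (d i') (M i') \<Longrightarrow> i = i'"
  shows "orthogonal S d M"
  unfolding orthogonal_def
proof (intro ballI allI impI)
  fix i i' j k k' j' assume *: "i \<in> S" "i' \<in> S" "j < d i" "k < d i" "k' < d i'" "j' < d i'"
  show "\<phi> (of_nat (d i) * corr (M i) (M i') j k k' j') = \<phi> (if i = i' \<and> j = j' \<and> k = k' then of_nat (card (carrier A)) else 0)"
  proof (cases "i = i'")
    case True
    then show ?thesis using degree_scalar[OF irr[OF *(1)], of j k k' j'] * by simp
  next
    case False
    have int: "intertwiner (d i) (M i) (d i') (M i') (\<lambda>j j'. corr (M i) (M i') j k k' j')"
      using irr(1) * by (intro corr_intertwiner) (auto simp: irreducible_def)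
    have "\<phi> (corr (M i) (M i') j k k' j') = \<phi> 0"
    proof (rule ccontr)
      assume "\<phi> (corr (M i) (M i') j k k' j') \<noteq> \<phi> 0"
      from schur[OF irr(1)[OF *(1)] irr(1)[OF *(2)] int *(3,6) this]
      obtain T' where T': "d i = d i'" "inverse_mats (d i) (\<lambda>j j'. corr (M i) (M i') j k k' j') T'" by blast
      have "intertwiner (d i) (M i) (d i) (M i') (\<lambda>j j'. corr (M i) (M i') j k k' j')"
        using int T'(1) by simp
      then have "equivalent (d i) (M i) (d i') (M i')"
        unfolding equivalent_def using T' by (intro conjI exI)
      then show False using ineq *(1,2) False by blast
    qed
    then show ?thesis using False mult_zero by auto
  qed
qed

text \<open>The translates of the first unit vector under the group span a nonzero invariant
  subspace, hence the whole space. The bound will show that there are only finitely many irreducible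
  representations over a finite field.\<close>

lemma irreducible_degree_le:
  assumes "irreducible n \<rho>"
  shows "n \<le> card (carrier A)"
proof -
  have n: "0 < n" and rep: "rep n \<rho>" using assms by (auto simp: irreducible_def)
  define W where "W = span {..<n} (carrier A) (\<lambda>g i. \<rho> g i 0)"
  have "act n (\<rho> h) v \<in> W" if h: "h \<in> carrier A" and v: "v \<in> W" for h v
  proof -
    obtain c where c: "\<And>i. i < n \<Longrightarrow> \<phi> (v i) = \<phi> (\<Sum>g\<in>carrier A. c g * \<rho> g i 0)"
      using v unfolding W_def span_def lincomb_def by auto
    have "\<phi> (act n (\<rho> h) v i) = \<phi> (lincomb (carrier A) (\<lambda>g i. \<rho> g i 0) (\<lambda>g. c (inv h \<otimes> g)) i)" if i: "i < n" for i
    proof -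
      have "\<phi> (act n (\<rho> h) v i) = \<phi> (\<Sum>j<n. \<rho> h i j * (\<Sum>g\<in>carrier A. c g * \<rho> g j 0))"
        unfolding act_eq using c by (intro sum_congr mult_congL) auto
      also have "\<dots> = \<phi> (\<Sum>g\<in>carrier A. c g * (\<Sum>j<n. \<rho> h i j * \<rho> g j 0))"
        unfolding sum_distrib_left by (subst sum.swap) (simp add: mult_ac)
      also have "\<dots> = \<phi> (\<Sum>g\<in>carrier A. c g * \<rho> (h \<otimes> g) i 0)"
        using h i n by (intro sum_congr mult_congL rep_mult[OF rep, symmetric]) auto
      also have "\<dots> = \<phi> (\<Sum>g\<in>carrier A. c (inv h \<otimes> (h \<otimes> g)) * \<rho> (h \<otimes> g) i 0)"
        using h by (intro arg_cong[where f = \<phi>] sum.cong refl) (simp add: m_assoc[symmetric])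
      also have "\<dots> = \<phi> (\<Sum>g\<in>carrier A. c (inv h \<otimes> g) * \<rho> g i 0)"
        using sum_left_translate[OF h, of "\<lambda>g. c (inv h \<otimes> g) * \<rho> g i 0"] by simp
      finally show ?thesis by (simp add: lincomb_def)
    qed
    then show ?thesis unfolding W_def span_def by (intro CollectI exI[of _ "\<lambda>g. c (inv h \<otimes> g)"]) auto
  qed
  then have inva: "invariant n \<rho> W" unfolding invariant_def W_def using subspace_span by blast
  have one: "(\<lambda>i. \<rho> \<one> i 0) \<in> W"
    unfolding W_def span_def lincomb_def
    by (intro CollectI exI[of _ "\<lambda>g. if g = \<one> then 1 else 0"])
      (simp add: finite_carrier if_distrib[of "\<lambda>x. x * _"] cong: if_cong)
  have "\<phi> (\<rho> \<one> 0 0) \<noteq> \<phi> 0" using rep_one[OF rep n n] one_neq_zero by simp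
  then have "\<not> (\<forall>w\<in>W. \<forall>i<n. \<phi> (w i) = \<phi> 0)"
    using bspec[OF _ one, of "\<lambda>w. \<forall>i<n. \<phi> (w i) = \<phi> 0"] n by auto
  then have "W = UNIV" using assms inva unfolding irreducible_def by blast
  then have "q ^ n \<le> q ^ card (carrier A)"
    using card_points_span_le[OF finite_carrier, of "{..<n}" "\<lambda>g i. \<rho> g i 0"] by (simp add: W_def card_points_UNIV)
  then show ?thesis using q_ge_2 by (simp add: power_le_imp_le_exp)
qed

end

section \<open>Functions on the group under translation\<close>

context group_residue_field
begin

definition translate :: "'a \<Rightarrow> ('a \<Rightarrow> 'r) \<Rightarrow> 'a \<Rightarrow> 'r" where
  "translate y f = (\<lambda>x. f (inv y \<otimes> x))"

definition translation_invariant :: "('a \<Rightarrow> 'r) set \<Rightarrow> bool" where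
  "translation_invariant W \<longleftrightarrow> subspace (carrier A) W \<and> (\<forall>y\<in>carrier A. \<forall>f\<in>W. translate y f \<in> W)"

text \<open>A smallest nonzero translation-invariant subspace of H is irreducible, and N describes
  translation in a basis b of it. The transformation rule for b is part of the conclusion because it
  shows the members of b to be matrix coefficients of N.\<close>

lemma exists_irreducible_translation_invariant:
  assumes H: "translation_invariant H" and f: "f \<in> H" "x\<^sub>0 \<in> carrier A" "\<phi> (f x\<^sub>0) \<noteq> \<phi> 0"
  obtains m N b where "irreducible m N" "\<And>l. l < m \<Longrightarrow> b l \<in> H"
    "\<And>l x y. l < m \<Longrightarrow> x \<in> carrier A \<Longrightarrow> y \<in> carrier A \<Longrightarrow>
      \<phi> (b l (inv y \<otimes> x)) = \<phi> (\<Sum>k<m. N y k l * b k x)"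
    "indep (carrier A) {..<m} b"
proof -
  let ?I = "carrier A"
  define good where "good W \<longleftrightarrow> translation_invariant W \<and> W \<subseteq> H \<and> \<not> (\<forall>w\<in>W. \<forall>x\<in>?I. \<phi> (w x) = \<phi> 0)" for W
  have "good H" unfolding good_def using H f by blast
  \<comment> \<open>The number of points is minimized in place of the dimension.\<close>
  define W where "W = arg_min (\<lambda>W. card (points ?I W)) good"
  have W: "good W" unfolding W_def using \<open>good H\<close> by (rule arg_min_natI)
  have W_min: "card (points ?I W) \<le> card (points ?I W')" if "good W'" for W'
    unfolding W_def using that by (rule arg_min_nat_le)
  have sub: "subspace ?I W" and tr: "\<And>y w. y \<in> ?I \<Longrightarrow> w \<in> W \<Longrightarrow> translate y w \<in> W"
    and WH: "W \<subseteq> H" and nz: "\<not> (\<forall>w\<in>W. \<forall>x\<in>?I. \<phi> (w x) = \<phi> 0)"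
    using W by (auto simp: good_def translation_invariant_def)
  obtain m :: nat and b where b: "b \<in> frames ?I {..<m} W" "span ?I {..<m} b = W"
    using basis_exists[OF finite_carrier sub] by metis
  have ind: "indep ?I {..<m} b" using b(1) by (simp add: frames_def)
  have bW: "b l \<in> W" if "l < m" for l
    using b(1) that by (auto simp: frames_def points_def)
  have uniq: "\<phi> (c l) = \<phi> (c' l)" if "\<And>x. x \<in> ?I \<Longrightarrow> \<phi> (lincomb {..<m} b c x) = \<phi> (lincomb {..<m} b c' x)" "l < m" for c c' l
  proof -
    have "\<phi> (lincomb {..<m} b (\<lambda>l. c l - c' l) x) = \<phi> 0" if "x \<in> ?I" for x
      unfolding lincomb_diff using \<open>\<And>x. x \<in> ?I \<Longrightarrow> _\<close>[OF that] by (simp only: eq_iff_diff[symmetric])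
    from indepD[OF ind this, of l] that(2) show ?thesis by (simp only: eq_iff_diff[symmetric] lessThan_iff)
  qed
  have "\<exists>c. \<forall>x\<in>?I. \<phi> (translate y (b l) x) = \<phi> (lincomb {..<m} b c x)" if "y \<in> ?I" "l < m" for y l
    using tr[OF that(1) bW[OF that(2)]] b(2) by (auto simp: span_def)
  then have "\<forall>y l. \<exists>c. y \<in> ?I \<longrightarrow> l < m \<longrightarrow> (\<forall>x\<in>?I. \<phi> (translate y (b l) x) = \<phi> (lincomb {..<m} b c x))"
    by blast
  then obtain c where c: "\<And>y l x. y \<in> ?I \<Longrightarrow> l < m \<Longrightarrow> x \<in> ?I \<Longrightarrow> \<phi> (translate y (b l) x) = \<phi> (lincomb {..<m} b (c y l) x)"
    by metis
  define N where "N y k l = c y l k" for y k l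
  have bN: "\<phi> (b l (inv y \<otimes> x)) = \<phi> (\<Sum>k<m. N y k l * b k x)" if "l < m" "x \<in> ?I" "y \<in> ?I" for l x y
    using c[OF that(3,1,2)] by (simp add: translate_def lincomb_def N_def)
  have trN: "\<phi> (lincomb {..<m} b v (inv y \<otimes> x)) = \<phi> (lincomb {..<m} b (act m (N y) v) x)"
    if "x \<in> ?I" "y \<in> ?I" for v x y
  proof -
    have "\<phi> (lincomb {..<m} b v (inv y \<otimes> x)) = \<phi> (\<Sum>l<m. v l * (\<Sum>k<m. N y k l * b k x))"
      unfolding lincomb_def using that by (intro sum_congr mult_congL bN) auto
    also have "\<dots> = \<phi> (lincomb {..<m} b (act m (N y) v) x)"
      unfolding lincomb_def act_eq sum_distrib_left sum_distrib_right
      by (subst sum.swap) (simp add: mult_ac)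
    finally show ?thesis .
  qed
  have rep: "rep m N"
    unfolding rep_def
  proof (intro conjI ballI allI impI)
    fix y z i j assume yz: "y \<in> ?I" "z \<in> ?I" and ij: "i < m" "j < m"
    have "\<phi> (lincomb {..<m} b (\<lambda>i. N (y \<otimes> z) i j) x) = \<phi> (lincomb {..<m} b (\<lambda>i. mat_mult m (N y) (N z) i j) x)"
      if x: "x \<in> ?I" for x
    proof -
      have "\<phi> (lincomb {..<m} b (\<lambda>i. N (y \<otimes> z) i j) x) = \<phi> (b j (inv (y \<otimes> z) \<otimes> x))"
        using bN[OF ij(2) x, of "y \<otimes> z"] yz by (simp add: lincomb_def)
      also have "\<dots> = \<phi> (b j (inv z \<otimes> (inv y \<otimes> x)))"
        using x yz by (simp add: inv_mult_group m_assoc)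
      also have "\<dots> = \<phi> (lincomb {..<m} b (\<lambda>i. N z i j) (inv y \<otimes> x))"
        using bN[OF ij(2), of "inv y \<otimes> x" z] x yz by (simp add: lincomb_def)
      also have "\<dots> = \<phi> (lincomb {..<m} b (act m (N y) (\<lambda>i. N z i j)) x)"
        by (rule trN[OF x yz(1)])
      finally show ?thesis by (simp add: act_eq[abs_def] mat_mult_def)
    qed
    then show "\<phi> (N (y \<otimes> z) i j) = \<phi> (mat_mult m (N y) (N z) i j)"
      by (rule uniq) (use ij in auto)
  next
    fix i j assume ij: "i < m" "j < m"
    have "\<phi> (lincomb {..<m} b (\<lambda>i. N \<one> i j) x) = \<phi> (lincomb {..<m} b (\<lambda>i. if i = j then 1 else 0) x)"
      if x: "x \<in> ?I" for x
    proof -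
      have "\<phi> (lincomb {..<m} b (\<lambda>i. N \<one> i j) x) = \<phi> (b j (inv \<one> \<otimes> x))"
        using bN[OF ij(2) x, of \<one>] by (simp add: lincomb_def)
      also have "b j (inv \<one> \<otimes> x) = lincomb {..<m} b (\<lambda>i. if i = j then 1 else 0) x"
        using x ij by (simp add: lincomb_def if_distrib[of "\<lambda>x. x * _"] cong: if_cong)
      finally show ?thesis .
    qed
    then show "\<phi> (N \<one> i j) = \<phi> (if i = j then 1 else 0)"
      by (rule uniq) (use ij in auto)
  qed
  have m: "m \<ge> 1"
  proof (rule ccontr)
    assume "\<not> m \<ge> 1"
    then have "m = 0" by simp
    then have "\<forall>w\<in>W. \<forall>x\<in>?I. \<phi> (w x) = \<phi> 0" unfolding b(2)[symmetric] by (auto simp: span_def lincomb_def)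
    then show False using nz by blast
  qed
  have "irreducible m N"
    unfolding irreducible_def
  proof (intro conjI allI impI rep m)
    fix V assume V: "invariant m N V"
    then have Vs: "subspace {..<m} V" and Vi: "\<And>y v. y \<in> ?I \<Longrightarrow> v \<in> V \<Longrightarrow> act m (N y) v \<in> V"
      by (auto simp: invariant_def)
    \<comment> \<open>The functions with coordinate vector in V. Invariance of V makes W'
      translation-invariant, so by minimality of W it is either zero or W.\<close>
    define W' where "W' = {w. \<exists>v\<in>V. \<forall>x\<in>?I. \<phi> (w x) = \<phi> (lincomb {..<m} b v x)}"
    have W'I: "w \<in> W'" if "v \<in> V" "\<And>x. x \<in> ?I \<Longrightarrow> \<phi> (w x) = \<phi> (lincomb {..<m} b v x)" for w v
      unfolding W'_def using that by blast
    have W'E: "\<exists>v\<in>V. \<forall>x\<in>?I. \<phi> (w x) = \<phi> (lincomb {..<m} b v x)" if "w \<in> W'" for w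
      using that unfolding W'_def by blast
    have W's: "subspace ?I W'"
      unfolding subspace_def
    proof (intro conjI ballI allI impI)
      show "(\<lambda>_. 0) \<in> W'" by (rule W'I[OF subspace_zero[OF Vs]]) (simp add: lincomb_def)
    next
      fix v w assume "v \<in> W'" "w \<in> W'"
      then obtain v' w' where vw: "v' \<in> V" "\<forall>x\<in>?I. \<phi> (v x) = \<phi> (lincomb {..<m} b v' x)"
        "w' \<in> V" "\<forall>x\<in>?I. \<phi> (w x) = \<phi> (lincomb {..<m} b w' x)" using W'E by metis
      show "(\<lambda>i. v i + w i) \<in> W'"
        by (rule W'I[OF subspace_add[OF Vs vw(1,3)]]) (use vw in \<open>auto simp: lincomb_add intro: add_cong\<close>)
    next
      fix s v assume "v \<in> W'"
      then obtain v' where v: "v' \<in> V" "\<forall>x\<in>?I. \<phi> (v x) = \<phi> (lincomb {..<m} b v' x)" using W'E by metis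
      show "(\<lambda>i. s * v i) \<in> W'"
        by (rule W'I[OF subspace_scale[OF Vs v(1), of s]]) (use v in \<open>auto simp: lincomb_scale intro: mult_congL\<close>)
    next
      fix v w assume *: "v \<in> W'" "\<forall>i\<in>?I. \<phi> (v i) = \<phi> (w i)"
      then obtain v' where v: "v' \<in> V" "\<forall>x\<in>?I. \<phi> (v x) = \<phi> (lincomb {..<m} b v' x)" using W'E by metis
      show "w \<in> W'" by (rule W'I[OF v(1)]) (use v(2) * in simp)
    qed
    have "translate y w \<in> W'" if y: "y \<in> ?I" and w: "w \<in> W'" for y w
    proof -
      obtain v where v: "v \<in> V" "\<forall>x\<in>?I. \<phi> (w x) = \<phi> (lincomb {..<m} b v x)" using W'E[OF w] by blast
      show ?thesis
      proof (rule W'I[OF Vi[OF y v(1)]])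
        fix x assume x: "x \<in> ?I"
        then have "\<phi> (translate y w x) = \<phi> (lincomb {..<m} b v (inv y \<otimes> x))"
          using v(2) y by (simp add: translate_def)
        then show "\<phi> (translate y w x) = \<phi> (lincomb {..<m} b (act m (N y) v) x)" using trN[OF x y] by simp
      qed
    qed
    then have W't: "translation_invariant W'" using W's by (simp add: translation_invariant_def)
    have W'W: "W' \<subseteq> W"
    proof
      fix w assume "w \<in> W'"
      then obtain v where v: "\<forall>x\<in>?I. \<phi> (w x) = \<phi> (lincomb {..<m} b v x)" using W'E by blast
      then show "w \<in> W" unfolding b(2)[symmetric] span_def by (intro CollectI exI[of _ v])
    qed
    show "(\<forall>w\<in>V. \<forall>i<m. \<phi> (w i) = \<phi> 0) \<or> V = UNIV"
    proof (cases "\<forall>w\<in>W'. \<forall>x\<in>?I. \<phi> (w x) = \<phi> 0")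
      case True
      have "\<phi> (v i) = \<phi> 0" if "v \<in> V" "i < m" for v i
      proof -
        have "lincomb {..<m} b v \<in> W'" by (rule W'I[OF that(1)]) simp
        then have "\<And>x. x \<in> ?I \<Longrightarrow> \<phi> (lincomb {..<m} b v x) = \<phi> 0" using True by (metis (full_types))
        from indepD[OF ind this, of i] that show ?thesis by simp
      qed
      then show ?thesis by blast
    next
      case False
      then have "good W'" using W't W'W WH by (auto simp: good_def)
      then have "points ?I W' = points ?I W"
        using W_min card_seteq[OF finite_points[OF finite_carrier] points_mono[OF W'W]] by blast
      then have eq: "W' = W" using points_eq_imp_eq[OF W's sub] by simp
      have "u \<in> V" for u
      proof -
        have "lincomb {..<m} b u \<in> W" unfolding b(2)[symmetric] span_def by (intro CollectI exI[of _ u]) simp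
        then obtain v where v: "v \<in> V" "\<forall>x\<in>?I. \<phi> (lincomb {..<m} b u x) = \<phi> (lincomb {..<m} b v x)"
          unfolding eq[symmetric] using W'E by metis
        show ?thesis
          by (rule subspace_cong[OF Vs v(1)], rule uniq) (use v(2) in auto)
      qed
      then show ?thesis by blast
    qed
  qed
  moreover have "b l \<in> H" if "l < m" for l using bW[OF that] WH by blast
  ultimately show ?thesis using that[of m N b] bN ind by blast
qed

text \<open>
  If the functions orthogonal to all matrix coefficients did not vanish, they would contain an
  irreducible translation-invariant space. Its elements are matrix coefficients, and by orthogonality
  no nonzero combination of these is orthogonal to all of them.
\<close>

theorem complete_irreducibles:
  assumes fin: "finite S" and orth: "orthogonal S d M"
    and rep: "\<And>i. i \<in> S \<Longrightarrow> rep (d i) (M i)"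
    and a: "\<phi> (of_nat (card (carrier A))) \<noteq> \<phi> 0"
    and all: "\<And>n \<rho>. irreducible n \<rho> \<Longrightarrow> \<exists>i\<in>S. equivalent n \<rho> (d i) (M i)"
  shows "complete S d M"
proof -
  let ?I = "carrier A" and ?a = "of_nat (card (carrier A)) :: 'r"
  define H where "H = {f. \<forall>i\<in>S. \<forall>j<d i. \<forall>k<d i. \<phi> (\<Sum>x\<in>?I. M i x j k * f x) = \<phi> 0}"
  have HI: "f \<in> H" if "\<And>i j k. i \<in> S \<Longrightarrow> j < d i \<Longrightarrow> k < d i \<Longrightarrow> \<phi> (\<Sum>x\<in>?I. M i x j k * f x) = \<phi> 0" for f
    using that unfolding H_def by blast
  have HD: "\<phi> (\<Sum>x\<in>?I. M i x j k * f x) = \<phi> 0" if "f \<in> H" "i \<in> S" "j < d i" "k < d i" for f i j k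
    using that unfolding H_def by blast
  have "subspace ?I H"
    unfolding subspace_def
  proof (intro conjI ballI allI impI)
    show "(\<lambda>_. 0) \<in> H" by (rule HI) simp
  next
    fix v w assume vw: "v \<in> H" "w \<in> H"
    show "(\<lambda>i. v i + w i) \<in> H"
    proof (rule HI)
      fix i j k assume *: "i \<in> S" "j < d i" "k < d i"
      from add_cong[OF HD[OF vw(1) *] HD[OF vw(2) *]]
      show "\<phi> (\<Sum>x\<in>?I. M i x j k * (v x + w x)) = \<phi> 0" by (simp add: distrib_left sum.distrib)
    qed
  next
    fix c v assume v: "v \<in> H"
    show "(\<lambda>i. c * v i) \<in> H"
    proof (rule HI)
      fix i j k assume *: "i \<in> S" "j < d i" "k < d i"
      from mult_zero[OF HD[OF v *], of c]
      show "\<phi> (\<Sum>x\<in>?I. M i x j k * (c * v x)) = \<phi> 0" by (simp add: sum_distrib_left mult_ac)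
    qed
  next
    fix v w assume v: "v \<in> H" and eq: "\<forall>i\<in>?I. \<phi> (v i) = \<phi> (w i)"
    show "w \<in> H"
    proof (rule HI)
      fix i j k assume *: "i \<in> S" "j < d i" "k < d i"
      have "\<phi> (\<Sum>x\<in>?I. M i x j k * w x) = \<phi> (\<Sum>x\<in>?I. M i x j k * v x)"
        using eq by (intro sum_congr mult_congL) auto
      then show "\<phi> (\<Sum>x\<in>?I. M i x j k * w x) = \<phi> 0" using HD[OF v *] by simp
    qed
  qed
  moreover have "translate y f \<in> H" if y: "y \<in> ?I" and f: "f \<in> H" for y f
  proof (rule HI)
    fix i j k assume *: "i \<in> S" "j < d i" "k < d i"
    have "\<phi> (\<Sum>x\<in>?I. M i x j k * translate y f x) = \<phi> (\<Sum>x\<in>?I. M i (y \<otimes> x) j k * translate y f (y \<otimes> x))"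
      using sum_left_translate[OF y, of "\<lambda>x. M i x j k * translate y f x"] by simp
    also have "\<dots> = \<phi> (\<Sum>x\<in>?I. M i (y \<otimes> x) j k * f x)"
      using y by (intro arg_cong[where f = \<phi>] sum.cong refl) (simp add: translate_def m_assoc[symmetric])
    also have "\<dots> = \<phi> (\<Sum>x\<in>?I. (\<Sum>l<d i. M i y j l * M i x l k) * f x)"
      using y * by (intro sum_congr mult_congR rep_mult[OF rep]) auto
    also have "\<dots> = \<phi> (\<Sum>l<d i. M i y j l * (\<Sum>x\<in>?I. M i x l k * f x))"
      unfolding sum_distrib_left sum_distrib_right by (subst sum.swap) (simp add: mult_ac)
    also have "\<dots> = \<phi> 0"
      using * f by (intro sum_zero mult_zero HD) auto
    finally show "\<phi> (\<Sum>x\<in>?I. M i x j k * translate y f x) = \<phi> 0" .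
  qed
  ultimately have Hinv: "translation_invariant H" by (simp add: translation_invariant_def)
  have H0: "\<phi> (f x) = \<phi> 0" if f: "f \<in> H" "x \<in> ?I" for f x
  proof (rule ccontr)
    assume nz: "\<phi> (f x) \<noteq> \<phi> 0"
    obtain m N b where N: "irreducible m N" and bH: "\<And>l. l < m \<Longrightarrow> b l \<in> H"
      and bN: "\<And>l x y. l < m \<Longrightarrow> x \<in> carrier A \<Longrightarrow> y \<in> carrier A \<Longrightarrow> \<phi> (b l (inv y \<otimes> x)) = \<phi> (\<Sum>k<m. N y k l * b k x)"
      and ind: "indep (carrier A) {..<m} b"
      using exists_irreducible_translation_invariant[OF Hinv f nz] by blast
    obtain i where i: "i \<in> S" "equivalent m N (d i) (M i)" using all[OF N] by blast
    let ?n = "d i" and ?\<rho> = "M i"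
    have mn: "m = ?n" using i by (simp add: equivalent_def)
    obtain T T' where T: "intertwiner ?n N ?n ?\<rho> T" "inverse_mats ?n T T'"
      using i(2) mn unfolding equivalent_def by blast
    have NT: "\<phi> (N g k l) = \<phi> (\<Sum>p<?n. \<Sum>r<?n. T k p * ?\<rho> g p r * T' r l)"
      if "g \<in> ?I" "k < ?n" "l < ?n" for g k l
    proof -
      have "\<phi> (N g k l) = \<phi> (mat_mult ?n (N g) (\<lambda>l j. if l = j then 1 else 0) k l)"
        using that by (simp add: mat_mult_identity)
      also have "\<dots> = \<phi> (mat_mult ?n (N g) (mat_mult ?n T T') k l)"
        using T(2) that unfolding inverse_mats_def by (intro mat_mult_cong) auto
      also have "\<dots> = \<phi> (mat_mult ?n (mat_mult ?n (N g) T) T' k l)" by (simp add: mat_mult_assoc)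
      also have "\<dots> = \<phi> (mat_mult ?n (mat_mult ?n T (?\<rho> g)) T' k l)"
        by (rule mat_mult_cong) (use T(1) that in \<open>auto simp: intertwiner_def\<close>)
      also have "mat_mult ?n (mat_mult ?n T (?\<rho> g)) T' k l = (\<Sum>p<?n. \<Sum>r<?n. T k p * ?\<rho> g p r * T' r l)"
        unfolding mat_mult_def sum_distrib_right by (rule sum.swap)
      finally show ?thesis .
    qed
    have m: "0 < m" using N by (simp add: irreducible_def)
    \<comment> \<open>The transformation rule evaluated at the identity expresses b 0 x by column 0
      of N(x^-1); conjugation by T rewrites it in the coefficients of M i, and \<beta> collects the
      factors independent of x.\<close>
    define \<beta> where "\<beta> p r = (\<Sum>k<?n. T k p * T' r 0 * b k \<one>)" for p r
    have b0: "\<phi> (b 0 x) = \<phi> (\<Sum>p<?n. \<Sum>r<?n. \<beta> p r * ?\<rho> (inv x) p r)" if x: "x \<in> ?I" for x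
    proof -
      have "\<phi> (b 0 x) = \<phi> (\<Sum>k<?n. N (inv x) k 0 * b k \<one>)"
        using bN[OF m, of \<one> "inv x"] x mn by simp
      also have "\<dots> = \<phi> (\<Sum>k<?n. (\<Sum>p<?n. \<Sum>r<?n. T k p * ?\<rho> (inv x) p r * T' r 0) * b k \<one>)"
        using x m mn by (intro sum_congr mult_congR NT) auto
      also have "(\<Sum>k<?n. (\<Sum>p<?n. \<Sum>r<?n. T k p * ?\<rho> (inv x) p r * T' r 0) * b k \<one>)
        = (\<Sum>k<?n. \<Sum>p<?n. \<Sum>r<?n. T k p * T' r 0 * b k \<one> * ?\<rho> (inv x) p r)"
        by (simp add: sum_distrib_left sum_distrib_right mult_ac)
      also have "\<dots> = (\<Sum>p<?n. \<Sum>r<?n. \<Sum>k<?n. T k p * T' r 0 * b k \<one> * ?\<rho> (inv x) p r)"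
        by (rule trans[OF sum.swap], rule sum.cong[OF refl], rule sum.swap)
      also have "\<dots> = (\<Sum>p<?n. \<Sum>r<?n. \<beta> p r * ?\<rho> (inv x) p r)"
        by (simp add: \<beta>_def sum_distrib_right)
      finally show ?thesis .
    qed
    have \<beta>0: "\<phi> (\<beta> p r) = \<phi> 0" if pr: "p < ?n" "r < ?n" for p r
    proof -
      \<comment> \<open>b 0 belongs to H, so its pairing with the coefficient (r, p) vanishes, while
        orthogonality evaluates this pairing to a times \<beta> p r.\<close>
      have "\<phi> 0 = \<phi> (of_nat ?n * (\<Sum>x\<in>?I. ?\<rho> x r p * b 0 x))"
        using mult_zero[OF HD[OF bH[OF m] i(1) pr(2,1)]] by simp
      also have "\<dots> = \<phi> (of_nat ?n * (\<Sum>x\<in>?I. ?\<rho> x r p * (\<Sum>p'<?n. \<Sum>r'<?n. \<beta> p' r' * ?\<rho> (inv x) p' r')))"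
        by (intro mult_congL sum_congr b0)
      also have "of_nat ?n * (\<Sum>x\<in>?I. ?\<rho> x r p * (\<Sum>p'<?n. \<Sum>r'<?n. \<beta> p' r' * ?\<rho> (inv x) p' r'))
        = (\<Sum>p'<?n. \<Sum>r'<?n. \<Sum>x\<in>?I. of_nat ?n * (?\<rho> x r p * (\<beta> p' r' * ?\<rho> (inv x) p' r')))"
        unfolding sum_distrib_left by (simp only: sum.swap[where A = ?I and B = "{..<?n}"])
      also have "\<dots> = (\<Sum>p'<?n. \<Sum>r'<?n. \<beta> p' r' * (of_nat ?n * corr ?\<rho> ?\<rho> r p p' r'))"
        by (simp add: corr_def sum_distrib_left mult_ac)
      also have "\<phi> \<dots> = \<phi> (\<Sum>p'<?n. \<Sum>r'<?n. \<beta> p' r' * (if i = i \<and> r = r' \<and> p = p' then ?a else 0))"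
        using pr i(1) by (intro sum_congr mult_congL orthogonalD[OF orth]) auto
      also have "(\<Sum>p'<?n. \<Sum>r'<?n. \<beta> p' r' * (if i = i \<and> r = r' \<and> p = p' then ?a else 0))
        = (\<Sum>p'<?n. \<Sum>r'<?n. if r' = r then (if p' = p then \<beta> p r * ?a else 0) else 0)"
        by (intro sum.cong) auto
      also have "\<dots> = ?a * \<beta> p r" using pr by (simp add: mult.commute)
      finally have z: "\<phi> (?a * \<beta> p r) = \<phi> 0" by simp
      obtain \<alpha> where \<alpha>: "\<phi> (?a * \<alpha>) = \<phi> 1" using inverse_ex[OF a] by blast
      have "\<phi> (1 * \<beta> p r) = \<phi> ((?a * \<alpha>) * \<beta> p r)" by (rule mult_congR[OF \<alpha>[symmetric]])
      also have "(?a * \<alpha>) * \<beta> p r = \<alpha> * (?a * \<beta> p r)" by (simp add: mult_ac)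
      finally show ?thesis using mult_zero[OF z, of \<alpha>] by simp
    qed
    have "\<phi> (lincomb {..<m} b (\<lambda>l. if l = 0 then 1 else 0) x) = \<phi> 0" if x: "x \<in> ?I" for x
    proof -
      have "lincomb {..<m} b (\<lambda>l. if l = 0 then 1 else 0) x = b 0 x"
        using m by (simp add: lincomb_def if_distrib[of "\<lambda>x. x * _"] cong: if_cong)
      moreover have "\<phi> (\<Sum>p<?n. \<Sum>r<?n. \<beta> p r * ?\<rho> (inv x) p r) = \<phi> 0"
        using \<beta>0 by (intro sum_zero mult_zeroL) auto
      ultimately show ?thesis using b0[OF x] by simp
    qed
    from indepD[OF ind this, of 0] m one_neq_zero show False by simp
  qed
  show ?thesis
    unfolding complete_def
  proof (intro ballI)
    fix g h assume gh: "g \<in> ?I" "h \<in> ?I"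
    let ?u = "\<lambda>h. \<Sum>i\<in>S. of_nat (d i) * (\<Sum>j<d i. \<Sum>k<d i. M i g j k * M i (inv h) k j)"
    \<comment> \<open>As functions of h, the completeness sum and a times the delta function at g
      pair with the coefficient (j', k') of M i' to the same value, a times the entry of M i' g.
      Their difference is therefore in H and vanishes.\<close>
    have "(\<lambda>h. ?u h - (if g = h then ?a else 0)) \<in> H"
    proof (rule HI)
      fix i' j' k' assume *: "i' \<in> S" "j' < d i'" "k' < d i'"
      have "(\<Sum>x\<in>?I. M i' x j' k' * ?u x)
        = (\<Sum>x\<in>?I. \<Sum>i\<in>S. \<Sum>j<d i. \<Sum>k<d i. M i g j k * (of_nat (d i) * (M i (inv x) k j * M i' (inv (inv x)) j' k')))"
        by (intro sum.cong refl) (simp add: sum_distrib_left mult_ac)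
      also have "\<dots> = (\<Sum>x\<in>?I. \<Sum>i\<in>S. \<Sum>j<d i. \<Sum>k<d i. M i g j k * (of_nat (d i) * (M i x k j * M i' (inv x) j' k')))"
        by (rule sum_inverse)
      also have "\<dots> = (\<Sum>i\<in>S. \<Sum>x\<in>?I. \<Sum>j<d i. \<Sum>k<d i. M i g j k * (of_nat (d i) * (M i x k j * M i' (inv x) j' k')))"
        by (rule sum.swap)
      also have "\<dots> = (\<Sum>i\<in>S. \<Sum>j<d i. \<Sum>k<d i. \<Sum>x\<in>?I. M i g j k * (of_nat (d i) * (M i x k j * M i' (inv x) j' k')))"
      proof (rule sum.cong[OF refl])
        fix i
        show "(\<Sum>x\<in>?I. \<Sum>j<d i. \<Sum>k<d i. M i g j k * (of_nat (d i) * (M i x k j * M i' (inv x) j' k')))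
          = (\<Sum>j<d i. \<Sum>k<d i. \<Sum>x\<in>?I. M i g j k * (of_nat (d i) * (M i x k j * M i' (inv x) j' k')))"
          by (rule trans[OF sum.swap], rule sum.cong[OF refl], rule sum.swap)
      qed
      also have "\<dots> = (\<Sum>i\<in>S. \<Sum>j<d i. \<Sum>k<d i. M i g j k * (of_nat (d i) * corr (M i) (M i') k j j' k'))"
        by (simp only: corr_def sum_distrib_left)
      finally have "\<phi> (\<Sum>x\<in>?I. M i' x j' k' * ?u x)
        = \<phi> (\<Sum>i\<in>S. \<Sum>j<d i. \<Sum>k<d i. M i g j k * (of_nat (d i) * corr (M i) (M i') k j j' k'))"
        by (rule arg_cong)
      also have "\<dots> = \<phi> (\<Sum>i\<in>S. \<Sum>j<d i. \<Sum>k<d i. M i g j k * (if i = i' \<and> k = k' \<and> j = j' then ?a else 0))"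
        using * by (intro sum_congr mult_congL orthogonalD[OF orth]) auto
      also have "(\<Sum>i\<in>S. \<Sum>j<d i. \<Sum>k<d i. M i g j k * (if i = i' \<and> k = k' \<and> j = j' then ?a else 0))
        = (\<Sum>i\<in>S. if i = i' then M i' g j' k' * ?a else 0)"
      proof (rule sum.cong[OF refl])
        fix i
        show "(\<Sum>j<d i. \<Sum>k<d i. M i g j k * (if i = i' \<and> k = k' \<and> j = j' then ?a else 0))
          = (if i = i' then M i' g j' k' * ?a else 0)"
        proof (cases "i = i'")
          case True
          have "(\<Sum>j<d i'. \<Sum>k<d i'. M i' g j k * (if i' = i' \<and> k = k' \<and> j = j' then ?a else 0))
            = (\<Sum>j<d i'. \<Sum>k<d i'. if k = k' then (if j = j' then M i' g j' k' * ?a else 0) else 0)"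
            by (intro sum.cong refl) auto
          then show ?thesis using * True by simp
        qed simp
      qed
      also have "\<dots> = M i' g j' k' * ?a" using * fin by simp
      finally have 1: "\<phi> (\<Sum>x\<in>?I. M i' x j' k' * ?u x) = \<phi> (M i' g j' k' * ?a)" .
      have "(\<Sum>x\<in>?I. M i' x j' k' * (?u x - (if g = x then ?a else 0)))
        = (\<Sum>x\<in>?I. M i' x j' k' * ?u x) - (\<Sum>x\<in>?I. if x = g then M i' g j' k' * ?a else 0)"
        unfolding right_diff_distrib sum_subtractf by (intro arg_cong2[where f = "(-)"] refl sum.cong) auto
      also have "\<dots> = (\<Sum>x\<in>?I. M i' x j' k' * ?u x) - M i' g j' k' * ?a"
        using gh by (simp add: finite_carrier)
      finally show "\<phi> (\<Sum>x\<in>?I. M i' x j' k' * (?u x - (if g = x then ?a else 0))) = \<phi> 0"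
        using 1 by (simp only: eq_iff_diff[symmetric])
    qed
    from H0[OF this gh(2)] show "\<phi> (?u h) = \<phi> (if g = h then ?a else 0)"
      by (simp only: eq_iff_diff[symmetric])
  qed
qed

end

section \<open>Counting representations of a given type\<close>

locale complete_system = group_residue_field \<phi> A
  for \<phi> :: "'r::comm_ring_1 \<Rightarrow> 'k" and A :: "('a, 'm) monoid_scheme" (structure) +
  fixes S :: "'i set" and d :: "'i \<Rightarrow> nat" and M :: "'i \<Rightarrow> 'a \<Rightarrow> nat \<Rightarrow> nat \<Rightarrow> 'r" and \<alpha> :: 'r
  assumes finite_S: "finite S"
    and degree_pos: "i \<in> S \<Longrightarrow> 0 < d i"
    and rep_M: "i \<in> S \<Longrightarrow> rep (d i) (M i)"
    and orth: "orthogonal S d M"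
    and compl: "complete S d M"
    and alpha: "\<phi> (\<alpha> * of_nat (card (carrier A))) = \<phi> 1"
begin

section \<open>Matrix units and their action\<close>

lemma sum_flip:
  assumes "i \<in> S" "i' \<in> S" "j < d i" "k < d i" "j' < d i'" "k' < d i'"
  shows "\<phi> (of_nat (d i) * (\<Sum>g\<in>carrier A. M i (inv g) k j * M i' g j' k'))
    = \<phi> (if i = i' \<and> j = j' \<and> k = k' then of_nat (card (carrier A)) else 0)"
proof -
  have "(\<Sum>g\<in>carrier A. M i (inv g) k j * M i' g j' k') = (\<Sum>g\<in>carrier A. M i (inv g) k j * M i' (inv (inv g)) j' k')"
    by (intro sum.cong refl) simp
  also have "\<dots> = corr (M i) (M i') k j j' k'"
    unfolding corr_def by (rule sum_inverse)
  finally show ?thesis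
    using orthogonalD[OF orth assms(1,2,4,3,5,6)] by (simp add: conj_ac)
qed

definition E :: "('a \<Rightarrow> nat \<Rightarrow> nat \<Rightarrow> 'r) \<Rightarrow> 'i \<Rightarrow> nat \<Rightarrow> nat \<Rightarrow> nat \<Rightarrow> nat \<Rightarrow> 'r" where
  "E \<rho> i j k u v = \<alpha> * of_nat (d i) * (\<Sum>g\<in>carrier A. M i (inv g) k j * \<rho> g u v)"

lemma act_E: "act n (E \<rho> i j k) v u = \<alpha> * of_nat (d i) * (\<Sum>g\<in>carrier A. M i (inv g) k j * act n (\<rho> g) v u)"
  unfolding act_eq E_def sum_distrib_left sum_distrib_right
  by (subst sum.swap) (simp add: mult_ac)

lemma act_lincomb: "act n X (lincomb T B c) u = (\<Sum>\<tau>\<in>T. c \<tau> * act n X (B \<tau>) u)"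
  unfolding act_eq lincomb_def sum_distrib_left
  by (subst sum.swap) (simp add: mult_ac)

lemma act_rep_mult:
  assumes "rep n \<rho>" "g \<in> carrier A" "h \<in> carrier A" "u < n"
  shows "\<phi> (act n (\<rho> g) (act n (\<rho> h) v) u) = \<phi> (act n (\<rho> (g \<otimes> h)) v u)"
  unfolding act_mult[symmetric]
  by (rule act_cong) (use assms in \<open>auto simp: rep_def\<close>)

lemma act_rep_one:
  assumes "rep n \<rho>" "u < n"
  shows "\<phi> (act n (\<rho> \<one>) v u) = \<phi> (v u)"
proof -
  have "\<phi> (act n (\<rho> \<one>) v u) = \<phi> (act n (\<lambda>i j. if i = j then 1 else 0) v u)"
    by (rule act_cong) (use rep_one[OF assms(1)] assms(2) in auto)
  then show ?thesis using assms(2) by (simp add: act_eq if_distrib[of "\<lambda>x. x * _"] cong: if_cong)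
qed

text \<open>For fixed i and k the vectors E_ijk v transform under the group like the standard basis
  of M i.\<close>

lemma rep_act_E:
  assumes rep: "rep n \<rho>" and h: "h \<in> carrier A" and i: "i \<in> S" "j < d i" "k < d i" and u: "u < n"
  shows "\<phi> (act n (\<rho> h) (act n (E \<rho> i j k) v) u) = \<phi> (\<Sum>l<d i. M i h l j * act n (E \<rho> i l k) v u)"
proof -
  let ?c = "\<alpha> * of_nat (d i)"
  have "act n (E \<rho> i j k) v = lincomb (carrier A) (\<lambda>g. act n (\<rho> g) v) (\<lambda>g. ?c * M i (inv g) k j)"
    by (rule ext) (simp add: act_E lincomb_def sum_distrib_left mult_ac)
  then have "\<phi> (act n (\<rho> h) (act n (E \<rho> i j k) v) u)
    = \<phi> (\<Sum>g\<in>carrier A. ?c * M i (inv g) k j * act n (\<rho> h) (act n (\<rho> g) v) u)"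
    by (simp only: act_lincomb)
  also have "\<dots> = \<phi> (\<Sum>g\<in>carrier A. ?c * M i (inv g) k j * act n (\<rho> (h \<otimes> g)) v u)"
    using h u by (intro sum_congr mult_congL act_rep_mult rep) auto
  also have "\<dots> = \<phi> (\<Sum>g\<in>carrier A. ?c * M i (inv (h \<otimes> g) \<otimes> h) k j * act n (\<rho> (h \<otimes> g)) v u)"
    using h by (intro arg_cong[where f = \<phi>] sum.cong refl) (simp add: inv_mult_group m_assoc)
  also have "\<dots> = \<phi> (\<Sum>g\<in>carrier A. ?c * M i (inv g \<otimes> h) k j * act n (\<rho> g) v u)"
    using sum_left_translate[OF h, of "\<lambda>g. ?c * M i (inv g \<otimes> h) k j * act n (\<rho> g) v u"] by simp
  also have "\<dots> = \<phi> (\<Sum>g\<in>carrier A. ?c * (\<Sum>l<d i. M i (inv g) k l * M i h l j) * act n (\<rho> g) v u)"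
    using h i by (intro sum_congr mult_congL mult_congR rep_mult rep_M) auto
  also have "(\<Sum>g\<in>carrier A. ?c * (\<Sum>l<d i. M i (inv g) k l * M i h l j) * act n (\<rho> g) v u)
    = (\<Sum>g\<in>carrier A. \<Sum>l<d i. ?c * M i (inv g) k l * M i h l j * act n (\<rho> g) v u)"
    by (simp add: sum_distrib_left sum_distrib_right mult_ac)
  also have "\<dots> = (\<Sum>l<d i. \<Sum>g\<in>carrier A. ?c * M i (inv g) k l * M i h l j * act n (\<rho> g) v u)"
    by (rule sum.swap)
  also have "\<dots> = (\<Sum>l<d i. M i h l j * act n (E \<rho> i l k) v u)"
    by (simp add: act_E sum_distrib_left mult_ac)
  finally show ?thesis .
qed

text \<open>Formulated for any family that transforms like the standard basis of M i', because it is
  applied both to vectors E_ijk v and to a basis prescribed in advance.\<close>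

lemma act_E_model:
  assumes B: "\<And>g. g \<in> carrier A \<Longrightarrow> \<phi> (act n (\<rho> g) (B k') u) = \<phi> (\<Sum>j'<d i'. M i' g j' k' * B j' u)"
    and i: "i \<in> S" "i' \<in> S" "j < d i" "k < d i" "k' < d i'"
  shows "\<phi> (act n (E \<rho> i j k) (B k') u) = \<phi> (if i = i' \<and> k = k' then B j u else 0)"
proof -
  have "\<phi> (act n (E \<rho> i j k) (B k') u)
    = \<phi> (\<alpha> * of_nat (d i) * (\<Sum>g\<in>carrier A. M i (inv g) k j * (\<Sum>j'<d i'. M i' g j' k' * B j' u)))"
    unfolding act_E by (intro mult_congL sum_congr B)
  also have "\<alpha> * of_nat (d i) * (\<Sum>g\<in>carrier A. M i (inv g) k j * (\<Sum>j'<d i'. M i' g j' k' * B j' u))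
    = (\<Sum>j'<d i'. (\<alpha> * B j' u) * (of_nat (d i) * (\<Sum>g\<in>carrier A. M i (inv g) k j * M i' g j' k')))"
    unfolding sum_distrib_left by (subst sum.swap) (simp add: mult_ac)
  also have "\<phi> \<dots> = \<phi> (\<Sum>j'<d i'. (\<alpha> * B j' u) * (if i = i' \<and> j = j' \<and> k = k' then of_nat (card (carrier A)) else 0))"
    using i by (intro sum_congr mult_congL sum_flip) auto
  also have "(\<Sum>j'<d i'. (\<alpha> * B j' u) * (if i = i' \<and> j = j' \<and> k = k' then of_nat (card (carrier A)) else 0))
    = (\<Sum>j'<d i'. if j' = j then (if i = i' \<and> k = k' then \<alpha> * of_nat (card (carrier A)) * B j u else 0) else 0)"
    by (intro sum.cong refl) (auto simp: mult_ac)
  also have "\<dots> = (if i = i' \<and> k = k' then \<alpha> * of_nat (card (carrier A)) * B j u else 0)"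
    using i by auto
  also have "\<phi> \<dots> = \<phi> (if i = i' \<and> k = k' then 1 * B j u else 0)"
    using mult_congR[OF alpha, of "B j u"] by auto
  finally show ?thesis by simp
qed

lemma act_E_E:
  assumes "rep n \<rho>" "i \<in> S" "i' \<in> S" "j < d i" "k < d i" "j' < d i'" "k' < d i'" "u < n"
  shows "\<phi> (act n (E \<rho> i j k) (act n (E \<rho> i' j' k') v) u)
    = \<phi> (if i = i' \<and> k = j' then act n (E \<rho> i' j k') v u else 0)"
  by (rule act_E_model[where B = "\<lambda>j'. act n (E \<rho> i' j' k') v" and k' = j' and i' = i'])
    (use assms in \<open>auto intro: rep_act_E\<close>)

text \<open>Fourier inversion: completeness recovers a group element from its matrix
  coefficients.\<close>

lemma act_decompose:
  assumes g: "g \<in> carrier A"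
  shows "\<phi> (act n (\<rho> g) v u) = \<phi> (\<Sum>i\<in>S. \<Sum>j<d i. \<Sum>k<d i. M i g j k * act n (E \<rho> i j k) v u)"
proof -
  let ?a = "of_nat (card (carrier A)) :: 'r"
  let ?U = "\<lambda>h. \<Sum>i\<in>S. of_nat (d i) * (\<Sum>j<d i. \<Sum>k<d i. M i g j k * M i (inv h) k j)"
  have U: "\<phi> (?U h) = \<phi> (if g = h then ?a else 0)" if "h \<in> carrier A" for h
    using compl g that unfolding complete_def by blast
  have "(\<Sum>i\<in>S. \<Sum>j<d i. \<Sum>k<d i. M i g j k * act n (E \<rho> i j k) v u)
    = (\<Sum>i\<in>S. \<Sum>j<d i. \<Sum>k<d i. \<Sum>h\<in>carrier A. \<alpha> * (of_nat (d i) * (M i g j k * M i (inv h) k j)) * act n (\<rho> h) v u)"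
    unfolding act_E by (simp add: sum_distrib_left mult_ac)
  also have "\<dots> = (\<Sum>i\<in>S. \<Sum>h\<in>carrier A. \<Sum>j<d i. \<Sum>k<d i. \<alpha> * (of_nat (d i) * (M i g j k * M i (inv h) k j)) * act n (\<rho> h) v u)"
    by (simp only: sum.swap[where B = "carrier A" and A = "{..<_}"])
  also have "\<dots> = (\<Sum>h\<in>carrier A. \<Sum>i\<in>S. \<Sum>j<d i. \<Sum>k<d i. \<alpha> * (of_nat (d i) * (M i g j k * M i (inv h) k j)) * act n (\<rho> h) v u)"
    by (rule sum.swap)
  also have "\<dots> = (\<Sum>h\<in>carrier A. \<alpha> * ?U h * act n (\<rho> h) v u)"
    by (simp add: sum_distrib_left sum_distrib_right mult_ac)
  finally have "\<phi> (\<Sum>i\<in>S. \<Sum>j<d i. \<Sum>k<d i. M i g j k * act n (E \<rho> i j k) v u) = \<phi> (\<Sum>h\<in>carrier A. \<alpha> * ?U h * act n (\<rho> h) v u)"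
    by (rule arg_cong)
  also have "\<dots> = \<phi> (\<Sum>h\<in>carrier A. \<alpha> * (if g = h then ?a else 0) * act n (\<rho> h) v u)"
    by (intro sum_congr mult_congL mult_congR U)
  also have "(\<Sum>h\<in>carrier A. \<alpha> * (if g = h then ?a else 0) * act n (\<rho> h) v u)
    = (\<Sum>h\<in>carrier A. if h = g then \<alpha> * ?a * act n (\<rho> g) v u else 0)"
    by (intro sum.cong refl) auto
  also have "\<dots> = \<alpha> * ?a * act n (\<rho> g) v u" using g by (simp add: finite_carrier)
  also have "\<phi> \<dots> = \<phi> (1 * act n (\<rho> g) v u)" by (intro mult_congR alpha)
  finally show ?thesis by simp
qed

text \<open>The case g = 1 of the inversion: the diagonal matrix units add up to the
  identity.\<close>

lemma act_E_sum:
  assumes "rep n \<rho>" "u < n"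
  shows "\<phi> (v u) = \<phi> (\<Sum>i\<in>S. \<Sum>j<d i. act n (E \<rho> i j j) v u)"
proof -
  have "\<phi> (v u) = \<phi> (\<Sum>i\<in>S. \<Sum>j<d i. \<Sum>k<d i. M i \<one> j k * act n (E \<rho> i j k) v u)"
    using act_rep_one[OF assms, of v] act_decompose[OF one_closed, of n \<rho> v u] by simp
  also have "\<dots> = \<phi> (\<Sum>i\<in>S. \<Sum>j<d i. \<Sum>k<d i. (if j = k then 1 else 0) * act n (E \<rho> i j k) v u)"
    using rep_one[OF rep_M] by (intro sum_congr mult_congR) auto
  also have "(\<Sum>i\<in>S. \<Sum>j<d i. \<Sum>k<d i. (if j = k then 1 else 0) * act n (E \<rho> i j k) v u)
    = (\<Sum>i\<in>S. \<Sum>j<d i. act n (E \<rho> i j j) v u)"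
    by (simp add: if_distrib[of "\<lambda>x. x * _"] cong: if_cong)
  finally show ?thesis .
qed

text \<open>The image of the idempotent E_i00, described by its fixed vectors; its dimension is the
  multiplicity of M i. The index 0 is available because degrees are positive.\<close>

definition multiplicity_space :: "nat \<Rightarrow> ('a \<Rightarrow> nat \<Rightarrow> nat \<Rightarrow> 'r) \<Rightarrow> 'i \<Rightarrow> (nat \<Rightarrow> 'r) set" where
  "multiplicity_space n \<rho> i = {v. \<forall>u<n. \<phi> (act n (E \<rho> i 0 0) v u) = \<phi> (v u)}"

lemma subspace_multiplicity_space: "subspace {..<n} (multiplicity_space n \<rho> i)"
  unfolding subspace_def multiplicity_space_def
proof (intro conjI ballI allI impI CollectI)
  fix v w u
  let ?P = "{v. \<forall>u<n. \<phi> (act n (E \<rho> i 0 0) v u) = \<phi> (v u)}"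
  show "\<phi> (act n (E \<rho> i 0 0) (\<lambda>_. 0) u) = \<phi> 0" by (simp add: act_eq)
  show "\<phi> (act n (E \<rho> i 0 0) (\<lambda>i. v i + w i) u) = \<phi> (v u + w u)" if "v \<in> ?P" "w \<in> ?P" "u < n"
    unfolding act_add using that by (intro add_cong) auto
  show "\<phi> (act n (E \<rho> i 0 0) (\<lambda>i. c * v i) u) = \<phi> (c * v u)" if "v \<in> ?P" "u < n" for c
    unfolding act_scale using that by (intro mult_congL) auto
  show "\<phi> (act n (E \<rho> i 0 0) w u) = \<phi> (w u)" if "v \<in> ?P" "\<forall>i\<in>{..<n}. \<phi> (v i) = \<phi> (w i)" "u < n"
  proof -
    have "\<phi> (act n (E \<rho> i 0 0) w u) = \<phi> (act n (E \<rho> i 0 0) v u)" by (rule act_cong) (use that in auto)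
    then show ?thesis using that by auto
  qed
qed

text \<open>The triple (i, j, l) stands for the j-th basis vector of the l-th copy of M i.\<close>

definition idx :: "('i \<Rightarrow> nat) \<Rightarrow> ('i \<times> nat \<times> nat) set" where
  "idx t = (SIGMA i:S. {..<d i} \<times> {..<t i})"

lemma finite_idx: "finite (idx t)"
  using finite_S by (simp add: idx_def)

lemma card_idx: "card (idx t) = (\<Sum>i\<in>S. d i * t i)"
  using finite_S by (simp add: idx_def)

lemma sum_idx: "(\<Sum>\<tau>\<in>idx t. f \<tau>) = (\<Sum>i\<in>S. \<Sum>j<d i. \<Sum>l<t i. f (i, j, l))"
  unfolding idx_def using finite_S by (simp add: sum.Sigma sum.cartesian_product)

lemma sum_idx_delta:
  assumes "i \<in> S" "j < d i" "\<And>\<tau>. \<tau> \<in> idx t \<Longrightarrow> f \<tau> = (if fst \<tau> = i \<and> fst (snd \<tau>) = j then h (snd (snd \<tau>)) else (0::'r))"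
  shows "(\<Sum>\<tau>\<in>idx t. f \<tau>) = (\<Sum>l<t i. h l)"
proof -
  have "(\<Sum>\<tau>\<in>idx t. f \<tau>) = (\<Sum>\<tau>\<in>idx t. if fst \<tau> = i \<and> fst (snd \<tau>) = j then h (snd (snd \<tau>)) else 0)"
    using assms(3) by (rule sum.cong[OF refl])
  also have "\<dots> = (\<Sum>i'\<in>S. \<Sum>j'<d i'. \<Sum>l<t i'. if i' = i \<and> j' = j then h l else 0)"
    unfolding sum_idx by (simp cong: if_cong)
  also have "\<dots> = (\<Sum>i'\<in>S. if i' = i then (\<Sum>j'<d i'. if j' = j then (\<Sum>l<t i'. h l) else 0) else 0)"
  proof (rule sum.cong[OF refl])
    fix i'
    have "(\<Sum>j'<d i'. \<Sum>l<t i'. if i' = i \<and> j' = j then h l else 0)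
      = (\<Sum>j'<d i'. if i' = i \<and> j' = j then (\<Sum>l<t i'. h l) else 0)"
      by (rule sum.cong[OF refl]) (auto intro!: sum.neutral)
    then show "(\<Sum>j'<d i'. \<Sum>l<t i'. if i' = i \<and> j' = j then h l else 0)
      = (if i' = i then (\<Sum>j'<d i'. if j' = j then (\<Sum>l<t i'. h l) else 0) else 0)"
      by simp
  qed
  also have "\<dots> = (\<Sum>l<t i. h l)" using assms(1,2) finite_S by simp
  finally show ?thesis .
qed

lemma matrix_eqI:
  assumes "span {..<n} T B = UNIV" "\<And>\<tau> u. \<tau> \<in> T \<Longrightarrow> u < n \<Longrightarrow> \<phi> (act n X (B \<tau>) u) = \<phi> (act n Y (B \<tau>) u)"
    and "u < n" "v < n"
  shows "\<phi> (X u v) = \<phi> (Y u v)"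
proof -
  let ?e = "\<lambda>l. if l = v then 1 else 0"
  have "?e \<in> span {..<n} T B" using assms(1) by simp
  then obtain c where c: "\<forall>l\<in>{..<n}. \<phi> (?e l) = \<phi> (lincomb T B c l)" unfolding span_def by blast
  have e: "\<phi> (Z u v) = \<phi> (\<Sum>\<tau>\<in>T. c \<tau> * act n Z (B \<tau>) u)" for Z
  proof -
    have "\<phi> (act n Z ?e u) = \<phi> (act n Z (lincomb T B c) u)"
      by (rule act_cong) (use c in auto)
    then show ?thesis using assms(4) by (simp add: act_unit act_lincomb)
  qed
  show ?thesis unfolding e using assms by (intro sum_congr mult_congL) auto
qed

section \<open>Representations of a given type and their adapted bases\<close>

definition mats :: "('a \<Rightarrow> nat \<times> nat \<Rightarrow> 'r) \<Rightarrow> 'a \<Rightarrow> nat \<Rightarrow> nat \<Rightarrow> 'r" where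
  "mats \<rho> = (\<lambda>g i j. \<rho> g (i, j))"

definition rep_set :: "nat \<Rightarrow> ('a \<Rightarrow> nat \<times> nat \<Rightarrow> 'r) set" where
  "rep_set n = {\<rho> \<in> carrier A \<rightarrow>\<^sub>E ({..<n} \<times> {..<n} \<rightarrow>\<^sub>E C). rep n (mats \<rho>)}"

text \<open>Multiplicities are read off from numbers of points; as q is at least 2, they are
  determined on S.\<close>

definition typed_reps :: "nat \<Rightarrow> ('i \<Rightarrow> nat) \<Rightarrow> ('a \<Rightarrow> nat \<times> nat \<Rightarrow> 'r) set" where
  "typed_reps n t = {\<rho> \<in> rep_set n. \<forall>i\<in>S. card (points {..<n} (multiplicity_space n (mats \<rho>) i)) = q ^ t i}"

lemma finite_rep_set: "finite (rep_set n)"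
proof -
  have "finite (carrier A \<rightarrow>\<^sub>E ({..<n} \<times> {..<n} \<rightarrow>\<^sub>E C))"
    using finite_carrier finite_C by (intro finite_PiE) auto
  then show ?thesis by (simp add: rep_set_def)
qed

definition local_frames :: "nat \<Rightarrow> ('i \<Rightarrow> nat) \<Rightarrow> ('a \<Rightarrow> nat \<times> nat \<Rightarrow> 'r) \<Rightarrow> ('i \<Rightarrow> nat \<Rightarrow> nat \<Rightarrow> 'r) set" where
  "local_frames n t \<rho> = (\<Pi>\<^sub>E i\<in>S. frames {..<n} {..<t i} (multiplicity_space n (mats \<rho>) i))"

definition glue :: "nat \<Rightarrow> ('i \<Rightarrow> nat) \<Rightarrow> ('a \<Rightarrow> nat \<times> nat \<Rightarrow> 'r) \<Rightarrow> ('i \<Rightarrow> nat \<Rightarrow> nat \<Rightarrow> 'r) \<Rightarrow> 'i \<times> nat \<times> nat \<Rightarrow> nat \<Rightarrow> 'r" where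
  "glue n t \<rho> b = (\<lambda>(i, j, l)\<in>idx t. canon {..<n} (act n (E (mats \<rho>) i j 0) (b i l)))"

lemma phi_glue:
  "(i, j, l) \<in> idx t \<Longrightarrow> u < n \<Longrightarrow> \<phi> (glue n t \<rho> b (i, j, l) u) = \<phi> (act n (E (mats \<rho>) i j 0) (b i l) u)"
  by (simp add: glue_def phi_canon)

lemma local_framesD:
  assumes "\<rho> \<in> typed_reps n t" "b \<in> local_frames n t \<rho>" "i \<in> S"
  shows "rep n (mats \<rho>)"
    and "l < t i \<Longrightarrow> b i l \<in> points {..<n} (multiplicity_space n (mats \<rho>) i)"
    and "indep {..<n} {..<t i} (b i)"
    and "span {..<n} {..<t i} (b i) = multiplicity_space n (mats \<rho>) i"
proof -
  show "rep n (mats \<rho>)" using assms by (simp add: typed_reps_def rep_set_def)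
  have b: "b i \<in> frames {..<n} {..<t i} (multiplicity_space n (mats \<rho>) i)"
    using assms by (auto simp: local_frames_def)
  then show pt: "b i l \<in> points {..<n} (multiplicity_space n (mats \<rho>) i)" if "l < t i" for l
    using that by (auto simp: frames_def)
  show ind: "indep {..<n} {..<t i} (b i)" using b by (simp add: frames_def)
  show "span {..<n} {..<t i} (b i) = multiplicity_space n (mats \<rho>) i"
    by (rule indep_card_imp_span[OF _ _ subspace_multiplicity_space _ ind])
      (use pt assms in \<open>auto simp: points_def typed_reps_def\<close>)
qed

text \<open>E_i0j annihilates all glued vectors except those at (i, j, l), which it carries back to
  b i l; this gives independence. Conversely v is the sum of the E_ij0 E_i0j v, and E_i0j v lies in
  the multiplicity space spanned by b i.\<close>

lemma glue_frame:
  assumes \<rho>: "\<rho> \<in> typed_reps n t" and b: "b \<in> local_frames n t \<rho>"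
  shows "glue n t \<rho> b \<in> frames {..<n} (idx t) UNIV" and "span {..<n} (idx t) (glue n t \<rho> b) = UNIV"
proof -
  let ?B = "glue n t \<rho> b" and ?e = "\<lambda>i j k. act n (E (mats \<rho>) i j k)"
  note D = local_framesD[OF \<rho> b]
  have fix_b: "\<phi> (?e i 0 0 (b i l) u) = \<phi> (b i l u)" if "i \<in> S" "l < t i" "u < n" for i l u
    using D(2)[OF that(1,2)] that(3) by (auto simp: points_def multiplicity_space_def)
  have eB: "\<phi> (?e i j k (?B (i', j', l)) u) = \<phi> (if i = i' \<and> k = j' then ?e i' j 0 (b i' l) u else 0)"
    if "i \<in> S" "j < d i" "k < d i" "(i', j', l) \<in> idx t" "u < n" for i j k i' j' l u
  proof -
    have i': "i' \<in> S" "j' < d i'" "l < t i'" using that(4) by (auto simp: idx_def)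
    have "\<phi> (?e i j k (?B (i', j', l)) u) = \<phi> (?e i j k (?e i' j' 0 (b i' l)) u)"
      by (rule act_cong) (use that(4) in \<open>auto intro: phi_glue\<close>)
    also have "\<dots> = \<phi> (if i = i' \<and> k = j' then ?e i' j 0 (b i' l) u else 0)"
      using that i' degree_pos by (intro act_E_E D(1)[OF i'(1)]) auto
    finally show ?thesis .
  qed
  have "indep {..<n} (idx t) ?B"
    unfolding indep_def
  proof (intro allI impI ballI)
    fix c \<tau> assume c: "\<forall>u\<in>{..<n}. \<phi> (lincomb (idx t) ?B c u) = \<phi> 0" and \<tau>: "\<tau> \<in> idx t"
    obtain i j l where ijl: "\<tau> = (i, j, l)" "i \<in> S" "j < d i" "l < t i"
      using \<tau> by (auto simp: idx_def)
    have z: "\<phi> (lincomb {..<t i} (b i) (\<lambda>l. c (i, j, l)) u) = \<phi> 0" if u: "u < n" for u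
    proof -
      have "\<phi> 0 = \<phi> (act n (E (mats \<rho>) i 0 j) (\<lambda>_. 0) u)" by (simp add: act_eq)
      also have "\<dots> = \<phi> (?e i 0 j (lincomb (idx t) ?B c) u)" by (rule act_cong) (use c in auto)
      also have "\<dots> = \<phi> (\<Sum>\<tau>\<in>idx t. c \<tau> * ?e i 0 j (?B \<tau>) u)" by (simp only: act_lincomb)
      also have "\<dots> = \<phi> (\<Sum>\<tau>\<in>idx t. c \<tau> * (if i = fst \<tau> \<and> j = fst (snd \<tau>) then ?e (fst \<tau>) 0 0 (b (fst \<tau>) (snd (snd \<tau>))) u else 0))"
      proof (intro sum_congr mult_congL)
        fix \<tau>' assume \<tau>': "\<tau>' \<in> idx t"
        obtain i' j' l' where "\<tau>' = (i', j', l')" by (cases \<tau>')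
        then show "\<phi> (?e i 0 j (?B \<tau>') u) = \<phi> (if i = fst \<tau>' \<and> j = fst (snd \<tau>') then ?e (fst \<tau>') 0 0 (b (fst \<tau>') (snd (snd \<tau>'))) u else 0)"
          using eB[of i 0 j i' j' l' u] \<tau>' ijl u degree_pos by simp
      qed
      also have "(\<Sum>\<tau>\<in>idx t. c \<tau> * (if i = fst \<tau> \<and> j = fst (snd \<tau>) then ?e (fst \<tau>) 0 0 (b (fst \<tau>) (snd (snd \<tau>))) u else 0))
         = (\<Sum>l<t i. c (i, j, l) * ?e i 0 0 (b i l) u)"
        by (rule sum_idx_delta[OF ijl(2,3)]) auto
      also have "\<phi> \<dots> = \<phi> (\<Sum>l<t i. c (i, j, l) * b i l u)"
        using ijl u by (intro sum_congr mult_congL fix_b) auto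
      finally show ?thesis by (simp add: lincomb_def)
    qed
    show "\<phi> (c \<tau>) = \<phi> 0"
      using indepD[OF D(3)[OF ijl(2)], of "\<lambda>l. c (i, j, l)" l] z ijl by simp
  qed
  moreover have "?B \<in> idx t \<rightarrow>\<^sub>E points {..<n} UNIV"
    unfolding glue_def restrict_PiE_iff by (simp add: canon_in_points[OF subspace_UNIV] split: prod.split)
  ultimately show "?B \<in> frames {..<n} (idx t) UNIV" by (simp add: frames_def)
  show "span {..<n} (idx t) ?B = UNIV"
  proof (intro equalityI subsetI UNIV_I)
    fix v :: "nat \<Rightarrow> 'r"
    have "\<exists>c. \<forall>u\<in>{..<n}. \<phi> (?e i 0 j v u) = \<phi> (lincomb {..<t i} (b i) c u)" if "i \<in> S" "j < d i" for i j
    proof -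
      have "?e i 0 j v \<in> multiplicity_space n (mats \<rho>) i"
        unfolding multiplicity_space_def
        using act_E_E[OF D(1)[OF that(1)] that(1) that(1), of 0 0 0 j _ v] degree_pos that by auto
      then show ?thesis unfolding D(4)[OF that(1), symmetric] span_def by blast
    qed
    then obtain c where c: "\<And>i j u. i \<in> S \<Longrightarrow> j < d i \<Longrightarrow> u \<in> {..<n} \<Longrightarrow> \<phi> (?e i 0 j v u) = \<phi> (lincomb {..<t i} (b i) (c i j) u)"
      by metis
    have "\<phi> (v u) = \<phi> (lincomb (idx t) ?B (\<lambda>\<tau>. c (fst \<tau>) (fst (snd \<tau>)) (snd (snd \<tau>))) u)" if u: "u \<in> {..<n}" for u
    \<comment> \<open>For empty S the identity is an empty sum of matrix units, so every vector is
      congruent to zero.\<close>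
    proof (cases "S = {}")
      case True
      then have "idx t = {}" unfolding idx_def by simp
      moreover have "rep n (mats \<rho>)" using \<rho> by (simp add: typed_reps_def rep_set_def)
      ultimately show ?thesis using act_E_sum[of n "mats \<rho>" u v] u True by (simp add: lincomb_def)
    next
      case False
      then have rep: "rep n (mats \<rho>)" using D(1) by blast
      have "\<phi> (v u) = \<phi> (\<Sum>i\<in>S. \<Sum>j<d i. ?e i j j v u)" using act_E_sum[OF rep] u by simp
      also have "\<dots> = \<phi> (\<Sum>i\<in>S. \<Sum>j<d i. \<Sum>l<t i. c i j l * ?B (i, j, l) u)"
      proof (intro sum_congr)
        fix i j assume ij: "i \<in> S" "j \<in> {..<d i}"
        have "\<phi> (?e i j j v u) = \<phi> (?e i j 0 (?e i 0 j v) u)"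
          using act_E_E[OF rep ij(1) ij(1), of j 0 0 j u v] ij u degree_pos by simp
        also have "\<dots> = \<phi> (?e i j 0 (lincomb {..<t i} (b i) (c i j)) u)"
          by (rule act_cong) (use c ij in auto)
        also have "\<dots> = \<phi> (\<Sum>l<t i. c i j l * ?e i j 0 (b i l) u)" by (simp only: act_lincomb)
        also have "\<dots> = \<phi> (\<Sum>l<t i. c i j l * ?B (i, j, l) u)"
          using ij u by (intro sum_congr mult_congL phi_glue[symmetric]) (auto simp: idx_def)
        finally show "\<phi> (?e i j j v u) = \<phi> (\<Sum>l<t i. c i j l * ?B (i, j, l) u)" .
      qed
      finally show ?thesis by (simp add: lincomb_def sum_idx)
    qed
    then show "v \<in> span {..<n} (idx t) ?B" unfolding span_def by blast
  qed
qed

lemma rep_act_glue: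
  assumes \<rho>: "\<rho> \<in> typed_reps n t" and b: "b \<in> local_frames n t \<rho>"
    and g: "g \<in> carrier A" and \<tau>: "(i, k, l) \<in> idx t" and u: "u < n"
  shows "\<phi> (act n (mats \<rho> g) (glue n t \<rho> b (i, k, l)) u) = \<phi> (\<Sum>j<d i. M i g j k * glue n t \<rho> b (i, j, l) u)"
proof -
  have i: "i \<in> S" "k < d i" "l < t i" using \<tau> by (auto simp: idx_def)
  have "\<phi> (act n (mats \<rho> g) (glue n t \<rho> b (i, k, l)) u) = \<phi> (act n (mats \<rho> g) (act n (E (mats \<rho>) i k 0) (b i l)) u)"
    by (rule act_cong) (use \<tau> in \<open>auto intro: phi_glue\<close>)
  also have "\<dots> = \<phi> (\<Sum>j<d i. M i g j k * act n (E (mats \<rho>) i j 0) (b i l) u)"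
    by (rule rep_act_E[OF local_framesD(1)[OF \<rho> b i(1)] g i(1,2) degree_pos[OF i(1)] u])
  also have "\<dots> = \<phi> (\<Sum>j<d i. M i g j k * glue n t \<rho> b (i, j, l) u)"
    using i u by (intro sum_congr mult_congL phi_glue[symmetric]) (auto simp: idx_def)
  finally show ?thesis .
qed

text \<open>The glued basis determines both ingredients: \<rho>(g) acts on it through the given M i
  g, and its members with j = 0 are the vectors b i l, because E_i00 fixes the multiplicity
  space.\<close>

lemma inj_glue: "inj_on (\<lambda>(\<rho>, b). glue n t \<rho> b) (SIGMA \<rho>:typed_reps n t. local_frames n t \<rho>)"
proof (rule inj_onI, clarify)
  fix \<rho> b \<rho>' b'
  assume \<rho>: "\<rho> \<in> typed_reps n t" and b: "b \<in> local_frames n t \<rho>"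
    and \<rho>': "\<rho>' \<in> typed_reps n t" and b': "b' \<in> local_frames n t \<rho>'"
    and eq: "glue n t \<rho> b = glue n t \<rho>' b'"
  have entry: "\<phi> (mats \<rho> g u v) = \<phi> (mats \<rho>' g u v)" if g: "g \<in> carrier A" and uv: "u < n" "v < n" for g u v
  proof (rule matrix_eqI[OF glue_frame(2)[OF \<rho> b] _ uv])
    fix \<tau> u assume "\<tau> \<in> idx t" "u < n"
    then show "\<phi> (act n (mats \<rho> g) (glue n t \<rho> b \<tau>) u) = \<phi> (act n (mats \<rho>' g) (glue n t \<rho> b \<tau>) u)"
      using rep_act_glue[OF \<rho> b g] rep_act_glue[OF \<rho>' b' g] eq by (cases \<tau>) simp
  qed
  have PiE: "\<sigma> \<in> carrier A \<rightarrow>\<^sub>E ({..<n} \<times> {..<n} \<rightarrow>\<^sub>E C)" if "\<sigma> \<in> typed_reps n t" for \<sigma>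
    using that by (simp add: typed_reps_def rep_set_def)
  have "\<rho> = \<rho>'"
  proof (rule PiE_ext[OF PiE[OF \<rho>] PiE[OF \<rho>']])
    fix g assume g: "g \<in> carrier A"
    have "canon ({..<n} \<times> {..<n}) (\<rho> g) = canon ({..<n} \<times> {..<n}) (\<rho>' g)"
      unfolding canon_eq_iff using entry[OF g] by (auto simp: mats_def)
    then show "\<rho> g = \<rho>' g"
      using canon_id[OF PiE_mem[OF PiE[OF \<rho>] g]] canon_id[OF PiE_mem[OF PiE[OF \<rho>'] g]] by simp
  qed
  moreover have pts: "glue n t \<sigma> c (i, 0, l) = c i l" if "\<sigma> \<in> typed_reps n t" "c \<in> local_frames n t \<sigma>" "i \<in> S" "l < t i" for \<sigma> c i l
  proof -
    have p: "c i l \<in> points {..<n} (multiplicity_space n (mats \<sigma>) i)"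
      by (rule local_framesD(2)[OF that])
    have "glue n t \<sigma> c (i, 0, l) = canon {..<n} (act n (E (mats \<sigma>) i 0 0) (c i l))"
      using that degree_pos by (simp add: glue_def idx_def)
    also have "\<dots> = canon {..<n} (c i l)"
      unfolding canon_eq_iff using p by (auto simp: points_def multiplicity_space_def)
    also have "\<dots> = c i l" using p by (intro canon_id) (auto simp: points_def)
    finally show ?thesis .
  qed
  have "b = b'"
  proof (rule PiE_ext[of b S _ b'])
    show "b \<in> (\<Pi>\<^sub>E i\<in>S. frames {..<n} {..<t i} (multiplicity_space n (mats \<rho>) i))"
      using b by (simp add: local_frames_def)
    show "b' \<in> (\<Pi>\<^sub>E i\<in>S. frames {..<n} {..<t i} (multiplicity_space n (mats \<rho>) i))"
      using b' \<open>\<rho> = \<rho>'\<close> by (simp add: local_frames_def)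
    fix i assume i: "i \<in> S"
    have ext: "b i \<in> extensional {..<t i}" "b' i \<in> extensional {..<t i}"
      using b b' i by (auto simp: local_frames_def frames_def PiE_def)
    show "b i = b' i"
      by (rule extensionalityI[OF ext]) (use pts[OF \<rho> b i] pts[OF \<rho>' b' i] eq in auto)
  qed
  ultimately show "\<rho> = \<rho>' \<and> b = b'" by blast
qed

text \<open>A basis indexed by \<open>idx t\<close> carries exactly one action in which g moves the
  vectors B (i, j, l), for fixed i and l, by the matrix M i g. This action is constructed and shown
  to have type t.\<close>

lemma surj_glue:
  assumes card: "card (idx t) = n" and B: "B \<in> frames {..<n} (idx t) UNIV"
  shows "B \<in> (\<lambda>(\<rho>, b). glue n t \<rho> b) ` (SIGMA \<rho>:typed_reps n t. local_frames n t \<rho>)"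
proof -
  have ind: "indep {..<n} (idx t) B" and pt: "\<And>\<tau>. \<tau> \<in> idx t \<Longrightarrow> B \<tau> \<in> points {..<n} UNIV"
    and BE: "B \<in> idx t \<rightarrow>\<^sub>E points {..<n} UNIV"
    using B by (auto simp: frames_def)
  have span: "span {..<n} (idx t) B = UNIV"
    by (rule indep_card_imp_span[OF finite_lessThan finite_idx subspace_UNIV UNIV_I ind])
      (simp add: card_points_UNIV card)
  have "\<exists>c. \<forall>u\<in>{..<n}. \<phi> (if u = v then 1 else 0) = \<phi> (lincomb (idx t) B c u)" for v
  proof -
    have "(\<lambda>u. if u = v then 1 else 0) \<in> span {..<n} (idx t) B" using span by simp
    then show ?thesis by (simp add: span_def)
  qed
  \<comment> \<open>P v holds the coordinates of the v-th unit vector with respect to B.\<close>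
  then obtain P where P: "\<And>v u. u \<in> {..<n} \<Longrightarrow> \<phi> (if u = v then 1 else 0) = \<phi> (lincomb (idx t) B (P v) u)"
    by metis
  \<comment> \<open>The image that B \<tau> is to have under g; the matrix of g below is obtained
    from it by the change of basis P.\<close>
  define G where "G g \<tau> u = (\<Sum>j<d (fst \<tau>). M (fst \<tau>) g j (fst (snd \<tau>)) * B (fst \<tau>, j, snd (snd \<tau>)) u)" for g \<tau> u
  define \<rho>0 where "\<rho>0 g u v = (\<Sum>\<tau>\<in>idx t. P v \<tau> * G g \<tau> u)" for g u v
  \<comment> \<open>The product of the two changes of basis; independence of B makes it the identity
    matrix.\<close>
  define \<kappa> where "\<kappa> \<tau>' \<tau> = (\<Sum>v<n. B \<tau>' v * P v \<tau>)" for \<tau>' \<tau>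
  have \<kappa>: "\<phi> (\<kappa> \<tau>' \<tau>) = \<phi> (if \<tau> = \<tau>' then 1 else 0)" if \<tau>: "\<tau> \<in> idx t" "\<tau>' \<in> idx t" for \<tau> \<tau>'
  proof -
    have "\<phi> (lincomb (idx t) B (\<lambda>\<tau>. \<kappa> \<tau>' \<tau> - (if \<tau> = \<tau>' then 1 else 0)) u) = \<phi> 0" if u: "u \<in> {..<n}" for u
    proof -
      have "lincomb (idx t) B (\<kappa> \<tau>') u = (\<Sum>v<n. B \<tau>' v * lincomb (idx t) B (P v) u)"
        unfolding lincomb_def \<kappa>_def sum_distrib_left sum_distrib_right
        by (subst sum.swap) (simp add: mult_ac)
      then have "\<phi> (lincomb (idx t) B (\<kappa> \<tau>') u) = \<phi> (\<Sum>v<n. B \<tau>' v * lincomb (idx t) B (P v) u)"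
        by (rule arg_cong)
      also have "\<dots> = \<phi> (\<Sum>v<n. B \<tau>' v * (if u = v then 1 else 0))"
        by (intro sum_congr mult_congL P[OF u, symmetric])
      also have "(\<Sum>v<n. B \<tau>' v * (if u = v then 1 else 0)) = B \<tau>' u"
        using u by (simp add: if_distrib[of "times _"] cong: if_cong)
      also have "B \<tau>' u = lincomb (idx t) B (\<lambda>\<tau>. if \<tau> = \<tau>' then 1 else 0) u"
        using \<tau>(2) by (simp add: lincomb_def finite_idx if_distrib[of "\<lambda>x. x * _"] cong: if_cong)
      finally show ?thesis unfolding lincomb_diff by (simp only: eq_iff_diff[symmetric])
    qed
    from indepD[OF ind this \<tau>(1)] show ?thesis by (simp only: eq_iff_diff[symmetric])
  qed
  define \<rho> where "\<rho> = (\<lambda>g\<in>carrier A. canon ({..<n} \<times> {..<n}) (\<lambda>(u, v). \<rho>0 g u v))"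
  have \<rho>_entry: "\<phi> (mats \<rho> g u v) = \<phi> (\<rho>0 g u v)" if "g \<in> carrier A" "u < n" "v < n" for g u v
    using that by (simp add: \<rho>_def mats_def phi_canon)
  have star: "\<phi> (act n (mats \<rho> g) (B \<tau>) u) = \<phi> (G g \<tau> u)" if g: "g \<in> carrier A" and \<tau>: "\<tau> \<in> idx t" and u: "u < n" for g \<tau> u
  proof -
    have "\<phi> (act n (mats \<rho> g) (B \<tau>) u) = \<phi> (act n (\<rho>0 g) (B \<tau>) u)"
      by (rule act_cong) (use \<rho>_entry g u in auto)
    also have "\<dots> = \<phi> (\<Sum>\<tau>'\<in>idx t. \<kappa> \<tau> \<tau>' * G g \<tau>' u)"
      unfolding act_eq \<rho>0_def \<kappa>_def sum_distrib_left sum_distrib_right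
      by (subst sum.swap) (simp add: mult_ac)
    also have "\<dots> = \<phi> (\<Sum>\<tau>'\<in>idx t. (if \<tau>' = \<tau> then 1 else 0) * G g \<tau>' u)"
      using \<tau> by (intro sum_congr mult_congR \<kappa>) auto
    also have "(\<Sum>\<tau>'\<in>idx t. (if \<tau>' = \<tau> then 1 else 0) * G g \<tau>' u) = G g \<tau> u"
      using \<tau> by (simp add: finite_idx if_distrib[of "\<lambda>x. x * _"] cong: if_cong)
    finally show ?thesis .
  qed
  have rep: "rep n (mats \<rho>)"
    unfolding rep_def
  proof (intro conjI ballI allI impI)
    fix g h i j assume gh: "g \<in> carrier A" "h \<in> carrier A" and ij: "i < n" "j < n"
    show "\<phi> (mats \<rho> (g \<otimes> h) i j) = \<phi> (mat_mult n (mats \<rho> g) (mats \<rho> h) i j)"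
    proof (rule matrix_eqI[OF span _ ij])
      fix \<tau> u assume \<tau>: "\<tau> \<in> idx t" and u: "u < n"
      let ?i = "fst \<tau>" and ?k = "fst (snd \<tau>)" and ?l = "snd (snd \<tau>)"
      have \<tau>': "?i \<in> S" "?k < d ?i" "?l < t ?i" using \<tau> by (auto simp: idx_def)
      have "\<phi> (act n (mat_mult n (mats \<rho> g) (mats \<rho> h)) (B \<tau>) u) = \<phi> (act n (mats \<rho> g) (act n (mats \<rho> h) (B \<tau>)) u)"
        by (simp add: act_mult)
      also have "\<dots> = \<phi> (act n (mats \<rho> g) (G h \<tau>) u)"
        by (rule act_cong) (use star[OF gh(2) \<tau>] in auto)
      also have "G h \<tau> = lincomb {..<d ?i} (\<lambda>j. B (?i, j, ?l)) (\<lambda>j. M ?i h j ?k)"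
        by (rule ext) (simp add: G_def lincomb_def)
      also have "\<phi> (act n (mats \<rho> g) (lincomb {..<d ?i} (\<lambda>j. B (?i, j, ?l)) (\<lambda>j. M ?i h j ?k)) u)
        = \<phi> (\<Sum>j<d ?i. M ?i h j ?k * act n (mats \<rho> g) (B (?i, j, ?l)) u)"
        by (simp only: act_lincomb)
      also have "\<dots> = \<phi> (\<Sum>j<d ?i. M ?i h j ?k * G g (?i, j, ?l) u)"
        using \<tau>' gh u by (intro sum_congr mult_congL star) (auto simp: idx_def)
      also have "\<dots> = \<phi> (\<Sum>m<d ?i. (\<Sum>j<d ?i. M ?i g m j * M ?i h j ?k) * B (?i, m, ?l) u)"
        unfolding G_def sum_distrib_left sum_distrib_right
        by (subst sum.swap) (simp add: mult_ac)
      also have "\<dots> = \<phi> (\<Sum>m<d ?i. M ?i (g \<otimes> h) m ?k * B (?i, m, ?l) u)"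
        using \<tau>' gh by (intro sum_congr mult_congR rep_mult[OF rep_M, symmetric]) auto
      finally show "\<phi> (act n (mats \<rho> (g \<otimes> h)) (B \<tau>) u) = \<phi> (act n (mat_mult n (mats \<rho> g) (mats \<rho> h)) (B \<tau>) u)"
        using star[OF m_closed[OF gh] \<tau> u] by (simp add: G_def)
    qed
  next
    fix i j assume ij: "i < n" "j < n"
    show "\<phi> (mats \<rho> \<one> i j) = \<phi> (if i = j then 1 else 0)"
    proof (rule matrix_eqI[OF span _ ij, where Y = "\<lambda>i j. if i = j then 1 else 0"])
      fix \<tau> u assume \<tau>: "\<tau> \<in> idx t" and u: "u < n"
      let ?i = "fst \<tau>" and ?k = "fst (snd \<tau>)" and ?l = "snd (snd \<tau>)"
      have \<tau>': "?i \<in> S" "?k < d ?i" using \<tau> by (auto simp: idx_def)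
      have "\<phi> (act n (mats \<rho> \<one>) (B \<tau>) u) = \<phi> (\<Sum>j<d ?i. M ?i \<one> j ?k * B (?i, j, ?l) u)"
        using star[OF one_closed \<tau> u] by (simp add: G_def)
      also have "\<dots> = \<phi> (\<Sum>j<d ?i. (if j = ?k then 1 else 0) * B (?i, j, ?l) u)"
        using \<tau>' by (intro sum_congr mult_congR rep_one[OF rep_M]) auto
      also have "(\<Sum>j<d ?i. (if j = ?k then 1 else 0) * B (?i, j, ?l) u) = B \<tau> u"
        using \<tau>' by (simp add: if_distrib[of "\<lambda>x. x * _"] cong: if_cong)
      also have "B \<tau> u = act n (\<lambda>i j. if i = j then 1 else 0) (B \<tau>) u"
        using u by (simp add: act_eq if_distrib[of "\<lambda>x. x * _"] cong: if_cong)
      finally show "\<phi> (act n (mats \<rho> \<one>) (B \<tau>) u) = \<phi> (act n (\<lambda>i j. if i = j then 1 else 0) (B \<tau>) u)" .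
    qed
  qed
  have eB: "\<phi> (act n (E (mats \<rho>) i j k) (B (i', k', l)) u) = \<phi> (if i = i' \<and> k = k' then B (i', j, l) u else 0)"
    if "i \<in> S" "j < d i" "k < d i" "(i', k', l) \<in> idx t" "u < n" for i j k i' k' l u
  proof (rule act_E_model[where B = "\<lambda>k'. B (i', k', l)"])
    fix g assume "g \<in> carrier A"
    from star[OF this that(4,5)]
    show "\<phi> (act n (mats \<rho> g) (B (i', k', l)) u) = \<phi> (\<Sum>j'<d i'. M i' g j' k' * B (i', j', l) u)"
      by (simp add: G_def)
  qed (use that in \<open>auto simp: idx_def\<close>)
  \<comment> \<open>The members of B with j = 0 are bases of the multiplicity spaces, from which
    gluing recovers B.\<close>
  define b where "b = (\<lambda>i\<in>S. \<lambda>l\<in>{..<t i}. B (i, 0, l))"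
  have b: "b i l = B (i, 0, l)" "(i, 0, l) \<in> idx t" if "i \<in> S" "l < t i" for i l
    using that degree_pos by (auto simp: b_def idx_def)
  let ?W = "multiplicity_space n (mats \<rho>)"
  have bW: "b i l \<in> points {..<n} (?W i)" if "i \<in> S" "l < t i" for i l
    using pt[OF b(2)[OF that]] eB[of i 0 0 i 0 l] b[OF that] that degree_pos
    by (auto simp: points_def multiplicity_space_def)
  have collapse: "(\<Sum>\<tau>\<in>idx t. (if fst \<tau> = i \<and> fst (snd \<tau>) = 0 then c (snd (snd \<tau>)) else 0) * B \<tau> u)
      = lincomb {..<t i} (b i) c u" if i: "i \<in> S" for i c u
  proof -
    have "(\<Sum>\<tau>\<in>idx t. (if fst \<tau> = i \<and> fst (snd \<tau>) = 0 then c (snd (snd \<tau>)) else 0) * B \<tau> u)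
      = (\<Sum>l<t i. c l * B (i, 0, l) u)"
      by (rule sum_idx_delta[OF i degree_pos[OF i]]) (auto simp: split_beta)
    then show ?thesis using b(1)[OF i] by (simp add: lincomb_def)
  qed
  have bind: "indep {..<n} {..<t i} (b i)" if i: "i \<in> S" for i
    unfolding indep_def
  proof (intro allI impI ballI)
    fix c l assume c: "\<forall>u\<in>{..<n}. \<phi> (lincomb {..<t i} (b i) c u) = \<phi> 0" and l: "l \<in> {..<t i}"
    let ?c = "\<lambda>\<tau>. if fst \<tau> = i \<and> fst (snd \<tau>) = 0 then c (snd (snd \<tau>)) else 0"
    have "\<phi> (lincomb (idx t) B ?c u) = \<phi> 0" if "u \<in> {..<n}" for u
      using c that unfolding lincomb_def[of "idx t"] collapse[OF i] by blast
    from indepD[OF ind this b(2)[OF i]] l show "\<phi> (c l) = \<phi> 0" by simp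
  qed
  have bspan: "span {..<n} {..<t i} (b i) = ?W i" if i: "i \<in> S" for i
  proof (rule equalityI[OF span_subset[OF subspace_multiplicity_space]])
    show "b i l \<in> ?W i" if "l \<in> {..<t i}" for l
      using bW[OF i, of l] that by (simp add: points_def)
    show "?W i \<subseteq> span {..<n} {..<t i} (b i)"
    proof
      fix v assume v: "v \<in> ?W i"
      have "v \<in> span {..<n} (idx t) B" using span by simp
      then obtain c where c: "\<forall>u\<in>{..<n}. \<phi> (v u) = \<phi> (lincomb (idx t) B c u)" by (auto simp: span_def)
      have "\<phi> (v u) = \<phi> (lincomb {..<t i} (b i) (\<lambda>l. c (i, 0, l)) u)" if u: "u \<in> {..<n}" for u
      proof -
        have "\<phi> (v u) = \<phi> (act n (E (mats \<rho>) i 0 0) v u)" using v u by (simp add: multiplicity_space_def)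
        also have "\<dots> = \<phi> (act n (E (mats \<rho>) i 0 0) (lincomb (idx t) B c) u)"
          by (rule act_cong) (use c in auto)
        also have "\<dots> = \<phi> (\<Sum>\<tau>\<in>idx t. c \<tau> * act n (E (mats \<rho>) i 0 0) (B \<tau>) u)" by (simp only: act_lincomb)
        also have "\<dots> = \<phi> (\<Sum>\<tau>\<in>idx t. c \<tau> * (if i = fst \<tau> \<and> 0 = fst (snd \<tau>) then B (fst \<tau>, 0, snd (snd \<tau>)) u else 0))"
        proof (intro sum_congr mult_congL)
          fix \<tau> assume "\<tau> \<in> idx t"
          then show "\<phi> (act n (E (mats \<rho>) i 0 0) (B \<tau>) u) = \<phi> (if i = fst \<tau> \<and> 0 = fst (snd \<tau>) then B (fst \<tau>, 0, snd (snd \<tau>)) u else 0)"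
            using eB[of i 0 0 "fst \<tau>" "fst (snd \<tau>)" "snd (snd \<tau>)" u] i u degree_pos[OF i] by simp
        qed
        also have "(\<Sum>\<tau>\<in>idx t. c \<tau> * (if i = fst \<tau> \<and> 0 = fst (snd \<tau>) then B (fst \<tau>, 0, snd (snd \<tau>)) u else 0))
          = (\<Sum>l<t i. c (i, 0, l) * B (i, 0, l) u)"
          by (rule sum_idx_delta[OF i degree_pos[OF i]]) (auto simp: split_beta)
        finally show ?thesis using b(1)[OF i] by (simp add: lincomb_def)
      qed
      then show "v \<in> span {..<n} {..<t i} (b i)" unfolding span_def by blast
    qed
  qed
  have "card (points {..<n} (?W i)) = q ^ t i" if i: "i \<in> S" for i
    using card_points_span[OF finite_lessThan bind[OF i]] bspan[OF i] by simp
  moreover have "\<rho> \<in> carrier A \<rightarrow>\<^sub>E ({..<n} \<times> {..<n} \<rightarrow>\<^sub>E C)"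
    unfolding \<rho>_def restrict_PiE_iff by (simp add: canon_PiE)
  then have "\<rho> \<in> rep_set n" using rep by (simp add: rep_set_def)
  ultimately have \<rho>t: "\<rho> \<in> typed_reps n t" by (simp add: typed_reps_def)
  have bt: "b \<in> local_frames n t \<rho>"
    unfolding local_frames_def
  proof (rule PiE_I)
    fix i assume i: "i \<in> S"
    have "b i \<in> {..<t i} \<rightarrow>\<^sub>E points {..<n} (?W i)"
      using bW[OF i] i by (intro PiE_I) (auto simp: b_def)
    then show "b i \<in> frames {..<n} {..<t i} (?W i)" using bind[OF i] by (simp add: frames_def)
  qed (simp add: b_def)
  have "glue n t \<rho> b = B"
  proof (rule PiE_ext[of _ "idx t" "\<lambda>_. points {..<n} UNIV"])
    show "glue n t \<rho> b \<in> idx t \<rightarrow>\<^sub>E points {..<n} UNIV"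
      using glue_frame(1)[OF \<rho>t bt] by (simp add: frames_def)
    show "B \<in> idx t \<rightarrow>\<^sub>E points {..<n} UNIV" by (rule BE)
    fix \<tau> assume \<tau>: "\<tau> \<in> idx t"
    obtain i j l where ijl: "\<tau> = (i, j, l)" "i \<in> S" "j < d i" "l < t i" using \<tau> by (auto simp: idx_def)
    have "glue n t \<rho> b \<tau> = canon {..<n} (act n (E (mats \<rho>) i j 0) (B (i, 0, l)))"
      using \<tau> ijl b(1) by (simp add: glue_def)
    also have "\<dots> = canon {..<n} (B \<tau>)"
      unfolding canon_eq_iff using eB[of i j 0 i 0 l] b(2) ijl degree_pos by simp
    also have "\<dots> = B \<tau>" using pt[OF \<tau>] by (intro canon_id) (simp add: points_def)
    finally show "glue n t \<rho> b \<tau> = B \<tau>" .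
  qed
  then show ?thesis using \<rho>t bt by force
qed

lemma prod_eq_poly_gl: "(\<Prod>i<m. int (q ^ m) - int q ^ i) = poly (gl_poly m) (int q)"
  by (simp add: poly_gl_poly)

text \<open>The bases of K^n indexed by \<open>idx t\<close> are counted twice, directly and through
  \<open>glue\<close> as pairs of a representation of type t and bases of its multiplicity spaces.
  The number of the latter depends on t alone, so it factors out.\<close>

theorem card_typed_reps:
  assumes "(\<Sum>i\<in>S. d i * t i) = n"
  shows "int (card (typed_reps n t)) * (\<Prod>i\<in>S. poly (gl_poly (t i)) (int q)) = poly (gl_poly n) (int q)"
proof -
  let ?X = "SIGMA \<rho>:typed_reps n t. local_frames n t \<rho>"
  have idx: "card (idx t) = n" using assms card_idx by simp
  have "bij_betw (\<lambda>(\<rho>, b). glue n t \<rho> b) ?X (frames {..<n} (idx t) UNIV)"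
    unfolding bij_betw_def using inj_glue surj_glue[OF idx] glue_frame(1) by auto
  then have "card ?X = card (frames {..<n} (idx t) UNIV)" by (rule bij_betw_same_card)
  also have "int \<dots> = poly (gl_poly n) (int q)"
    using card_frames[OF finite_lessThan finite_idx subspace_UNIV, of n t] prod_eq_poly_gl[of n]
    by (simp add: card_points_UNIV idx)
  finally have X: "int (card ?X) = poly (gl_poly n) (int q)" .
  have fin: "finite (typed_reps n t)" using finite_rep_set by (simp add: typed_reps_def)
  have lf: "int (card (local_frames n t \<rho>)) = (\<Prod>i\<in>S. poly (gl_poly (t i)) (int q))" if "\<rho> \<in> typed_reps n t" for \<rho>
  proof -
    have "int (card (local_frames n t \<rho>)) = (\<Prod>i\<in>S. int (card (frames {..<n} {..<t i} (multiplicity_space n (mats \<rho>) i))))"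
      unfolding local_frames_def using finite_S by (simp add: card_PiE)
    also have "\<dots> = (\<Prod>i\<in>S. poly (gl_poly (t i)) (int q))"
    proof (rule prod.cong[OF refl])
      fix i assume "i \<in> S"
      then have "card (points {..<n} (multiplicity_space n (mats \<rho>) i)) = q ^ t i" using that by (simp add: typed_reps_def)
      then show "int (card (frames {..<n} {..<t i} (multiplicity_space n (mats \<rho>) i))) = poly (gl_poly (t i)) (int q)"
        using card_frames[OF finite_lessThan finite_lessThan subspace_multiplicity_space, of n "t i" "mats \<rho>" i] prod_eq_poly_gl[of "t i"]
        by simp
    qed
    finally show ?thesis .
  qed
  have "finite (local_frames n t \<rho>)" for \<rho>
    unfolding local_frames_def using finite_S finite_frames by (intro finite_PiE) auto
  then have "card ?X = (\<Sum>\<rho>\<in>typed_reps n t. card (local_frames n t \<rho>))"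
    using fin by (intro card_SigmaI) auto
  then have "int (card ?X) = (\<Sum>\<rho>\<in>typed_reps n t. \<Prod>i\<in>S. poly (gl_poly (t i)) (int q))"
    using lf by simp
  then show ?thesis using X by simp
qed

text \<open>Every representation has a type because a subspace has q^m points for some m. Its glued
  basis has sum d_i t_i members and spans K^n, so that sum is n.\<close>

theorem card_rep_set:
  "card (rep_set n) = (\<Sum>t\<in>{t \<in> S \<rightarrow>\<^sub>E UNIV. (\<Sum>i\<in>S. d i * t i) = n}. card (typed_reps n t))"
proof -
  let ?T = "{t \<in> S \<rightarrow>\<^sub>E UNIV. (\<Sum>i\<in>S. d i * t i) = n}"
  have finT: "finite ?T"
  proof (rule finite_subset)
    show "?T \<subseteq> S \<rightarrow>\<^sub>E {..n}"
    proof
      fix t assume t: "t \<in> ?T"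
      have "t i \<le> n" if "i \<in> S" for i
      proof -
        have "t i \<le> d i * t i" using degree_pos[OF that] by simp
        also have "\<dots> \<le> (\<Sum>i\<in>S. d i * t i)" by (rule member_le_sum[OF that]) (use finite_S in auto)
        finally show ?thesis using t by simp
      qed
      then show "t \<in> S \<rightarrow>\<^sub>E {..n}" using t by (auto simp: PiE_def)
    qed
    show "finite (S \<rightarrow>\<^sub>E {..n})" using finite_S by (intro finite_PiE) auto
  qed
  have union: "rep_set n = (\<Union>t\<in>?T. typed_reps n t)"
  proof (intro equalityI subsetI)
    fix \<rho> assume \<rho>: "\<rho> \<in> rep_set n"
    have "\<exists>m. card (points {..<n} (multiplicity_space n (mats \<rho>) i)) = q ^ m" for i
      using basis_exists[OF finite_lessThan subspace_multiplicity_space] by metis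
    then obtain m where m: "\<And>i. card (points {..<n} (multiplicity_space n (mats \<rho>) i)) = q ^ m i" by metis
    define t where "t = restrict m S"
    have \<rho>t: "\<rho> \<in> typed_reps n t" using \<rho> m by (simp add: typed_reps_def t_def)
    have "\<exists>b. b \<in> frames {..<n} {..<t i} (multiplicity_space n (mats \<rho>) i)" if "i \<in> S" for i
    proof -
      obtain l :: nat and b where b: "b \<in> frames {..<n} {..<l} (multiplicity_space n (mats \<rho>) i)"
        "card (points {..<n} (multiplicity_space n (mats \<rho>) i)) = q ^ l"
        using basis_exists[OF finite_lessThan subspace_multiplicity_space] by metis
      then have "q ^ l = q ^ t i" using m[of i] that by (simp add: t_def)
      then have "l = t i" using q_ge_2 by (simp add: power_inject_exp)
      then show ?thesis using b by blast
    qed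
    then obtain b where "\<And>i. i \<in> S \<Longrightarrow> b i \<in> frames {..<n} {..<t i} (multiplicity_space n (mats \<rho>) i)" by metis
    then have "restrict b S \<in> local_frames n t \<rho>" by (simp add: local_frames_def)
    from glue_frame[OF \<rho>t this] have "q ^ n = q ^ card (idx t)"
      using card_points_span[OF finite_idx, of "{..<n}" t "glue n t \<rho> (restrict b S)"]
      by (simp add: card_points_UNIV frames_def)
    then have "card (idx t) = n" using q_ge_2 by (simp add: power_inject_exp)
    then have "t \<in> ?T" using card_idx by (simp add: t_def)
    then show "\<rho> \<in> (\<Union>t\<in>?T. typed_reps n t)" using \<rho>t by blast
  qed (auto simp: typed_reps_def)
  show ?thesis
    unfolding union
  proof (rule card_UN_disjoint[OF finT])
    show "\<forall>t\<in>?T. finite (typed_reps n t)" using finite_rep_set by (simp add: typed_reps_def)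
    show "\<forall>t\<in>?T. \<forall>t'\<in>?T. t \<noteq> t' \<longrightarrow> typed_reps n t \<inter> typed_reps n t' = {}"
    proof (intro ballI impI)
      fix t t' assume t: "t \<in> ?T" "t' \<in> ?T" "t \<noteq> t'"
      show "typed_reps n t \<inter> typed_reps n t' = {}"
      proof (rule ccontr)
        assume "typed_reps n t \<inter> typed_reps n t' \<noteq> {}"
        then obtain \<rho> where "\<rho> \<in> typed_reps n t" "\<rho> \<in> typed_reps n t'" by blast
        then have "q ^ t i = q ^ t' i" if "i \<in> S" for i using that by (simp add: typed_reps_def)
        then have "t i = t' i" if "i \<in> S" for i using that q_ge_2 by (simp add: power_inject_exp)
        then have "t = t'" using t by (intro PiE_ext[of t S "\<lambda>_. UNIV" t']) auto
        then show False using t by simp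
      qed
    qed
  qed
qed

end

section \<open>Matrices over the given field\<close>

lemma (in finite_group) card_carrier_pos: "card (carrier A) > 0"
  using finite_carrier one_closed by (auto simp: card_gt_0_iff)

text \<open>Identifies additive inverses when subsets are shown to be submodules. It is proved for
  every ring because it is applied to K and to an extension field of K.\<close>

lemma (in ring) group_coord_space: "group (add_monoid (coord_space R n))"
proof (rule groupI)
  fix x assume "x \<in> carrier (add_monoid (coord_space R n))"
  then have x: "x \<in> {..<n} \<rightarrow>\<^sub>E carrier R" by (simp add: coord_space_def)
  then have xi: "x i \<in> carrier R" if "i < n" for i using that by auto
  have "(\<lambda>i\<in>{..<n}. \<zero> \<oplus> x i) = x"
    using x xi by (intro extensionalityI[of _ "{..<n}"]) (auto simp: PiE_def)
  then show "\<one>\<^bsub>add_monoid (coord_space R n)\<^esub> \<otimes>\<^bsub>add_monoid (coord_space R n)\<^esub> x = x"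
    by (simp add: coord_space_def cong: restrict_cong)
  show "\<exists>y\<in>carrier (add_monoid (coord_space R n)). y \<otimes>\<^bsub>add_monoid (coord_space R n)\<^esub> x = \<one>\<^bsub>add_monoid (coord_space R n)\<^esub>"
    using xi by (intro bexI[of _ "\<lambda>i\<in>{..<n}. \<ominus> x i"]) (auto simp: coord_space_def l_neg intro!: restrict_ext)
next
  fix x y assume "x \<in> carrier (add_monoid (coord_space R n))" "y \<in> carrier (add_monoid (coord_space R n))"
  then have x: "x i \<in> carrier R" "y i \<in> carrier R" if "i < n" for i
    using that by (auto simp: coord_space_def)
  then show "x \<otimes>\<^bsub>add_monoid (coord_space R n)\<^esub> y \<in> carrier (add_monoid (coord_space R n))"
    by (simp add: coord_space_def)
  fix z assume "z \<in> carrier (add_monoid (coord_space R n))"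
  then have "z i \<in> carrier R" if "i < n" for i
    using that by (auto simp: coord_space_def)
  then show "x \<otimes>\<^bsub>add_monoid (coord_space R n)\<^esub> y \<otimes>\<^bsub>add_monoid (coord_space R n)\<^esub> z
    = x \<otimes>\<^bsub>add_monoid (coord_space R n)\<^esub> (y \<otimes>\<^bsub>add_monoid (coord_space R n)\<^esub> z)"
    using x by (auto simp: coord_space_def a_assoc intro!: restrict_ext)
qed (simp add: coord_space_def)

locale field_reps = fld: finite_field K p e + finite_group A
  for K :: "('k, 'l) ring_scheme" and p e :: nat and A :: "('a, 'm) monoid_scheme" (structure) +
  assumes p_ndvd: "\<not> p dvd card (carrier A)"
begin

abbreviation \<phi> :: "int poly \<Rightarrow> 'k" where "\<phi> \<equiv> fld.\<phi>"

sublocale group_residue_field \<phi> A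
proof
  show "finite (range \<phi>)" using fld.range_phi fld.finite_K by simp
  show "\<phi> 1 \<noteq> \<phi> 0" by simp
  fix x assume "\<phi> x \<noteq> \<phi> 0"
  then have "\<phi> x \<in> Units K" using fld.field_Units fld.phi_closed by auto
  then obtain y where "y \<in> carrier K" "\<phi> x \<otimes>\<^bsub>K\<^esub> y = \<one>\<^bsub>K\<^esub>" using fld.Units_r_inv_ex by blast
  moreover obtain z where "y = \<phi> z" using fld.range_phi \<open>y \<in> carrier K\<close> by blast
  ultimately show "\<exists>y. \<phi> (x * y) = \<phi> 1" by (auto simp: fld.phi_mult)
qed

sublocale filt: group_filtration fld.J A ..

lemma q_eq: "q = card (carrier K)"
  by (simp add: q_def fld.range_phi)

lemma phi_of_nat_group: "\<phi> (of_nat (card (carrier A))) \<noteq> \<phi> 0"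
proof
  assume *: "\<phi> (of_nat (card (carrier A))) = \<phi> 0"
  obtain \<alpha> where "fld.residue 1 (\<alpha> * of_nat (card (carrier A))) = fld.residue 1 1"
    using fld.residue_of_nat_inverse[OF p_ndvd] by blast
  then have "\<phi> (\<alpha> * of_nat (card (carrier A))) = \<phi> 1" by (simp only: fld.phi_eq_iff)
  then show False using fld.mult_zero[OF *, of \<alpha>] one_neq_zero by simp
qed

lemma phi_sum: "finite S \<Longrightarrow> \<phi> (sum f S) = finsum K (\<lambda>i. \<phi> (f i)) S"
  by (induction S rule: finite_induct) (auto simp: fld.phi_add)

lemma phi_lift_carrier: "c \<in> carrier K \<Longrightarrow> \<phi> (lift c) = c"
  using phi_lift fld.range_phi by force

section \<open>Translation between polynomial matrices and matrices over K\<close>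

definition to_mat :: "nat \<Rightarrow> (nat \<Rightarrow> nat \<Rightarrow> int poly) \<Rightarrow> nat \<times> nat \<Rightarrow> 'k" where
  "to_mat n X = (\<lambda>(i, j)\<in>{..<n} \<times> {..<n}. \<phi> (X i j))"

definition of_mat :: "(nat \<times> nat \<Rightarrow> 'k) \<Rightarrow> nat \<Rightarrow> nat \<Rightarrow> int poly" where
  "of_mat X i j = lift (X (i, j))"

definition to_vec :: "nat \<Rightarrow> (nat \<Rightarrow> int poly) \<Rightarrow> nat \<Rightarrow> 'k" where
  "to_vec n v = (\<lambda>i\<in>{..<n}. \<phi> (v i))"

lemma to_mat_eq_iff: "to_mat n X = to_mat n Y \<longleftrightarrow> (\<forall>i<n. \<forall>j<n. \<phi> (X i j) = \<phi> (Y i j))"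
  unfolding to_mat_def restrict_def fun_eq_iff by (auto split: if_splits)

lemma to_vec_eq_iff: "to_vec n v = to_vec n w \<longleftrightarrow> (\<forall>i<n. \<phi> (v i) = \<phi> (w i))"
  unfolding to_vec_def restrict_def fun_eq_iff by (auto split: if_splits)

lemma carrier_mat_monoid: "carrier (mat_monoid K n) = {..<n} \<times> {..<n} \<rightarrow>\<^sub>E carrier K"
  by (simp add: mat_monoid_def)

lemma carrier_coord_space: "carrier (coord_space K n) = {..<n} \<rightarrow>\<^sub>E carrier K"
  by (simp add: coord_space_def)

lemma to_mat_closed [simp]: "to_mat n X \<in> carrier (mat_monoid K n)"
  unfolding carrier_mat_monoid to_mat_def restrict_PiE_iff by auto

lemma to_vec_closed [simp]: "to_vec n v \<in> carrier (coord_space K n)"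
  unfolding carrier_coord_space to_vec_def restrict_PiE_iff by auto

lemma to_of_mat: "X \<in> carrier (mat_monoid K n) \<Longrightarrow> to_mat n (of_mat X) = X"
  unfolding carrier_mat_monoid
proof (rule extensionalityI)
  fix x assume "X \<in> {..<n} \<times> {..<n} \<rightarrow>\<^sub>E carrier K" and x: "x \<in> {..<n} \<times> {..<n}"
  then have "X x \<in> carrier K" by (rule PiE_mem)
  then show "to_mat n (of_mat X) x = X x"
    using x by (cases x) (simp add: to_mat_def of_mat_def phi_lift_carrier)
qed (auto simp: to_mat_def PiE_def)

lemma to_vec_surj: "w \<in> carrier (coord_space K n) \<Longrightarrow> \<exists>v. w = to_vec n v"
  unfolding carrier_coord_space
proof (intro exI extensionalityI)
  fix i assume "w \<in> {..<n} \<rightarrow>\<^sub>E carrier K" and i: "i \<in> {..<n}"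
  then have "w i \<in> carrier K" by (rule PiE_mem)
  then show "w i = to_vec n (\<lambda>i. lift (w i)) i"
    using i by (simp add: to_vec_def phi_lift_carrier)
qed (auto simp: to_vec_def PiE_def)

lemma of_mat_entry: "X \<in> carrier (mat_monoid K n) \<Longrightarrow> i < n \<Longrightarrow> j < n \<Longrightarrow> \<phi> (of_mat X i j) = X (i, j)"
  unfolding carrier_mat_monoid of_mat_def by (auto intro!: phi_lift_carrier)

lemma to_mat_mult: "to_mat n X \<otimes>\<^bsub>mat_monoid K n\<^esub> to_mat n Y = to_mat n (mat_mult n X Y)"
proof -
  have "finsum K (\<lambda>l. to_mat n X (i, l) \<otimes>\<^bsub>K\<^esub> to_mat n Y (l, j)) {..<n} = \<phi> (mat_mult n X Y i j)"
    if "i < n" "j < n" for i j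
    unfolding mat_mult_def phi_sum[OF finite_lessThan] fld.phi_mult
    using that by (intro fld.finsum_cong') (auto simp: to_mat_def)
  then show ?thesis by (auto simp: mat_monoid_def to_mat_def[of n "mat_mult n X Y"] restrict_def fun_eq_iff)
qed

lemma to_mat_one: "\<one>\<^bsub>mat_monoid K n\<^esub> = to_mat n (\<lambda>i j. if i = j then 1 else 0)"
  by (auto simp: mat_monoid_def to_mat_def restrict_def fun_eq_iff)

lemma to_mat_vec: "mat_vec K n (to_mat n X) (to_vec n v) = to_vec n (act n X v)"
proof -
  have "finsum K (\<lambda>j. to_mat n X (i, j) \<otimes>\<^bsub>K\<^esub> to_vec n v j) {..<n} = \<phi> (act n X v i)" if "i < n" for i
    unfolding act_eq phi_sum[OF finite_lessThan] fld.phi_mult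
    using that by (intro fld.finsum_cong') (auto simp: to_mat_def to_vec_def)
  then show ?thesis by (auto simp: mat_vec_def to_vec_def[of n "act n X v"] restrict_def fun_eq_iff)
qed

lemma monoid_mat: "monoid (mat_monoid K n)"
proof (rule monoidI)
  fix X Y Z assume *: "X \<in> carrier (mat_monoid K n)" "Y \<in> carrier (mat_monoid K n)" "Z \<in> carrier (mat_monoid K n)"
  then have e: "X = to_mat n (of_mat X)" "Y = to_mat n (of_mat Y)" "Z = to_mat n (of_mat Z)" by (simp_all add: to_of_mat)
  show "X \<otimes>\<^bsub>mat_monoid K n\<^esub> Y \<in> carrier (mat_monoid K n)"
    by (subst e(1), subst e(2)) (simp add: to_mat_mult)
  show "X \<otimes>\<^bsub>mat_monoid K n\<^esub> Y \<otimes>\<^bsub>mat_monoid K n\<^esub> Z = X \<otimes>\<^bsub>mat_monoid K n\<^esub> (Y \<otimes>\<^bsub>mat_monoid K n\<^esub> Z)"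
    by (subst (1 2) e(1), subst (1 2) e(2), subst (1 2) e(3)) (simp add: to_mat_mult to_mat_eq_iff mat_mult_assoc)
next
  show "\<one>\<^bsub>mat_monoid K n\<^esub> \<in> carrier (mat_monoid K n)" by (simp add: to_mat_one)
next
  fix X assume "X \<in> carrier (mat_monoid K n)"
  then have e: "X = to_mat n (of_mat X)" by (simp add: to_of_mat)
  show "\<one>\<^bsub>mat_monoid K n\<^esub> \<otimes>\<^bsub>mat_monoid K n\<^esub> X = X" "X \<otimes>\<^bsub>mat_monoid K n\<^esub> \<one>\<^bsub>mat_monoid K n\<^esub> = X"
    by (subst (1 2) e, simp add: to_mat_one to_mat_mult to_mat_eq_iff mat_mult_def
        if_distrib[of "times _"] if_distrib[of "\<lambda>x. x * _"] cong: if_cong)+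
qed

lemma carrier_GL: "carrier (GL K n) = Units (mat_monoid K n)"
  by (simp add: GL_def units_of_def)

lemma mult_GL: "X \<otimes>\<^bsub>GL K n\<^esub> Y = X \<otimes>\<^bsub>mat_monoid K n\<^esub> Y"
  by (simp add: GL_def units_of_def)

lemma group_GL: "group (GL K n)"
  unfolding GL_def using monoid_mat by (rule monoid.units_group)

lemma one_GL: "\<one>\<^bsub>GL K n\<^esub> = \<one>\<^bsub>mat_monoid K n\<^esub>"
  by (simp add: GL_def units_of_def)

lemma to_mat_in_GL: "to_mat n T \<in> carrier (GL K n) \<longleftrightarrow> (\<exists>T'. inverse_mats n T T')"
proof
  assume "to_mat n T \<in> carrier (GL K n)"
  then obtain X where X: "X \<in> carrier (mat_monoid K n)" "X \<otimes>\<^bsub>mat_monoid K n\<^esub> to_mat n T = \<one>\<^bsub>mat_monoid K n\<^esub>"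
    "to_mat n T \<otimes>\<^bsub>mat_monoid K n\<^esub> X = \<one>\<^bsub>mat_monoid K n\<^esub>"
    by (auto simp: carrier_GL Units_def)
  have "to_mat n (of_mat X) \<otimes>\<^bsub>mat_monoid K n\<^esub> to_mat n T = \<one>\<^bsub>mat_monoid K n\<^esub>"
    "to_mat n T \<otimes>\<^bsub>mat_monoid K n\<^esub> to_mat n (of_mat X) = \<one>\<^bsub>mat_monoid K n\<^esub>"
    using X by (simp_all add: to_of_mat)
  then have "inverse_mats n T (of_mat X)"
    unfolding inverse_mats_def to_mat_mult to_mat_one to_mat_eq_iff by blast
  then show "\<exists>T'. inverse_mats n T T'" by blast
next
  assume "\<exists>T'. inverse_mats n T T'"
  then obtain T' where "inverse_mats n T T'" by blast
  then have "to_mat n T \<otimes>\<^bsub>mat_monoid K n\<^esub> to_mat n T' = \<one>\<^bsub>mat_monoid K n\<^esub>" "to_mat n T' \<otimes>\<^bsub>mat_monoid K n\<^esub> to_mat n T = \<one>\<^bsub>mat_monoid K n\<^esub>"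
    unfolding inverse_mats_def to_mat_mult to_mat_one to_mat_eq_iff by auto
  then show "to_mat n T \<in> carrier (GL K n)" unfolding carrier_GL Units_def by (auto intro: to_mat_closed)
qed

definition of_rep :: "('a \<Rightarrow> nat \<times> nat \<Rightarrow> 'k) \<Rightarrow> 'a \<Rightarrow> nat \<Rightarrow> nat \<Rightarrow> int poly" where
  "of_rep \<rho> g = of_mat (\<rho> g)"

definition to_rep :: "nat \<Rightarrow> ('a \<Rightarrow> nat \<Rightarrow> nat \<Rightarrow> int poly) \<Rightarrow> 'a \<Rightarrow> nat \<times> nat \<Rightarrow> 'k" where
  "to_rep n \<sigma> = (\<lambda>g\<in>carrier A. to_mat n (\<sigma> g))"

lemma Homs_mat:
  assumes "\<rho> \<in> Homs A (GL K n)" "g \<in> carrier A"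
  shows "\<rho> g \<in> carrier (mat_monoid K n)" and "to_mat n (of_rep \<rho> g) = \<rho> g"
proof -
  have "\<rho> g \<in> carrier (GL K n)" using assms by (auto simp: Homs_def hom_def)
  then show "\<rho> g \<in> carrier (mat_monoid K n)" by (simp add: carrier_GL Units_def)
  then show "to_mat n (of_rep \<rho> g) = \<rho> g" by (simp add: of_rep_def to_of_mat)
qed

lemma rep_of_rep:
  assumes \<rho>: "\<rho> \<in> Homs A (GL K n)"
  shows "rep n (of_rep \<rho>)"
proof -
  have h: "\<rho> \<in> hom A (GL K n)" using \<rho> by (simp add: Homs_def)
  have "to_mat n (of_rep \<rho> (x \<otimes> y)) = to_mat n (mat_mult n (of_rep \<rho> x) (of_rep \<rho> y))"
    if "x \<in> carrier A" "y \<in> carrier A" for x y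
    using that hom_mult[OF h that] by (simp add: to_mat_mult[symmetric] Homs_mat(2)[OF \<rho>] mult_GL)
  moreover have "to_mat n (of_rep \<rho> \<one>) = to_mat n (\<lambda>i j. if i = j then 1 else 0)"
    using hom_one[OF h is_group group_GL] by (simp add: Homs_mat(2)[OF \<rho>] one_GL to_mat_one)
  ultimately show ?thesis unfolding rep_def to_mat_eq_iff by blast
qed

lemma to_rep_Homs:
  assumes \<sigma>: "rep n \<sigma>"
  shows "to_rep n \<sigma> \<in> Homs A (GL K n)"
proof -
  have m: "to_mat n (\<sigma> x) \<otimes>\<^bsub>mat_monoid K n\<^esub> to_mat n (\<sigma> y) = to_mat n (\<sigma> (x \<otimes> y))" if "x \<in> carrier A" "y \<in> carrier A" for x y
    unfolding to_mat_mult to_mat_eq_iff using \<sigma> that by (simp add: rep_def)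
  have o: "to_mat n (\<sigma> \<one>) = \<one>\<^bsub>mat_monoid K n\<^esub>"
    unfolding to_mat_one to_mat_eq_iff using \<sigma> by (simp add: rep_def)
  have "to_mat n (\<sigma> x) \<in> carrier (GL K n)" if x: "x \<in> carrier A" for x
    unfolding carrier_GL Units_def using m[of x "inv x"] m[of "inv x" x] x o
    by (auto intro!: bexI[of _ "to_mat n (\<sigma> (inv x))"])
  then show ?thesis using m by (auto simp: Homs_def hom_def to_rep_def mult_GL)
qed

lemma of_to_rep: "g \<in> carrier A \<Longrightarrow> i < n \<Longrightarrow> j < n \<Longrightarrow> \<phi> (of_rep (to_rep n \<sigma>) g i j) = \<phi> (\<sigma> g i j)"
  by (simp add: of_rep_def to_rep_def of_mat_entry[OF to_mat_closed]) (simp add: to_mat_def)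

text \<open>Entrywise passage to canonical representatives is a bijection, inverted by reduction.
  The right-hand side spells out \<open>rep_set\<close>, which presupposes a complete system of
  irreducible representations.\<close>

lemma card_Homs:
  "card (Homs A (GL K n)) = card {\<rho> \<in> carrier A \<rightarrow>\<^sub>E ({..<n} \<times> {..<n} \<rightarrow>\<^sub>E C). rep n (\<lambda>g i j. \<rho> g (i, j))}"
proof -
  let ?I = "{..<n} \<times> {..<n}"
  let ?f = "\<lambda>\<rho>. \<lambda>g\<in>carrier A. \<lambda>x\<in>?I. lift (\<rho> g x)"
  let ?f' = "\<lambda>\<rho>. to_rep n (\<lambda>g i j. \<rho> g (i, j))"
  let ?R = "{\<rho> \<in> carrier A \<rightarrow>\<^sub>E (?I \<rightarrow>\<^sub>E C). rep n (\<lambda>g i j. \<rho> g (i, j))}"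
  have "bij_betw ?f (Homs A (GL K n)) ?R"
  proof (rule bij_betw_byWitness[where f' = ?f'])
    show "\<forall>\<rho>\<in>Homs A (GL K n). ?f' (?f \<rho>) = \<rho>"
    proof
      fix \<rho> assume \<rho>: "\<rho> \<in> Homs A (GL K n)"
      show "?f' (?f \<rho>) = \<rho>"
      proof (rule extensionalityI[of _ "carrier A"])
        show "\<rho> \<in> extensional (carrier A)" using \<rho> by (simp add: Homs_def)
        fix g assume g: "g \<in> carrier A"
        have "?f' (?f \<rho>) g = to_mat n (of_rep \<rho> g)"
          using g by (simp add: to_rep_def to_mat_eq_iff of_rep_def of_mat_def)
        then show "?f' (?f \<rho>) g = \<rho> g" using Homs_mat(2)[OF \<rho> g] by simp
      qed (simp add: to_rep_def)
    qed
    show "\<forall>\<rho>\<in>?R. ?f (?f' \<rho>) = \<rho>"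
    proof
      fix \<rho> assume "\<rho> \<in> ?R"
      then have \<rho>: "\<rho> \<in> carrier A \<rightarrow>\<^sub>E (?I \<rightarrow>\<^sub>E C)" by simp
      show "?f (?f' \<rho>) = \<rho>"
      proof (rule extensionalityI[of _ "carrier A"])
        show "\<rho> \<in> extensional (carrier A)" using \<rho> by (simp add: PiE_def)
        fix g assume g: "g \<in> carrier A"
        have \<rho>g: "\<rho> g \<in> ?I \<rightarrow>\<^sub>E C" using \<rho> g by (rule PiE_mem)
        have "?f (?f' \<rho>) g = canon ?I (\<rho> g)"
          using g by (auto simp: to_rep_def to_mat_def canon_def restrict_def fun_eq_iff)
        then show "?f (?f' \<rho>) g = \<rho> g" using canon_id[OF \<rho>g] by simp
      qed simp
    qed
    show "?f ` Homs A (GL K n) \<subseteq> ?R"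
    proof
      fix \<sigma> assume "\<sigma> \<in> ?f ` Homs A (GL K n)"
      then obtain \<rho> where \<rho>: "\<rho> \<in> Homs A (GL K n)" "\<sigma> = ?f \<rho>" by blast
      have C: "lift (\<rho> g x) \<in> C" if "g \<in> carrier A" "x \<in> ?I" for g x
      proof -
        have "\<rho> g x \<in> range \<phi>"
          using Homs_mat(1)[OF \<rho>(1) that(1)] that(2) unfolding carrier_mat_monoid fld.range_phi by (rule PiE_mem)
        then show ?thesis by (simp add: C_def)
      qed
      have "rep n (\<lambda>g i j. \<sigma> g (i, j))"
        using rep_of_rep[OF \<rho>(1)] unfolding rep_def mat_mult_def
        by (simp add: \<rho>(2) of_rep_def of_mat_def)
      then show "\<sigma> \<in> ?R" using C \<rho>(2) by auto
    qed
    show "?f' ` ?R \<subseteq> Homs A (GL K n)" using to_rep_Homs by auto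
  qed
  then show ?thesis by (rule bij_betw_same_card)
qed

lemma coord_add: "to_vec n v \<oplus>\<^bsub>coord_space K n\<^esub> to_vec n w = to_vec n (\<lambda>i. v i + w i)"
  by (auto simp: coord_space_def to_vec_def restrict_def fun_eq_iff fld.phi_add)

lemma coord_zero: "\<zero>\<^bsub>coord_space K n\<^esub> = to_vec n (\<lambda>_. 0)"
  by (auto simp: coord_space_def to_vec_def restrict_def fun_eq_iff)

lemma coord_smult: "\<phi> c \<odot>\<^bsub>coord_space K n\<^esub> to_vec n v = to_vec n (\<lambda>i. c * v i)"
  by (auto simp: coord_space_def to_vec_def restrict_def fun_eq_iff fld.phi_mult)

text \<open>Invariant subspaces in preimage form and submodules of K^n correspond to each other by
  images and preimages under \<open>to_vec\<close>.\<close>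

lemma irreducible_of_rep:
  assumes "irreducible_rep A K n \<rho>"
  shows "irreducible n (of_rep \<rho>)"
proof -
  have \<rho>: "\<rho> \<in> Homs A (GL K n)" and n: "n \<ge> 1"
    and irr: "\<And>W. submodule W K (coord_space K n) \<Longrightarrow> (\<And>g w. g \<in> carrier A \<Longrightarrow> w \<in> W \<Longrightarrow> mat_vec K n (\<rho> g) w \<in> W) \<Longrightarrow>
        W = {\<zero>\<^bsub>coord_space K n\<^esub>} \<or> W = carrier (coord_space K n)"
    using assms unfolding irreducible_rep_def by blast+
  have "(\<forall>w\<in>W. \<forall>i<n. \<phi> (w i) = \<phi> 0) \<or> W = UNIV" if W: "invariant n (of_rep \<rho>) W" for W
  proof -
    have sub: "subspace {..<n} W" and inva: "\<And>g w. g \<in> carrier A \<Longrightarrow> w \<in> W \<Longrightarrow> act n (of_rep \<rho> g) w \<in> W"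
      using W by (auto simp: invariant_def)
    \<comment> \<open>Closure under congruence makes W the full preimage of its image.\<close>
    have mem: "to_vec n v \<in> to_vec n ` W \<longleftrightarrow> v \<in> W" for v
    proof
      assume "to_vec n v \<in> to_vec n ` W"
      then obtain w where w: "w \<in> W" "to_vec n v = to_vec n w" by blast
      then have "\<forall>i<n. \<phi> (w i) = \<phi> (v i)" by (metis to_vec_eq_iff)
      then show "v \<in> W" by (intro subspace_cong[OF sub w(1)]) auto
    qed blast
    have "submodule (to_vec n ` W) K (coord_space K n)"
    proof (intro submodule.intro submodule_axioms.intro)
      show "subgroup (to_vec n ` W) (add_monoid (coord_space K n))"
      proof (rule group.subgroupI[OF fld.group_coord_space])
        show "to_vec n ` W \<subseteq> carrier (add_monoid (coord_space K n))" by auto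
        show "to_vec n ` W \<noteq> {}" using subspace_zero[OF sub] by blast
        fix a assume "a \<in> to_vec n ` W"
        then obtain v where v: "v \<in> W" "a = to_vec n v" by blast
        have "inv\<^bsub>add_monoid (coord_space K n)\<^esub> a = to_vec n (\<lambda>i. (- 1) * v i)"
          by (rule group.inv_equality[OF fld.group_coord_space]) (simp_all add: v coord_add coord_zero)
        then show "inv\<^bsub>add_monoid (coord_space K n)\<^esub> a \<in> to_vec n ` W"
          using subspace_scale[OF sub v(1), of "- 1"] by (simp only: image_eqI)
        fix b assume "b \<in> to_vec n ` W"
        then obtain w where w: "w \<in> W" "b = to_vec n w" by blast
        then show "a \<otimes>\<^bsub>add_monoid (coord_space K n)\<^esub> b \<in> to_vec n ` W"
          using v subspace_add[OF sub v(1) w(1)] by (simp add: coord_add)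
      qed
      fix a x assume "a \<in> carrier K" "x \<in> to_vec n ` W"
      then obtain c v where "a = \<phi> c" "v \<in> W" "x = to_vec n v" using fld.range_phi by blast
      then show "a \<odot>\<^bsub>coord_space K n\<^esub> x \<in> to_vec n ` W"
        using subspace_scale[OF sub, of v c] by (simp add: coord_smult)
    qed
    moreover have "mat_vec K n (\<rho> g) w \<in> to_vec n ` W" if g: "g \<in> carrier A" and w: "w \<in> to_vec n ` W" for g w
    proof -
      obtain v where v: "v \<in> W" "w = to_vec n v" using w by blast
      have "mat_vec K n (\<rho> g) w = to_vec n (act n (of_rep \<rho> g) v)"
        by (simp add: v to_mat_vec[symmetric] Homs_mat(2)[OF \<rho> g])
      then show ?thesis using inva[OF g v(1)] by simp
    qed
    ultimately consider "to_vec n ` W = {\<zero>\<^bsub>coord_space K n\<^esub>}" | "to_vec n ` W = carrier (coord_space K n)"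
      using irr by blast
    then show ?thesis
    proof cases
      case 1
      have "\<forall>i<n. \<phi> (w i) = \<phi> 0" if "w \<in> W" for w
      proof -
        have "to_vec n w = to_vec n (\<lambda>_. 0)" using 1 that unfolding coord_zero by blast
        then show ?thesis by (simp add: to_vec_eq_iff)
      qed
      then show ?thesis by blast
    next
      case 2
      then have "v \<in> W" for v using mem[of v] by simp
      then show ?thesis by blast
    qed
  qed
  then show ?thesis using rep_of_rep[OF \<rho>] n unfolding irreducible_def by blast
qed

lemma irreducible_to_rep:
  assumes \<sigma>: "irreducible n \<sigma>"
  shows "irreducible_rep A K n (to_rep n \<sigma>)"
  unfolding irreducible_rep_def
proof (intro conjI allI impI)
  show "to_rep n \<sigma> \<in> Homs A (GL K n)" using \<sigma> to_rep_Homs by (simp add: irreducible_def)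
  show "1 \<le> n" using \<sigma> by (simp add: irreducible_def)
  fix W assume W: "submodule W K (coord_space K n) \<and> (\<forall>g\<in>carrier A. \<forall>w\<in>W. mat_vec K n (to_rep n \<sigma> g) w \<in> W)"
  then interpret W: submodule W K "coord_space K n" by blast
  define V where "V = {v. to_vec n v \<in> W}"
  have "subspace {..<n} V"
    unfolding subspace_def
  proof (intro conjI ballI allI impI)
    show "(\<lambda>_. 0) \<in> V" using W.one_closed by (simp add: V_def coord_zero[symmetric])
    show "(\<lambda>i. v i + w i) \<in> V" if "v \<in> V" "w \<in> V" for v w
      using that W.m_closed by (simp add: V_def coord_add[symmetric])
    show "(\<lambda>i. c * v i) \<in> V" if "v \<in> V" for c v
      using that W.smult_closed by (simp add: V_def coord_smult[symmetric])
    show "w \<in> V" if "v \<in> V" "\<forall>i\<in>{..<n}. \<phi> (v i) = \<phi> (w i)" for v w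
    proof -
      have "to_vec n v = to_vec n w" using that(2) by (simp add: to_vec_eq_iff)
      then show ?thesis using that(1) by (simp add: V_def)
    qed
  qed
  moreover have "act n (\<sigma> g) v \<in> V" if "g \<in> carrier A" "v \<in> V" for g v
  proof -
    have "mat_vec K n (to_rep n \<sigma> g) (to_vec n v) \<in> W" using W that by (auto simp: V_def)
    then show ?thesis using that by (simp add: V_def to_rep_def to_mat_vec)
  qed
  ultimately have "(\<forall>w\<in>V. \<forall>i<n. \<phi> (w i) = \<phi> 0) \<or> V = UNIV" using \<sigma> by (simp add: irreducible_def invariant_def)
  then show "W = {\<zero>\<^bsub>coord_space K n\<^esub>} \<or> W = carrier (coord_space K n)"
  proof
    assume *: "\<forall>w\<in>V. \<forall>i<n. \<phi> (w i) = \<phi> 0"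
    have "w = \<zero>\<^bsub>coord_space K n\<^esub>" if "w \<in> W" for w
    proof -
      obtain v where v: "w = to_vec n v" using to_vec_surj W.mem_carrier \<open>w \<in> W\<close> by fastforce
      then have "v \<in> V" using \<open>w \<in> W\<close> by (simp add: V_def)
      then show ?thesis using * v by (simp add: coord_zero to_vec_eq_iff)
    qed
    moreover have "\<zero>\<^bsub>coord_space K n\<^esub> \<in> W" using W.one_closed by simp
    ultimately show ?thesis by blast
  next
    assume "V = UNIV"
    then have "to_vec n v \<in> W" for v by (auto simp: V_def)
    then have "carrier (coord_space K n) \<subseteq> W" using to_vec_surj by fastforce
    moreover have "W \<subseteq> carrier (coord_space K n)" using W.subset by simp
    ultimately show ?thesis by blast
  qed
qed

lemma inverse_mats_sym: "inverse_mats n T T' \<Longrightarrow> inverse_mats n T' T"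
  by (simp add: inverse_mats_def)

lemma equivalent_sym:
  assumes "equivalent n \<rho> m \<sigma>"
  shows "equivalent m \<sigma> n \<rho>"
proof -
  obtain T T' where nm: "n = m" and T: "intertwiner n \<rho> n \<sigma> T" "inverse_mats n T T'"
    using assms unfolding equivalent_def by blast
  have i: "to_mat n T \<otimes>\<^bsub>mat_monoid K n\<^esub> to_mat n T' = \<one>\<^bsub>mat_monoid K n\<^esub>" "to_mat n T' \<otimes>\<^bsub>mat_monoid K n\<^esub> to_mat n T = \<one>\<^bsub>mat_monoid K n\<^esub>"
    using T(2) unfolding inverse_mats_def to_mat_mult to_mat_one to_mat_eq_iff by auto
  interpret mm: monoid "mat_monoid K n" by (rule monoid_mat)
  have "to_mat n T' \<otimes>\<^bsub>mat_monoid K n\<^esub> to_mat n (\<rho> g) = to_mat n (\<sigma> g) \<otimes>\<^bsub>mat_monoid K n\<^esub> to_mat n T'" if g: "g \<in> carrier A" for g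
  proof -
    let ?m = "\<lambda>X Y. X \<otimes>\<^bsub>mat_monoid K n\<^esub> Y"
    have c: "?m (to_mat n T) (to_mat n (\<sigma> g)) = ?m (to_mat n (\<rho> g)) (to_mat n T)"
      using T(1) g unfolding intertwiner_def to_mat_mult to_mat_eq_iff by auto
    have "?m (to_mat n T') (to_mat n (\<rho> g)) = ?m (?m (to_mat n T') (to_mat n (\<rho> g))) (?m (to_mat n T) (to_mat n T'))"
      by (simp add: i)
    also have "\<dots> = ?m (?m (to_mat n T') (?m (to_mat n (\<rho> g)) (to_mat n T))) (to_mat n T')"
      by (simp add: mm.m_assoc)
    also have "\<dots> = ?m (?m (to_mat n T') (?m (to_mat n T) (to_mat n (\<sigma> g)))) (to_mat n T')"
      by (simp add: c)
    also have "\<dots> = ?m (?m (to_mat n T') (to_mat n T)) (?m (to_mat n (\<sigma> g)) (to_mat n T'))"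
      by (simp add: mm.m_assoc)
    finally show ?thesis by (simp add: i)
  qed
  then have "intertwiner n \<sigma> n \<rho> T'" unfolding intertwiner_def to_mat_mult to_mat_eq_iff by auto
  then show ?thesis using nm inverse_mats_sym[OF T(2)] unfolding equivalent_def by blast
qed

text \<open>The arguments change places: in \<open>equivalent_reps\<close> the matrix T maps the
  first space to the second, in \<open>equivalent\<close> the second to the first.\<close>

lemma equivalent_reps_iff:
  assumes \<rho>: "\<rho> \<in> Homs A (GL K n)" and \<sigma>: "\<sigma> \<in> Homs A (GL K m)"
  shows "equivalent_reps A K n \<rho> m \<sigma> \<longleftrightarrow> equivalent m (of_rep \<sigma>) n (of_rep \<rho>)"
proof
  assume "equivalent_reps A K n \<rho> m \<sigma>"
  then obtain T where nm: "n = m" and T: "T \<in> carrier (GL K n)" "\<And>g. g \<in> carrier A \<Longrightarrow> T \<otimes>\<^bsub>GL K n\<^esub> \<rho> g = \<sigma> g \<otimes>\<^bsub>GL K n\<^esub> T"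
    unfolding equivalent_reps_def by blast
  have TT: "to_mat n (of_mat T) = T" using T(1) by (intro to_of_mat) (simp add: carrier_GL Units_def)
  have "to_mat n (mat_mult n (of_mat T) (of_rep \<rho> g)) = to_mat n (mat_mult n (of_rep \<sigma> g) (of_mat T))" if g: "g \<in> carrier A" for g
    using T(2)[OF g] Homs_mat(2)[OF \<rho> g] Homs_mat(2)[OF \<sigma> g] nm TT by (simp add: to_mat_mult[symmetric] mult_GL)
  then have "intertwiner n (of_rep \<sigma>) n (of_rep \<rho>) (of_mat T)" unfolding intertwiner_def to_mat_eq_iff by blast
  moreover have "\<exists>T'. inverse_mats n (of_mat T) T'" using T(1) to_mat_in_GL[of n "of_mat T"] TT by simp
  ultimately show "equivalent m (of_rep \<sigma>) n (of_rep \<rho>)" unfolding equivalent_def using nm by blast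
next
  assume "equivalent m (of_rep \<sigma>) n (of_rep \<rho>)"
  then obtain T T' where nm: "n = m" and T: "intertwiner n (of_rep \<sigma>) n (of_rep \<rho>) T" "inverse_mats n T T'"
    unfolding equivalent_def by blast
  have "to_mat n T \<in> carrier (GL K n)" using T(2) to_mat_in_GL by blast
  moreover have "to_mat n T \<otimes>\<^bsub>GL K n\<^esub> \<rho> g = \<sigma> g \<otimes>\<^bsub>GL K n\<^esub> to_mat n T" if g: "g \<in> carrier A" for g
  proof -
    have "to_mat n (mat_mult n T (of_rep \<rho> g)) = to_mat n (mat_mult n (of_rep \<sigma> g) T)"
      using T(1) g unfolding intertwiner_def to_mat_eq_iff by blast
    then show ?thesis using Homs_mat(2)[OF \<rho> g] Homs_mat(2)[OF \<sigma> g] nm by (simp add: to_mat_mult[symmetric] mult_GL)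
  qed
  ultimately show "equivalent_reps A K n \<rho> m \<sigma>" unfolding equivalent_reps_def using nm by blast
qed

lemma equivalent_cong:
  assumes "\<And>g i j. g \<in> carrier A \<Longrightarrow> i < n \<Longrightarrow> j < n \<Longrightarrow> \<phi> (\<rho> g i j) = \<phi> (\<rho>' g i j)" "equivalent n \<rho> m \<sigma>"
  shows "equivalent n \<rho>' m \<sigma>"
proof -
  obtain T T' where nm: "n = m" and T: "intertwiner n \<rho> n \<sigma> T" "inverse_mats n T T'"
    using assms(2) unfolding equivalent_def by blast
  have "\<phi> (mat_mult n (\<rho> g) T i j) = \<phi> (mat_mult n (\<rho>' g) T i j)" if "g \<in> carrier A" "i < n" for g i j
    by (rule fld.mat_mult_cong) (use assms(1) that in auto)
  then have "intertwiner n \<rho>' n \<sigma> T" using T(1) unfolding intertwiner_def by simp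
  then show ?thesis unfolding equivalent_def using nm T(2) by blast
qed

end

section \<open>Commuting matrices\<close>

context field_reps
begin

definition mat_add :: "(nat \<Rightarrow> nat \<Rightarrow> int poly) \<Rightarrow> (nat \<Rightarrow> nat \<Rightarrow> int poly) \<Rightarrow> nat \<Rightarrow> nat \<Rightarrow> int poly" where
  "mat_add X Y = (\<lambda>i j. X i j + Y i j)"

definition scalar_mat :: "int poly \<Rightarrow> nat \<Rightarrow> nat \<Rightarrow> int poly" where
  "scalar_mat c = (\<lambda>i j. if i = j then c else 0)"

definition commute :: "nat \<Rightarrow> (nat \<Rightarrow> nat \<Rightarrow> int poly) \<Rightarrow> (nat \<Rightarrow> nat \<Rightarrow> int poly) \<Rightarrow> bool" where
  "commute n X Y \<longleftrightarrow> to_mat n (mat_mult n X Y) = to_mat n (mat_mult n Y X)"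

lemma mat_mult_to_mat_cong:
  "to_mat n X = to_mat n X' \<Longrightarrow> to_mat n Y = to_mat n Y' \<Longrightarrow>
    to_mat n (mat_mult n X Y) = to_mat n (mat_mult n X' Y')"
  by (simp add: to_mat_mult[symmetric])

lemma mat_add_to_mat_cong:
  "to_mat n X = to_mat n X' \<Longrightarrow> to_mat n Y = to_mat n Y' \<Longrightarrow> to_mat n (mat_add X Y) = to_mat n (mat_add X' Y')"
  unfolding to_mat_eq_iff mat_add_def by (auto intro: fld.add_cong)

lemma commute_sym: "commute n X Y \<Longrightarrow> commute n Y X"
  by (simp add: commute_def)

lemma commute_mult:
  assumes "commute n X Z" "commute n Y Z"
  shows "commute n (mat_mult n X Y) Z"
proof -
  interpret mm: monoid "mat_monoid K n" by (rule monoid_mat)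
  have "to_mat n X \<otimes>\<^bsub>mat_monoid K n\<^esub> (to_mat n Y \<otimes>\<^bsub>mat_monoid K n\<^esub> to_mat n Z)
    = (to_mat n X \<otimes>\<^bsub>mat_monoid K n\<^esub> to_mat n Z) \<otimes>\<^bsub>mat_monoid K n\<^esub> to_mat n Y"
    using assms(2) by (simp add: commute_def to_mat_mult[symmetric] mm.m_assoc)
  also have "\<dots> = to_mat n Z \<otimes>\<^bsub>mat_monoid K n\<^esub> (to_mat n X \<otimes>\<^bsub>mat_monoid K n\<^esub> to_mat n Y)"
    using assms(1) by (simp add: commute_def to_mat_mult[symmetric] mm.m_assoc)
  finally show ?thesis by (simp add: commute_def to_mat_mult[symmetric] mm.m_assoc)
qed

lemma commute_inverse:
  assumes "inverse_mats n X X'" "commute n X Y"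
  shows "commute n X' Y"
proof -
  interpret mm: monoid "mat_monoid K n" by (rule monoid_mat)
  let ?m = "\<lambda>X Y. X \<otimes>\<^bsub>mat_monoid K n\<^esub> Y"
  have i: "?m (to_mat n X) (to_mat n X') = \<one>\<^bsub>mat_monoid K n\<^esub>" "?m (to_mat n X') (to_mat n X) = \<one>\<^bsub>mat_monoid K n\<^esub>"
    using assms(1) unfolding inverse_mats_def to_mat_mult to_mat_one to_mat_eq_iff by auto
  have c: "?m (to_mat n X) (to_mat n Y) = ?m (to_mat n Y) (to_mat n X)"
    using assms(2) by (simp add: commute_def to_mat_mult)
  have "?m (to_mat n X') (to_mat n Y) = ?m (?m (to_mat n X') (to_mat n Y)) (?m (to_mat n X) (to_mat n X'))"
    by (simp add: i)
  also have "\<dots> = ?m (?m (to_mat n X') (?m (to_mat n Y) (to_mat n X))) (to_mat n X')"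
    by (simp add: mm.m_assoc)
  also have "\<dots> = ?m (?m (to_mat n X') (?m (to_mat n X) (to_mat n Y))) (to_mat n X')"
    by (simp add: c)
  also have "\<dots> = ?m (?m (to_mat n X') (to_mat n X)) (?m (to_mat n Y) (to_mat n X'))"
    by (simp add: mm.m_assoc)
  finally show ?thesis by (simp add: i commute_def to_mat_mult[symmetric])
qed

lemma mat_mult_add_left: "mat_mult n (mat_add X Y) Z = mat_add (mat_mult n X Z) (mat_mult n Y Z)"
  by (intro ext) (simp add: mat_mult_def mat_add_def distrib_right sum.distrib)

lemma mat_mult_add_right: "mat_mult n Z (mat_add X Y) = mat_add (mat_mult n Z X) (mat_mult n Z Y)"
  by (intro ext) (simp add: mat_mult_def mat_add_def distrib_left sum.distrib)

lemma mat_mult_scalar_left: "i < n \<Longrightarrow> mat_mult n (scalar_mat c) X i j = c * X i j"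
  by (simp add: mat_mult_def scalar_mat_def if_distrib[of "\<lambda>x. x * _"] cong: if_cong)

lemma mat_mult_scalar_right: "j < n \<Longrightarrow> mat_mult n X (scalar_mat c) i j = c * X i j"
  by (simp add: mat_mult_def scalar_mat_def if_distrib[of "times _"] mult.commute cong: if_cong)

lemma commute_add:
  assumes "commute n X Z" "commute n Y Z"
  shows "commute n (mat_add X Y) Z"
  using assms unfolding commute_def mat_mult_add_left mat_mult_add_right by (rule mat_add_to_mat_cong)

lemma commute_scalar: "commute n (scalar_mat c) X"
  unfolding commute_def to_mat_eq_iff by (simp add: mat_mult_scalar_left mat_mult_scalar_right)

lemma intertwiner_iff_commute:
  "intertwiner n \<sigma> n \<sigma> X \<longleftrightarrow> (\<forall>g\<in>carrier A. commute n X (\<sigma> g))"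
  by (simp add: intertwiner_def commute_def to_mat_eq_iff)

end

section \<open>Absolute irreducibility implies a scalar commutant\<close>

locale nat_field_reps = field_reps K p e A
  for K :: "nat ring" and p e :: nat and A :: "('a, 'm) monoid_scheme" (structure)
begin

text \<open>
  If \<open>T\<close> commutes with the representation, then the double centralizer \<open>L\<close> of \<open>T\<close> in the commutant is a
  field by Schur's lemma. Evaluation \<open>w \<mapsto> \<Sum>\<^sub>j w\<^sub>j e\<^sub>j\<close> maps \<open>L\<^sup>n\<close> equivariantly to \<open>K\<^sup>n\<close>, so its kernel \<open>W\<close> is an
  invariant subspace over \<open>L\<close>; it is proper, and it contains
  \<open>(T - T\<^sub>0\<^sub>0, - T\<^sub>1\<^sub>0, - T\<^sub>2\<^sub>0, \<dots>)\<close>, which is nonzero unless \<open>T\<close> is scalar.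
\<close>

theorem scalar_commutant_if_absolutely_irreducible:
  assumes irr: "irreducible n \<sigma>"
    and abs_irr: "\<And>L h. field L \<Longrightarrow> h \<in> ring_hom K L \<Longrightarrow>
      irreducible_rep A (L :: nat ring) n (base_change A n h (to_rep n \<sigma>))"
  shows "scalar_commutant n \<sigma>"
proof (rule ccontr)
  assume "\<not> scalar_commutant n \<sigma>"
  then obtain T where T: "intertwiner n \<sigma> n \<sigma> T"
    and T_ns: "\<And>c. \<not> (\<forall>i<n. \<forall>j<n. \<phi> (T i j) = \<phi> (if i = j then c else 0))"
    unfolding scalar_commutant_def by blast
  have n: "n > 0" using irr by (simp add: irreducible_def)
  define D where "D X \<longleftrightarrow> (\<forall>g\<in>carrier A. commute n X (\<sigma> g))" for X
  have DT: "D T" using T by (simp add: D_def intertwiner_iff_commute)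
  \<comment> \<open>A member of Z commutes with everything in D that commutes with T. The other
    members of Z are of this kind, since T itself is in D and commutes with T; so Z is
    commutative.\<close>
  define Z where "Z X \<longleftrightarrow> D X \<and> (\<forall>Y. D Y \<longrightarrow> commute n Y T \<longrightarrow> commute n X Y)" for X
  have TT: "commute n T T" by (simp add: commute_def)
  have Z_comm: "commute n X Y" if "Z X" "Z Y" for X Y
    using that DT TT unfolding Z_def by blast
  have ZT: "Z T" using DT unfolding Z_def by (meson commute_sym)
  have Z_scalar: "Z (scalar_mat c)" for c by (simp add: Z_def D_def commute_scalar)
  have Z_mult: "Z (mat_mult n X Y)" if "Z X" "Z Y" for X Y
    using that unfolding Z_def D_def by (simp add: commute_mult)
  have Z_add: "Z (mat_add X Y)" if "Z X" "Z Y" for X Y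
    using that unfolding Z_def D_def by (simp add: commute_add)
  have Z_inv: "\<exists>X'. Z X' \<and> inverse_mats n X X'" if X: "Z X" and nz: "to_mat n X \<noteq> to_mat n (scalar_mat 0)" for X
  proof -
    obtain i j where "i < n" "j < n" "\<phi> (X i j) \<noteq> \<phi> 0"
      using nz unfolding to_mat_eq_iff scalar_mat_def by auto
    moreover have "intertwiner n \<sigma> n \<sigma> X" using X by (simp add: Z_def D_def intertwiner_iff_commute)
    ultimately obtain X' where X': "inverse_mats n X X'" using schur[OF irr irr] by blast
    then have "Z X'" using X commute_inverse[OF X'] unfolding Z_def D_def by blast
    then show ?thesis using X' by blast
  qed
  \<comment> \<open>Absolute irreducibility is tested on fields with natural numbers as elements, so
    the finitely many matrices over K are coded by numbers.\<close>
  have "finite (carrier (mat_monoid K n))"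
    unfolding carrier_mat_monoid using fld.finite_K by (intro finite_PiE) auto
  then obtain enc :: "(nat \<times> nat \<Rightarrow> nat) \<Rightarrow> nat" where enc: "inj_on enc (carrier (mat_monoid K n))"
    using finite_imp_inj_to_nat_seg by blast
  define \<Phi> where "\<Phi> X = enc (to_mat n X)" for X
  have \<Phi>_eq: "\<Phi> X = \<Phi> Y \<longleftrightarrow> to_mat n X = to_mat n Y" for X Y
    unfolding \<Phi>_def using enc by (simp add: inj_on_eq_iff)
  define \<psi> where "\<psi> u = (SOME X. Z X \<and> \<Phi> X = u)" for u
  have \<psi>: "Z (\<psi> (\<Phi> X))" "to_mat n (\<psi> (\<Phi> X)) = to_mat n X" if "Z X" for X
    using someI[of "\<lambda>Y. Z Y \<and> \<Phi> Y = \<Phi> X" X] that unfolding \<psi>_def \<Phi>_eq by blast+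
  define L :: "nat ring" where "L = \<lparr>carrier = \<Phi> ` {X. Z X}, monoid.mult = (\<lambda>u v. \<Phi> (mat_mult n (\<psi> u) (\<psi> v))),
    one = \<Phi> (scalar_mat 1), zero = \<Phi> (scalar_mat 0), add = (\<lambda>u v. \<Phi> (mat_add (\<psi> u) (\<psi> v)))\<rparr>"
  have L_carrier: "\<Phi> X \<in> carrier L" if "Z X" for X using that by (simp add: L_def)
  have L_E: "\<exists>X. Z X \<and> u = \<Phi> X" if "u \<in> carrier L" for u using that by (auto simp: L_def)
  have L_mult: "\<Phi> X \<otimes>\<^bsub>L\<^esub> \<Phi> Y = \<Phi> (mat_mult n X Y)" if "Z X" "Z Y" for X Y
  proof -
    have "\<Phi> (mat_mult n (\<psi> (\<Phi> X)) (\<psi> (\<Phi> Y))) = \<Phi> (mat_mult n X Y)"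
      unfolding \<Phi>_eq by (rule mat_mult_to_mat_cong[OF \<psi>(2)[OF that(1)] \<psi>(2)[OF that(2)]])
    then show ?thesis by (simp add: L_def)
  qed
  have L_add: "\<Phi> X \<oplus>\<^bsub>L\<^esub> \<Phi> Y = \<Phi> (mat_add X Y)" if "Z X" "Z Y" for X Y
  proof -
    have "\<Phi> (mat_add (\<psi> (\<Phi> X)) (\<psi> (\<Phi> Y))) = \<Phi> (mat_add X Y)"
      unfolding \<Phi>_eq by (rule mat_add_to_mat_cong[OF \<psi>(2)[OF that(1)] \<psi>(2)[OF that(2)]])
    then show ?thesis by (simp add: L_def)
  qed
  have L_one: "\<one>\<^bsub>L\<^esub> = \<Phi> (scalar_mat 1)" and L_zero: "\<zero>\<^bsub>L\<^esub> = \<Phi> (scalar_mat 0)" by (simp_all add: L_def)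
  have abel: "abelian_group L"
  proof (rule abelian_groupI)
    fix u v w assume u: "u \<in> carrier L" and v: "v \<in> carrier L"
    obtain X Y where X: "Z X" "u = \<Phi> X" and Y: "Z Y" "v = \<Phi> Y" using L_E u v by metis
    show "u \<oplus>\<^bsub>L\<^esub> v \<in> carrier L" by (simp add: X Y L_add L_carrier Z_add)
    show "u \<oplus>\<^bsub>L\<^esub> v = v \<oplus>\<^bsub>L\<^esub> u" by (simp add: X Y L_add) (simp add: mat_add_def add.commute)
    assume "w \<in> carrier L"
    then obtain W where W: "Z W" "w = \<Phi> W" using L_E by metis
    show "u \<oplus>\<^bsub>L\<^esub> v \<oplus>\<^bsub>L\<^esub> w = u \<oplus>\<^bsub>L\<^esub> (v \<oplus>\<^bsub>L\<^esub> w)"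
      by (simp add: X Y W L_add Z_add) (simp add: mat_add_def add.assoc)
  next
    show "\<zero>\<^bsub>L\<^esub> \<in> carrier L" by (simp add: L_zero L_carrier Z_scalar)
  next
    fix u assume u: "u \<in> carrier L"
    obtain X where X: "Z X" "u = \<Phi> X" using L_E u by metis
    show "\<zero>\<^bsub>L\<^esub> \<oplus>\<^bsub>L\<^esub> u = u" by (simp add: X L_zero L_add Z_scalar) (simp add: mat_add_def scalar_mat_def)
    have "Z (mat_mult n (scalar_mat (- 1)) X)" by (intro Z_mult Z_scalar X)
    moreover have "\<Phi> (mat_add (mat_mult n (scalar_mat (- 1)) X) X) = \<Phi> (scalar_mat 0)"
      unfolding \<Phi>_eq to_mat_eq_iff by (simp add: mat_add_def mat_mult_scalar_left) (simp add: scalar_mat_def)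
    ultimately show "\<exists>y\<in>carrier L. y \<oplus>\<^bsub>L\<^esub> u = \<zero>\<^bsub>L\<^esub>"
      by (intro bexI[of _ "\<Phi> (mat_mult n (scalar_mat (- 1)) X)"]) (simp_all add: X L_zero L_add L_carrier)
  qed
  have cring: "cring L"
  proof (rule cringI[OF abel comm_monoidI])
    fix u v w assume u: "u \<in> carrier L" and v: "v \<in> carrier L"
    obtain X Y where X: "Z X" "u = \<Phi> X" and Y: "Z Y" "v = \<Phi> Y" using L_E u v by metis
    show "u \<otimes>\<^bsub>L\<^esub> v \<in> carrier L" by (simp add: X Y L_mult L_carrier Z_mult)
    show "u \<otimes>\<^bsub>L\<^esub> v = v \<otimes>\<^bsub>L\<^esub> u" using Z_comm[OF X(1) Y(1)] by (simp add: X Y L_mult \<Phi>_eq commute_def)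
    assume "w \<in> carrier L"
    then obtain W where W: "Z W" "w = \<Phi> W" using L_E by metis
    show "u \<otimes>\<^bsub>L\<^esub> v \<otimes>\<^bsub>L\<^esub> w = u \<otimes>\<^bsub>L\<^esub> (v \<otimes>\<^bsub>L\<^esub> w)"
      by (simp add: X Y W L_mult Z_mult \<Phi>_eq to_mat_eq_iff mat_mult_assoc)
    show "(u \<oplus>\<^bsub>L\<^esub> v) \<otimes>\<^bsub>L\<^esub> w = u \<otimes>\<^bsub>L\<^esub> w \<oplus>\<^bsub>L\<^esub> v \<otimes>\<^bsub>L\<^esub> w"
      by (simp add: X Y W L_mult L_add Z_mult Z_add mat_mult_add_left)
  next
    show "\<one>\<^bsub>L\<^esub> \<in> carrier L" by (simp add: L_one L_carrier Z_scalar)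
  next
    fix u assume u: "u \<in> carrier L"
    obtain X where X: "Z X" "u = \<Phi> X" using L_E u by metis
    show "\<one>\<^bsub>L\<^esub> \<otimes>\<^bsub>L\<^esub> u = u" by (simp add: X L_one L_mult Z_scalar \<Phi>_eq to_mat_eq_iff mat_mult_scalar_left)
  qed
  have field: "field L"
  proof (rule cring.cring_fieldI2[OF cring])
    have "to_mat n (scalar_mat 0) \<noteq> to_mat n (scalar_mat 1)"
      unfolding to_mat_eq_iff scalar_mat_def using n one_neq_zero by auto
    then show "\<zero>\<^bsub>L\<^esub> \<noteq> \<one>\<^bsub>L\<^esub>" by (simp add: L_zero L_one \<Phi>_eq)
    fix u assume u: "u \<in> carrier L" "u \<noteq> \<zero>\<^bsub>L\<^esub>"
    obtain X where X: "Z X" "u = \<Phi> X" using L_E u by metis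
    then obtain X' where X': "Z X'" "inverse_mats n X X'" using Z_inv u(2) by (auto simp: L_zero \<Phi>_eq)
    then have "\<Phi> (mat_mult n X X') = \<Phi> (scalar_mat 1)"
      unfolding \<Phi>_eq to_mat_eq_iff scalar_mat_def inverse_mats_def by blast
    then show "\<exists>b\<in>carrier L. u \<otimes>\<^bsub>L\<^esub> b = \<one>\<^bsub>L\<^esub>"
      by (intro bexI[of _ "\<Phi> X'"]) (simp_all add: X X' L_mult L_one L_carrier)
  qed
  interpret L: field L by (rule field)
  define h where "h c = \<Phi> (scalar_mat (lift c))" for c
  have h_phi: "h (\<phi> c) = \<Phi> (scalar_mat c)" for c
    unfolding h_def \<Phi>_eq to_mat_eq_iff scalar_mat_def using phi_lift by simp
  have h: "h \<in> ring_hom K L"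
  proof (rule ring_hom_memI)
    fix x y assume "x \<in> carrier K" "y \<in> carrier K"
    then obtain c d where cd: "x = \<phi> c" "y = \<phi> d" using fld.range_phi by blast
    show "h x \<in> carrier L" by (simp add: cd h_phi L_carrier Z_scalar)
    have "\<Phi> (mat_mult n (scalar_mat c) (scalar_mat d)) = \<Phi> (scalar_mat (c * d))"
      unfolding \<Phi>_eq to_mat_eq_iff by (simp add: mat_mult_scalar_left) (simp add: scalar_mat_def)
    then show "h (x \<otimes>\<^bsub>K\<^esub> y) = h x \<otimes>\<^bsub>L\<^esub> h y"
      by (simp add: cd h_phi fld.phi_mult[symmetric] L_mult Z_scalar)
    have "mat_add (scalar_mat c) (scalar_mat d) = scalar_mat (c + d)"
      by (intro ext) (simp add: mat_add_def scalar_mat_def)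
    then show "h (x \<oplus>\<^bsub>K\<^esub> y) = h x \<oplus>\<^bsub>L\<^esub> h y"
      by (simp add: cd h_phi fld.phi_add[symmetric] L_add Z_scalar)
  next
    show "h \<one>\<^bsub>K\<^esub> = \<one>\<^bsub>L\<^esub>" using h_phi[of 1] by (simp add: L_one)
  qed
  \<comment> \<open>The i-th coordinate of the sum of the w_j e_j: applying the matrix w_j to e_j
    gives its column j.\<close>
  define ev where "ev w i = (\<Sum>j<n. \<psi> (w j) i j)" for w :: "nat \<Rightarrow> nat" and i
  have ev_cong: "\<phi> (ev w i) = \<phi> (\<Sum>j<n. X j i j)" if "\<And>j. j < n \<Longrightarrow> Z (X j) \<and> w j = \<Phi> (X j)" "i < n" for w X i
    unfolding ev_def
  proof (intro fld.sum_congr)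
    fix j assume "j \<in> {..<n}"
    then have "to_mat n (\<psi> (w j)) = to_mat n (X j)" using \<psi>(2)[of "X j"] that(1)[of j] by simp
    then show "\<phi> (\<psi> (w j) i j) = \<phi> (X j i j)" using \<open>j \<in> _\<close> that(2) by (simp add: to_mat_eq_iff)
  qed
  define W where "W = {w \<in> carrier (coord_space L n). \<forall>i<n. \<phi> (ev w i) = \<phi> 0}"
  have L_vec: "\<exists>X. \<forall>j<n. Z (X j) \<and> w j = \<Phi> (X j)" if "w \<in> carrier (coord_space L n)" for w
  proof -
    have "\<forall>j. \<exists>X. j < n \<longrightarrow> Z X \<and> w j = \<Phi> X" using that L_E by (auto simp: coord_space_def)
    then show ?thesis by metis
  qed
  have L_vecI: "(\<lambda>j\<in>{..<n}. \<Phi> (X j)) \<in> carrier (coord_space L n)" if "\<And>j. j < n \<Longrightarrow> Z (X j)" for X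
    using that L_carrier by (auto simp: coord_space_def)
  have W_I: "w \<in> W" if "w \<in> carrier (coord_space L n)" "\<And>j. j < n \<Longrightarrow> Z (X j) \<and> w j = \<Phi> (X j)" "\<And>i. i < n \<Longrightarrow> \<phi> (\<Sum>j<n. X j i j) = \<phi> 0" for w X
    using that ev_cong[OF that(2)] by (simp add: W_def)
  have W_E: "\<exists>X. (\<forall>j<n. Z (X j) \<and> w j = \<Phi> (X j)) \<and> (\<forall>i<n. \<phi> (\<Sum>j<n. X j i j) = \<phi> 0)" if w: "w \<in> W" for w
  proof -
    obtain X where X: "\<forall>j<n. Z (X j) \<and> w j = \<Phi> (X j)" using L_vec[of w] w unfolding W_def by blast
    then have "\<phi> (\<Sum>j<n. X j i j) = \<phi> 0" if "i < n" for i
      using ev_cong[of X w i] that w X by (simp add: W_def)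
    then show ?thesis using X by blast
  qed
  have W_carrier: "w \<in> carrier (coord_space L n)" if "w \<in> W" for w using that by (simp add: W_def)
  \<comment> \<open>If the vectors Y_j e_j add up to zero, so do their images under X. This gives
    closure of W under scalars from L, and under \<sigma>(g) once it is moved past the entries of
    L.\<close>
  have col: "\<phi> (\<Sum>j<n. mat_mult n X (Y j) i j) = \<phi> 0" if "\<And>l. l < n \<Longrightarrow> \<phi> (\<Sum>j<n. Y j l j) = \<phi> 0" for X Y i
  proof -
    have "(\<Sum>j<n. mat_mult n X (Y j) i j) = (\<Sum>l<n. X i l * (\<Sum>j<n. Y j l j))"
      unfolding mat_mult_def sum_distrib_left by (rule sum.swap)
    moreover have "\<phi> (\<Sum>l<n. X i l * (\<Sum>j<n. Y j l j)) = \<phi> 0"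
      by (rule fld.sum_zero, rule fld.mult_zero, rule that) simp
    ultimately show ?thesis by (simp only:)
  qed
  have Lfinsum: "finsum L (\<lambda>j. \<Phi> (X j)) {..<m} = \<Phi> (\<lambda>i k. \<Sum>j<m. X j i k) \<and> Z (\<lambda>i k. \<Sum>j<m. X j i k)"
    if "\<And>j. j < m \<Longrightarrow> Z (X j)" for X and m :: nat
    using that
  proof (induction m)
    case 0
    have "(\<lambda>i k. 0) = scalar_mat 0" by (intro ext) (simp add: scalar_mat_def)
    then show ?case using Z_scalar[of 0] by (simp add: L_zero)
  next
    case (Suc m)
    have e: "(\<lambda>i k. \<Sum>j<Suc m. X j i k) = mat_add (X m) (\<lambda>i k. \<Sum>j<m. X j i k)"
      by (intro ext) (simp add: mat_add_def)
    have "finsum L (\<lambda>j. \<Phi> (X j)) (insert m {..<m}) = \<Phi> (X m) \<oplus>\<^bsub>L\<^esub> finsum L (\<lambda>j. \<Phi> (X j)) {..<m}"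
      using Suc.prems L_carrier by (intro L.finsum_insert) auto
    then show ?case using Suc e Z_add L_add by (simp add: lessThan_Suc)
  qed
  have "submodule W L (coord_space L n)"
  proof (intro submodule.intro submodule_axioms.intro)
    show "subgroup W (add_monoid (coord_space L n))"
    proof (rule group.subgroupI[OF L.group_coord_space])
      show "W \<subseteq> carrier (add_monoid (coord_space L n))" by (auto simp: W_def)
      have "(\<lambda>j\<in>{..<n}. \<Phi> (scalar_mat 0)) \<in> W"
        by (rule W_I[of _ "\<lambda>_. scalar_mat 0"]) (auto simp: Z_scalar L_vecI, simp add: scalar_mat_def)
      then show "W \<noteq> {}" by blast
      fix a assume a: "a \<in> W"
      obtain X where X: "\<And>j. j < n \<Longrightarrow> Z (X j) \<and> a j = \<Phi> (X j)" "\<And>i. i < n \<Longrightarrow> \<phi> (\<Sum>j<n. X j i j) = \<phi> 0"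
        using W_E[OF a] by blast
      let ?N = "\<lambda>j. mat_mult n (scalar_mat (- 1)) (X j)"
      have ZN: "Z (?N j)" if "j < n" for j using X(1)[OF that] by (intro Z_mult Z_scalar) auto
      have "(\<lambda>j\<in>{..<n}. \<Phi> (?N j)) \<in> W"
        by (rule W_I[of _ ?N]) (use ZN L_vecI col[of X, OF X(2)] in auto)
      moreover have "inv\<^bsub>add_monoid (coord_space L n)\<^esub> a = (\<lambda>j\<in>{..<n}. \<Phi> (?N j))"
      proof (rule group.inv_equality[OF L.group_coord_space])
        have "\<Phi> (?N j) \<oplus>\<^bsub>L\<^esub> a j = \<zero>\<^bsub>L\<^esub>" if j: "j < n" for j
        proof -
          have "\<Phi> (mat_add (?N j) (X j)) = \<Phi> (scalar_mat 0)"
            unfolding \<Phi>_eq to_mat_eq_iff by (simp add: mat_add_def mat_mult_scalar_left) (simp add: scalar_mat_def)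
          then show ?thesis using X(1)[OF j] ZN[OF j] by (simp add: L_add L_zero)
        qed
        then show "(\<lambda>j\<in>{..<n}. \<Phi> (?N j)) \<otimes>\<^bsub>add_monoid (coord_space L n)\<^esub> a = \<one>\<^bsub>add_monoid (coord_space L n)\<^esub>"
          by (auto simp: coord_space_def intro!: restrict_ext)
        show "a \<in> carrier (add_monoid (coord_space L n))" using W_carrier[OF a] by simp
        show "(\<lambda>j\<in>{..<n}. \<Phi> (?N j)) \<in> carrier (add_monoid (coord_space L n))" using L_vecI[of ?N] ZN by simp
      qed
      ultimately show "inv\<^bsub>add_monoid (coord_space L n)\<^esub> a \<in> W" by simp
      fix b assume b: "b \<in> W"
      obtain Y where Y: "\<And>j. j < n \<Longrightarrow> Z (Y j) \<and> b j = \<Phi> (Y j)" "\<And>i. i < n \<Longrightarrow> \<phi> (\<Sum>j<n. Y j i j) = \<phi> 0"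
        using W_E[OF b] by blast
      have eq: "a \<oplus>\<^bsub>coord_space L n\<^esub> b = (\<lambda>j\<in>{..<n}. \<Phi> (mat_add (X j) (Y j)))"
        using X(1) Y(1) by (auto simp: coord_space_def L_add intro!: restrict_ext)
      have "(\<lambda>j\<in>{..<n}. \<Phi> (mat_add (X j) (Y j))) \<in> W"
      proof (rule W_I[of _ "\<lambda>j. mat_add (X j) (Y j)"])
        show "(\<lambda>j\<in>{..<n}. \<Phi> (mat_add (X j) (Y j))) \<in> carrier (coord_space L n)"
          using X(1) Y(1) by (intro L_vecI Z_add) auto
        show "Z (mat_add (X j) (Y j)) \<and> (\<lambda>j\<in>{..<n}. \<Phi> (mat_add (X j) (Y j))) j = \<Phi> (mat_add (X j) (Y j))" if "j < n" for j
          using that X(1) Y(1) by (simp add: Z_add)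
        show "\<phi> (\<Sum>j<n. mat_add (X j) (Y j) i j) = \<phi> 0" if "i < n" for i
          using fld.add_cong[OF X(2)[OF that] Y(2)[OF that]] by (simp add: mat_add_def sum.distrib)
      qed
      then show "a \<otimes>\<^bsub>add_monoid (coord_space L n)\<^esub> b \<in> W" by (simp add: eq)
    qed
    fix a w assume a: "a \<in> carrier L" and w: "w \<in> W"
    obtain Y where Y: "Z Y" "a = \<Phi> Y" using L_E a by metis
    obtain X where X: "\<And>j. j < n \<Longrightarrow> Z (X j) \<and> w j = \<Phi> (X j)" "\<And>i. i < n \<Longrightarrow> \<phi> (\<Sum>j<n. X j i j) = \<phi> 0"
      using W_E[OF w] by blast
    have eq: "a \<odot>\<^bsub>coord_space L n\<^esub> w = (\<lambda>j\<in>{..<n}. \<Phi> (mat_mult n Y (X j)))"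
      using X(1) Y by (auto simp: coord_space_def L_mult intro!: restrict_ext)
    have ZY: "Z (mat_mult n Y (X j))" if "j < n" for j using X(1)[OF that] Y by (intro Z_mult) auto
    have "(\<lambda>j\<in>{..<n}. \<Phi> (mat_mult n Y (X j))) \<in> W"
      by (rule W_I[of _ "\<lambda>j. mat_mult n Y (X j)"]) (use ZY L_vecI col[of X, OF X(2)] in auto)
    then show "a \<odot>\<^bsub>coord_space L n\<^esub> w \<in> W" by (simp add: eq)
  qed
  moreover have "mat_vec L n (base_change A n h (to_rep n \<sigma>) g) w \<in> W" if g: "g \<in> carrier A" and w: "w \<in> W" for g w
  proof -
    obtain X where X: "\<And>j. j < n \<Longrightarrow> Z (X j) \<and> w j = \<Phi> (X j)" "\<And>i. i < n \<Longrightarrow> \<phi> (\<Sum>j<n. X j i j) = \<phi> 0"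
      using W_E[OF w] by blast
    define Y where "Y i j = mat_mult n (scalar_mat (\<sigma> g i j)) (X j)" for i j
    have ZY: "Z (Y i j)" if "j < n" for i j using X(1)[OF that] unfolding Y_def by (intro Z_mult Z_scalar) auto
    define V where "V i = (\<lambda>u v. \<Sum>j<n. Y i j u v)" for i
    have V: "finsum L (\<lambda>j. \<Phi> (Y i j)) {..<n} = \<Phi> (V i)" "Z (V i)" for i
      using Lfinsum[of n "Y i"] ZY unfolding V_def by blast+
    have bc: "base_change A n h (to_rep n \<sigma>) g (i, j) \<otimes>\<^bsub>L\<^esub> w j = \<Phi> (Y i j)" if "i < n" "j < n" for i j
      using that g X(1)[of j] by (simp add: base_change_def to_rep_def to_mat_def h_phi L_mult Z_scalar Y_def)
    have eq: "mat_vec L n (base_change A n h (to_rep n \<sigma>) g) w = (\<lambda>i\<in>{..<n}. \<Phi> (V i))"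
      unfolding mat_vec_def
    proof (rule restrict_ext)
      fix i assume i: "i \<in> {..<n}"
      have "finsum L (\<lambda>j. base_change A n h (to_rep n \<sigma>) g (i, j) \<otimes>\<^bsub>L\<^esub> w j) {..<n} = finsum L (\<lambda>j. \<Phi> (Y i j)) {..<n}"
        using i bc ZY L_carrier by (intro L.finsum_cong') auto
      then show "finsum L (\<lambda>j. base_change A n h (to_rep n \<sigma>) g (i, j) \<otimes>\<^bsub>L\<^esub> w j) {..<n} = \<Phi> (V i)" by (simp add: V)
    qed
    have "(\<lambda>i\<in>{..<n}. \<Phi> (V i)) \<in> W"
    proof (rule W_I[of _ V])
      show "(\<lambda>i\<in>{..<n}. \<Phi> (V i)) \<in> carrier (coord_space L n)" by (rule L_vecI) (rule V)
      show "Z (V j) \<and> (\<lambda>i\<in>{..<n}. \<Phi> (V i)) j = \<Phi> (V j)" if "j < n" for j using that V by simp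
      fix u assume u: "u < n"
      \<comment> \<open>Equivariance of the evaluation: the transformed vector evaluates to the sum
        of the X_j \<sigma>(g) e_j, and X_j commutes with \<sigma>(g).\<close>
      have "(\<Sum>i<n. V i u i) = (\<Sum>i<n. \<Sum>j<n. X j u i * \<sigma> g i j)"
        unfolding V_def Y_def using u by (simp add: mat_mult_scalar_left mult.commute)
      also have "\<dots> = (\<Sum>j<n. mat_mult n (X j) (\<sigma> g) u j)"
        unfolding mat_mult_def by (rule sum.swap)
      finally have "\<phi> (\<Sum>i<n. V i u i) = \<phi> (\<Sum>j<n. mat_mult n (X j) (\<sigma> g) u j)" by (rule arg_cong)
      also have "\<dots> = \<phi> (\<Sum>j<n. mat_mult n (\<sigma> g) (X j) u j)"
      proof (intro fld.sum_congr)
        fix j assume j: "j \<in> {..<n}"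
        then have "commute n (X j) (\<sigma> g)" using X(1) g by (auto simp: Z_def D_def)
        then show "\<phi> (mat_mult n (X j) (\<sigma> g) u j) = \<phi> (mat_mult n (\<sigma> g) (X j) u j)"
          using u j by (simp add: commute_def to_mat_eq_iff)
      qed
      also have "\<dots> = \<phi> 0" by (rule col[of X, OF X(2)])
      finally show "\<phi> (\<Sum>i<n. V i u i) = \<phi> 0" .
    qed
    then show ?thesis by (simp add: eq)
  qed
  ultimately have alt: "W = {\<zero>\<^bsub>coord_space L n\<^esub>} \<or> W = carrier (coord_space L n)"
    using abs_irr[OF field h] unfolding irreducible_rep_def by blast
  \<comment> \<open>Its evaluation vanishes because T e_0 is the sum of the T_j0 e_j.\<close>
  define X where "X j = mat_add (if j = 0 then T else scalar_mat 0) (scalar_mat (- T j 0))" for j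
  have ZX: "Z (X j)" for j unfolding X_def using ZT Z_scalar by (auto intro: Z_add)
  have XW: "(\<lambda>j\<in>{..<n}. \<Phi> (X j)) \<in> W"
  proof (rule W_I[of _ X])
    show "(\<lambda>j\<in>{..<n}. \<Phi> (X j)) \<in> carrier (coord_space L n)" by (rule L_vecI) (rule ZX)
    show "Z (X j) \<and> (\<lambda>i\<in>{..<n}. \<Phi> (X i)) j = \<Phi> (X j)" if "j < n" for j using that ZX by simp
    fix i assume i: "i < n"
    have "(\<Sum>j<n. X j i j) = (\<Sum>j<n. (if j = 0 then T i 0 else 0) - (if j = i then T i 0 else 0))"
      by (intro sum.cong refl) (auto simp: X_def mat_add_def scalar_mat_def)
    also have "\<dots> = 0" using i n by (simp add: sum_subtractf)
    finally show "\<phi> (\<Sum>j<n. X j i j) = \<phi> 0" by simp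
  qed
  from alt show False
  proof
    assume "W = {\<zero>\<^bsub>coord_space L n\<^esub>}"
    then have "(\<lambda>j\<in>{..<n}. \<Phi> (X j)) = (\<lambda>j\<in>{..<n}. \<zero>\<^bsub>L\<^esub>)" using XW by (simp add: coord_space_def)
    then have "\<Phi> (X 0) = \<Phi> (scalar_mat 0)" using n L_zero by (metis lessThan_iff restrict_apply')
    then have X0: "\<phi> (X 0 i j) = \<phi> 0" if "i < n" "j < n" for i j
      using that by (auto simp: \<Phi>_eq to_mat_eq_iff scalar_mat_def)
    have "\<phi> (T i j) = \<phi> (if i = j then T 0 0 else 0)" if "i < n" "j < n" for i j
    proof -
      have "X 0 i j = T i j - (if i = j then T 0 0 else 0)"
        by (simp add: X_def mat_add_def scalar_mat_def)
      then show ?thesis using X0[OF that] fld.eq_iff_diff by metis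
    qed
    then show False using T_ns by blast
  next
    assume *: "W = carrier (coord_space L n)"
    \<comment> \<open>The vector (1, 0, ..., 0) over L evaluates to e_0, which is nonzero, so W is
      proper.\<close>
    let ?I = "\<lambda>j. if j = 0 then scalar_mat 1 else scalar_mat 0"
    have ZI: "Z (?I j)" for j using Z_scalar by simp
    have "(\<lambda>j\<in>{..<n}. \<Phi> (?I j)) \<in> W" unfolding * by (rule L_vecI) (rule ZI)
    then have "\<phi> (ev (\<lambda>j\<in>{..<n}. \<Phi> (?I j)) 0) = \<phi> 0" using n by (simp add: W_def)
    moreover have "\<phi> (ev (\<lambda>j\<in>{..<n}. \<Phi> (?I j)) 0) = \<phi> (\<Sum>j<n. ?I j 0 j)"
      by (rule ev_cong[of ?I]) (simp_all only: ZI n restrict_apply' lessThan_iff)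
    ultimately have "\<phi> (\<Sum>j<n. ?I j 0 j) = \<phi> 0" by simp
    moreover have "(\<Sum>j<n. ?I j 0 j) = (\<Sum>j<n. if j = 0 then 1 else 0)"
      by (intro sum.cong refl) (simp add: scalar_mat_def)
    ultimately show False using one_neq_zero n by simp
  qed
qed

end

section \<open>Representations over splitting fields\<close>

text \<open>By linearity the sums of d_i^2 Q((a/d_i)^2) agree for every polynomial Q. A product Q of
  linear factors that vanishes at the nodes of all occurring degrees except v isolates the number of
  degrees equal to v.\<close>

lemma power_sums_determine_counts:
  fixes d :: "'i \<Rightarrow> nat" and d' :: "'j \<Rightarrow> nat" and a :: real
  assumes fin: "finite S" "finite S'" and a: "a > 0"
    and pos: "\<And>i. i \<in> S \<Longrightarrow> d i > 0" "\<And>i. i \<in> S' \<Longrightarrow> d' i > 0"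
    and sums: "\<And>m. (\<Sum>i\<in>S. (real (d i))\<^sup>2 * ((a / real (d i))\<^sup>2) ^ m) = (\<Sum>i\<in>S'. (real (d' i))\<^sup>2 * ((a / real (d' i))\<^sup>2) ^ m)"
  shows "card {i \<in> S. d i = v} = card {i \<in> S'. d' i = v}"
proof (cases "v = 0")
  case True
  then have "{i \<in> S. d i = v} = {}" "{i \<in> S'. d' i = v} = {}" using pos by fastforce+
  then show ?thesis by (simp only: card.empty)
next
  case False
  let ?x = "\<lambda>w :: nat. (a / real w)\<^sup>2"
  have poly: "(\<Sum>i\<in>S. (real (d i))\<^sup>2 * poly Q (?x (d i))) = (\<Sum>i\<in>S'. (real (d' i))\<^sup>2 * poly Q (?x (d' i)))" for Q
  proof -
    have e: "(\<Sum>i\<in>T. (real (f i))\<^sup>2 * poly Q (?x (f i))) = (\<Sum>k\<le>degree Q. poly.coeff Q k * (\<Sum>i\<in>T. (real (f i))\<^sup>2 * ?x (f i) ^ k))"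
      for T :: "'z set" and f :: "'z \<Rightarrow> nat"
      unfolding poly_altdef sum_distrib_left by (subst sum.swap) (simp add: mult_ac)
    show ?thesis unfolding e sums ..
  qed
  define V where "V = (d ` S \<union> d' ` S') - {v}"
  have finV: "finite V" and V0: "0 \<notin> V" using fin pos by (fastforce simp: V_def)+
  define Q where "Q = (\<Prod>w\<in>V. [:- ?x w, 1:])"
  have Q: "poly Q y = (\<Prod>w\<in>V. y - ?x w)" for y by (simp add: Q_def poly_prod)
  have Q0: "poly Q (?x u) = 0" if "u \<in> V" for u
    unfolding Q using finV that by (intro prod_zero) auto
  have inj: "?x w \<noteq> ?x v" if "w \<in> V" for w
  proof
    assume "?x w = ?x v"
    then have "a / real w = a / real v" using a by (simp add: power2_eq_iff_nonneg)
    moreover have "w \<noteq> 0" "w \<noteq> v" using that V0 by (auto simp: V_def)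
    ultimately show False using a False by (simp add: field_simps)
  qed
  have Qv: "poly Q (?x v) \<noteq> 0" unfolding Q prod_zero_iff[OF finV] using inj by fastforce
  have collapse: "(\<Sum>i\<in>T. (real (f i))\<^sup>2 * poly Q (?x (f i))) = real (card {i \<in> T. f i = v}) * ((real v)\<^sup>2 * poly Q (?x v))"
    if "finite T" "f ` T \<subseteq> insert v V" for T :: "'z set" and f :: "'z \<Rightarrow> nat"
  proof -
    have "(\<Sum>i\<in>T. (real (f i))\<^sup>2 * poly Q (?x (f i))) = (\<Sum>i\<in>T. if f i = v then (real v)\<^sup>2 * poly Q (?x v) else 0)"
      using that(2) Q0 by (intro sum.cong refl) auto
    also have "\<dots> = (\<Sum>i\<in>{i \<in> T. f i = v}. (real v)\<^sup>2 * poly Q (?x v))"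
      using that(1) by (simp add: sum.If_cases Int_def)
    finally show ?thesis by simp
  qed
  have "real (card {i \<in> S. d i = v}) * ((real v)\<^sup>2 * poly Q (?x v)) = real (card {i \<in> S'. d' i = v}) * ((real v)\<^sup>2 * poly Q (?x v))"
  proof -
    have "d ` S \<subseteq> insert v V" "d' ` S' \<subseteq> insert v V" by (auto simp: V_def)
    then show ?thesis using poly[of Q] collapse[OF fin(1), of d] collapse[OF fin(2), of d'] by simp
  qed
  then show ?thesis using Qv False by simp
qed

lemma bij_betw_of_equal_fibres:
  assumes fin: "finite S" "finite S'" and card: "\<And>v. card {i \<in> S. d i = v} = card {i \<in> S'. d' i = v}"
  shows "\<exists>\<beta>. bij_betw \<beta> S S' \<and> (\<forall>i\<in>S. d' (\<beta> i) = d i)"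
proof -
  have "\<exists>f. bij_betw f {i \<in> S. d i = v} {i \<in> S'. d' i = v}" for v
    using fin card by (intro finite_same_card_bij) auto
  then obtain f where f: "\<And>v. bij_betw (f v) {i \<in> S. d i = v} {i \<in> S'. d' i = v}" by metis
  define \<beta> where "\<beta> i = f (d i) i" for i
  have mem: "\<beta> i \<in> S' \<and> d' (\<beta> i) = d i" if "i \<in> S" for i
    using bij_betwE[OF f[of "d i"]] that by (auto simp: \<beta>_def)
  have "inj_on \<beta> S"
  proof (rule inj_onI)
    fix i j assume ij: "i \<in> S" "j \<in> S" "\<beta> i = \<beta> j"
    then have "d i = d j" using mem by metis
    then show "i = j" using bij_betw_imp_inj_on[OF f[of "d j"]] ij by (auto simp: \<beta>_def inj_on_def)
  qed
  moreover have "\<beta> ` S = S'"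
  proof (intro equalityI subsetI)
    fix j assume "j \<in> S'"
    then have "j \<in> f (d' j) ` {i \<in> S. d i = d' j}" using bij_betw_imp_surj_on[OF f[of "d' j"]] by auto
    then obtain i where i: "j = f (d' j) i" "i \<in> S" "d i = d' j" by blast
    then have "j = \<beta> i" by (simp add: \<beta>_def)
    then show "j \<in> \<beta> ` S" using i(2) by (rule image_eqI)
  qed (use mem in auto)
  ultimately show ?thesis using mem by (auto simp: bij_betw_def)
qed

section \<open>Systems of irreducible representations over a splitting field\<close>

locale splitting_reps = nat_field_reps +
  assumes splitting: "irreducible_rep A K n \<rho> \<Longrightarrow> absolutely_irreducible_rep A K n \<rho>"
begin

lemma irreducible_rep_Homs: "irreducible_rep A K n \<rho> \<Longrightarrow> \<rho> \<in> Homs A (GL K n)"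
  by (simp add: irreducible_rep_def)

lemma to_of_rep: "\<rho> \<in> Homs A (GL K n) \<Longrightarrow> to_rep n (of_rep \<rho>) = \<rho>"
  by (rule extensionalityI[of _ "carrier A"]) (auto simp: to_rep_def Homs_mat Homs_def)

lemma scalar_commutant_of_rep:
  assumes "irreducible_rep A K n \<rho>"
  shows "scalar_commutant n (of_rep \<rho>)"
  using scalar_commutant_if_absolutely_irreducible[OF irreducible_of_rep[OF assms]] splitting[OF assms]
  by (simp add: to_of_rep[OF irreducible_rep_Homs[OF assms]] absolutely_irreducible_rep_def)

lemma equivalent_reps_sym:
  assumes "\<rho> \<in> Homs A (GL K n)" "\<sigma> \<in> Homs A (GL K m)" "equivalent_reps A K n \<rho> m \<sigma>"
  shows "equivalent_reps A K m \<sigma> n \<rho>"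
  using assms equivalent_reps_iff equivalent_sym by blast

text \<open>The index type is left open: a system may be indexed by {1..s} or by its own members, as
  pairs of degree and representation.\<close>

definition is_system :: "'i set \<Rightarrow> ('i \<Rightarrow> nat) \<Rightarrow> ('i \<Rightarrow> 'a \<Rightarrow> nat \<times> nat \<Rightarrow> nat) \<Rightarrow> bool" where
  "is_system S d M \<longleftrightarrow> finite S \<and> (\<forall>i\<in>S. irreducible_rep A K (d i) (M i)) \<and>
    (\<forall>i\<in>S. \<forall>j\<in>S. equivalent_reps A K (d i) (M i) (d j) (M j) \<longrightarrow> i = j) \<and>
    (\<forall>n \<rho>. irreducible_rep A K n \<rho> \<longrightarrow> (\<exists>i\<in>S. equivalent_reps A K n \<rho> (d i) (M i)))"

text \<open>There are finitely many irreducible representations, as K is finite and degrees are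
  bounded; a maximal set of pairwise inequivalent ones is a system.\<close>

lemma is_system_exists: "\<exists>S. is_system S fst snd"
proof -
  define X where "X = {x. irreducible_rep A K (fst x) (snd x)}"
  have "X \<subseteq> (SIGMA n:{..card (carrier A)}. Homs A (GL K n))"
  proof
    fix x assume "x \<in> X"
    then have "irreducible_rep A K (fst x) (snd x)" by (simp add: X_def)
    then show "x \<in> (SIGMA n:{..card (carrier A)}. Homs A (GL K n))"
      using irreducible_degree_le[OF irreducible_of_rep] irreducible_rep_Homs by (cases x) auto
  qed
  moreover have "finite (Homs A (GL K n))" for n
  proof (rule finite_subset)
    show "Homs A (GL K n) \<subseteq> carrier A \<rightarrow>\<^sub>E carrier (mat_monoid K n)"
      using Homs_mat(1) by (auto simp: Homs_def PiE_def)
    show "finite (carrier A \<rightarrow>\<^sub>E carrier (mat_monoid K n))"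
      unfolding carrier_mat_monoid using finite_carrier fld.finite_K by (intro finite_PiE) auto
  qed
  ultimately have finX: "finite X" by (elim finite_subset) auto
  define E where "E x y \<longleftrightarrow> equivalent_reps A K (fst x) (snd x) (fst y) (snd y)" for x y :: "nat \<times> ('a \<Rightarrow> nat \<times> nat \<Rightarrow> nat)"
  have E_sym: "E y x" if "E x y" "x \<in> X" "y \<in> X" for x y
    using that equivalent_reps_sym irreducible_rep_Homs unfolding E_def X_def by blast
  define \<P> where "\<P> = {S \<in> Pow X. \<forall>x\<in>S. \<forall>y\<in>S. E x y \<longrightarrow> x = y}"
  have "finite \<P>" "\<P> \<noteq> {}" using finX by (auto simp: \<P>_def)
  then obtain S where S: "S \<in> \<P>" "\<And>S'. S' \<in> \<P> \<Longrightarrow> S \<subseteq> S' \<Longrightarrow> S = S'"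
    using finite_has_maximal[of \<P>] by metis
  have ex: "\<exists>y\<in>S. E x y" if x: "x \<in> X" for x
  proof (rule ccontr)
    assume n: "\<not> (\<exists>y\<in>S. E x y)"
    \<comment> \<open>Maximality puts x itself into S; reflexivity, witnessed by the identity
      matrix, then contradicts n.\<close>
    then have "insert x S \<in> \<P>" using S(1) x E_sym unfolding \<P>_def by blast
    then have xS: "x \<in> S" using S(2)[of "insert x S"] by blast
    have "snd x \<in> Homs A (GL K (fst x))" using x irreducible_rep_Homs by (simp add: X_def)
    moreover have "equivalent (fst x) (of_rep (snd x)) (fst x) (of_rep (snd x))"
      unfolding equivalent_def
      by (intro conjI exI[of _ "scalar_mat 1"])
        (simp_all add: intertwiner_iff_commute commute_scalar inverse_mats_def mat_mult_scalar_left, simp add: scalar_mat_def)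
    ultimately have "E x x" unfolding E_def using equivalent_reps_iff by blast
    then show False using n xS by blast
  qed
  have SX: "S \<subseteq> X" and ineq: "\<And>x y. x \<in> S \<Longrightarrow> y \<in> S \<Longrightarrow> E x y \<Longrightarrow> x = y"
    using S(1) unfolding \<P>_def by blast+
  have "is_system S fst snd"
    unfolding is_system_def
  proof (intro conjI ballI allI impI)
    show "finite S" using finX SX by (rule finite_subset[rotated])
    show "irreducible_rep A K (fst x) (snd x)" if "x \<in> S" for x using SX that by (auto simp: X_def)
    show "x = y" if "x \<in> S" "y \<in> S" "equivalent_reps A K (fst x) (snd x) (fst y) (snd y)" for x y
      using ineq that by (simp add: E_def)
    show "\<exists>y\<in>S. equivalent_reps A K n \<rho> (fst y) (snd y)" if "irreducible_rep A K n \<rho>" for n \<rho>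
      using ex[of "(n, \<rho>)"] that by (simp add: X_def E_def)
  qed
  then show ?thesis ..
qed

lemma complete_system_of_is_system:
  assumes sys: "is_system S d M"
  shows "\<exists>\<alpha>. complete_system \<phi> A S d (\<lambda>i. of_rep (M i)) \<alpha>"
proof -
  have fin: "finite S" and irr: "\<And>i. i \<in> S \<Longrightarrow> irreducible_rep A K (d i) (M i)"
    and ineq: "\<And>i j. i \<in> S \<Longrightarrow> j \<in> S \<Longrightarrow> equivalent_reps A K (d i) (M i) (d j) (M j) \<Longrightarrow> i = j"
    and all: "\<And>n \<rho>. irreducible_rep A K n \<rho> \<Longrightarrow> \<exists>i\<in>S. equivalent_reps A K n \<rho> (d i) (M i)"
    using sys unfolding is_system_def by blast+
  have H: "\<And>i. i \<in> S \<Longrightarrow> M i \<in> Homs A (GL K (d i))" using irr irreducible_rep_Homs by blast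
  have irr': "\<And>i. i \<in> S \<Longrightarrow> irreducible (d i) (of_rep (M i))" using irr irreducible_of_rep by blast
  have orth: "orthogonal S d (\<lambda>i. of_rep (M i))"
  proof (rule orthogonal_irreducibles)
    show "irreducible (d i) (of_rep (M i))" if "i \<in> S" for i by (rule irr'[OF that])
    show "scalar_commutant (d i) (of_rep (M i))" if "i \<in> S" for i
      by (rule scalar_commutant_of_rep[OF irr[OF that]])
    show "i = i'" if "i \<in> S" "i' \<in> S" "equivalent (d i) (of_rep (M i)) (d i') (of_rep (M i'))" for i i'
      using ineq[OF that(2,1)] equivalent_reps_iff[OF H[OF that(2)] H[OF that(1)]] that(3) by simp
  qed
  have "\<exists>i\<in>S. equivalent n \<sigma> (d i) (of_rep (M i))" if \<sigma>: "irreducible n \<sigma>" for n \<sigma>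
  proof -
    have H': "to_rep n \<sigma> \<in> Homs A (GL K n)" using irreducible_to_rep[OF \<sigma>] irreducible_rep_Homs by blast
    obtain i where i: "i \<in> S" "equivalent_reps A K n (to_rep n \<sigma>) (d i) (M i)"
      using all[OF irreducible_to_rep[OF \<sigma>]] by blast
    then have "equivalent (d i) (of_rep (M i)) n (of_rep (to_rep n \<sigma>))"
      using equivalent_reps_iff[OF H' H[OF i(1)]] by simp
    then have "equivalent n (of_rep (to_rep n \<sigma>)) (d i) (of_rep (M i))" by (rule equivalent_sym)
    then have "equivalent n \<sigma> (d i) (of_rep (M i))" by (rule equivalent_cong[rotated]) (rule of_to_rep)
    then show ?thesis using i(1) by blast
  qed
  then have compl: "complete S d (\<lambda>i. of_rep (M i))"
    using complete_irreducibles[OF fin orth _ phi_of_nat_group] irr' by (simp add: irreducible_def)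
  obtain \<alpha> where "\<phi> (of_nat (card (carrier A)) * \<alpha>) = \<phi> 1" using inverse_ex[OF phi_of_nat_group] by blast
  moreover have "0 < d i" "rep (d i) (of_rep (M i))" if "i \<in> S" for i
    using irr'[OF that] by (simp_all add: irreducible_def)
  ultimately have "complete_system \<phi> A S d (\<lambda>i. of_rep (M i)) \<alpha>"
    using fin orth compl by unfold_locales (simp_all add: mult.commute)
  then show ?thesis ..
qed

text \<open>The right-hand side depends on \<open>A\<close> alone, which makes the degrees over
  different splitting fields comparable.\<close>

lemma degree_power_sum:
  assumes sys: "is_system S d M"
  shows "(\<Sum>i\<in>S. (real (d i))\<^sup>2 * ((real (card (carrier A)) / real (d i))\<^sup>2) ^ m)
    = real (card (carrier A) * commutator_count m \<one>)"
proof -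
  let ?M = "\<lambda>i. of_rep (M i)" and ?a = "card (carrier A)"
  obtain \<alpha> where "complete_system \<phi> A S d ?M \<alpha>" using complete_system_of_is_system[OF sys] by blast
  then interpret cs: complete_system \<phi> A S d ?M \<alpha> .
  have irr: "\<And>i. i \<in> S \<Longrightarrow> irreducible_rep A K (d i) (M i)" using sys by (simp add: is_system_def)
  have pd: "\<not> p dvd d i" if "i \<in> S" for i
  proof
    assume "p dvd d i"
    then obtain c where "d i = p * c" by (auto simp: dvd_def)
    then have "(of_nat (d i) :: int poly) = [:int p:] * of_nat c" by (simp add: of_nat_poly)
    then have "\<phi> (of_nat (d i)) = \<phi> ([:int p:] * of_nat c)" by (rule arg_cong)
    also have "\<dots> = \<phi> 0" by (rule fld.mult_zeroL) (simp add: fld.phi_p)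
    finally show False
      using degree_nonzero[OF irreducible_of_rep scalar_commutant_of_rep phi_of_nat_group] irr[OF that] by blast
  qed
  \<comment> \<open>A common multiple of the degrees, to clear the denominators d_i; it is nonzero
    and is cancelled at the end.\<close>
  define D where "D = (\<Prod>i\<in>S. d i)"
  define e where "e i = (\<Prod>j\<in>S - {i}. d j)" for i
  have D: "d i * e i = D" if "i \<in> S" for i
    unfolding D_def e_def by (rule prod.remove[OF cs.finite_S that, symmetric])
  have "?a * commutator_count m \<one> * D ^ (2 * m) = (\<Sum>i\<in>S. (d i)\<^sup>2 * (?a * e i) ^ (2 * m))"
  proof (rule filt.degree_identity[where M = ?M, OF cs.finite_S])
    show "\<exists>\<alpha>. fld.residue k (\<alpha> * of_nat ?a) = fld.residue k 1" for k
      by (rule fld.residue_of_nat_inverse[OF p_ndvd])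
    show "\<exists>\<gamma>. fld.residue k (\<gamma> * of_nat (d i)) = fld.residue k 1" if "i \<in> S" for k i
      by (rule fld.residue_of_nat_inverse[OF pd[OF that]])
    show "x = y" if "\<And>k. k \<ge> 1 \<Longrightarrow> fld.residue k (of_nat x) = fld.residue k (of_nat y)" for x y
      using that by (rule fld.residue_of_nat_separated)
    show "filt.level.rep 1 (d i) (?M i)" if "i \<in> S" for i
      using cs.rep_M[OF that] by (simp only: rep_def filt.level.rep_def fld.phi_eq_iff)
    show "filt.level.orthogonal 1 S d ?M"
      using cs.orth by (simp only: orthogonal_def filt.level.orthogonal_def corr_def filt.level.corr_def fld.phi_eq_iff)
    show "filt.level.complete 1 S d ?M"
      using cs.compl by (simp only: complete_def filt.level.complete_def fld.phi_eq_iff)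
    show "d i * e i = D" if "i \<in> S" for i by (rule D[OF that])
  qed
  then have "real (?a * commutator_count m \<one>) * real D ^ (2 * m) = (\<Sum>i\<in>S. (real (d i))\<^sup>2 * (real ?a * real (e i)) ^ (2 * m))"
    by (simp only: of_nat_mult[symmetric] of_nat_power[symmetric] of_nat_sum[symmetric])
  also have "\<dots> = (\<Sum>i\<in>S. (real (d i))\<^sup>2 * ((real ?a / real (d i))\<^sup>2) ^ m) * real D ^ (2 * m)"
    unfolding sum_distrib_right
  proof (rule sum.cong[OF refl])
    fix i assume i: "i \<in> S"
    have "real (e i) = real D / real (d i)"
      using D[OF i] cs.degree_pos[OF i] by (simp add: field_simps flip: of_nat_mult)
    then show "(real (d i))\<^sup>2 * (real ?a * real (e i)) ^ (2 * m) = (real (d i))\<^sup>2 * ((real ?a / real (d i))\<^sup>2) ^ m * real D ^ (2 * m)"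
      by (simp add: power_mult_distrib power_divide power_mult[symmetric])
  qed
  finally have eq: "real (?a * commutator_count m \<one>) * real D ^ (2 * m)
    = (\<Sum>i\<in>S. (real (d i))\<^sup>2 * ((real ?a / real (d i))\<^sup>2) ^ m) * real D ^ (2 * m)" .
  have "D \<noteq> 0" unfolding D_def using cs.finite_S cs.degree_pos by (simp add: prod_zero_iff)
  then show ?thesis using eq by simp
qed

text \<open>The case m = 0 of the power sums: the empty product is the one way to write 1 with no
  commutators.\<close>

lemma sum_degree_squares:
  assumes "is_system S d M"
  shows "(\<Sum>i\<in>S. (d i)\<^sup>2) = card (carrier A)"
proof -
  have "real (\<Sum>i\<in>S. (d i)\<^sup>2) = real (card (carrier A))"
    using degree_power_sum[OF assms, of 0] by simp
  then show ?thesis by (simp only: of_nat_eq_iff)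
qed

text \<open>Any degree function with these power sums agrees, up to a bijection of index sets, with
  the degrees of some system over K; the representations are transported along the
  bijection.\<close>

lemma is_system_reindex:
  assumes S: "finite S" and pos: "\<And>i. i \<in> S \<Longrightarrow> d i > 0"
    and sums: "\<And>m. (\<Sum>i\<in>S. (real (d i))\<^sup>2 * ((real (card (carrier A)) / real (d i))\<^sup>2) ^ m)
      = real (card (carrier A) * commutator_count m \<one>)"
  shows "\<exists>M. is_system S d M"
proof -
  obtain S' where S': "is_system S' fst snd" using is_system_exists by blast
  have pos': "fst i > 0" if "i \<in> S'" for i
    using S' that by (auto simp: is_system_def irreducible_rep_def)
  have "card {i \<in> S. d i = v} = card {i \<in> S'. fst i = v}" for v
  proof (rule power_sums_determine_counts[where a = "real (card (carrier A))"])
    show "finite S'" using S' by (simp add: is_system_def)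
    show "(\<Sum>i\<in>S. (real (d i))\<^sup>2 * ((real (card (carrier A)) / real (d i))\<^sup>2) ^ m)
      = (\<Sum>i\<in>S'. (real (fst i))\<^sup>2 * ((real (card (carrier A)) / real (fst i))\<^sup>2) ^ m)" for m
      unfolding sums degree_power_sum[OF S'] ..
  qed (use S pos pos' card_carrier_pos in auto)
  then obtain \<beta> where \<beta>: "bij_betw \<beta> S S'" "\<And>i. i \<in> S \<Longrightarrow> fst (\<beta> i) = d i"
    using bij_betw_of_equal_fibres[of S S' d fst] S S' by (auto simp: is_system_def)
  have mem: "\<beta> i \<in> S'" if "i \<in> S" for i using \<beta>(1) that by (rule bij_betw_apply)
  have "is_system S d (\<lambda>i. snd (\<beta> i))"
    unfolding is_system_def
  proof (intro conjI ballI allI impI S)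
    show "irreducible_rep A K (d i) (snd (\<beta> i))" if "i \<in> S" for i
      using S' mem[OF that] \<beta>(2)[OF that] by (auto simp: is_system_def)
    show "i = j" if "i \<in> S" "j \<in> S" "equivalent_reps A K (d i) (snd (\<beta> i)) (d j) (snd (\<beta> j))" for i j
    proof -
      have "\<beta> i = \<beta> j" using S' mem[OF that(1)] mem[OF that(2)] that(3) \<beta>(2) that(1,2) by (auto simp: is_system_def)
      then show ?thesis using bij_betw_imp_inj_on[OF \<beta>(1)] that(1,2) by (simp add: inj_on_eq_iff)
    qed
    show "\<exists>i\<in>S. equivalent_reps A K n \<rho> (d i) (snd (\<beta> i))" if irr: "irreducible_rep A K n \<rho>" for n \<rho>
    proof -
      obtain x where x: "x \<in> S'" "equivalent_reps A K n \<rho> (fst x) (snd x)"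
        using S' irr unfolding is_system_def by blast
      obtain i where "i \<in> S" "x = \<beta> i" using x(1) bij_betw_imp_surj_on[OF \<beta>(1)] by blast
      then show ?thesis using x(2) \<beta>(2) by auto
    qed
  qed
  then show ?thesis by (rule exI[of _ "\<lambda>i. snd (\<beta> i)"])
qed

text \<open>The polynomials f t do not involve K. At q the orders of the groups GL_t_i(q) are
  nonzero, so the count of each type is the value of the quotient.\<close>

theorem card_Homs_eq:
  assumes sys: "is_system S d M"
    and f: "\<And>t. t \<in> S \<rightarrow>\<^sub>E UNIV \<Longrightarrow> (\<Sum>i\<in>S. d i * t i) = n \<Longrightarrow> f t * (\<Prod>i\<in>S. gl_poly (t i)) = gl_poly n"
  shows "int (card (Homs A (GL K n))) = (\<Sum>t\<in>{t \<in> S \<rightarrow>\<^sub>E UNIV. (\<Sum>i\<in>S. d i * t i) = n}. poly (f t) (int (card (carrier K))))"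
proof -
  let ?M = "\<lambda>i. of_rep (M i)"
  obtain \<alpha> where "complete_system \<phi> A S d ?M \<alpha>" using complete_system_of_is_system[OF sys] by blast
  then interpret cs: complete_system \<phi> A S d ?M \<alpha> .
  have nz: "poly (gl_poly m) (int q) \<noteq> 0" for m
  proof -
    have "int q ^ m \<noteq> int q ^ i" if "i < m" for i
      using that q_ge_2 by (simp add: power_inject_exp)
    then show ?thesis by (simp add: poly_gl_poly)
  qed
  have "card (Homs A (GL K n)) = card (cs.rep_set n)"
    unfolding card_Homs cs.rep_set_def cs.mats_def ..
  then have "int (card (Homs A (GL K n))) = (\<Sum>t\<in>{t \<in> S \<rightarrow>\<^sub>E UNIV. (\<Sum>i\<in>S. d i * t i) = n}. int (card (cs.typed_reps n t)))"
    by (simp add: cs.card_rep_set)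
  also have "\<dots> = (\<Sum>t\<in>{t \<in> S \<rightarrow>\<^sub>E UNIV. (\<Sum>i\<in>S. d i * t i) = n}. poly (f t) (int q))"
  proof (rule sum.cong[OF refl])
    fix t assume t: "t \<in> {t \<in> S \<rightarrow>\<^sub>E UNIV. (\<Sum>i\<in>S. d i * t i) = n}"
    let ?P = "\<Prod>i\<in>S. poly (gl_poly (t i)) (int q)"
    have "poly (f t * (\<Prod>i\<in>S. gl_poly (t i))) (int q) = poly (gl_poly n) (int q)"
      using f t by simp
    then have "poly (f t) (int q) * ?P = int (card (cs.typed_reps n t)) * ?P"
      using cs.card_typed_reps[of t n] t by (simp add: poly_prod)
    moreover have "?P \<noteq> 0" using cs.finite_S nz by (simp add: prod_zero_iff)
    ultimately show "int (card (cs.typed_reps n t)) = poly (f t) (int q)" by simp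
  qed
  finally show ?thesis by (simp add: q_eq)
qed

end

lemma splitting_reps_of_splitting_field:
  assumes "group A" "finite (carrier A)" "splitting_field A K"
  shows "\<exists>p e. splitting_reps K p e A"
proof -
  obtain p e where pe: "prime (p :: nat)" "card (carrier K) = p ^ e" "\<not> p dvd card (carrier A)"
    and K: "field K" "finite (carrier K)" and spl: "\<And>n \<rho>. irreducible_rep A K n \<rho> \<Longrightarrow> absolutely_irreducible_rep A K n \<rho>"
    using assms(3) unfolding splitting_field_def by blast
  interpret field K by fact
  interpret group A by fact
  have "splitting_reps K p e A"
    by unfold_locales (use pe K spl assms(2) in auto)
  then show ?thesis by blast
qed

section \<open>Minimal tuples and the counting polynomial\<close>

definition shift :: "nat \<Rightarrow> (nat \<Rightarrow> nat) \<Rightarrow> int \<Rightarrow> (nat \<Rightarrow> int) \<Rightarrow> nat \<Rightarrow> int" where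
  "shift s d k u = (\<lambda>i\<in>{1..s}. u i + k * int (d i))"

lemma shift_shift: "u \<in> {1..s} \<rightarrow>\<^sub>E UNIV \<Longrightarrow> shift s d (- k) (shift s d k u) = u"
  by (rule extensionalityI[of _ "{1..s}"]) (auto simp: shift_def PiE_def)

lemma sum_int_squares: "(\<Sum>i\<in>S. (d i)\<^sup>2) = a \<Longrightarrow> (\<Sum>i\<in>S. (int (d i))\<^sup>2) = int a"
  by (simp flip: of_nat_power of_nat_sum)

text \<open>The squares of the degrees add up to a, so adding k d raises the value by k a. The sum
  of squares changes by 2kr + k^2 a, the same amount for every admissible tuple, which is why
  minimality is preserved.\<close>

lemma shift_admissible:
  assumes sq: "(\<Sum>i=1..s. (d i)\<^sup>2) = a" and n: "int n = k * int a + int r" and u: "admissible s d r u"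
  shows "admissible s d n (shift s d k u)"
    and "(\<Sum>i=1..s. (shift s d k u i)\<^sup>2) = (\<Sum>i=1..s. (u i)\<^sup>2) + 2 * k * int r + k\<^sup>2 * int a"
proof -
  have r: "(\<Sum>i=1..s. u i * int (d i)) = int r" using u by (simp add: admissible_def)
  note sq = sum_int_squares[OF sq]
  have "(\<Sum>i=1..s. shift s d k u i * int (d i)) = (\<Sum>i=1..s. u i * int (d i) + k * (int (d i))\<^sup>2)"
    by (intro sum.cong refl) (simp add: shift_def algebra_simps power2_eq_square)
  also have "\<dots> = int n" by (simp only: sum.distrib sum_distrib_left[symmetric] r sq n add.commute)
  finally show "admissible s d n (shift s d k u)" by (simp add: admissible_def shift_def)
  have "(\<Sum>i=1..s. (shift s d k u i)\<^sup>2) = (\<Sum>i=1..s. (u i)\<^sup>2 + (2 * k * (u i * int (d i)) + k\<^sup>2 * (int (d i))\<^sup>2))"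
    by (intro sum.cong refl) (simp add: shift_def algebra_simps power2_eq_square)
  then show "(\<Sum>i=1..s. (shift s d k u i)\<^sup>2) = (\<Sum>i=1..s. (u i)\<^sup>2) + 2 * k * int r + k\<^sup>2 * int a"
    by (simp only: sum.distrib sum_distrib_left[symmetric] r sq add.assoc)
qed

lemma shift_minimal:
  assumes sq: "(\<Sum>i=1..s. (d i)\<^sup>2) = a" and n: "int n = k * int a + int r" and u: "minimal_tuple s d r u"
  shows "minimal_tuple s d n (shift s d k u)"
  unfolding minimal_tuple_def
proof (intro conjI allI impI)
  have ua: "admissible s d r u" using u by (simp add: minimal_tuple_def)
  show "admissible s d n (shift s d k u)" by (rule shift_admissible(1)[OF sq n ua])
  fix v assume v: "admissible s d n v"
  have r: "int r = (- k) * int a + int n" using n by simp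
  have "(\<Sum>i=1..s. (u i)\<^sup>2) \<le> (\<Sum>i=1..s. (shift s d (- k) v i)\<^sup>2)"
    using u shift_admissible(1)[OF sq r v] by (simp add: minimal_tuple_def)
  then show "(\<Sum>i=1..s. (shift s d k u i)\<^sup>2) \<le> (\<Sum>i=1..s. (v i)\<^sup>2)"
    unfolding shift_admissible(2)[OF sq n ua] shift_admissible(2)[OF sq r v] n
    by (simp add: algebra_simps power2_eq_square)
qed

lemma card_minimal_shift:
  assumes sq: "(\<Sum>i=1..s. (d i)\<^sup>2) = a" and n: "int n = k * int a + int r"
  shows "card {u. minimal_tuple s d r u} = card {u. minimal_tuple s d n u}"
proof (rule bij_betw_same_card[OF bij_betw_byWitness[where f = "shift s d k" and f' = "shift s d (- k)"]])
  have r: "int r = (- k) * int a + int n" using n by simp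
  have ext: "u \<in> {1..s} \<rightarrow>\<^sub>E UNIV" if "minimal_tuple s d m u" for m u
    using that by (simp add: minimal_tuple_def admissible_def)
  show "\<forall>u\<in>{u. minimal_tuple s d r u}. shift s d (- k) (shift s d k u) = u"
    using shift_shift ext by blast
  show "\<forall>u\<in>{u. minimal_tuple s d n u}. shift s d k (shift s d (- k) u) = u"
    using shift_shift[of _ s d "- k"] ext by simp
  show "shift s d k ` {u. minimal_tuple s d r u} \<subseteq> {u. minimal_tuple s d n u}"
    using shift_minimal[OF sq n] by blast
  show "shift s d (- k) ` {u. minimal_tuple s d n u} \<subseteq> {u. minimal_tuple s d r u}"
    using shift_minimal[OF sq r] by blast
qed

text \<open>a^2 \<epsilon> is the sum of the (a t_i - r d_i)^2: \<epsilon> is the squared distance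
  of t from its projection (r/a) d onto the line of d. If it is zero, the entry with d_1 = 1 gives a
  t_1 = r, so a divides r < a.\<close>

lemma minimal_tuple_defect:
  fixes \<epsilon> :: real
  assumes s: "s \<ge> 1" "d 1 = 1" and sq: "(\<Sum>i=1..s. (d i)\<^sup>2) = a" and a: "a > 0" and r: "r < a"
    and t: "minimal_tuple s d r t"
    and \<epsilon>: "\<epsilon> = (\<Sum>i=1..s. (real_of_int (t i))\<^sup>2) - (real r)\<^sup>2 / real a"
  shows "\<epsilon> \<ge> 0" and "\<epsilon> = 0 \<longleftrightarrow> r = 0"
proof -
  let ?x = "\<lambda>i. real a * real_of_int (t i) - real r * real (d i)"
  have "(\<Sum>i=1..s. t i * int (d i)) = int r" using t by (simp add: minimal_tuple_def admissible_def)
  then have "real_of_int (\<Sum>i=1..s. t i * int (d i)) = real r" by simp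
  then have tr: "(\<Sum>i=1..s. real_of_int (t i) * real (d i)) = real r" by simp
  have sq': "(\<Sum>i=1..s. (real (d i))\<^sup>2) = real a" unfolding sq[symmetric] by simp
  have "(\<Sum>i=1..s. (?x i)\<^sup>2) = (\<Sum>i=1..s. (real a)\<^sup>2 * (real_of_int (t i))\<^sup>2
      - 2 * real a * real r * (real_of_int (t i) * real (d i)) + (real r)\<^sup>2 * (real (d i))\<^sup>2)"
    by (intro sum.cong refl) (simp add: power2_eq_square algebra_simps)
  also have "\<dots> = (real a)\<^sup>2 * (\<Sum>i=1..s. (real_of_int (t i))\<^sup>2) - 2 * real a * real r * real r + (real r)\<^sup>2 * real a"
    by (simp only: sum.distrib sum_subtractf sum_distrib_left[symmetric] tr sq')
  also have "\<dots> = (real a)\<^sup>2 * \<epsilon>"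
    using a by (simp add: \<epsilon> field_simps power2_eq_square)
  finally have eq: "(\<Sum>i=1..s. (?x i)\<^sup>2) = (real a)\<^sup>2 * \<epsilon>" .
  have "(real a)\<^sup>2 * \<epsilon> \<ge> 0" unfolding eq[symmetric] by (intro sum_nonneg) auto
  then show "\<epsilon> \<ge> 0" using a by (simp add: zero_le_mult_iff)
  show "\<epsilon> = 0 \<longleftrightarrow> r = 0"
  proof
    assume "\<epsilon> = 0"
    then have "\<forall>i\<in>{1..s}. (?x i)\<^sup>2 = 0"
      using eq by (subst sum_nonneg_eq_0_iff[symmetric]) auto
    then have "real a * real_of_int (t 1) = real r" using s by auto
    then have "int a * t 1 = int r" by (metis of_int_eq_iff of_int_mult of_int_of_nat_eq)
    then have "int a dvd int r" by (metis dvd_triv_left)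
    then have "a dvd r" by simp
    then show "r = 0" using r nat_dvd_not_less by blast
  next
    assume r0: "r = 0"
    \<comment> \<open>For r = 0 the zero tuple competes with t, so minimality makes t zero.\<close>
    have "admissible s d r (\<lambda>i\<in>{1..s}. 0)" by (simp add: admissible_def r0)
    then have "(\<Sum>i=1..s. (t i)\<^sup>2) \<le> (\<Sum>i=1..s. ((\<lambda>i\<in>{1..s}. 0) i)\<^sup>2)"
      using t unfolding minimal_tuple_def by blast
    then have "(\<Sum>i=1..s. (t i)\<^sup>2) \<le> 0" by simp
    then have "real_of_int (\<Sum>i=1..s. (t i)\<^sup>2) \<le> 0" by linarith
    then have "\<epsilon> \<le> 0" using r0 by (simp add: \<epsilon>)
    then show "\<epsilon> = 0" using \<open>\<epsilon> \<ge> 0\<close> by simp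
  qed
qed

text \<open>All leading coefficients are 1, so the terms of least weight, which have the top degree,
  cannot cancel.\<close>

lemma leading_term_sum:
  fixes F :: "'b \<Rightarrow> int poly"
  assumes fin: "finite T" and F: "\<And>t. t \<in> T \<Longrightarrow> lead_coeff (F t) = 1" "\<And>t. t \<in> T \<Longrightarrow> degree (F t) + w t = N"
    and \<mu>: "\<And>t. t \<in> T \<Longrightarrow> \<mu> \<le> w t" and ne: "{t \<in> T. w t = \<mu>} \<noteq> {}"
  shows "degree (\<Sum>t\<in>T. F t) + \<mu> = N" and "lead_coeff (\<Sum>t\<in>T. F t) = int (card {t \<in> T. w t = \<mu>})"
proof -
  let ?D = "N - \<mu>" and ?G = "\<Sum>t\<in>T. F t"
  have "\<mu> \<le> N" using ne F(2) by fastforce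
  have deg: "degree (F t) = N - w t" if "t \<in> T" for t using F(2)[OF that] by simp
  have "poly.coeff ?G ?D = (\<Sum>t\<in>T. if w t = \<mu> then 1 else 0)"
    unfolding coeff_sum
  proof (rule sum.cong[OF refl])
    fix t assume t: "t \<in> T"
    show "poly.coeff (F t) ?D = (if w t = \<mu> then 1 else 0)"
    proof (cases "w t = \<mu>")
      case True
      then show ?thesis using F(1)[OF t] deg[OF t] by simp
    next
      case False
      then have "degree (F t) < ?D" using \<mu>[OF t] F(2)[OF t] by simp
      then show ?thesis using False by (simp add: coeff_eq_0)
    qed
  qed
  then have c: "poly.coeff ?G ?D = int (card {t \<in> T. w t = \<mu>})"
    using fin by (simp add: sum.If_cases Int_def)
  have "card {t \<in> T. w t = \<mu>} > 0" using ne fin by (simp add: card_gt_0_iff)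
  then have "?D \<le> degree ?G" using c by (intro le_degree) simp
  moreover have "degree ?G \<le> ?D"
    using fin deg \<mu> by (intro degree_sum_le) (auto intro: diff_le_mono2)
  ultimately have D: "degree ?G = ?D" by simp
  then show "degree ?G + \<mu> = N" using \<open>\<mu> \<le> N\<close> by simp
  show "lead_coeff ?G = int (card {t \<in> T. w t = \<mu>})" using c D by simp
qed

text \<open>T consists of the possible multiplicities of representations. Eligibility puts every
  minimal integer tuple into T, so the minimum over T is the minimum over all admissible tuples and
  is attained equally often.\<close>

lemma minimal_tuples_nat:
  assumes elig: "\<And>u. minimal_tuple s d n u \<Longrightarrow> eligible s d n u" and u: "minimal_tuple s d n u"
    and \<mu>: "int \<mu> = (\<Sum>i=1..s. (u i)\<^sup>2)"
  defines "T \<equiv> {t \<in> {1..s} \<rightarrow>\<^sub>E UNIV. (\<Sum>i\<in>{1..s}. d i * t i) = n}"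
  shows "t \<in> T \<Longrightarrow> \<mu> \<le> (\<Sum>i\<in>{1..s}. (t i)\<^sup>2)"
    and "card {t \<in> T. (\<Sum>i\<in>{1..s}. (t i)\<^sup>2) = \<mu>} = card {u. minimal_tuple s d n u}"
    and "{t \<in> T. (\<Sum>i\<in>{1..s}. (t i)\<^sup>2) = \<mu>} \<noteq> {}"
proof -
  define to_int where "to_int t = (\<lambda>i\<in>{1..s}. int (t i))" for t
  define to_nat where "to_nat v = (\<lambda>i\<in>{1..s}. nat (v i))" for v
  have adm: "admissible s d n (to_int t)" if "t \<in> T" for t
  proof -
    have "(\<Sum>i=1..s. to_int t i * int (d i)) = int (\<Sum>i\<in>{1..s}. d i * t i)"
      unfolding of_nat_sum by (intro sum.cong refl) (simp add: to_int_def mult.commute)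
    also have "\<dots> = int n" using that by (simp only: T_def mem_Collect_eq)
    finally show ?thesis unfolding admissible_def by (intro conjI) (simp_all add: to_int_def)
  qed
  have sq: "(\<Sum>i=1..s. (to_int t i)\<^sup>2) = int (\<Sum>i\<in>{1..s}. (t i)\<^sup>2)" for t
    unfolding of_nat_sum by (intro sum.cong refl) (simp add: to_int_def)
  show le: "\<mu> \<le> (\<Sum>i\<in>{1..s}. (t i)\<^sup>2)" if "t \<in> T" for t
  proof -
    have "int \<mu> \<le> int (\<Sum>i\<in>{1..s}. (t i)\<^sup>2)"
      using u adm[OF that] unfolding \<mu> sq[symmetric] minimal_tuple_def by blast
    then show ?thesis by (simp only: of_nat_le_iff)
  qed
  have min_sq: "(\<Sum>i=1..s. (v i)\<^sup>2) = int \<mu>" if "minimal_tuple s d n v" for v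
    using that u unfolding \<mu> minimal_tuple_def by (meson order_antisym)
  have nonneg: "0 \<le> v i" if "minimal_tuple s d n v" "i \<in> {1..s}" for v i
    using elig[OF that(1)] that(2) by (simp add: eligible_def)
  have to_int_nat: "to_int (to_nat v) = v" if "minimal_tuple s d n v" for v
  proof (rule extensionalityI[of _ "{1..s}"])
    show "v \<in> extensional {1..s}" using that by (simp add: minimal_tuple_def admissible_def PiE_def)
  qed (use nonneg[OF that] in \<open>auto simp: to_int_def to_nat_def\<close>)
  have bij: "bij_betw to_int {t \<in> T. (\<Sum>i\<in>{1..s}. (t i)\<^sup>2) = \<mu>} {u. minimal_tuple s d n u}"
  proof (rule bij_betw_byWitness[where f' = to_nat])
    show "\<forall>t\<in>{t \<in> T. (\<Sum>i\<in>{1..s}. (t i)\<^sup>2) = \<mu>}. to_nat (to_int t) = t"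
      by (auto simp: T_def to_nat_def to_int_def PiE_def intro!: extensionalityI[of _ "{1..s}"])
    show "\<forall>v\<in>{u. minimal_tuple s d n u}. to_int (to_nat v) = v" using to_int_nat by blast
    show "to_int ` {t \<in> T. (\<Sum>i\<in>{1..s}. (t i)\<^sup>2) = \<mu>} \<subseteq> {u. minimal_tuple s d n u}"
    proof clarify
      fix t assume t: "t \<in> T" "\<mu> = (\<Sum>i\<in>{1..s}. (t i)\<^sup>2)"
      then have "(\<Sum>i=1..s. (to_int t i)\<^sup>2) = (\<Sum>i=1..s. (u i)\<^sup>2)"
        unfolding sq \<mu>[symmetric] by simp
      then show "minimal_tuple s d n (to_int t)"
        using u adm[OF t(1)] by (simp add: minimal_tuple_def)
    qed
    show "to_nat ` {u. minimal_tuple s d n u} \<subseteq> {t \<in> T. (\<Sum>i\<in>{1..s}. (t i)\<^sup>2) = \<mu>}"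
    proof clarify
      fix v assume v: "minimal_tuple s d n v"
      have "int (\<Sum>i\<in>{1..s}. d i * to_nat v i) = (\<Sum>i=1..s. v i * int (d i))"
        unfolding of_nat_sum using nonneg[OF v] by (intro sum.cong refl) (simp add: to_nat_def mult.commute)
      also have "\<dots> = int n" using v by (simp add: minimal_tuple_def admissible_def)
      finally have "(\<Sum>i\<in>{1..s}. d i * to_nat v i) = n" by (simp only: of_nat_eq_iff)
      then have "to_nat v \<in> T" unfolding T_def by (intro CollectI conjI) (simp_all add: to_nat_def)
      moreover have "int (\<Sum>i\<in>{1..s}. (to_nat v i)\<^sup>2) = int \<mu>"
        unfolding sq[symmetric] to_int_nat[OF v] by (rule min_sq[OF v])
      ultimately show "to_nat v \<in> T \<and> (\<Sum>i\<in>{1..s}. (to_nat v i)\<^sup>2) = \<mu>" by (simp only: of_nat_eq_iff)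
    qed
  qed
  then show "card {t \<in> T. (\<Sum>i\<in>{1..s}. (t i)\<^sup>2) = \<mu>} = card {u. minimal_tuple s d n u}"
    by (rule bij_betw_same_card)
  show "{t \<in> T. (\<Sum>i\<in>{1..s}. (t i)\<^sup>2) = \<mu>} \<noteq> {}"
    using bij u bij_betw_empty2 by (metis (no_types, lifting) empty_iff mem_Collect_eq bij_betw_imp_surj_on image_empty)
qed

theorem proposition3p8:
  fixes A :: "('a, 'm) monoid_scheme"
    and K\<^sub>0 :: "nat ring"
    and M :: "nat \<Rightarrow> 'a \<Rightarrow> nat \<times> nat \<Rightarrow> nat"
    and s a N n r m :: nat
    and d :: "nat \<Rightarrow> nat"
    and k :: int
    and t :: "nat \<Rightarrow> int"
    and \<epsilon> :: real
  assumes "group A" and "finite (carrier A)" and "a = card (carrier A)"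
    and "splitting_field A K\<^sub>0"
    and "irreducible_representatives A K\<^sub>0 s d M"
    and "\<And>n' u. n' \<ge> N \<Longrightarrow> minimal_tuple s d n' u \<Longrightarrow> eligible s d n' u"
    and "n \<ge> N"
    and "int n = k * int a + int r" and "r < a"
    and "m = card {u. minimal_tuple s d r u}"
    and "minimal_tuple s d r t"
    and "\<epsilon> = (\<Sum>i=1..s. (real_of_int (t i))\<^sup>2) - (real r)\<^sup>2 / real a"
  shows "(\<epsilon> \<ge> 0 \<and> (\<epsilon> = 0 \<longleftrightarrow> r = 0)) \<and>
    (\<exists>f :: int poly.
       Polynomial.coeff f (Polynomial.degree f) = int m \<and>
       real (Polynomial.degree f) = (real n)\<^sup>2 * (1 - 1 / real a) - \<epsilon> \<and>
       (\<forall>K :: nat ring. splitting_field A K \<longrightarrow>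
          int (card (Homs A (GL K n))) = Polynomial.poly f (int (card (carrier K)))))"
proof -
  let ?S = "{1..s}"
  obtain p\<^sub>0 e\<^sub>0 where "splitting_reps K\<^sub>0 p\<^sub>0 e\<^sub>0 A"
    using splitting_reps_of_splitting_field assms(1,2,4) by blast
  then interpret R0: splitting_reps K\<^sub>0 p\<^sub>0 e\<^sub>0 A .
  have s: "s \<ge> 1" "d 1 = 1"
    using assms(5) unfolding irreducible_representatives_def by blast+
  have sys0: "R0.is_system ?S d M"
    unfolding R0.is_system_def
  proof (rule conjI[OF finite_atLeastAtMost])
    show "(\<forall>i\<in>?S. irreducible_rep A K\<^sub>0 (d i) (M i)) \<and>
      (\<forall>i\<in>?S. \<forall>j\<in>?S. equivalent_reps A K\<^sub>0 (d i) (M i) (d j) (M j) \<longrightarrow> i = j) \<and>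
      (\<forall>n \<rho>. irreducible_rep A K\<^sub>0 n \<rho> \<longrightarrow> (\<exists>i\<in>?S. equivalent_reps A K\<^sub>0 n \<rho> (d i) (M i)))"
      using assms(5) unfolding irreducible_representatives_def by (elim conjE) (intro conjI)
  qed
  have pos: "d i > 0" if "i \<in> ?S" for i
  proof -
    have "irreducible_rep A K\<^sub>0 (d i) (M i)" using sys0 that unfolding R0.is_system_def by blast
    then have "1 \<le> d i" unfolding irreducible_rep_def by blast
    then show ?thesis by simp
  qed
  have sq: "(\<Sum>i=1..s. (d i)\<^sup>2) = a" using R0.sum_degree_squares[OF sys0] assms(3) by simp
  have a: "a > 0" using R0.card_carrier_pos assms(3) by simp
  define T where "T = {t \<in> ?S \<rightarrow>\<^sub>E UNIV. (\<Sum>i\<in>?S. d i * t i) = n}"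
  have le_n: "(\<Sum>i\<in>?S. t i) \<le> n" if "t \<in> T" for t
  proof -
    have "(\<Sum>i\<in>?S. t i) \<le> (\<Sum>i\<in>?S. d i * t i)"
      using pos by (intro sum_mono) (simp add: Suc_leI)
    then show ?thesis using that by (simp add: T_def)
  qed
  have finT: "finite T"
  proof (rule finite_subset)
    show "T \<subseteq> ?S \<rightarrow>\<^sub>E {..n}"
    proof
      fix t assume t: "t \<in> T"
      have "t i \<le> n" if "i \<in> ?S" for i
        using member_le_sum[OF that, of t] le_n[OF t] by simp
      then show "t \<in> ?S \<rightarrow>\<^sub>E {..n}" using t by (auto simp: T_def PiE_def)
    qed
    show "finite (?S \<rightarrow>\<^sub>E {..n})" by (intro finite_PiE) auto
  qed
  \<comment> \<open>The quotients are built from d and n alone, before a second field is considered;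
    this makes the final polynomial independent of q.\<close>
  have "\<exists>f. t \<in> T \<longrightarrow> f * (\<Prod>i\<in>?S. gl_poly (t i)) = gl_poly n \<and> lead_coeff f = 1 \<and> degree f + (\<Sum>i\<in>?S. (t i)\<^sup>2) = n\<^sup>2" for t
    using gl_poly_quotient[OF finite_atLeastAtMost le_n] by metis
  then obtain f where f: "\<And>t. t \<in> T \<Longrightarrow> f t * (\<Prod>i\<in>?S. gl_poly (t i)) = gl_poly n"
    "\<And>t. t \<in> T \<Longrightarrow> lead_coeff (f t) = 1" "\<And>t. t \<in> T \<Longrightarrow> degree (f t) + (\<Sum>i\<in>?S. (t i)\<^sup>2) = n\<^sup>2"
    by metis
  define u where "u = shift s d k t"
  have u: "minimal_tuple s d n u" unfolding u_def by (rule shift_minimal[OF sq assms(8,11)])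
  have ta: "admissible s d r t" using assms(11) by (simp add: minimal_tuple_def)
  define \<mu> where "\<mu> = nat (\<Sum>i=1..s. (u i)\<^sup>2)"
  have \<mu>: "int \<mu> = (\<Sum>i=1..s. (u i)\<^sup>2)" unfolding \<mu>_def by (simp add: sum_nonneg)
  note nat = minimal_tuples_nat[OF assms(6)[OF assms(7)] u \<mu>, folded T_def]
  note lead = leading_term_sum[OF finT f(2,3) nat(1) nat(3)]
  have "real \<mu> = (\<Sum>i=1..s. (real_of_int (t i))\<^sup>2) + 2 * real_of_int k * real r + (real_of_int k)\<^sup>2 * real a"
  proof -
    have "real \<mu> = real_of_int (int \<mu>)" by simp
    also have "\<dots> = real_of_int ((\<Sum>i=1..s. (t i)\<^sup>2) + 2 * k * int r + k\<^sup>2 * int a)"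
      unfolding \<mu> u_def shift_admissible(2)[OF sq assms(8) ta] ..
    finally show ?thesis by simp
  qed
  moreover have "real (degree (\<Sum>t\<in>T. f t)) = (real n)\<^sup>2 - real \<mu>"
    using lead(1) by (simp flip: of_nat_power of_nat_add)
  \<comment> \<open>Subtracting \<mu> leaves r^2/a minus the sum of the t_i^2, which is -\<epsilon>;
    so n^2 - \<mu> is the exponent of the claim.\<close>
  moreover have "(real n)\<^sup>2 * (1 / real a) = (real_of_int k)\<^sup>2 * real a + 2 * real_of_int k * real r + (real r)\<^sup>2 / real a"
  proof -
    have "real n = real_of_int k * real a + real r"
      using assms(8) by (metis of_int_add of_int_mult of_int_of_nat_eq)
    then show ?thesis using a by (simp add: field_simps power2_eq_square)
  qed
  ultimately have deg: "real (degree (\<Sum>t\<in>T. f t)) = (real n)\<^sup>2 * (1 - 1 / real a) - \<epsilon>"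
    unfolding assms(12) right_diff_distrib by linarith
  have "int (card (Homs A (GL K n))) = poly (\<Sum>t\<in>T. f t) (int (card (carrier K)))" if K: "splitting_field A K" for K :: "nat ring"
  proof -
    obtain p e where "splitting_reps K p e A"
      using splitting_reps_of_splitting_field assms(1,2) K by blast
    then interpret R: splitting_reps K p e A .
    \<comment> \<open>Both fields have the same power sums, so K has a system with the degrees d on
      the same index set.\<close>
    obtain M' where "R.is_system ?S d M'"
      using R.is_system_reindex[OF finite_atLeastAtMost pos R0.degree_power_sum[OF sys0]] by blast
    from R.card_Homs_eq[OF this, of n f] f(1) show ?thesis by (simp add: T_def poly_sum)
  qed
  moreover have "lead_coeff (\<Sum>t\<in>T. f t) = int m"
    using lead(2) nat(2) card_minimal_shift[OF sq assms(8)] assms(10) by simp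
  ultimately show ?thesis
    using deg minimal_tuple_defect[OF s sq a assms(9,11,12)] by blast
qed

end
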